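(* Let $\Bbbk$ be a field of characteristic zero, $n\ge2$ an integer, $a\in\Bbbk$ and $R=R(n,a)$. When $a\in\mathbb{Q}$ the skewfield $\operatorname{Frac}R$ is isomorphic to the first Weyl skewfield $D_1(F)$ over a field $F$ of transcendence degree $n-1$ over $\Bbbk$. When $a\notin\mathbb{Q}$, we have $Z(\operatorname{Frac}R)=K$, and $\operatorname{Frac}R$ is not isomorphic to any Weyl skewfield.
   Context: Let $A=\Bbbk[X_0,\dots,X_n]$ be the commutative polynomial ring, $\partial_i=\partial/\partial X_i$, and define the derivations $\Delta=\sum_{i=1}^{n}X_{i-1}\partial_i$ and $\Gamma_a=\sum_{i=0}^n (a+i)X_i\partial_i$ of $A$. For $k\in\mathbb{N}$ put $\binom{\Gamma_a}{k}=\frac{1}{k!}\Gamma_a(\Gamma_a-1)\cdots(\Gamma_a-(k-1))$. Then $R(n,a)$ is the associative $\Bbbk$-algebra with underlying vector space $A$ and multiplication $f\ast g=\sum_{k\ge 0}\Delta^k(f)\binom{\Gamma_a}{k}(g)$; it is a noetherian domain and $\operatorname{Frac}R$ is its skewfield of fractions. The element $X_0$ is normal in $R$ and $R^\circ=R[X_0^{-1}]$ has underlying vector space $A[X_0^{-1}]$ with multiplication given by the same formula ($\Delta,\Gamma_a$ extended to $A[X_0^{-1}]$). For $2\le j\le n$ let $Y_j=\sum_{p\ge0}\frac{(-X_1)^p}{p!\,X_0^p}\Delta^p(X_j)\in A[X_0^{-1}]$ (commutative products), and let $B=\Bbbk[X_0^{\pm1},Y_2,\dots,Y_n]$. One has $\Delta(B)=0$,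 so $B$ is a commutative subring of $R^\circ$, and the listed generators are algebraically independent. Give $B$ the $\mathbb{Z}^2$-grading $f$ with $f(X_0^{\pm1})=(\pm1,0)$ and $f(Y_i)=(1,i)$. Let $Q_{gr}(B)$ be the localisation of $B$ at all nonzero $f$-homogeneous elements, and let $K=Q_{gr}(B)_{(0,0)}$ be its degree $(0,0)$ component, a field of transcendence degree $n-2$ over $\Bbbk$, regarded as a subfield of $\operatorname{Frac}R$. For a field $F$, the Weyl skewfield $D_m(F)$ is the skewfield of fractions of the $m$-th Weyl algebra over $F$. $\mathbb{Q}$ is identified with the prime subfield of $\Bbbk$. *)

theory Defs
  imports
    "HOL-Library.Poly_Mapping"
    "HOL-Algebra.QuotRing"
    "HOL-Algebra.Generated_Fields"
    "HOL-Algebra.Finite_Extensions"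
    "HOL-Algebra.Algebraic_Closure_Type"
begin

section \<open>The algebra \<open>R(n,a)\<close>\<close>

text \<open>
  The commutative rings \<open>A = k[X\<^sub>0,\<dots>,X\<^sub>n]\<close> and \<open>A[X\<^sub>0\<^sup>-\<^sup>1]\<close> are both taken inside one type of
  Laurent polynomials in countably many variables over \<open>k\<close>: an exponent vector is a finitely
  supported function from the variable indices to the integers. The type's own \<open>*\<close> is the
  commutative product. \<open>poly_carrier n\<close> is \<open>A\<close>.
\<close>

type_synonym exponent = "nat \<Rightarrow>\<^sub>0 int"
type_synonym 'k laurent = "exponent \<Rightarrow>\<^sub>0 'k"

definition poly_carrier :: "nat \<Rightarrow> 'k::zero laurent set" where
  "poly_carrier n =
     {f. \<forall>m\<in>Poly_Mapping.keys f.
           Poly_Mapping.keys m \<subseteq> {..n} \<and> (\<forall>i. 0 \<le> Poly_Mapping.lookup m i)}"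

definition Const :: "'k::zero \<Rightarrow> 'k laurent" where
  "Const c = Poly_Mapping.single 0 c"

definition Var :: "nat \<Rightarrow> 'k::zero_neq_one laurent" where
  "Var i = Poly_Mapping.single (Poly_Mapping.single i 1) 1"

definition X0_powi :: "int \<Rightarrow> 'k::zero_neq_one laurent" where
  "X0_powi e = Poly_Mapping.single (Poly_Mapping.single 0 e) 1"

definition pdiff :: "nat \<Rightarrow> 'k::field laurent \<Rightarrow> 'k laurent" where
  "pdiff i f = (\<Sum>m\<in>Poly_Mapping.keys f.
     Poly_Mapping.single (m - Poly_Mapping.single i 1)
       (of_int (Poly_Mapping.lookup m i) * Poly_Mapping.lookup f m))"

definition Delta :: "nat \<Rightarrow> 'k::field laurent \<Rightarrow> 'k laurent" where
  "Delta n f = (\<Sum>i=1..n. Var (i - 1) * pdiff i f)"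

definition Gamma :: "nat \<Rightarrow> 'k::field \<Rightarrow> 'k laurent \<Rightarrow> 'k laurent" where
  "Gamma n a f = (\<Sum>i=0..n. Const (a + of_nat i) * Var i * pdiff i f)"

primrec Gamma_falling :: "nat \<Rightarrow> 'k::field \<Rightarrow> nat \<Rightarrow> 'k laurent \<Rightarrow> 'k laurent" where
  "Gamma_falling n a 0 g = g"
| "Gamma_falling n a (Suc k) g =
     Gamma n a (Gamma_falling n a k g) - Const (of_nat k) * Gamma_falling n a k g"

definition Gamma_binom :: "nat \<Rightarrow> 'k::field_char_0 \<Rightarrow> nat \<Rightarrow> 'k laurent \<Rightarrow> 'k laurent" where
  "Gamma_binom n a k g = Const (1 / fact k) * Gamma_falling n a k g"

text \<open>
  On \<open>A[X\<^sub>0\<^sup>-\<^sup>1]\<close> the operator \<open>\<Delta>\<close> is locally nilpotent, so only finitely many summands are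
  nonzero and \<^const>\<open>Sum_any\<close> is the actual sum.
\<close>
definition star :: "nat \<Rightarrow> 'k::field_char_0 \<Rightarrow> 'k laurent \<Rightarrow> 'k laurent \<Rightarrow> 'k laurent" where
  "star n a f g = Sum_any (\<lambda>k. (Delta n ^^ k) f * Gamma_binom n a k g)"

definition R_alg :: "nat \<Rightarrow> 'k::field_char_0 \<Rightarrow> 'k laurent ring" where
  "R_alg n a =
     \<lparr>carrier = poly_carrier n, monoid.mult = star n a, one = 1, zero = 0, add = (+)\<rparr>"


section \<open>Skewfields of fractions\<close>

definition skewfield :: "('q, 'x) ring_scheme \<Rightarrow> bool" where
  "skewfield Q \<longleftrightarrow> ring Q \<and> Units Q = carrier Q - {\<zero>\<^bsub>Q\<^esub>}"

text \<open>
  \<open>skewfield_of_fractions R Q \<iota>\<close>: the skewfield \<open>Q\<close>, with the embedding \<open>\<iota>\<close> of the domain \<open>R\<close>,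
  is a skewfield of fractions of \<open>R\<close>. This determines \<open>(Q, \<iota>)\<close> up to unique isomorphism under
  \<open>R\<close>. For a two-sided Ore domain such as a noetherian domain, being a right or a left skewfield
  of fractions amounts to the same.
\<close>
definition skewfield_of_fractions ::
  "('r, 'x) ring_scheme \<Rightarrow> ('q, 'y) ring_scheme \<Rightarrow> ('r \<Rightarrow> 'q) \<Rightarrow> bool" where
  "skewfield_of_fractions R Q \<iota> \<longleftrightarrow>
     skewfield Q \<and> \<iota> \<in> ring_hom R Q \<and> inj_on \<iota> (carrier R) \<and>
     (\<forall>q\<in>carrier Q. \<exists>r\<in>carrier R. \<exists>s\<in>carrier R - {\<zero>\<^bsub>R\<^esub>}. q = \<iota> r \<otimes>\<^bsub>Q\<^esub> inv\<^bsub>Q\<^esub> (\<iota> s))"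

definition ring_center :: "('q, 'x) ring_scheme \<Rightarrow> 'q set" where
  "ring_center Q = {z \<in> carrier Q. \<forall>x\<in>carrier Q. z \<otimes>\<^bsub>Q\<^esub> x = x \<otimes>\<^bsub>Q\<^esub> z}"


section \<open>The graded ring \<open>B\<close> and the field \<open>K\<close>\<close>

definition Y_elem :: "nat \<Rightarrow> nat \<Rightarrow> 'k::field_char_0 laurent" where
  "Y_elem n j = Sum_any (\<lambda>p. (- Var 1) ^ p * (Const (1 / fact p) * X0_powi (- int p))
                        * (Delta n ^^ p) (Var j))"

text \<open>
  The monomials in \<open>X\<^sub>0\<^sup>\<plusminus>\<^sup>1, Y\<^sub>2, \<dots>, Y\<^sub>n\<close> are indexed by exponent vectors \<open>e\<close>, where \<open>e 0\<close> is the
  exponent of \<open>X\<^sub>0\<close> and \<open>e j\<close> that of \<open>Y\<^sub>j\<close>.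
\<close>
definition B_exponents :: "nat \<Rightarrow> exponent set" where
  "B_exponents n = {e. Poly_Mapping.keys e \<subseteq> {0} \<union> {2..n} \<and>
     (\<forall>j\<in>{2..n}. 0 \<le> Poly_Mapping.lookup e j)}"

definition B_monom :: "nat \<Rightarrow> exponent \<Rightarrow> 'k::field_char_0 laurent" where
  "B_monom n e = X0_powi (Poly_Mapping.lookup e 0) *
     (\<Prod>j=2..n. Y_elem n j ^ nat (Poly_Mapping.lookup e j))"

definition B_degree :: "nat \<Rightarrow> exponent \<Rightarrow> int \<times> int" where
  "B_degree n e = (Poly_Mapping.lookup e 0 + (\<Sum>j=2..n. Poly_Mapping.lookup e j),
      \<Sum>j=2..n. int j * Poly_Mapping.lookup e j)"

definition B_component :: "nat \<Rightarrow> int \<times> int \<Rightarrow> 'k::field_char_0 laurent set" where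
  "B_component n d =
     {\<Sum>e\<in>E. Const (c e) * B_monom n e | E c.
        finite E \<and> E \<subseteq> {e \<in> B_exponents n. B_degree n e = d}}"

text \<open>
  The inclusion of \<open>R\<^sup>\<circ> = R[X\<^sub>0\<^sup>-\<^sup>1]\<close> into the skewfield of fractions \<open>Q\<close> of \<open>R\<close>. Since
  \<open>\<Delta>(X\<^sub>0) = 0\<close>, the product in \<open>R\<^sup>\<circ>\<close> of \<open>X\<^sub>0\<^sup>N\<close> with \<open>f\<close> (in this order) is the commutative one,
  so \<open>f\<close> is the left fraction \<open>(X\<^sub>0\<^sup>N)\<^sup>-\<^sup>1 (X\<^sub>0\<^sup>N f)\<close> for every \<open>N\<close> with \<open>X\<^sub>0\<^sup>N f \<in> A\<close>.
\<close>
definition loc_embed ::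
  "nat \<Rightarrow> ('q, 'x) ring_scheme \<Rightarrow> ('k::field_char_0 laurent \<Rightarrow> 'q) \<Rightarrow> 'k laurent \<Rightarrow> 'q" where
  "loc_embed n Q \<iota> f =
     (let N = (LEAST N. Var 0 ^ N * f \<in> poly_carrier n)
      in inv\<^bsub>Q\<^esub> (\<iota> (Var 0 ^ N)) \<otimes>\<^bsub>Q\<^esub> \<iota> (Var 0 ^ N * f))"

text \<open>The component of degree \<open>d\<close> of \<open>Q\<^sub>g\<^sub>r(B)\<close>, as a subset of \<open>Q = Frac R\<close>.\<close>
definition Qgr_B_component ::
  "nat \<Rightarrow> ('q, 'x) ring_scheme \<Rightarrow> ('k::field_char_0 laurent \<Rightarrow> 'q) \<Rightarrow> int \<times> int \<Rightarrow> 'q set" where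
  "Qgr_B_component n Q \<iota> d =
     {loc_embed n Q \<iota> b \<otimes>\<^bsub>Q\<^esub> inv\<^bsub>Q\<^esub> (loc_embed n Q \<iota> s) | b s e.
        s \<in> B_component n e \<and> s \<noteq> 0 \<and>
        b \<in> B_component n (fst d + fst e, snd d + snd e)}"

definition K_field ::
  "nat \<Rightarrow> ('q, 'x) ring_scheme \<Rightarrow> ('k::field_char_0 laurent \<Rightarrow> 'q) \<Rightarrow> 'q set" where
  "K_field n Q \<iota> = Qgr_B_component n Q \<iota> (0, 0)"


section \<open>Field extensions and transcendence degree\<close>

definition field_extension :: "('k::field \<Rightarrow> 'f) \<Rightarrow> ('f, 'x) ring_scheme \<Rightarrow> bool" where
  "field_extension \<kappa> F \<longleftrightarrow> field F \<and> \<kappa> \<in> ring_hom ring_of_type_algebra F"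

definition poly_eval ::
  "('k::field \<Rightarrow> 'f) \<Rightarrow> ('f, 'x) ring_scheme \<Rightarrow> (nat \<Rightarrow> 'f) \<Rightarrow> ((nat \<Rightarrow>\<^sub>0 nat) \<Rightarrow>\<^sub>0 'k) \<Rightarrow> 'f" where
  "poly_eval \<kappa> F t p =
     (\<Oplus>\<^bsub>F\<^esub>m\<in>Poly_Mapping.keys p.
        \<kappa> (Poly_Mapping.lookup p m) \<otimes>\<^bsub>F\<^esub>
        (\<Otimes>\<^bsub>F\<^esub>i\<in>Poly_Mapping.keys m. t i [^]\<^bsub>F\<^esub> Poly_Mapping.lookup m i))"

definition algebraically_independent ::
  "('k::field \<Rightarrow> 'f) \<Rightarrow> ('f, 'x) ring_scheme \<Rightarrow> nat \<Rightarrow> (nat \<Rightarrow> 'f) \<Rightarrow> bool" where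
  "algebraically_independent \<kappa> F d t \<longleftrightarrow>
     (\<forall>p. (\<forall>m\<in>Poly_Mapping.keys p. Poly_Mapping.keys m \<subseteq> {..<d}) \<longrightarrow>
          poly_eval \<kappa> F t p = \<zero>\<^bsub>F\<^esub> \<longrightarrow> p = 0)"

definition has_transcendence_degree ::
  "('k::field \<Rightarrow> 'f) \<Rightarrow> ('f, 'x) ring_scheme \<Rightarrow> nat \<Rightarrow> bool" where
  "has_transcendence_degree \<kappa> F d \<longleftrightarrow>
     (\<exists>t. t ` {..<d} \<subseteq> carrier F \<and> algebraically_independent \<kappa> F d t \<and>
        (\<forall>z\<in>carrier F.
           \<not> ring.transcendental F (generate_field F (range \<kappa> \<union> t ` {..<d})) z))"


section \<open>Weyl algebras\<close>

text \<open>
  The free associative algebra over the field \<open>F\<close> on the set \<open>S\<close>: finitely supported functions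
  from words over \<open>S\<close> to \<open>F\<close>, multiplied by convolution along concatenation.
\<close>
definition free_algebra :: "('f, 'x) ring_scheme \<Rightarrow> 's set \<Rightarrow> ('s list \<Rightarrow> 'f) ring" where
  "free_algebra F S =
     \<lparr>carrier = {f. range f \<subseteq> carrier F \<and> finite {w. f w \<noteq> \<zero>\<^bsub>F\<^esub>} \<and>
                    {w. f w \<noteq> \<zero>\<^bsub>F\<^esub>} \<subseteq> lists S},
      monoid.mult = (\<lambda>f g w. \<Oplus>\<^bsub>F\<^esub>i\<in>{..length w}. f (take i w) \<otimes>\<^bsub>F\<^esub> g (drop i w)),
      one = (\<lambda>w. if w = [] then \<one>\<^bsub>F\<^esub> else \<zero>\<^bsub>F\<^esub>),
      zero = (\<lambda>w. \<zero>\<^bsub>F\<^esub>),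
      add = (\<lambda>f g w. f w \<oplus>\<^bsub>F\<^esub> g w)\<rparr>"

definition free_scalar :: "('f, 'x) ring_scheme \<Rightarrow> 'f \<Rightarrow> 's list \<Rightarrow> 'f" where
  "free_scalar F c = (\<lambda>w. if w = [] then c else \<zero>\<^bsub>F\<^esub>)"

definition free_gen :: "('f, 'x) ring_scheme \<Rightarrow> 's \<Rightarrow> 's list \<Rightarrow> 'f" where
  "free_gen F s = (\<lambda>w. if w = [s] then \<one>\<^bsub>F\<^esub> else \<zero>\<^bsub>F\<^esub>)"

datatype weyl_gen = Pos nat | Mom nat

definition weyl_gens :: "nat \<Rightarrow> weyl_gen set" where
  "weyl_gens m = Pos ` {..<m} \<union> Mom ` {..<m}"

definition weyl_free :: "nat \<Rightarrow> ('f, 'x) ring_scheme \<Rightarrow> (weyl_gen list \<Rightarrow> 'f) ring" where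
  "weyl_free m F = free_algebra F (weyl_gens m)"

definition free_commutator ::
  "nat \<Rightarrow> ('f, 'x) ring_scheme \<Rightarrow> weyl_gen \<Rightarrow> weyl_gen \<Rightarrow> weyl_gen list \<Rightarrow> 'f" where
  "free_commutator m F u v =
     (free_gen F u \<otimes>\<^bsub>weyl_free m F\<^esub> free_gen F v)
       \<ominus>\<^bsub>weyl_free m F\<^esub> (free_gen F v \<otimes>\<^bsub>weyl_free m F\<^esub> free_gen F u)"

text \<open>
  With \<open>x\<^sub>i = Pos i\<close> and \<open>y\<^sub>i = Mom i\<close> the relations are \<open>[x\<^sub>i, x\<^sub>j] = 0\<close>, \<open>[y\<^sub>i, y\<^sub>j] = 0\<close> and
  \<open>[y\<^sub>i, x\<^sub>j] = \<delta>\<^sub>i\<^sub>j\<close>.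
\<close>
definition weyl_relations :: "nat \<Rightarrow> ('f, 'x) ring_scheme \<Rightarrow> (weyl_gen list \<Rightarrow> 'f) set" where
  "weyl_relations m F =
     {free_commutator m F (Pos i) (Pos j) | i j. i < m \<and> j < m}
     \<union> {free_commutator m F (Mom i) (Mom j) | i j. i < m \<and> j < m}
     \<union> {free_commutator m F (Mom i) (Pos j)
          \<ominus>\<^bsub>weyl_free m F\<^esub> (if i = j then \<one>\<^bsub>weyl_free m F\<^esub> else \<zero>\<^bsub>weyl_free m F\<^esub>)
        | i j. i < m \<and> j < m}"

definition weyl_ideal :: "nat \<Rightarrow> ('f, 'x) ring_scheme \<Rightarrow> (weyl_gen list \<Rightarrow> 'f) set" where
  "weyl_ideal m F = Idl\<^bsub>weyl_free m F\<^esub> (weyl_relations m F)"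

definition weyl_algebra :: "nat \<Rightarrow> ('f, 'x) ring_scheme \<Rightarrow> (weyl_gen list \<Rightarrow> 'f) set ring" where
  "weyl_algebra m F = weyl_free m F Quot weyl_ideal m F"

definition weyl_scalar :: "nat \<Rightarrow> ('f, 'x) ring_scheme \<Rightarrow> 'f \<Rightarrow> (weyl_gen list \<Rightarrow> 'f) set" where
  "weyl_scalar m F c = weyl_ideal m F +>\<^bsub>weyl_free m F\<^esub> free_scalar F c"

text \<open>\<open>(D, \<eta>)\<close> is the Weyl skewfield \<open>D\<^sub>m(F)\<close>.\<close>
definition weyl_skewfield ::
  "nat \<Rightarrow> ('f, 'x) ring_scheme \<Rightarrow> ('d, 'y) ring_scheme \<Rightarrow> ((weyl_gen list \<Rightarrow> 'f) set \<Rightarrow> 'd) \<Rightarrow> bool"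
  where
  "weyl_skewfield m F D \<eta> \<longleftrightarrow> field F \<and> skewfield_of_fractions (weyl_algebra m F) D \<eta>"

end

(*
  With z = X_1 / X_0 one has R^o = B[z], where B is commutative and z acts on B by the derivation
  with eigenvalue a d + w in bidegree (d, w).
  For rational a the values of a d + w on monomials form a cyclic group. A monomial fraction t
  whose eigenvalue generates it, together with a multiple of t^-1 z, generates a first Weyl
  algebra over the field of central elements algebraic over the monomial fractions of eigenvalue 0.
  For irrational a the eigenvalue determines the bidegree, so the centre is K. A Weyl skewfield
  D_m(F) is excluded according to m. For m = 0 it is commutative. For m = 1 the first Weyl algebra
  has quadratic growth over the centre, while X_0, X_1, X_2 have independent values under a
  valuation trivial on the centre. For m >= 2 two canonical pairs have independent values under a
  valuation trivial on the centre, while R has growth of order at most three over the centre.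
*)
theory Submission
  imports Defs "HOL-Library.Product_Lexorder" "HOL-Library.Product_Plus"
begin

text \<open>The growth of a ring does not bound the growth of its skewfield of fractions, so growth
  and values, which live on different subrings of Frac R, cannot be compared directly. The bridge is
  a common denominator \<open>s\<close>: it moves elements with independent values into the filtered
  ring, and padding every word to the same number of factors \<open>s\<close> keeps the values of
  distinct words distinct. The ring giving the growth and the ring giving the valuation change
  places between m = 1 and m >= 2. Only right fractions are given. The Ore condition is recovered
  from their existence. For rational \<open>a\<close>, the explicit fractions of eigenvalue 0
  generate only a subgroup of finite index in the group of all of them. Closing algebraically inside
  the centre adjoins the missing roots and leaves the explicit elements a transcendence basis. A
  Weyl algebra is presented as a quotient of a free algebra, so its map to Frac R has to be shown
  injective. Normal forms provide monomials, and a valuation built from inner derivations shows that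
  their images are independent over the centre.\<close>

section \<open>Coefficients, supports and constants of Laurent polynomials\<close>

abbreviation lookup :: "('a \<Rightarrow>\<^sub>0 'b::zero) \<Rightarrow> 'a \<Rightarrow> 'b" where
  "lookup \<equiv> Poly_Mapping.lookup"

abbreviation keys :: "('a \<Rightarrow>\<^sub>0 'b::zero) \<Rightarrow> 'a set" where
  "keys \<equiv> Poly_Mapping.keys"

abbreviation single :: "'a \<Rightarrow> 'b \<Rightarrow> ('a \<Rightarrow>\<^sub>0 'b::zero)" where
  "single \<equiv> Poly_Mapping.single"

abbreviation unit_exp :: "nat \<Rightarrow> exponent" where
  "unit_exp i \<equiv> single i 1"

lemma sum_keys_single:
  fixes f :: "'a \<Rightarrow>\<^sub>0 'b::comm_monoid_add"
  shows "(\<Sum>m\<in>keys f. single m (lookup f m)) = f"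
  by (rule poly_mapping_eqI)
    (auto simp: lookup_sum lookup_single when_def in_keys_iff sum.delta)

lemma laurent_induct [case_names zero add]:
  fixes f :: "'a \<Rightarrow>\<^sub>0 'b::comm_monoid_add"
  assumes "P 0" and "\<And>m c f. P f \<Longrightarrow> P (single m c + f)"
  shows "P f"
proof -
  have "P (\<Sum>m\<in>A. single m (lookup f m))" if "finite A" for A
    using that by (induction A) (auto intro: assms)
  from this[of "keys f"] show ?thesis
    by (simp add: sum_keys_single)
qed

lemma laurent_induct_on [consumes 1, case_names zero add]:
  fixes f :: "'a \<Rightarrow>\<^sub>0 'b::comm_monoid_add"
  assumes "keys f \<subseteq> S" and "P 0" and "\<And>m c f. m \<in> S \<Longrightarrow> P f \<Longrightarrow> P (single m c + f)"
  shows "P f"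
proof -
  have "P (\<Sum>m\<in>A. single m (lookup f m))" if "finite A" "A \<subseteq> S" for A
    using that by (induction A) (auto intro: assms)
  from this[of "keys f"] show ?thesis
    using assms(1) by (simp add: sum_keys_single)
qed

lemma lookup_single_mult:
  fixes f :: "'k::comm_ring laurent"
  shows "lookup (single m0 c * f) m = c * lookup f (m - m0)"
proof -
  have eq: "(m = m0 + q) = (q = m - m0)" for q
    by (auto simp: algebra_simps)
  have *: "(\<Sum>q. lookup f q when m = l + q) = lookup f (m - l)" for l
  proof -
    have "(m = l + q) = (q = m - l)" for q by (auto simp: algebra_simps)
    then show ?thesis by simp
  qed
  show ?thesis
    unfolding lookup_mult * lookup_single when_mult
    by simp
qed

lemma lookup_mult_keys:
  fixes f g :: "'k::comm_ring laurent"
  shows "lookup (f * g) m = (\<Sum>l\<in>keys f. lookup f l * lookup g (m - l))"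
proof -
  have "lookup (f * g) m = lookup ((\<Sum>l\<in>keys f. single l (lookup f l)) * g) m"
    by (simp add: sum_keys_single)
  then show ?thesis
    by (simp add: sum_distrib_right lookup_sum lookup_single_mult)
qed

lemma keys_multE:
  fixes f g :: "'k::comm_ring laurent"
  assumes "m \<in> keys (f * g)"
  obtains m1 m2 where "m1 \<in> keys f" "m2 \<in> keys g" "m = m1 + m2"
  using assms keys_mult by blast

lemma Const_mult [simp]: "Const c * Const d = Const (c * d :: 'k::comm_ring_1)"
  by (simp add: Const_def mult_single)

lemma Const_add: "Const (c + d) = Const c + (Const d :: 'k::comm_ring_1 laurent)"
  by (simp add: Const_def single_add)

lemma Const_0 [simp]: "Const 0 = 0"
  by (simp add: Const_def)

lemma Const_1 [simp]: "Const 1 = (1 :: 'k::comm_ring_1 laurent)"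
  by (simp add: Const_def)

lemma Const_uminus: "Const (- c) = - (Const c :: 'k::comm_ring_1 laurent)"
  by (simp add: Const_def single_uminus)

lemma Const_of_nat: "Const (of_nat k) = (of_nat k :: 'k::comm_ring_1 laurent)"
  by (induction k) (simp_all add: Const_add)

lemma Const_eq_iff [simp]: "Const c = Const d \<longleftrightarrow> c = (d :: 'k::comm_ring_1)"
  unfolding Const_def by (rule inj_eq[OF inj_single])

lemma Const_eq_0_iff [simp]: "Const c = 0 \<longleftrightarrow> c = (0 :: 'k::comm_ring_1)"
  using Const_eq_iff[of c 0] by simp

lemma lookup_Const_mult [simp]: "lookup (Const c * f) m = c * lookup (f :: 'k::comm_ring laurent) m"
  by (simp add: Const_def lookup_single_mult)

lemma single_eq_Const_mult: "single m c = Const c * single m (1 :: 'k::comm_ring_1)"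
  by (simp add: Const_def mult_single)

subsection \<open>The derivations\<close>

lemma lookup_pdiff:
  fixes f :: "'k::field laurent"
  shows "lookup (pdiff i f) m = of_int (lookup m i + 1) * lookup f (m + unit_exp i)"
proof -
  have "lookup (pdiff i f) m
      = (\<Sum>m'\<in>keys f. if m' = m + unit_exp i then of_int (lookup m' i) * lookup f m' else 0)"
    unfolding pdiff_def lookup_sum lookup_single when_def
    by (intro sum.cong refl if_cong) (auto simp: algebra_simps)
  also have "\<dots> = (if m + unit_exp i \<in> keys f then of_int (lookup (m + unit_exp i) i) * lookup f (m + unit_exp i) else 0)"
    by (simp add: sum.delta')
  also have "\<dots> = of_int (lookup m i + 1) * lookup f (m + unit_exp i)"
    by (auto simp: in_keys_iff lookup_add)
  finally show ?thesis .
qed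

lemma lookup_Delta:
  fixes f :: "'k::field laurent"
  shows "lookup (Delta n f) m = (\<Sum>i=1..n. of_int (lookup m i + 1) *
           lookup f (m - unit_exp (i - 1) + unit_exp i))"
  unfolding Delta_def lookup_sum Var_def lookup_single_mult lookup_pdiff
  by (intro sum.cong refl) (auto simp: lookup_minus lookup_single when_def)

text \<open>\<open>Gamma n a\<close> is diagonal in the monomial basis and this is its eigenvalue at
  the exponent \<open>m\<close>. Falling factorials and binomials of the operator are therefore
  computed coefficientwise.\<close>

definition gam :: "nat \<Rightarrow> 'k::field \<Rightarrow> exponent \<Rightarrow> 'k" where
  "gam n a m = (\<Sum>i=0..n. (a + of_nat i) * of_int (lookup m i))"

lemma lookup_Gamma [simp]: "lookup (Gamma n a f) m = gam n a m * lookup f m"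
  unfolding Gamma_def lookup_sum Var_def gam_def mult.assoc lookup_Const_mult lookup_single_mult
    lookup_pdiff sum_distrib_right
  by (intro sum.cong refl) (auto simp: lookup_minus)

lemma lookup_Gamma_falling:
  "lookup (Gamma_falling n a k g) m = (\<Prod>i<k. gam n a m - of_nat i) * lookup g m"
  by (induction k) (simp_all add: lookup_minus algebra_simps)

lemma lookup_Gamma_binom [simp]:
  "lookup (Gamma_binom n a k g) m = (gam n a m gchoose k) * lookup g m"
  by (simp add: Gamma_binom_def lookup_Gamma_falling gbinomial_prod_rev atLeast0LessThan)

lemma gam_add: "gam n a (m + m') = gam n a m + gam n a m'"
  by (simp add: gam_def lookup_add sum.distrib algebra_simps)

lemma Delta_add: "Delta n (f + g) = Delta n f + Delta n (g :: 'k::field laurent)"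
  by (rule poly_mapping_eqI) (simp add: lookup_Delta lookup_add distrib_left sum.distrib)

lemma Delta_0 [simp]: "Delta n 0 = (0 :: 'k::field laurent)"
  by (rule poly_mapping_eqI) (simp add: lookup_Delta)

lemma Delta_Const_mult: "Delta n (Const c * f) = Const c * Delta n (f :: 'k::field laurent)"
  by (rule poly_mapping_eqI) (simp add: lookup_Delta sum_distrib_left mult.left_commute)

lemma Delta_sum: "Delta n (sum f I) = (\<Sum>i\<in>I. Delta n (f i :: 'k::field laurent))"
  by (induction I rule: infinite_finite_induct) (auto simp: Delta_add)

lemma Delta_single:
  "Delta n (single m c) = (\<Sum>i=1..n. single (m - unit_exp i + unit_exp (i - 1))
     (of_int (lookup m i) * (c :: 'k::field)))"
proof (rule poly_mapping_eqI)
  fix m'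
  have "of_int (lookup m' i + 1) * (c when m = m' - unit_exp (i - 1) + unit_exp i) =
      (of_int (lookup m i) * c when m - unit_exp i + unit_exp (i - 1) = m')" if "i \<in> {1..n}" for i
  proof (cases "m = m' - unit_exp (i - 1) + unit_exp i")
    case True
    with that have "lookup m i = lookup m' i + 1"
      by (auto simp: lookup_add lookup_minus lookup_single when_def)
    then show ?thesis using True by simp
  next
    case False
    then have "m - unit_exp i + unit_exp (i - 1) \<noteq> m'" by (auto simp: algebra_simps)
    then show ?thesis using False by (simp add: when_def)
  qed
  then show "lookup (Delta n (single m c)) m' = lookup (\<Sum>i=1..n. single (m - unit_exp i + unit_exp (i - 1))
     (of_int (lookup m i) * c)) m'"
    unfolding lookup_Delta lookup_sum lookup_single by (intro sum.cong refl)
qed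

text \<open>Both sides are biadditive, so only a pair of monomials matters, and there the rule is
  the additivity of the exponent \<open>lookup m i\<close>.\<close>

lemma Delta_mult: "Delta n (f * g) = Delta n f * g + f * Delta n (g :: 'k::field laurent)"
proof -
  have single: "Delta n (single m c * single m' c') =
      Delta n (single m c) * single m' c' + single m c * Delta n (single m' c')" for m m' and c c' :: 'k
    unfolding mult_single Delta_single sum_distrib_left sum_distrib_right sum.distrib[symmetric]
    by (intro sum.cong refl)
      (simp add: mult_single lookup_add single_add[symmetric] algebra_simps)
  have 2: "Delta n (single m c * g) = Delta n (single m c) * g + single m c * Delta n g" for m and c :: 'k and g
    by (induction g rule: laurent_induct) (simp_all add: distrib_left Delta_add single algebra_simps)
  show ?thesis
    by (induction f rule: laurent_induct) (simp_all add: distrib_right Delta_add 2)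
qed

text \<open>The clause \<open>lookup m' i \<noteq> 0\<close> is what later keeps exponents
  nonnegative: a unit is moved from \<open>i\<close> to \<open>i - 1\<close> only if the exponent at
  \<open>i\<close> does not vanish.\<close>

lemma keys_DeltaE:
  fixes f :: "'k::field laurent"
  assumes "m \<in> keys (Delta n f)"
  obtains i m' where "i \<in> {1..n}" "m' \<in> keys f" "lookup m' i \<noteq> 0"
    "m = m' - unit_exp i + unit_exp (i - 1)"
proof -
  from assms have "lookup (Delta n f) m \<noteq> 0" by (simp add: in_keys_iff)
  then obtain i where i: "i \<in> {1..n}" "of_int (lookup m i + 1) * lookup f (m - unit_exp (i - 1) + unit_exp i) \<noteq> 0"
    unfolding lookup_Delta by (meson sum.not_neutral_contains_not_neutral)
  show ?thesis
  proof (rule that[OF i(1)])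
    show "m - unit_exp (i - 1) + unit_exp i \<in> keys f" using i by (auto simp: in_keys_iff)
    show "m = m - unit_exp (i - 1) + unit_exp i - unit_exp i + unit_exp (i - 1)" by simp
    have "of_int (lookup m i + 1) \<noteq> (0::'k)" using i by auto
    then have "lookup m i + 1 \<noteq> 0" by (metis of_int_0)
    then show "lookup (m - unit_exp (i - 1) + unit_exp i) i \<noteq> 0"
      using i(1) by (auto simp: lookup_add lookup_minus lookup_single when_def)
  qed
qed

lemma Delta_pow_0 [simp]: "(Delta n ^^ k) 0 = (0 :: 'k::field laurent)"
  by (induction k) auto

lemma Delta_pow_add: "(Delta n ^^ k) (f + g) = (Delta n ^^ k) f + (Delta n ^^ k) (g :: 'k::field laurent)"
  by (induction k arbitrary: f g) (simp_all add: Delta_add)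

lemma Delta_pow_Const_mult: "(Delta n ^^ k) (Const c * f) = Const c * (Delta n ^^ k) (f :: 'k::field laurent)"
  by (induction k arbitrary: f) (simp_all add: Delta_Const_mult)

lemma Delta_pow_sum: "(Delta n ^^ k) (sum f I) = (\<Sum>i\<in>I. (Delta n ^^ k) (f i :: 'k::field laurent))"
  by (induction I rule: infinite_finite_induct) (auto simp: Delta_pow_add)

lemma Delta_pow_eq_0_mono: "(Delta n ^^ k) f = (0 :: 'k::field laurent) \<Longrightarrow> k \<le> l \<Longrightarrow> (Delta n ^^ l) f = 0"
  by (metis Delta_pow_0 comp_apply funpow_add le_add_diff_inverse2)

subsection \<open>Supports\<close>

text \<open>\<open>Delta\<close> preserves this grading and lowers \<open>wt_exp\<close> by one. By
  \<open>gam_eq\<close> the eigenvalue of \<open>Gamma n a\<close> at a monomial is \<open>a\<close>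
  times this degree plus the weight.\<close>

definition deg_exp :: "nat \<Rightarrow> exponent \<Rightarrow> int" where
  "deg_exp n m = (\<Sum>i\<le>n. lookup m i)"

definition wt_exp :: "nat \<Rightarrow> exponent \<Rightarrow> int" where
  "wt_exp n m = (\<Sum>i\<le>n. int i * lookup m i)"

definition poly_exps :: "nat \<Rightarrow> exponent set" where
  "poly_exps n = {m. keys m \<subseteq> {..n} \<and> (\<forall>i. 0 \<le> lookup m i)}"

text \<open>These are the exponents of the localised ring. X_0 has weight 0, so its negative powers
  leave all weights nonnegative.\<close>

definition loc_exps :: "nat \<Rightarrow> exponent set" where
  "loc_exps n = {m. keys m \<subseteq> {..n} \<and> (\<forall>i>0. 0 \<le> lookup m i)}"

lemma poly_carrier_iff: "f \<in> poly_carrier n \<longleftrightarrow> keys f \<subseteq> poly_exps n"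
  by (auto simp: poly_carrier_def poly_exps_def)

lemma poly_exps_subset: "poly_exps n \<subseteq> loc_exps n"
  by (auto simp: poly_exps_def loc_exps_def)

lemma deg_exp_add: "deg_exp n (m + m') = deg_exp n m + deg_exp n m'"
  by (simp add: deg_exp_def lookup_add sum.distrib)

lemma deg_exp_diff: "deg_exp n (m - m') = deg_exp n m - deg_exp n m'"
  by (simp add: deg_exp_def lookup_minus sum_subtractf)

lemma wt_exp_add: "wt_exp n (m + m') = wt_exp n m + wt_exp n m'"
  by (simp add: wt_exp_def lookup_add sum.distrib algebra_simps)

lemma wt_exp_diff: "wt_exp n (m - m') = wt_exp n m - wt_exp n m'"
  by (simp add: wt_exp_def lookup_minus sum_subtractf algebra_simps)

lemma deg_exp_0 [simp]: "deg_exp n 0 = 0" and wt_exp_0 [simp]: "wt_exp n 0 = 0"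
  by (simp_all add: deg_exp_def wt_exp_def)

lemma deg_exp_single [simp]: "deg_exp n (single i e) = (if i \<le> n then e else 0)"
  by (simp add: deg_exp_def lookup_single when_def)

lemma wt_exp_single [simp]: "wt_exp n (single i e) = (if i \<le> n then int i * e else 0)"
  by (simp add: wt_exp_def lookup_single when_def if_distrib cong: if_cong)

lemma gam_eq: "gam n a m = a * of_int (deg_exp n m) + of_int (wt_exp n m)"
  by (simp add: gam_def deg_exp_def wt_exp_def atLeast0AtMost algebra_simps sum.distrib sum_distrib_left)

lemma poly_exps_add: "m \<in> poly_exps n \<Longrightarrow> m' \<in> poly_exps n \<Longrightarrow> m + m' \<in> poly_exps n"
  using Poly_Mapping.keys_add[of m m'] by (auto simp: poly_exps_def lookup_add)

lemma loc_exps_add: "m \<in> loc_exps n \<Longrightarrow> m' \<in> loc_exps n \<Longrightarrow> m + m' \<in> loc_exps n"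
  using Poly_Mapping.keys_add[of m m'] by (auto simp: loc_exps_def lookup_add)

lemma poly_exps_0 [simp]: "0 \<in> poly_exps n" and loc_exps_0 [simp]: "0 \<in> loc_exps n"
  by (auto simp: poly_exps_def loc_exps_def)

lemma poly_exps_single: "i \<le> n \<Longrightarrow> e \<ge> 0 \<Longrightarrow> single i e \<in> poly_exps n"
  by (auto simp: poly_exps_def lookup_single when_def)

lemma loc_exps_single: "i \<le> n \<Longrightarrow> i = 0 \<or> e \<ge> 0 \<Longrightarrow> single i e \<in> loc_exps n"
  by (auto simp: loc_exps_def lookup_single when_def)

lemma keys_shift: "keys (m - unit_exp i + unit_exp j) \<subseteq> keys m \<union> {i, j}"
  by (auto simp: in_keys_iff lookup_add lookup_minus lookup_single when_def split: if_splits)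

lemma poly_exps_shift:
  assumes "m \<in> poly_exps n" "i \<in> {1..n}" "lookup m i \<noteq> 0"
  shows "m - unit_exp i + unit_exp (i - 1) \<in> poly_exps n"
proof -
  have "lookup m i \<ge> 1" using assms by (simp add: poly_exps_def) (smt (verit))
  then show ?thesis
    using assms keys_shift[of m i "i - 1"]
    by (auto simp: poly_exps_def lookup_add lookup_minus lookup_single when_def)
qed

lemma loc_exps_shift:
  assumes "m \<in> loc_exps n" "i \<in> {1..n}" "lookup m i \<noteq> 0"
  shows "m - unit_exp i + unit_exp (i - 1) \<in> loc_exps n"
proof -
  have "lookup m i \<ge> 0" using assms(1,2) by (simp add: loc_exps_def)
  then have "lookup m i \<ge> 1" using assms by linarith
  then show ?thesis
    using assms keys_shift[of m i "i - 1"]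
    by (auto simp: loc_exps_def lookup_add lookup_minus lookup_single when_def)
qed

lemma wt_exp_nonneg:
  assumes "m \<in> loc_exps n"
  shows "0 \<le> wt_exp n m"
  unfolding wt_exp_def
proof (rule sum_nonneg)
  fix i
  show "0 \<le> int i * lookup m i"
    using assms by (cases "i = 0") (auto simp: loc_exps_def)
qed

lemma wt_exp_shift: "i \<in> {1..n} \<Longrightarrow> wt_exp n (m - unit_exp i + unit_exp (i - 1)) = wt_exp n m - 1"
  by (auto simp: wt_exp_add wt_exp_diff of_nat_diff)

lemma deg_exp_shift: "i \<in> {1..n} \<Longrightarrow> deg_exp n (m - unit_exp i + unit_exp (i - 1)) = deg_exp n m"
  by (auto simp: deg_exp_add deg_exp_diff)

lemma keys_add_subset: "keys f \<subseteq> S \<Longrightarrow> keys g \<subseteq> S \<Longrightarrow> keys (f + g) \<subseteq> S"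
  using Poly_Mapping.keys_add[of f g] by blast

lemma keys_sum_subset: "(\<And>i. i \<in> I \<Longrightarrow> keys (f i) \<subseteq> S) \<Longrightarrow> keys (sum f I) \<subseteq> S"
  by (induction I rule: infinite_finite_induct) (simp_all add: keys_add_subset)

lemma keys_mult_subset:
  fixes f g :: "'k::comm_ring laurent"
  assumes "keys f \<subseteq> S" "keys g \<subseteq> T" "\<And>m m'. m \<in> S \<Longrightarrow> m' \<in> T \<Longrightarrow> m + m' \<in> U"
  shows "keys (f * g) \<subseteq> U"
  using assms by (blast elim: keys_multE)

lemma keys_Const_mult: "keys (Const c * (f :: 'k::comm_ring laurent)) \<subseteq> keys f"
  by (auto simp: in_keys_iff)

lemma keys_Gamma: "keys (Gamma n a f) \<subseteq> keys f"
  by (auto simp: in_keys_iff)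

lemma keys_Gamma_binom: "keys (Gamma_binom n a k f) \<subseteq> keys f"
  by (auto simp: in_keys_iff)

lemma keys_Delta_subset:
  fixes f :: "'k::field laurent"
  assumes "keys f \<subseteq> S"
    and "\<And>m i. m \<in> S \<Longrightarrow> i \<in> {1..n} \<Longrightarrow> lookup m i \<noteq> 0 \<Longrightarrow> m - unit_exp i + unit_exp (i - 1) \<in> T"
  shows "keys (Delta n f) \<subseteq> T"
  using assms by (blast elim: keys_DeltaE)

text \<open>The supports \<open>S\<close> are indexed by the number of applications, which lets a
  drifting bound, such as one on the weight, serve as an invariant.\<close>

lemma keys_Delta_pow_subset:
  fixes f :: "'k::field laurent"
  assumes "keys f \<subseteq> S k"
    and "\<And>k m i. m \<in> S k \<Longrightarrow> i \<in> {1..n} \<Longrightarrow> lookup m i \<noteq> 0 \<Longrightarrow> m - unit_exp i + unit_exp (i - 1) \<in> S (Suc k)"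
  shows "keys ((Delta n ^^ l) f) \<subseteq> S (k + l)"
proof (induction l)
  case (Suc l)
  then show ?case
    using keys_Delta_subset[OF Suc, where T = "S (k + Suc l)"] assms(2) by auto
qed (use assms in simp)

text \<open>Each application of \<open>Delta\<close> lowers the weight by one, and weights on
  \<open>loc_exps n\<close> are nonnegative.\<close>

lemma Delta_nilpotent:
  fixes f :: "'k::field laurent"
  assumes "keys f \<subseteq> loc_exps n"
  obtains N where "\<And>k. k \<ge> N \<Longrightarrow> (Delta n ^^ k) f = 0"
proof -
  \<comment> \<open>\<open>insert 0\<close> covers \<open>f = 0\<close>, where there are no weights
    to maximise.\<close>
  define N where "N = nat (Max (insert 0 (wt_exp n ` keys f))) + 1"
  have N: "wt_exp n m < int N" if "m \<in> keys f" for m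
  proof -
    have "wt_exp n m \<le> Max (insert 0 (wt_exp n ` keys f))"
      by (intro Max_ge) (use that in auto)
    then show ?thesis unfolding N_def by linarith
  qed
  have "keys ((Delta n ^^ N) f) \<subseteq> {m \<in> loc_exps n. wt_exp n m + int (0 + N) < int N}"
    by (rule keys_Delta_pow_subset[where S = "\<lambda>k. {m \<in> loc_exps n. wt_exp n m + int k < int N}"])
      (use assms N in \<open>auto simp: loc_exps_shift[simplified] wt_exp_shift[simplified]\<close>)
  also have "\<dots> = {}" using wt_exp_nonneg by force
  finally have "(Delta n ^^ N) f = 0" by simp
  then show ?thesis using that Delta_pow_eq_0_mono by blast
qed

lemma poly_carrier_Delta_nilpotent:
  fixes f :: "'k::field laurent"
  assumes "f \<in> poly_carrier n"
  obtains N where "(Delta n ^^ N) f = 0"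
proof -
  have "keys f \<subseteq> loc_exps n" using assms poly_exps_subset unfolding poly_carrier_iff by blast
  then show ?thesis using Delta_nilpotent that by blast
qed

lemma poly_carrier_Delta: "f \<in> poly_carrier n \<Longrightarrow> Delta n f \<in> poly_carrier n"
  unfolding poly_carrier_iff by (rule keys_Delta_subset) (auto simp: poly_exps_shift[simplified])

lemma poly_carrier_Delta_pow: "f \<in> poly_carrier n \<Longrightarrow> (Delta n ^^ k) f \<in> poly_carrier n"
  by (induction k) (auto simp: poly_carrier_Delta)

lemma poly_carrier_add: "f \<in> poly_carrier n \<Longrightarrow> g \<in> poly_carrier n \<Longrightarrow> f + g \<in> poly_carrier n"
  unfolding poly_carrier_iff by (rule keys_add_subset)

lemma poly_carrier_uminus: "f \<in> poly_carrier n \<Longrightarrow> - f \<in> poly_carrier n"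
  for f :: "'k::comm_ring_1 laurent"
  unfolding poly_carrier_iff by (auto simp: in_keys_iff)

lemma poly_carrier_0 [simp]: "0 \<in> poly_carrier n"
  by (simp add: poly_carrier_iff)

lemma poly_carrier_1 [simp]: "1 \<in> poly_carrier n"
  by (simp add: poly_carrier_iff)

lemma poly_carrier_sum: "(\<And>i. i \<in> I \<Longrightarrow> f i \<in> poly_carrier n) \<Longrightarrow> sum f I \<in> poly_carrier n"
  unfolding poly_carrier_iff by (rule keys_sum_subset)

lemma poly_carrier_mult: "f \<in> poly_carrier n \<Longrightarrow> g \<in> poly_carrier n \<Longrightarrow> f * g \<in> poly_carrier n"
  for f :: "'k::comm_ring laurent"
  unfolding poly_carrier_iff by (rule keys_mult_subset) (auto simp: poly_exps_add)

lemma poly_carrier_power: "f \<in> poly_carrier n \<Longrightarrow> f ^ k \<in> poly_carrier n"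
  for f :: "'k::comm_ring_1 laurent"
  by (induction k) (auto intro: poly_carrier_mult)

lemma poly_carrier_Const: "Const c \<in> poly_carrier n"
  by (simp add: poly_carrier_iff Const_def)

lemma poly_carrier_Var: "i \<le> n \<Longrightarrow> Var i \<in> poly_carrier n"
  by (simp add: poly_carrier_iff Var_def poly_exps_single)

lemma poly_carrier_Gamma: "f \<in> poly_carrier n \<Longrightarrow> Gamma n a f \<in> poly_carrier n"
  unfolding poly_carrier_iff using keys_Gamma by blast

lemma poly_carrier_Gamma_binom: "f \<in> poly_carrier n \<Longrightarrow> Gamma_binom n a k f \<in> poly_carrier n"
  unfolding poly_carrier_iff using keys_Gamma_binom by blast

subsection \<open>The product\<close>

text \<open>Any bound on the nilpotency of the left factor truncates the sum. Every computation with
  \<open>star\<close> passes through this form.\<close>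

lemma star_eq_sum:
  assumes "(Delta n ^^ N) f = 0"
  shows "star n a f g = (\<Sum>k<N. (Delta n ^^ k) f * Gamma_binom n a k g)"
  unfolding star_def
proof (rule Sum_any.expand_superset)
  show "{k. (Delta n ^^ k) f * Gamma_binom n a k g \<noteq> 0} \<subseteq> {..<N}"
    using Delta_pow_eq_0_mono[OF assms] by (auto simp: not_less[symmetric])
qed simp

lemma poly_carrier_star:
  assumes "f \<in> poly_carrier n" "g \<in> poly_carrier n"
  shows "star n a f g \<in> poly_carrier n"
proof -
  obtain N where "(Delta n ^^ N) f = 0"
    using poly_carrier_Delta_nilpotent[OF assms(1)] .
  then show ?thesis
    using assms by (simp only: star_eq_sum) (intro poly_carrier_sum poly_carrier_mult
      poly_carrier_Delta_pow poly_carrier_Gamma_binom)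
qed

lemma Gamma_binom_0 [simp]: "Gamma_binom n a 0 g = g"
  by (rule poly_mapping_eqI) simp

lemma Gamma_binom_1 [simp]: "Gamma_binom n a (Suc 0) g = Gamma n a g"
  by (rule poly_mapping_eqI) simp

lemma star_Delta_eq_0: "Delta n f = 0 \<Longrightarrow> star n a f g = f * g"
  using star_eq_sum[where N = 1 and n = n and f = f] by simp

lemma Gamma_binom_eigen:
  "(\<And>m. m \<in> keys g \<Longrightarrow> gam n a m = c) \<Longrightarrow> Gamma_binom n a k g = Const (c gchoose k) * g"
  by (rule poly_mapping_eqI) (auto simp: in_keys_iff)

text \<open>A right factor that is an eigenvector of \<open>Gamma n a\<close> only twists the left
  factor, and the twist depends on the eigenvalue \<open>c\<close> alone. Right factors with equal
  eigenvalues twist alike, which is the source of the centrality of \<open>K\<close>.\<close>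

lemma star_eigen:
  assumes "(Delta n ^^ N) f = 0" "\<And>m. m \<in> keys g \<Longrightarrow> gam n a m = c"
  shows "star n a f g = (\<Sum>k<N. Const (c gchoose k) * (Delta n ^^ k) f) * g"
  unfolding star_eq_sum[OF assms(1)] sum_distrib_right
  by (intro sum.cong refl) (simp add: Gamma_binom_eigen[OF assms(2)] mult_ac)

lemma Delta_Var: "Delta n (Var i) = (if 1 \<le> i \<and> i \<le> n then Var (i - 1) else (0 :: 'k::field laurent))"
proof -
  have "single (unit_exp i - unit_exp i' + unit_exp (i' - 1)) (of_int (lookup (unit_exp i) i') * (1::'k)) =
     (if i' = i then Var (i - 1) else 0)" for i'
    by (auto simp: Var_def lookup_single when_def)
  then show ?thesis by (auto simp: Var_def[of i] Delta_single)
qed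

lemma Delta_X0_powi [simp]: "Delta n (X0_powi e) = (0 :: 'k::field laurent)"
  by (simp add: X0_powi_def Delta_single lookup_single when_def)

text \<open>\<open>Delta\<close> kills X_1 in two steps, so only k = 0 and k = 1 contribute.
  Commutators with X_1 thus make \<open>Gamma\<close> accessible inside the ring.\<close>

lemma star_Var1:
  fixes a :: "'k::field_char_0"
  assumes "n \<ge> 1"
  shows "star n a (Var 1) g = Var 1 * g + Var 0 * Gamma n a g"
proof -
  have "(Delta n ^^ 2) (Var 1 :: 'k laurent) = 0" using assms by (simp add: numeral_2_eq_2 Delta_Var)
  from star_eq_sum[OF this] show ?thesis
    using assms by (simp add: numeral_2_eq_2 Delta_Var)
qed

subsection \<open>Monomial valuations\<close>

text \<open>Degree-like convention: the largest value on the support. At \<open>f = 0\<close> this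
  is an unspecified \<open>Max {}\<close>, hence the nonzero hypotheses below.\<close>

definition val :: "(exponent \<Rightarrow> 'g::linorder) \<Rightarrow> 'k::zero laurent \<Rightarrow> 'g" where
  "val \<phi> f = Max (\<phi> ` keys f)"

lemma val_ge: "m \<in> keys f \<Longrightarrow> \<phi> m \<le> val \<phi> f"
  unfolding val_def by (intro Max_ge) auto

lemma val_eqI:
  assumes "m \<in> keys f" "\<phi> m = x" "\<And>m. m \<in> keys f \<Longrightarrow> \<phi> m \<le> x"
  shows "val \<phi> f = x"
  unfolding val_def using assms by (intro Max_eqI) auto

lemma val_single [simp]: "c \<noteq> 0 \<Longrightarrow> val \<phi> (single m c) = \<phi> m"
  by (rule val_eqI[of m]) auto

lemma val_attained:
  assumes "f \<noteq> 0"
  shows "\<exists>m\<in>keys f. \<phi> m = val \<phi> f"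
proof -
  have "val \<phi> f \<in> \<phi> ` keys f" unfolding val_def using assms by (intro Max_in) auto
  then show ?thesis by auto
qed

lemma val_add:
  assumes "f + g \<noteq> 0" and "f \<noteq> 0" "g \<noteq> 0"
  shows "val \<phi> (f + g) \<le> max (val \<phi> f) (val \<phi> g)"
proof -
  obtain m where "m \<in> keys (f + g)" and m: "\<phi> m = val \<phi> (f + g)"
    using val_attained[of "f + g" \<phi>] assms(1) by metis
  then have "m \<in> keys f \<or> m \<in> keys g" using Poly_Mapping.keys_add[of f g] by auto
  then show ?thesis
    using val_ge[of m f \<phi>] val_ge[of m g \<phi>] m by (auto simp: le_max_iff_disj)
qed

text \<open>Several exponents may share the top value of \<open>\<phi>\<close>. Ties are broken by
  the linear order of the exponent type: the sum of the largest top exponents of \<open>f\<close>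
  and of \<open>g\<close> arises in only one way, so its coefficient cannot cancel.\<close>

lemma top_key_mult:
  fixes f g :: "'k::idom laurent" and \<phi> :: "exponent \<Rightarrow> 'g::linordered_ab_group_add"
  assumes add: "\<And>m m'. \<phi> (m + m') = \<phi> m + \<phi> m'" and "f \<noteq> 0" "g \<noteq> 0"
  obtains m where "\<phi> m = val \<phi> f + val \<phi> g" "lookup (f * g) m \<noteq> 0"
proof -
  define F where "F = {m \<in> keys f. \<phi> m = val \<phi> f}"
  define G where "G = {m \<in> keys g. \<phi> m = val \<phi> g}"
  have F: "finite F" "F \<noteq> {}" and G: "finite G" "G \<noteq> {}"
    using val_attained[of f \<phi>] val_attained[of g \<phi>] assms(2,3) by (auto simp: F_def G_def)
  define mf where "mf = Max F" define mg where "mg = Max G"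
  have mf: "mf \<in> F" and mg: "mg \<in> G" using F G by (simp_all add: mf_def mg_def)
  have "lookup f l * lookup g (mf + mg - l) = (if l = mf then lookup f mf * lookup g mg else 0)"
    if l: "l \<in> keys f" for l
  proof (cases "l = mf")
    case False
    have "mf + mg - l \<notin> keys g"
    proof
      assume k: "mf + mg - l \<in> keys g"
      have "\<phi> l + \<phi> (mf + mg - l) = val \<phi> f + val \<phi> g"
        using add[of l "mf + mg - l"] add[of mf mg] mf mg by (simp add: F_def G_def)
      then have "\<phi> l = val \<phi> f" "\<phi> (mf + mg - l) = val \<phi> g"
        using val_ge[OF l, of \<phi>] val_ge[OF k, of \<phi>]
        by (metis add_le_cancel_left add_le_cancel_right add_mono order_antisym)+
      then have "l \<in> F" "mf + mg - l \<in> G" using l k by (auto simp: F_def G_def)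
      \<comment> \<open>Since the order is compatible with addition, the two inequalities force
        \<open>l = mf\<close>.\<close>
      then have "l \<le> mf" "mf + mg - l \<le> mg" using F G by (simp_all add: mf_def mg_def)
      then show False using False by (simp add: algebra_simps)
    qed
    then show ?thesis using False by (simp add: in_keys_iff)
  qed simp
  then have "lookup (f * g) (mf + mg) = lookup f mf * lookup g mg"
    using mf by (simp add: lookup_mult_keys F_def cong: sum.cong)
  then have "lookup (f * g) (mf + mg) \<noteq> 0" using mf mg by (auto simp: F_def G_def in_keys_iff)
  moreover have "\<phi> (mf + mg) = val \<phi> f + val \<phi> g" using mf mg by (simp add: add F_def G_def)
  ultimately show ?thesis using that by blast
qed

text \<open>\<open>Delta\<close> replaces X_i by X_(i-1) and so strictly lowers
  \<open>\<phi>\<close>, while the binomials of \<open>Gamma\<close> do not enlarge supports. Hence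
  \<open>star\<close> is the commutative product plus terms of smaller value.\<close>

lemma val_star:
  fixes \<phi> :: "exponent \<Rightarrow> 'g::linordered_ab_group_add" and f g :: "'k::field_char_0 laurent"
  assumes add: "\<And>m m'. \<phi> (m + m') = \<phi> m + \<phi> m'"
    and shift: "\<And>i. i \<in> {1..n} \<Longrightarrow> \<phi> (unit_exp (i - 1)) < \<phi> (unit_exp i)"
    and f: "keys f \<subseteq> loc_exps n" "f \<noteq> 0" and "g \<noteq> 0"
  shows "star n a f g \<noteq> 0" "val \<phi> (star n a f g) = val \<phi> f + val \<phi> g"
proof -
  obtain N where N: "\<And>k. k \<ge> N \<Longrightarrow> (Delta n ^^ k) f = 0" using Delta_nilpotent[OF f(1)] by blast
  define x where "x = val \<phi> f" define y where "y = val \<phi> g"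
  have diff: "\<phi> (m - m') = \<phi> m - \<phi> m'" for m m' using add[of "m - m'" m'] by simp
  have Delta: "\<phi> m < x" if "m \<in> keys ((Delta n ^^ Suc k) f)" for m k
  proof -
    have "\<phi> (m - unit_exp i + unit_exp (i - 1)) < \<phi> m" if "i \<in> {1..n}" for i m
      using shift[OF that] by (simp add: add diff algebra_simps)
    \<comment> \<open>The bound is weak before the first application and strict afterwards.\<close>
    then have "keys ((Delta n ^^ Suc k) f) \<subseteq> (if 0 + Suc k = 0 then {m. \<phi> m \<le> x} else {m. \<phi> m < x})"
      using val_ge[of _ f \<phi>]
      by (intro keys_Delta_pow_subset[where S = "\<lambda>k. if k = 0 then {m. \<phi> m \<le> x} else {m. \<phi> m < x}"])
        (auto simp: x_def split: if_splits intro: less_le_trans less_trans)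
    then show ?thesis using that by auto
  qed
  define h where "h = (\<Sum>k<N. (Delta n ^^ Suc k) f * Gamma_binom n a (Suc k) g)"
  have "star n a f g = f * g + h"
    using star_eq_sum[OF N[of "Suc N"], of a g]
    by (simp add: h_def sum.lessThan_Suc_shift del: funpow.simps sum.lessThan_Suc)
  have h: "keys h \<subseteq> {m. \<phi> m < x + y}"
    unfolding h_def
  proof (rule keys_sum_subset, rule keys_mult_subset)
    fix k
    show "keys ((Delta n ^^ Suc k) f) \<subseteq> {m. \<phi> m < x}" using Delta by blast
    show "keys (Gamma_binom n a (Suc k) g) \<subseteq> {m. \<phi> m \<le> y}"
      using keys_Gamma_binom[of n a "Suc k" g] val_ge[of _ g \<phi>] by (auto simp: y_def)
  qed (auto simp: add add_less_le_mono)
  have fg: "keys (f * g) \<subseteq> {m. \<phi> m \<le> x + y}"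
    by (rule keys_mult_subset[where S = "{m. \<phi> m \<le> x}" and T = "{m. \<phi> m \<le> y}"])
      (auto simp: add add_mono val_ge x_def y_def)
  obtain m where m: "\<phi> m = x + y" "lookup (f * g) m \<noteq> 0"
    using top_key_mult[of \<phi> f g] add f(2) \<open>g \<noteq> 0\<close> unfolding x_def y_def by metis
  have "lookup h m = 0" using h m(1) by (auto simp: in_keys_iff)
  then have mk: "m \<in> keys (star n a f g)" using m(2) \<open>star n a f g = f * g + h\<close> by (simp add: in_keys_iff lookup_add)
  then show "star n a f g \<noteq> 0" by auto
  have "keys (star n a f g) \<subseteq> {m. \<phi> m \<le> x + y}"
    unfolding \<open>star n a f g = f * g + h\<close> using h fg by (intro keys_add_subset) auto
  then show "val \<phi> (star n a f g) = val \<phi> f + val \<phi> g"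
    using mk m(1) by (intro val_eqI[of m]) (auto simp: x_def y_def)
qed

text \<open>\<open>Delta\<close> and \<open>Gamma\<close> do not raise the degree, so bounded degree
  gives a multiplicative filtration of R. This is the filtration whose growth is measured for m >=
  2.\<close>

lemma deg_star:
  assumes "f \<in> poly_carrier n" "\<And>m. m \<in> keys f \<Longrightarrow> deg_exp n m \<le> d" "\<And>m. m \<in> keys g \<Longrightarrow> deg_exp n m \<le> d'"
    "m \<in> keys (star n a f g)"
  shows "deg_exp n m \<le> d + d'"
proof -
  obtain N where N: "(Delta n ^^ N) f = 0"
    using poly_carrier_Delta_nilpotent[OF assms(1)] .
  have "keys (star n a f g) \<subseteq> {m. deg_exp n m \<le> d + d'}"
    unfolding star_eq_sum[OF N]
  proof (rule keys_sum_subset, rule keys_mult_subset)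
    fix k
    show "keys ((Delta n ^^ k) f) \<subseteq> {m. deg_exp n m \<le> d}"
      using keys_Delta_pow_subset[of f "\<lambda>_. {m. deg_exp n m \<le> d}" 0 n k] assms(2)
      by (auto simp: deg_exp_shift[simplified])
    show "keys (Gamma_binom n a k g) \<subseteq> {m. deg_exp n m \<le> d'}"
      using keys_Gamma_binom[of n a k g] assms(3) by auto
  qed (auto simp: deg_exp_add)
  then show ?thesis using assms(4) by auto
qed

subsection \<open>The kernel of \<open>\<Delta>\<close>\<close>

text \<open>A slice of the locally nilpotent derivation: \<open>Delta n zed = 1\<close>. This
  property makes the localised ring a polynomial ring in \<open>zed\<close> over the kernel of
  \<open>Delta\<close>.\<close>

definition zed :: "'k::field laurent" where
  "zed = X0_powi (- 1) * Var 1"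

lemma X0_powi_mult: "X0_powi e * X0_powi e' = (X0_powi (e + e') :: 'k::comm_ring_1 laurent)"
  by (simp add: X0_powi_def mult_single single_add)

lemma X0_powi_0 [simp]: "X0_powi 0 = (1 :: 'k::comm_ring_1 laurent)"
  by (simp add: X0_powi_def)

lemma Var_0: "Var 0 = X0_powi 1"
  by (simp add: Var_def X0_powi_def)

lemma X0_powi_power: "X0_powi e ^ k = (X0_powi (e * int k) :: 'k::comm_ring_1 laurent)"
  by (induction k) (simp_all add: X0_powi_mult algebra_simps)

lemma Var_0_power: "Var 0 ^ N = (X0_powi (int N) :: 'k::comm_ring_1 laurent)"
  by (simp add: Var_0 X0_powi_power)

lemma Var_power: "Var i ^ k = (single (single i (int k)) 1 :: 'k::comm_ring_1 laurent)"
  by (induction k) (simp_all add: Var_def mult_single single_add[symmetric])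

lemma zed_power: "zed ^ k = X0_powi (- int k) * (Var 1 ^ k :: 'k::field laurent)"
  by (simp add: zed_def power_mult_distrib X0_powi_power)

lemma Delta_zed: "n \<ge> 1 \<Longrightarrow> Delta n zed = (1 :: 'k::field laurent)"
  by (simp add: zed_def Delta_mult Delta_Var Var_0 X0_powi_mult)

lemma Delta_1 [simp]: "Delta n 1 = (0 :: 'k::field laurent)"
  using Delta_X0_powi[of n 0] by simp

lemma Delta_Const [simp]: "Delta n (Const c) = (0 :: 'k::field laurent)"
  using Delta_Const_mult[of n c 1] by simp

lemma Delta_zed_power:
  assumes "n \<ge> 1"
  shows "Delta n (zed ^ k) = Const (of_nat k) * (zed ^ (k - 1) :: 'k::field laurent)"
proof -
  have "Delta n (zed ^ k) = of_nat k * (zed ^ (k - 1) :: 'k laurent)"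
  proof (induction k)
    case (Suc k)
    then show ?case
      using assms by (cases k) (simp_all add: Delta_mult Delta_zed distrib_left distrib_right mult_ac)
  qed simp
  then show ?thesis by (simp only: Const_of_nat)
qed

lemma Delta_pow_Var:
  "j \<le> n \<Longrightarrow> (Delta n ^^ p) (Var j) = (if p \<le> j then Var (j - p) else (0 :: 'k::field laurent))"
  by (induction p) (auto simp: Delta_Var)

text \<open>\<open>Y_elem n j\<close> is exp(- zed Delta) applied to X_j, the usual way to push an
  element into the kernel with the help of a slice. The sum stops at p = j because
  \<open>Delta\<close> shifts X_j down to X_0 and then to 0.\<close>

lemma Y_elem_eq:
  assumes "j \<le> n"
  shows "Y_elem n j = (\<Sum>p\<le>j. Const ((- 1) ^ p / fact p) * zed ^ p * (Var (j - p) :: 'k::field_char_0 laurent))"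
proof -
  have C: "Const ((- 1) ^ p * c) = (- 1) ^ p * (Const c :: 'k laurent)" for p c
    by (induction p) (simp_all add: Const_uminus)
  have *: "(- Var 1) ^ p * (Const (1 / fact p) * X0_powi (- int p)) * (Delta n ^^ p) (Var j) =
    (if p \<le> j then Const ((- 1) ^ p / fact p) * zed ^ p * (Var (j - p) :: 'k laurent) else 0)" for p
    using C[of p "1 / fact p"]
    by (simp add: Delta_pow_Var[OF assms] zed_power power_minus[of "Var (Suc 0)"] mult_ac)
  show ?thesis
    unfolding Y_elem_def * by (subst Sum_any.expand_superset[of "{..j}"]) auto
qed

lemma Delta_Y_elem:
  assumes "1 \<le> j" "j \<le> n"
  shows "Delta n (Y_elem n j) = (0 :: 'k::field_char_0 laurent)"
proof -
  define c :: "nat \<Rightarrow> 'k" where "c p = (- 1) ^ p / fact p" for p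
  define t :: "nat \<Rightarrow> 'k laurent" where "t p = Const (c p) * zed ^ p * Var (j - Suc p)" for p
  \<comment> \<open>This recursion makes the two halves of the Leibniz rule telescope.\<close>
  have c: "c (Suc p) * of_nat (Suc p) = - c p" for p
    by (simp add: c_def field_simps del: of_nat_Suc)
  have D: "Delta n (Const (c p) * zed ^ p * Var (j - p)) =
      (if p < j then t p else 0) - (if 0 < p then t (p - 1) else 0)" if "p \<le> j" for p
  proof (cases p)
    case 0
    then show ?thesis using assms by (simp add: t_def Delta_Const_mult Delta_mult Delta_Var)
  next
    case (Suc q)
    have "Const (c p) * (Const (of_nat p) * zed ^ q) = - (Const (c q) * (zed ^ q :: 'k laurent))"
      unfolding mult.assoc[symmetric] Const_mult Suc c by (simp add: Const_uminus)
    moreover have "Delta n (zed ^ p) = Const (of_nat p) * (zed ^ q :: 'k laurent)"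
      using Delta_zed_power[of n p] assms Suc by simp
    ultimately have "Delta n (Const (c p) * zed ^ p) = - (Const (c q) * (zed ^ q :: 'k laurent))"
      by (simp only: Delta_Const_mult)
    then have "Delta n (Const (c p) * zed ^ p * Var (j - p)) =
        Const (c p) * zed ^ p * Delta n (Var (j - p)) - t q"
      by (simp add: Delta_mult t_def Suc)
    moreover have "Const (c p) * zed ^ p * Delta n (Var (j - p)) = (if p < j then t p else 0)"
      using assms that by (auto simp: Delta_Var t_def)
    ultimately show ?thesis using Suc by simp
  qed
  have "Delta n (Y_elem n j) = (\<Sum>p\<le>j. (if p < j then t p else 0) - (if 0 < p then t (p - 1) else 0))"
    unfolding Y_elem_eq[OF assms(2)] Delta_sum c_def[symmetric] by (intro sum.cong refl D) auto
  also have "\<dots> = (\<Sum>p\<le>j. if p < j then t p else 0) - (\<Sum>p\<le>j. if 0 < p then t (p - 1) else 0)"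
    by (simp add: sum_subtractf)
  also have "(\<Sum>p\<le>j. if p < j then t p else 0) = (\<Sum>p<j. t p)"
    by (intro sum.mono_neutral_cong_right) auto
  also have "(\<Sum>p\<le>j. if 0 < p then t (p - 1) else 0) = (\<Sum>p<j. t p)"
    by (subst sum.atMost_shift) simp
  finally show ?thesis by simp
qed

section \<open>Bidegrees and the graded components of \<open>B\<close>\<close>

definition hom_exps :: "nat \<Rightarrow> int \<Rightarrow> int \<Rightarrow> exponent set" where
  "hom_exps n d w = {m \<in> loc_exps n. deg_exp n m = d \<and> wt_exp n m = w}"

lemma hom_exps_0 [simp]: "0 \<in> hom_exps n 0 0"
  by (simp add: hom_exps_def)

lemma hom_exps_add: "m \<in> hom_exps n d w \<Longrightarrow> m' \<in> hom_exps n d' w' \<Longrightarrow> m + m' \<in> hom_exps n (d + d') (w + w')"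
  by (auto simp: hom_exps_def loc_exps_add deg_exp_add wt_exp_add)

lemma keys_mult_hom:
  fixes f g :: "'k::comm_ring laurent"
  assumes "keys f \<subseteq> hom_exps n d w" "keys g \<subseteq> hom_exps n d' w'"
  shows "keys (f * g) \<subseteq> hom_exps n (d + d') (w + w')"
  using keys_mult_subset[OF assms hom_exps_add] .

lemma keys_power_hom:
  fixes f :: "'k::comm_ring_1 laurent"
  assumes "keys f \<subseteq> hom_exps n d w"
  shows "keys (f ^ k) \<subseteq> hom_exps n (int k * d) (int k * w)"
proof (induction k)
  case (Suc k)
  show ?case using keys_mult_hom[OF assms Suc] by (simp add: algebra_simps)
qed (simp add: hom_exps_def)

lemma keys_prod_hom:
  fixes f :: "nat \<Rightarrow> 'k::comm_ring_1 laurent"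
  assumes "\<And>i. i \<in> I \<Longrightarrow> keys (f i) \<subseteq> hom_exps n (d i) (w i)"
  shows "keys (prod f I) \<subseteq> hom_exps n (sum d I) (sum w I)"
  using assms by (induction I rule: infinite_finite_induct) (simp_all add: keys_mult_hom)

lemma keys_X0_powi: "keys (X0_powi e :: 'k::comm_ring_1 laurent) \<subseteq> hom_exps n e 0"
  by (simp add: X0_powi_def hom_exps_def loc_exps_single)

lemma keys_Var: "i \<le> n \<Longrightarrow> keys (Var i :: 'k::comm_ring_1 laurent) \<subseteq> hom_exps n 1 (int i)"
  by (simp add: Var_def hom_exps_def loc_exps_single)

lemma keys_zed: "n \<ge> 1 \<Longrightarrow> keys (zed :: 'k::field laurent) \<subseteq> hom_exps n 0 1"
  using keys_mult_hom[OF keys_X0_powi[of "-1" n] keys_Var[of 1 n]] unfolding zed_def by simp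

lemma keys_Y_elem:
  assumes "1 \<le> j" "j \<le> n"
  shows "keys (Y_elem n j :: 'k::field_char_0 laurent) \<subseteq> hom_exps n 1 (int j)"
  unfolding Y_elem_eq[OF assms(2)]
proof (rule keys_sum_subset)
  fix p assume "p \<in> {..j}"
  then have "j - p \<le> n" "p \<le> j" using assms by auto
  then have "keys (zed ^ p * Var (j - p) :: 'k laurent) \<subseteq> hom_exps n 1 (int j)"
    using keys_mult_hom[OF keys_power_hom[OF keys_zed, of n p] keys_Var[of "j - p" n]] assms
    by (simp add: of_nat_diff)
  then show "keys (Const ((- 1) ^ p / fact p) * zed ^ p * Var (j - p) :: 'k laurent) \<subseteq> hom_exps n 1 (int j)"
    using keys_Const_mult unfolding mult.assoc by blast
qed

text \<open>The grading of \<open>B\<close> by \<open>B_degree\<close> is induced by the bigrading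
  (degree, weight) of the Laurent polynomials, since X_0 has bidegree (1, 0) and
  \<open>Y_elem n j\<close> has bidegree (1, j).\<close>

lemma keys_B_monom:
  assumes "e \<in> B_exponents n" "n \<ge> 2"
  shows "keys (B_monom n e :: 'k::field_char_0 laurent) \<subseteq> hom_exps n (fst (B_degree n e)) (snd (B_degree n e))"
proof -
  have "keys (Y_elem n j ^ nat (lookup e j) :: 'k laurent) \<subseteq> hom_exps n (lookup e j) (int j * lookup e j)"
    if "j \<in> {2..n}" for j
    using keys_power_hom[OF keys_Y_elem[of j n], of "nat (lookup e j)"] that assms(1)
    by (simp add: B_exponents_def mult.commute)
  from keys_mult_hom[OF keys_X0_powi keys_prod_hom[of "{2..n}", OF this]]
  show ?thesis unfolding B_monom_def B_degree_def by simp
qed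

lemma Delta_power_eq_0: "Delta n f = 0 \<Longrightarrow> Delta n (f ^ k) = (0 :: 'k::field laurent)"
  by (induction k) (simp_all add: Delta_mult)

lemma Delta_prod_eq_0: "(\<And>i. i \<in> I \<Longrightarrow> Delta n (f i) = 0) \<Longrightarrow> Delta n (prod f I) = (0 :: 'k::field laurent)"
  by (induction I rule: infinite_finite_induct) (simp_all add: Delta_mult)

lemma Delta_B_monom [simp]: "Delta n (B_monom n e) = (0 :: 'k::field_char_0 laurent)"
  by (auto simp: B_monom_def Delta_mult Delta_Y_elem intro!: Delta_prod_eq_0 Delta_power_eq_0)

lemma B_exponents_add: "e \<in> B_exponents n \<Longrightarrow> e' \<in> B_exponents n \<Longrightarrow> e + e' \<in> B_exponents n"
  using Poly_Mapping.keys_add[of e e'] by (auto simp: B_exponents_def lookup_add)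

lemma B_exponents_0 [simp]: "0 \<in> B_exponents n"
  by (simp add: B_exponents_def)

lemma B_monom_add:
  assumes "e \<in> B_exponents n" "e' \<in> B_exponents n"
  shows "B_monom n (e + e') = B_monom n e * (B_monom n e' :: 'k::field_char_0 laurent)"
proof -
  have "Y_elem n j ^ nat (lookup (e + e') j) = Y_elem n j ^ nat (lookup e j) * (Y_elem n j ^ nat (lookup e' j) :: 'k laurent)"
    if "j \<in> {2..n}" for j
    using that assms by (simp add: B_exponents_def lookup_add nat_add_distrib power_add)
  then have "(\<Prod>j=2..n. Y_elem n j ^ nat (lookup (e + e') j)) =
    (\<Prod>j=2..n. Y_elem n j ^ nat (lookup e j)) * (\<Prod>j=2..n. Y_elem n j ^ nat (lookup e' j) :: 'k laurent)"
    unfolding prod.distrib[symmetric] by (rule prod.cong[OF refl])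
  then show ?thesis
    by (simp add: B_monom_def lookup_add X0_powi_mult[symmetric] mult_ac)
qed

lemma B_monom_0 [simp]: "B_monom n 0 = (1 :: 'k::field_char_0 laurent)"
  by (simp add: B_monom_def)

lemma B_degree_add: "B_degree n (e + e') = (fst (B_degree n e) + fst (B_degree n e'), snd (B_degree n e) + snd (B_degree n e'))"
  by (simp add: B_degree_def lookup_add sum.distrib algebra_simps)

text \<open>Modulo \<open>X\<^sub>1\<close> the element \<open>Y\<^sub>j\<close> becomes \<open>X\<^sub>j\<close>.\<close>

definition cong_X1 :: "'k::field laurent \<Rightarrow> 'k laurent \<Rightarrow> bool" where
  "cong_X1 f g \<longleftrightarrow> keys f \<subseteq> {m. 0 \<le> lookup m 1} \<and> keys g \<subseteq> {m. 0 \<le> lookup m 1} \<and>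
     keys (f - g) \<subseteq> {m. 0 < lookup m 1}"

lemma cong_X1_refl: "keys f \<subseteq> {m. 0 \<le> lookup m 1} \<Longrightarrow> cong_X1 f f"
  by (simp add: cong_X1_def)

lemma cong_X1_mult:
  assumes "cong_X1 f f'" "cong_X1 g g'"
  shows "cong_X1 (f * g) (f' * g')"
proof -
  have "f * g - f' * g' = f * (g - g') + (f - f') * g'" by (simp add: algebra_simps)
  moreover have "keys (f * (g - g')) \<subseteq> {m. 0 < lookup m 1}"
    by (rule keys_mult_subset[where S = "{m. 0 \<le> lookup m 1}" and T = "{m. 0 < lookup m 1}"])
      (use assms in \<open>auto simp: cong_X1_def lookup_add\<close>)
  moreover have "keys ((f - f') * g') \<subseteq> {m. 0 < lookup m 1}"
    by (rule keys_mult_subset[where S = "{m. 0 < lookup m 1}" and T = "{m. 0 \<le> lookup m 1}"])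
      (use assms in \<open>auto simp: cong_X1_def lookup_add\<close>)
  moreover have "keys (f * g) \<subseteq> {m. 0 \<le> lookup m 1}" "keys (f' * g') \<subseteq> {m. 0 \<le> lookup m 1}"
    by (rule keys_mult_subset[where S = "{m. 0 \<le> lookup m 1}" and T = "{m. 0 \<le> lookup m 1}"];
      use assms in \<open>auto simp: cong_X1_def lookup_add\<close>)+
  ultimately show ?thesis by (simp add: cong_X1_def keys_add_subset)
qed

lemma cong_X1_power: "cong_X1 f g \<Longrightarrow> cong_X1 (f ^ k) (g ^ k)"
  by (induction k) (simp_all add: cong_X1_mult cong_X1_refl)

lemma cong_X1_prod: "(\<And>i. i \<in> I \<Longrightarrow> cong_X1 (f i) (g i)) \<Longrightarrow> cong_X1 (prod f I) (prod g I)"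
  by (induction I rule: infinite_finite_induct) (simp_all add: cong_X1_mult cong_X1_refl)

text \<open>Terms with p > 0 carry the factor \<open>zed ^ p\<close> and hence a positive power of
  X_1. The term p = 0 is X_j.\<close>

lemma cong_X1_Y_elem:
  assumes "2 \<le> j" "j \<le> n"
  shows "cong_X1 (Y_elem n j :: 'k::field_char_0 laurent) (Var j)"
proof -
  define h :: "'k laurent" where "h = (\<Sum>p<j. Const ((- 1) ^ Suc p / fact (Suc p)) * zed ^ Suc p * Var (j - Suc p))"
  have Y: "Y_elem n j = Var j + h"
    unfolding Y_elem_eq[OF assms(2)] h_def by (subst sum.atMost_shift) simp
  have "keys h \<subseteq> {m. 0 < lookup m 1}"
    unfolding h_def
  proof (rule keys_sum_subset)
    fix p
    have "Const ((- 1) ^ Suc p / fact (Suc p)) * zed ^ Suc p * Var (j - Suc p) = Const ((- 1) ^ Suc p / fact (Suc p)) *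
      (single (single 0 (- int (Suc p)) + single 1 (int (Suc p)) + unit_exp (j - Suc p)) 1 :: 'k laurent)"
      unfolding zed_power Var_power unfolding X0_powi_def Var_def mult.assoc by (simp add: mult_single add.assoc)
    moreover have "keys (Const ((- 1) ^ Suc p / fact (Suc p)) *
      (single (single 0 (- int (Suc p)) + single 1 (int (Suc p)) + unit_exp (j - Suc p)) 1 :: 'k laurent)) \<subseteq>
       {m. 0 < lookup m 1}"
      by (rule subset_trans[OF keys_Const_mult]) (simp add: lookup_add lookup_single when_def)
    ultimately show "keys (Const ((- 1) ^ Suc p / fact (Suc p)) * zed ^ Suc p * Var (j - Suc p) :: 'k laurent)
       \<subseteq> {m. 0 < lookup m 1}" by (simp only:)
  qed
  moreover have "keys (Var j :: 'k laurent) \<subseteq> {m. 0 \<le> lookup m 1}"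
    by (simp add: Var_def lookup_single when_def)
  moreover have "keys (Var j + h) \<subseteq> {m. 0 \<le> lookup m 1}"
    using calculation by (intro keys_add_subset) auto
  ultimately show ?thesis by (simp add: cong_X1_def Y)
qed

lemma single_eq_prod:
  assumes "keys m \<subseteq> {0} \<union> J" "0 \<notin> J" "finite J" "\<And>j. j \<in> J \<Longrightarrow> 0 \<le> lookup m j"
  shows "single m 1 = X0_powi (lookup m 0) * (\<Prod>j\<in>J. Var j ^ nat (lookup m j) :: 'k::comm_ring_1 laurent)"
proof -
  have prod: "(\<Prod>j\<in>I. single (single j (lookup m j)) 1) = (single (\<Sum>j\<in>I. single j (lookup m j)) 1 :: 'k laurent)" for I
    by (induction I rule: infinite_finite_induct) (simp_all add: mult_single)
  have "X0_powi (lookup m 0) * (\<Prod>j\<in>J. Var j ^ nat (lookup m j) :: 'k laurent) =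
      (\<Prod>j\<in>insert 0 J. single (single j (lookup m j)) 1)"
    using assms by (simp add: Var_power X0_powi_def cong: prod.cong)
  also have "\<dots> = single (\<Sum>j\<in>insert 0 J. single j (lookup m j)) 1" by (rule prod)
  also have "(\<Sum>j\<in>insert 0 J. single j (lookup m j)) = (\<Sum>j\<in>keys m. single j (lookup m j))"
    using assms by (intro sum.mono_neutral_right) (auto simp: in_keys_iff)
  also have "\<dots> = m" by (rule sum_keys_single)
  finally show ?thesis by simp
qed

text \<open>Modulo X_1 the monomial of \<open>B\<close> with exponent \<open>e\<close> is the
  Laurent monomial with the same exponent. Coefficients at exponents free of X_1 therefore separate
  the monomials of \<open>B\<close>, which is the algebraic independence of its generators in usable
  form.\<close>

lemma lookup_B_monom:
  assumes "e \<in> B_exponents n" "lookup m 1 = 0"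
  shows "lookup (B_monom n e :: 'k::field_char_0 laurent) m = (1 when m = e)"
proof -
  have "cong_X1 (B_monom n e) (X0_powi (lookup e 0) * (\<Prod>j=2..n. Var j ^ nat (lookup e j) :: 'k laurent))"
    unfolding B_monom_def
    by (intro cong_X1_mult cong_X1_prod cong_X1_power cong_X1_Y_elem cong_X1_refl)
      (auto simp: X0_powi_def lookup_single when_def)
  also have "X0_powi (lookup e 0) * (\<Prod>j=2..n. Var j ^ nat (lookup e j) :: 'k laurent) = single e 1"
    using assms by (intro single_eq_prod[symmetric]) (auto simp: B_exponents_def)
  finally have "m \<notin> keys (B_monom n e - (single e 1 :: 'k laurent))"
    using assms(2) by (auto simp: cong_X1_def)
  then show ?thesis by (auto simp: in_keys_iff lookup_minus lookup_single when_def split: if_splits)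
qed

lemma B_component_0 [simp]: "0 \<in> B_component n d"
  unfolding B_component_def by (rule CollectI, rule exI[of _ "{}"]) simp

lemma B_component_monom_add:
  assumes "e \<in> B_exponents n" "B_degree n e = d" "f \<in> B_component n d"
  shows "Const c * B_monom n e + f \<in> B_component n d"
proof -
  from assms(3) obtain E c' where E: "finite E" "E \<subseteq> {e \<in> B_exponents n. B_degree n e = d}"
    and f: "f = (\<Sum>e\<in>E. Const (c' e) * B_monom n e)"
    unfolding B_component_def by blast
  \<comment> \<open>The exponent \<open>e\<close> may already occur in \<open>E\<close>, so its
    coefficient is added to the old one.\<close>
  define c'' where "c'' = (\<lambda>e'. (if e' \<in> E then c' e' else 0) + (if e' = e then c else 0))"
  have "(\<Sum>e'\<in>insert e E. Const (c'' e') * B_monom n e') =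
      (\<Sum>e'\<in>insert e E. if e' \<in> E then Const (c' e') * B_monom n e' else 0) +
      (\<Sum>e'\<in>insert e E. if e' = e then Const c * B_monom n e' else 0)"
    unfolding c''_def sum.distrib[symmetric] by (intro sum.cong refl) (auto simp: Const_add distrib_right)
  also have "(\<Sum>e'\<in>insert e E. if e' \<in> E then Const (c' e') * B_monom n e' else 0) = f"
    unfolding f using E(1) by (intro sum.mono_neutral_cong_right) auto
  also have "(\<Sum>e'\<in>insert e E. if e' = e then Const c * B_monom n e' else 0) = Const c * B_monom n e"
    using E(1) by simp
  finally have "Const c * B_monom n e + f = (\<Sum>e'\<in>insert e E. Const (c'' e') * B_monom n e')"
    by simp
  then show ?thesis
    unfolding B_component_def using E assms by (intro CollectI exI[of _ "insert e E"] exI[of _ c'']) auto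
qed

lemma B_component_induct [consumes 1, case_names zero add]:
  assumes "f \<in> B_component n d" and "P 0"
    and "\<And>e c f. e \<in> B_exponents n \<Longrightarrow> B_degree n e = d \<Longrightarrow> f \<in> B_component n d \<Longrightarrow> P f \<Longrightarrow> P (Const c * B_monom n e + f)"
  shows "P f"
proof -
  from assms(1) obtain E c where E: "finite E" "E \<subseteq> {e \<in> B_exponents n. B_degree n e = d}"
    and f: "f = (\<Sum>e\<in>E. Const (c e) * B_monom n e)"
    unfolding B_component_def by blast
  have "P (\<Sum>e\<in>E. Const (c e) * B_monom n e) \<and> (\<Sum>e\<in>E. Const (c e) * B_monom n e) \<in> B_component n d"
    using E by (induction E) (auto intro!: assms(2,3) B_component_monom_add)
  then show ?thesis using f by simp
qed

lemma B_component_monom: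
  "e \<in> B_exponents n \<Longrightarrow> B_degree n e = d \<Longrightarrow> Const c * B_monom n e \<in> B_component n d"
  using B_component_monom_add[of e n d 0 c] by simp

lemma B_component_add:
  assumes "f \<in> B_component n d" "g \<in> B_component n d"
  shows "f + g \<in> B_component n d"
  using assms(1)
proof (induction f rule: B_component_induct)
  case (add e c f)
  then show ?case using B_component_monom_add[of e n d "f + g" c] by (simp add: add.assoc)
qed (use assms in simp)

lemma B_component_Const_mult: "f \<in> B_component n d \<Longrightarrow> Const c * f \<in> B_component n d"
proof (induction f rule: B_component_induct)
  case (add e c' f)
  then show ?case using B_component_monom_add[of e n d "Const c * f" "c * c'"]
    by (simp add: distrib_left mult.assoc[symmetric])
qed simp

lemma B_component_monom_mult:
  assumes "e \<in> B_exponents n" "f \<in> B_component n d"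
  shows "B_monom n e * f \<in> B_component n (fst (B_degree n e) + fst d, snd (B_degree n e) + snd d)"
  using assms(2)
proof (induction f rule: B_component_induct)
  case (add e' c f)
  have "B_monom n e * (Const c * B_monom n e' + f) = Const c * B_monom n (e + e') + B_monom n e * f"
    using assms(1) add by (simp add: B_monom_add algebra_simps)
  then show ?case
    using add assms(1) by (auto intro!: B_component_monom_add B_exponents_add simp: B_degree_add)
qed simp

lemma B_component_mult:
  assumes "f \<in> B_component n d" "g \<in> B_component n d'"
  shows "f * g \<in> B_component n (fst d + fst d', snd d + snd d')"
  using assms(1)
proof (induction f rule: B_component_induct)
  case (add e c f)
  then show ?case
    using B_component_add[OF B_component_Const_mult[OF B_component_monom_mult[OF add(1) assms(2)]], of "f * g" c]
    by (simp add: algebra_simps)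
qed simp

lemma B_component_Delta: "f \<in> B_component n d \<Longrightarrow> Delta n f = 0"
  by (induction f rule: B_component_induct) (simp_all add: Delta_add Delta_Const_mult)

lemma keys_B_component:
  assumes "f \<in> B_component n d" "n \<ge> 2"
  shows "keys f \<subseteq> hom_exps n (fst d) (snd d)"
  using assms(1)
proof (induction f rule: B_component_induct)
  case (add e c f)
  then show ?case
    using keys_B_monom[OF add(1) assms(2)] keys_Const_mult[of c "B_monom n e"] by (intro keys_add_subset) auto
qed simp

lemma B_component_neg:
  fixes f :: "'k::field_char_0 laurent"
  assumes "f \<in> B_component n d" "snd d < 0"
  shows "f = 0"
proof -
  have "e \<notin> B_exponents n \<or> B_degree n e \<noteq> d" for e
  proof -
    have "0 \<le> snd (B_degree n e)" if "e \<in> B_exponents n"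
      using that by (auto simp: B_degree_def B_exponents_def intro!: sum_nonneg)
    then show ?thesis using assms(2) by auto
  qed
  then have "{e \<in> B_exponents n. B_degree n e = d} = {}" by blast
  moreover obtain E c where "finite E" "E \<subseteq> {e \<in> B_exponents n. B_degree n e = d}"
    and f: "f = (\<Sum>e\<in>E. Const (c e) * B_monom n e)"
    using assms(1) unfolding B_component_def by blast
  ultimately have "E = {}" by blast
  then show ?thesis using f by simp
qed

text \<open>The leading exponents of elements of \<open>B\<close> do not involve \<open>X\<^sub>1\<close>.\<close>

lemma B_component_key:
  assumes "f \<in> B_component n d" "f \<noteq> 0"
  shows "\<exists>m\<in>keys f. lookup m 1 = 0"
proof -
  from assms(1) obtain E c where E: "finite E" "E \<subseteq> {e \<in> B_exponents n. B_degree n e = d}"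
    and f: "f = (\<Sum>e\<in>E. Const (c e) * B_monom n e)"
    unfolding B_component_def by blast
  from assms(2) obtain e where e: "e \<in> E" "c e \<noteq> 0"
    unfolding f by (metis (mono_tags, lifting) Const_0 mult_zero_left sum.neutral)
  have "keys e' \<subseteq> {0} \<union> {2..n}" if "e' \<in> E" for e'
    using that E(2) by (auto simp: B_exponents_def)
  then have "1 \<notin> keys e" using e(1) by fastforce
  then have e1: "lookup e 1 = 0" by (simp add: in_keys_iff)
  have "lookup f e = (\<Sum>e'\<in>E. c e' * (1 when e = e'))"
    unfolding f lookup_sum using E(2) e1 by (intro sum.cong refl) (auto simp: lookup_B_monom)
  also have "\<dots> = (\<Sum>e'\<in>E. if e' = e then c e' else 0)"
    by (intro sum.cong refl) (auto simp: when_def)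
  also have "\<dots> = c e" using E(1) e(1) by simp
  finally show ?thesis using e(2) e1 by (auto simp: in_keys_iff)
qed

section \<open>Bihomogeneous elements as polynomials in \<open>zed\<close> over
  \<open>B\<close>\<close>

text \<open>\<open>zed\<close> has bidegree (0, 1), so a coefficient of \<open>zed ^ j\<close> in
  total bidegree (d, w) has weight \<open>w - j\<close>. Products here are commutative ones, and
  repeated exponents \<open>j\<close> are allowed until \<open>zed_span_sumE\<close> collects
  them.\<close>

inductive_set zed_span :: "nat \<Rightarrow> int \<Rightarrow> int \<Rightarrow> 'k::field_char_0 laurent set" for n d w where
  zero: "0 \<in> zed_span n d w"
| add: "b \<in> B_component n (d, w - int j) \<Longrightarrow> f \<in> zed_span n d w \<Longrightarrow> b * zed ^ j + f \<in> zed_span n d w"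

lemma zed_span_add: "f \<in> zed_span n d w \<Longrightarrow> g \<in> zed_span n d w \<Longrightarrow> f + g \<in> zed_span n d w"
  by (induction f rule: zed_span.induct) (simp_all add: add.assoc zed_span.add)

lemma zed_span_base: "b \<in> B_component n (d, w - int j) \<Longrightarrow> b * zed ^ j \<in> zed_span n d w"
  using zed_span.add[OF _ zed_span.zero] by fastforce

lemma zed_span_mult:
  assumes "f \<in> zed_span n d w" "g \<in> zed_span n d' w'"
  shows "f * g \<in> zed_span n (d + d') (w + w')"
proof -
  have base: "b * zed ^ j * g \<in> zed_span n (d + d') (w + w')" if b: "b \<in> B_component n (d, w - int j)" for b j
    using assms(2)
  proof (induction g rule: zed_span.induct)
    case (add b' j' f)
    have "b * b' * zed ^ (j + j') \<in> zed_span n (d + d') (w + w')"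
      using B_component_mult[OF b add(1)] by (intro zed_span_base) (simp add: algebra_simps)
    moreover have "b * zed ^ j * (b' * zed ^ j' + f) = b * b' * zed ^ (j + j') + b * zed ^ j * f"
      by (simp add: algebra_simps power_add)
    ultimately show ?case using zed_span_add[OF _ add(3)] by (simp only:)
  qed (simp add: zed_span.zero)
  show ?thesis
    using assms(1)
  proof (induction f rule: zed_span.induct)
    case (add b j f)
    have "(b * zed ^ j + f) * g = b * zed ^ j * g + f * g" by (rule distrib_right)
    then show ?case using zed_span_add[OF base[OF add(1)] add(3)] by (simp only:)
  qed (simp add: zed_span.zero)
qed

lemma zed_span_1: "1 \<in> zed_span n 0 0"
  using zed_span_base[of 1 n 0 0 0] B_component_monom[of 0 n "(0, 0)" 1] by (simp add: B_degree_def)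

lemma zed_span_power: "f \<in> zed_span n d w \<Longrightarrow> f ^ k \<in> zed_span n (int k * d) (int k * w)"
proof (induction k)
  case (Suc k)
  show ?case using zed_span_mult[OF Suc(2) Suc(1)[OF Suc(2)]] by (simp add: algebra_simps)
qed (simp add: zed_span_1)

lemma zed_span_prod:
  "(\<And>i. i \<in> I \<Longrightarrow> f i \<in> zed_span n (d i) (w i)) \<Longrightarrow> prod f I \<in> zed_span n (sum d I) (sum w I)"
  by (induction I rule: infinite_finite_induct) (auto simp: zed_span_1 zed_span_mult)

lemma zed_span_zed_power: "zed ^ p \<in> zed_span n 0 (int p)"
  using zed_span_base[of 1 n 0 "int p" p] B_component_monom[of 0 n "(0, 0)" 1] by (simp add: B_degree_def)

lemma B_component_X0_powi: "X0_powi e \<in> B_component n (e, 0)"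
  using B_component_monom[of "single 0 e" n "(e, 0)" 1]
  by (cases "e = 0") (auto simp: B_exponents_def B_degree_def B_monom_def lookup_single when_def)

lemma zed_span_X0_powi: "(X0_powi e :: 'k::field_char_0 laurent) \<in> zed_span n e 0"
  using zed_span_base[of "X0_powi e :: 'k laurent" n e 0 0] B_component_X0_powi[of e n] by simp

lemma B_component_Y_elem:
  assumes "2 \<le> j" "j \<le> n"
  shows "(Y_elem n j :: 'k::field_char_0 laurent) \<in> B_component n (1, int j)"
proof -
  have 1: "(\<Sum>i=2..n. int i * lookup (unit_exp j) i) = int j" "(\<Sum>i=2..n. lookup (unit_exp j) i) = 1"
    using assms by (simp_all add: lookup_single when_def if_distrib cong: if_cong)
  have 2: "Y_elem n i ^ nat (lookup (unit_exp j) i) = (if i = j then Y_elem n j else (1 :: 'k laurent))" for i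
    by (auto simp: lookup_single when_def)
  have "B_monom n (unit_exp j) = (Y_elem n j :: 'k laurent)"
    unfolding B_monom_def 2 using assms by (simp add: lookup_single when_def)
  moreover have "unit_exp j \<in> B_exponents n"
    using assms by (auto simp: B_exponents_def lookup_single when_def)
  moreover have "B_degree n (unit_exp j) = (1, int j)"
    unfolding B_degree_def 1 using assms by (simp add: lookup_single)
  ultimately show ?thesis
    using B_component_monom[of "unit_exp j" n "(1, int j)" "1 :: 'k"] by simp
qed

lemma zed_span_Const_mult: "f \<in> zed_span n d w \<Longrightarrow> Const c * f \<in> zed_span n d w"
proof (induction f rule: zed_span.induct)
  case (add b j f)
  then show ?case
    using zed_span.add[OF B_component_Const_mult[OF add(1), of c] add(3)] by (simp add: algebra_simps)
qed (simp add: zed_span.zero)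

lemma zed_span_sum: "(\<And>i. i \<in> I \<Longrightarrow> f i \<in> zed_span n d w) \<Longrightarrow> sum f I \<in> zed_span n d w"
  by (induction I rule: infinite_finite_induct) (auto simp: zed_span_add zed_span.zero)

text \<open>The formula for \<open>Y_elem n j\<close> is solved for its term p = 0. The other terms
  involve only variables of smaller index, which gives a strong induction.\<close>

lemma Var_in_zed_span: "j \<le> n \<Longrightarrow> (Var j :: 'k::field_char_0 laurent) \<in> zed_span n 1 (int j)"
proof (induction j rule: less_induct)
  case (less j)
  consider "j = 0" | "j = 1" | "2 \<le> j" by linarith
  then show ?case
  proof cases
    case 1
    then show ?thesis
      by (simp add: Var_0 zed_span_X0_powi)
  next
    case 2
    have "Var 1 = X0_powi 1 * (zed ^ 1 :: 'k laurent)"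
      by (simp add: zed_def mult.assoc[symmetric] X0_powi_mult)
    then show ?thesis
      using zed_span_base[of "X0_powi 1" n 1 1 1] B_component_X0_powi[of 1 n] 2 by simp
  next
    case 3
    define g :: "nat \<Rightarrow> 'k laurent" where "g p = Const ((- 1) ^ p / fact p) * zed ^ p * Var (j - p)" for p
    have "Y_elem n j = Var j + (\<Sum>p<j. g (Suc p))"
      unfolding Y_elem_eq[OF less(2)] g_def[symmetric] by (subst sum.atMost_shift) (simp add: g_def)
    then have "Var j = Y_elem n j * zed ^ 0 + Const (- 1) * (\<Sum>p<j. g (Suc p))"
      by (simp add: Const_uminus)
    moreover have "g (Suc p) \<in> zed_span n 1 (int j)" if "p < j" for p
    proof -
      have "zed ^ Suc p * (Var (j - Suc p) :: 'k laurent) \<in> zed_span n (0 + 1) (int (Suc p) + int (j - Suc p))"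
        by (intro zed_span_mult zed_span_zed_power less(1)) (use that less(2) in auto)
      moreover have "int (Suc p) + int (j - Suc p) = int j" using that by linarith
      ultimately show ?thesis
        unfolding g_def mult.assoc by (intro zed_span_Const_mult) (simp only: add_0)
    qed
    ultimately show ?thesis
      using 3 less(2)
      by (simp only:) (intro zed_span.add zed_span_Const_mult zed_span_sum, simp_all add: B_component_Y_elem)
  qed
qed

lemma single_in_zed_span:
  assumes "m \<in> loc_exps n"
  shows "single m (c :: 'k::field_char_0) \<in> zed_span n (deg_exp n m) (wt_exp n m)"
proof -
  have m: "keys m \<subseteq> {..n}" "\<And>i. i \<in> {1..n} \<Longrightarrow> 0 \<le> lookup m i" using assms by (auto simp: loc_exps_def)
  have "(X0_powi (lookup m 0) :: 'k laurent) \<in> zed_span n (lookup m 0) 0"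
    by (rule zed_span_X0_powi)
  moreover have "(\<Prod>i=1..n. Var i ^ nat (lookup m i) :: 'k laurent) \<in> zed_span n (\<Sum>i=1..n. lookup m i) (\<Sum>i=1..n. int i * lookup m i)"
  proof (rule zed_span_prod)
    fix i assume i: "i \<in> {1..n}"
    show "(Var i ^ nat (lookup m i) :: 'k laurent) \<in> zed_span n (lookup m i) (int i * lookup m i)"
      using zed_span_power[OF Var_in_zed_span[of i n], of "nat (lookup m i)"] i m(2)[OF i] by (simp add: mult.commute)
  qed
  ultimately have "(X0_powi (lookup m 0) * (\<Prod>i=1..n. Var i ^ nat (lookup m i)) :: 'k laurent) \<in>
      zed_span n (lookup m 0 + (\<Sum>i=1..n. lookup m i)) (0 + (\<Sum>i=1..n. int i * lookup m i))"
    by (rule zed_span_mult)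
  moreover have "X0_powi (lookup m 0) * (\<Prod>i=1..n. Var i ^ nat (lookup m i)) = (single m 1 :: 'k laurent)"
    using m by (intro single_eq_prod[symmetric]) auto
  moreover have "lookup m 0 + (\<Sum>i=1..n. lookup m i) = deg_exp n m"
    by (simp add: deg_exp_def sum.atLeast_Suc_atMost atMost_atLeast0)
  moreover have "0 + (\<Sum>i=1..n. int i * lookup m i) = wt_exp n m"
    by (simp add: wt_exp_def sum.atLeast_Suc_atMost atMost_atLeast0)
  ultimately show ?thesis
    by (subst single_eq_Const_mult) (simp add: zed_span_Const_mult)
qed

lemma hom_in_zed_span:
  assumes "keys f \<subseteq> hom_exps n d w"
  shows "f \<in> zed_span n d w"
  using assms
proof (induction f rule: laurent_induct_on)
  case (add m c f)
  then show ?case using single_in_zed_span[of m n c] by (auto simp: hom_exps_def intro: zed_span_add)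
qed (rule zed_span.zero)

lemma zed_span_sumE:
  assumes "f \<in> zed_span n d w"
  shows "\<exists>b J. (\<forall>j. b j \<in> B_component n (d, w - int j)) \<and> f = (\<Sum>j\<le>J. b j * zed ^ j)"
  using assms
proof (induction f rule: zed_span.induct)
  case zero
  show ?case by (rule exI[of _ "\<lambda>_. 0"]) simp
next
  case (add b0 i f)
  then obtain b J where b: "\<And>j. b j \<in> B_component n (d, w - int j)" and f: "f = (\<Sum>j\<le>J. b j * zed ^ j)"
    by blast
  define b1 where "b1 j = (if j \<le> J then b j else 0) + (if j = i then b0 else 0)" for j
  define K where "K = max i J"
  have "(\<Sum>j\<le>K. b1 j * zed ^ j) = (\<Sum>j\<le>K. if j \<le> J then b j * zed ^ j else 0) + (\<Sum>j\<le>K. if j = i then b0 * zed ^ j else 0)"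
    unfolding b1_def sum.distrib[symmetric] by (intro sum.cong refl) (auto simp: distrib_right)
  also have "(\<Sum>j\<le>K. if j \<le> J then b j * zed ^ j else 0) = f"
    unfolding f by (intro sum.mono_neutral_cong_right) (auto simp: K_def)
  also have "(\<Sum>j\<le>K. if j = i then b0 * zed ^ j else 0) = b0 * zed ^ i"
    by (simp add: K_def)
  finally have "b0 * zed ^ i + f = (\<Sum>j\<le>K. b1 j * zed ^ j)" by simp
  moreover have "b1 j \<in> B_component n (d, w - int j)" for j
    unfolding b1_def using b add(1) by (intro B_component_add) auto
  ultimately show ?case by blast
qed

text \<open>The product over \<open>i < k\<close> of \<open>j - i\<close> is a falling factorial;
  for \<open>k = j\<close> it is j factorial and only \<open>b\<close> remains.\<close>

lemma Delta_pow_zed_power: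
  assumes "n \<ge> 1" "Delta n b = 0"
  shows "(Delta n ^^ k) (b * zed ^ j) = (if k \<le> j then Const (of_nat (\<Prod>i<k. j - i)) * (b * zed ^ (j - k)) else (0 :: 'k::field_char_0 laurent))"
proof (induction k)
  case (Suc k)
  have D: "Delta n (b * zed ^ i) = Const (of_nat i) * (b * zed ^ (i - 1))" for i
    using assms by (simp add: Delta_mult Delta_zed_power mult_ac)
  show ?case
  proof (cases "k \<le> j")
    case True
    let ?c = "of_nat (\<Prod>i<k. j - i) :: 'k"
    have "(Delta n ^^ Suc k) (b * zed ^ j) = Const ?c * (Const (of_nat (j - k)) * (b * zed ^ (j - Suc k)))"
      using Suc True by (simp only: funpow.simps comp_apply if_True Delta_Const_mult D) simp
    also have "\<dots> = Const (of_nat (\<Prod>i<Suc k. j - i)) * (b * zed ^ (j - Suc k))"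
      by (simp only: mult.assoc[symmetric] Const_mult of_nat_mult[symmetric] prod.lessThan_Suc)
    finally show ?thesis using True by (auto simp: not_less_eq_eq)
  next
    case False
    then show ?thesis using Suc by simp
  qed
qed simp

text \<open>\<open>Delta\<close> applied J times to a polynomial of degree J in \<open>zed\<close>
  leaves its top coefficient times J factorial. In characteristic zero a polynomial killed by
  \<open>Delta\<close> thus loses its positive powers of \<open>zed\<close> one at a time.\<close>

lemma zed_span_kernel:
  assumes "n \<ge> 1" "f \<in> zed_span n d w" "Delta n f = 0"
  shows "f \<in> B_component n (d, w)"
proof -
  obtain b J where b: "\<And>j. b j \<in> B_component n (d, w - int j)" and f: "f = (\<Sum>j\<le>J. b j * zed ^ j)"
    using zed_span_sumE[OF assms(2)] by blast
  have "(\<Sum>j\<le>J. b j * zed ^ j) = b 0" if "Delta n (\<Sum>j\<le>J. b j * zed ^ j) = 0" for J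
    using that
  proof (induction J)
    case (Suc J)
    have D: "Delta n (b j) = 0" for j using b B_component_Delta by blast
    have "(Delta n ^^ Suc J) (\<Sum>j\<le>Suc J. b j * zed ^ j) = 0"
      using Suc(2) by (simp only: funpow_Suc_right comp_apply) simp
    then have "(\<Sum>j\<le>Suc J. (Delta n ^^ Suc J) (b j * zed ^ j)) = 0"
      by (simp only: Delta_pow_sum)
    also have "(\<Sum>j\<le>Suc J. (Delta n ^^ Suc J) (b j * zed ^ j)) = Const (of_nat (\<Prod>i<Suc J. Suc J - i)) * b (Suc J)"
      unfolding Delta_pow_zed_power[OF assms(1) D] by simp
    finally have "b (Suc J) = 0" by (auto simp del: of_nat_Suc)
    then show ?case using Suc by simp
  qed simp
  then show ?thesis using assms(3) b[of 0] f by simp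
qed

lemma kernel_hom_B_component:
  assumes "n \<ge> 1" "keys f \<subseteq> hom_exps n d w" "Delta n f = 0"
  shows "f \<in> B_component n (d, w)"
  using zed_span_kernel[OF assms(1) hom_in_zed_span[OF assms(2)] assms(3)] .

section \<open>Skewfields and valuations\<close>

text \<open>Tuples of integers with the lexicographic order serve as value groups
  throughout.\<close>

instance prod :: (ordered_ab_group_add, ordered_ab_group_add) ordered_ab_group_add
  by standard (auto simp: less_eq_prod_def)

instance prod :: (linordered_ab_group_add, linordered_ab_group_add) linordered_ab_group_add ..

locale skew = ring R for R (structure) +
  assumes Units_eq: "Units R = carrier R - {\<zero>}"

lemma skewfield_iff: "skewfield Q \<longleftrightarrow> skew Q"
  by (simp add: skewfield_def skew_def skew_axioms_def)

context skew
begin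

lemma inv_closed' [simp, intro]: "x \<in> carrier R \<Longrightarrow> x \<noteq> \<zero> \<Longrightarrow> inv x \<in> carrier R"
  using Units_eq by auto

lemma r_inv' [simp]: "x \<in> carrier R \<Longrightarrow> x \<noteq> \<zero> \<Longrightarrow> x \<otimes> inv x = \<one>"
  using Units_eq by auto

lemma l_inv' [simp]: "x \<in> carrier R \<Longrightarrow> x \<noteq> \<zero> \<Longrightarrow> inv x \<otimes> x = \<one>"
  using Units_eq by auto

lemma one_neq_zero [simp]: "\<one> \<noteq> \<zero>"
  using Units_eq by (metis Diff_iff Units_one_closed singletonI)

lemma zero_neq_one [simp]: "\<zero> \<noteq> \<one>"
  using one_neq_zero by metis

lemma l_inv_cancel [simp]: "x \<in> carrier R \<Longrightarrow> x \<noteq> \<zero> \<Longrightarrow> y \<in> carrier R \<Longrightarrow> inv x \<otimes> (x \<otimes> y) = y"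
  by (simp add: m_assoc[symmetric])

lemma r_inv_cancel [simp]: "x \<in> carrier R \<Longrightarrow> x \<noteq> \<zero> \<Longrightarrow> y \<in> carrier R \<Longrightarrow> x \<otimes> (inv x \<otimes> y) = y"
  by (simp add: m_assoc[symmetric])

lemma mult_nonzero: "x \<in> carrier R \<Longrightarrow> y \<in> carrier R \<Longrightarrow> x \<noteq> \<zero> \<Longrightarrow> y \<noteq> \<zero> \<Longrightarrow> x \<otimes> y \<noteq> \<zero>"
  using l_inv_cancel[of x y] by (metis inv_closed' r_null)

lemma inv_nonzero [simp]: "x \<in> carrier R \<Longrightarrow> x \<noteq> \<zero> \<Longrightarrow> inv x \<noteq> \<zero>"
  using r_inv'[of x] by (metis one_neq_zero r_null)

lemma m_cancel_left: "x \<in> carrier R \<Longrightarrow> x \<noteq> \<zero> \<Longrightarrow> y \<in> carrier R \<Longrightarrow> z \<in> carrier R \<Longrightarrow> x \<otimes> y = x \<otimes> z \<Longrightarrow> y = z"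
  by (metis l_inv_cancel)

lemma inv_mult: "x \<in> carrier R \<Longrightarrow> y \<in> carrier R \<Longrightarrow> x \<noteq> \<zero> \<Longrightarrow> y \<noteq> \<zero> \<Longrightarrow> inv (x \<otimes> y) = inv y \<otimes> inv x"
  by (rule m_cancel_left[of "x \<otimes> y"]) (auto simp: mult_nonzero m_assoc)

lemma inv_commute:
  assumes "x \<in> carrier R" "x \<noteq> \<zero>" "y \<in> carrier R" "x \<otimes> y = y \<otimes> x"
  shows "inv x \<otimes> y = y \<otimes> inv x"
proof (rule m_cancel_left[of x])
  have "x \<otimes> (y \<otimes> inv x) = y \<otimes> x \<otimes> inv x" using assms by (simp add: m_assoc[symmetric])
  then show "x \<otimes> (inv x \<otimes> y) = x \<otimes> (y \<otimes> inv x)" using assms by (simp add: m_assoc)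
qed (use assms in auto)

lemma pow_nonzero: "x \<in> carrier R \<Longrightarrow> x \<noteq> \<zero> \<Longrightarrow> x [^] (k::nat) \<noteq> \<zero>"
  by (induction k) (auto simp: mult_nonzero)

lemma uminus_one_nonzero: "x \<in> carrier R \<Longrightarrow> x \<noteq> \<zero> \<Longrightarrow> \<ominus> x \<noteq> \<zero>"
  using minus_minus minus_zero by force

lemma center_subring: "subring (ring_center R) R"
proof (rule subringI)
  show "ring_center R \<subseteq> carrier R" "\<one> \<in> ring_center R" by (auto simp: ring_center_def)
next
  fix x assume "x \<in> ring_center R"
  then show "\<ominus> x \<in> ring_center R" by (auto simp: ring_center_def l_minus r_minus)
next
  fix x y assume "x \<in> ring_center R" "y \<in> ring_center R"
  then have c: "x \<in> carrier R" "y \<in> carrier R"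
    and x: "x \<otimes> z = z \<otimes> x" and y: "y \<otimes> z = z \<otimes> y" if "z \<in> carrier R" for z
    using that by (auto simp: ring_center_def)
  have "x \<otimes> y \<otimes> z = z \<otimes> (x \<otimes> y)" if "z \<in> carrier R" for z
    using c that x y by (metis m_assoc)
  moreover have "(x \<oplus> y) \<otimes> z = z \<otimes> (x \<oplus> y)" if "z \<in> carrier R" for z
    using c that x y by (simp add: l_distr r_distr)
  ultimately show "x \<otimes> y \<in> ring_center R" "x \<oplus> y \<in> ring_center R"
    unfolding ring_center_def using c m_closed[OF c] add.m_closed[OF c] by blast+
qed

lemma center_subfield: "subfield (ring_center R) R"
proof (rule subfieldI)
  have ZR: "ring_center R \<subseteq> carrier R" by (auto simp: ring_center_def)
  have comm: "x \<otimes> y = y \<otimes> x" if "x \<in> ring_center R" "y \<in> carrier R" for x y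
    using that by (simp add: ring_center_def)
  show "subcring (ring_center R) R"
    by (rule subcringI[OF center_subring]) (use comm ZR in blast)
  show "Units (R\<lparr>carrier := ring_center R\<rparr>) = ring_center R - {\<zero>}"
  proof (intro equalityI subsetI)
    fix x assume "x \<in> Units (R\<lparr>carrier := ring_center R\<rparr>)"
    then obtain y where "x \<in> ring_center R" "y \<in> ring_center R" "x \<otimes> y = \<one>"
      by (auto simp: Units_def)
    moreover from this have "y \<in> carrier R" using ZR by blast
    ultimately have "x \<noteq> \<zero>" "x \<in> ring_center R" using l_null[of y] one_neq_zero by auto
    then show "x \<in> ring_center R - {\<zero>}" by simp
  next
    fix x assume x: "x \<in> ring_center R - {\<zero>}"
    then have c: "x \<in> carrier R" "x \<noteq> \<zero>" using ZR by auto
    have "inv x \<in> ring_center R"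
      unfolding ring_center_def using c inv_commute[OF c] comm[of x] x by auto
    moreover have "inv x \<otimes> x = \<one> \<and> x \<otimes> inv x = \<one>" using c by simp
    ultimately show "x \<in> Units (R\<lparr>carrier := ring_center R\<rparr>)"
      unfolding Units_def using x by fastforce
  qed
qed

subsection \<open>Fractions\<close>

definition fracs_of :: "'a set \<Rightarrow> bool" where
  "fracs_of S \<longleftrightarrow> (\<forall>q\<in>carrier R. \<exists>r\<in>S. \<exists>s\<in>S - {\<zero>}. q = r \<otimes> inv s)"

lemma fracs_ofE:
  assumes "fracs_of S" "q \<in> carrier R"
  obtains r s where "r \<in> S" "s \<in> S - {\<zero>}" "q = r \<otimes> inv s"
  using assms unfolding fracs_of_def by meson

text \<open>The quotient \<open>inv a \<otimes> b\<close> is itself a right fraction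
  \<open>x \<otimes> inv y\<close>; clearing both denominators gives the right Ore
  condition.\<close>

lemma ore:
  assumes "subring S R" "fracs_of S" "a \<in> S" "b \<in> S" "a \<noteq> \<zero>"
  shows "\<exists>x\<in>S. \<exists>y\<in>S - {\<zero>}. b \<otimes> y = a \<otimes> x"
proof -
  have S: "S \<subseteq> carrier R" using assms(1) by (rule subringE)
  then have c: "a \<in> carrier R" "b \<in> carrier R" using assms by auto
  obtain x y where xy: "x \<in> S" "y \<in> S - {\<zero>}" "inv a \<otimes> b = x \<otimes> inv y"
    using assms(2,5) c unfolding fracs_of_def by (meson inv_closed' m_closed)
  then have c': "x \<in> carrier R" "y \<in> carrier R" "y \<noteq> \<zero>" using S by auto
  have "b \<otimes> y = a \<otimes> (inv a \<otimes> b) \<otimes> y" using c c' assms(5) by simp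
  also have "\<dots> = a \<otimes> x" using c c' assms(5) by (simp add: xy(3) m_assoc)
  finally show ?thesis using xy by blast
qed

text \<open>A new denominator \<open>t\<close> is merged with the old one \<open>s\<close> through a
  common right multiple \<open>s \<otimes> y = t \<otimes> x\<close>.\<close>

lemma common_denominator:
  assumes S: "subring S R" "fracs_of S" and "finite U" "U \<subseteq> carrier R"
  shows "\<exists>s\<in>S - {\<zero>}. \<forall>u\<in>U. u \<otimes> s \<in> S"
  using assms(3,4)
proof (induction U)
  case empty
  then show ?case using subringE(3)[OF S(1)] by auto
next
  case (insert u U)
  have SR: "S \<subseteq> carrier R" using S(1) by (rule subringE)
  obtain s where s: "s \<in> S - {\<zero>}" "\<forall>u\<in>U. u \<otimes> s \<in> S" using insert by auto
  obtain r t where rt: "r \<in> S" "t \<in> S - {\<zero>}" "u = r \<otimes> inv t" using fracs_ofE[OF S(2), of u] insert(4) by blast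
  obtain x y where xy: "x \<in> S" "y \<in> S - {\<zero>}" "s \<otimes> y = t \<otimes> x" using ore[OF S, of t s] s rt by auto
  have c: "s \<in> carrier R" "t \<in> carrier R" "r \<in> carrier R" "x \<in> carrier R" "y \<in> carrier R"
    and nz: "s \<noteq> \<zero>" "y \<noteq> \<zero>" "t \<noteq> \<zero>"
    using s rt xy SR by auto
  have "u \<otimes> (s \<otimes> y) = r \<otimes> x" using c nz by (simp add: xy(3) rt(3) m_assoc)
  then have "u \<otimes> (s \<otimes> y) \<in> S" using subringE(6)[OF S(1)] rt xy by simp
  moreover have "w \<otimes> (s \<otimes> y) \<in> S" if "w \<in> U" for w
    using subringE(6)[OF S(1), of "w \<otimes> s" y] that s(2) xy(2) insert(4) c by (auto simp: m_assoc)
  moreover have "s \<otimes> y \<in> S - {\<zero>}"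
    using subringE(6)[OF S(1), of s y] s(1) xy(1,2) mult_nonzero[of s y] c nz by blast
  ultimately show ?case by blast
qed

subsection \<open>Valuations\<close>

text \<open>Degree-like valuations: \<open>max\<close> instead of \<open>min\<close>, and nothing is
  asserted about the value of zero.\<close>

definition valn :: "'a set \<Rightarrow> ('a \<Rightarrow> 'g::linordered_ab_group_add) \<Rightarrow> bool" where
  "valn S v \<longleftrightarrow>
     (\<forall>a\<in>S - {\<zero>}. \<forall>b\<in>S - {\<zero>}. v (a \<otimes> b) = v a + v b) \<and>
     (\<forall>a\<in>S - {\<zero>}. \<forall>b\<in>S - {\<zero>}. a \<oplus> b \<noteq> \<zero> \<longrightarrow> v (a \<oplus> b) \<le> max (v a) (v b))"

lemma valn_mult: "valn S v \<Longrightarrow> a \<in> S \<Longrightarrow> b \<in> S \<Longrightarrow> a \<noteq> \<zero> \<Longrightarrow> b \<noteq> \<zero> \<Longrightarrow> v (a \<otimes> b) = v a + v b"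
  by (simp add: valn_def)

lemma valn_add: "valn S v \<Longrightarrow> a \<in> S \<Longrightarrow> b \<in> S \<Longrightarrow> a \<noteq> \<zero> \<Longrightarrow> b \<noteq> \<zero> \<Longrightarrow> a \<oplus> b \<noteq> \<zero> \<Longrightarrow> v (a \<oplus> b) \<le> max (v a) (v b)"
  by (simp add: valn_def)

text \<open>The extension is \<open>v r - v s\<close> on the right fraction of \<open>r\<close> by
  \<open>s\<close>. The Ore condition supplies well-definedness and multiplicativity, and a common
  denominator supplies the inequality for sums.\<close>

lemma valn_extend:
  assumes S: "subring S R" "fracs_of S" and v: "valn S v"
  obtains V where "valn (carrier R) V" "\<And>s. s \<in> S \<Longrightarrow> s \<noteq> \<zero> \<Longrightarrow> V s = v s"
proof -
  have SR: "S \<subseteq> carrier R" using S(1) by (rule subringE)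
  note SD = subringE(6,7)[OF S(1)]
  define V where "V q = (SOME x. \<exists>r\<in>S - {\<zero>}. \<exists>s\<in>S - {\<zero>}. q = r \<otimes> inv s \<and> x = v r - v s)" for q
  \<comment> \<open>Both fractions are expanded to the common denominator
    \<open>s \<otimes> x = s' \<otimes> y\<close>. The values agree because the value group is
    commutative, although the ring is not.\<close>
  have unique: "v r - v s = v r' - v s'"
    if h: "r \<in> S - {\<zero>}" "s \<in> S - {\<zero>}" "r' \<in> S - {\<zero>}" "s' \<in> S - {\<zero>}" "r \<otimes> inv s = r' \<otimes> inv s'" for r s r' s'
  proof -
    have c: "r \<in> carrier R" "s \<in> carrier R" "r' \<in> carrier R" "s' \<in> carrier R"
      "r \<noteq> \<zero>" "s \<noteq> \<zero>" "r' \<noteq> \<zero>" "s' \<noteq> \<zero>"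
      using h SR by auto
    obtain x y where xy: "x \<in> S" "y \<in> S - {\<zero>}" "s' \<otimes> y = s \<otimes> x"
      using ore[OF S, of s s'] h by auto
    have cxy: "x \<in> carrier R" "y \<in> carrier R" "y \<noteq> \<zero>" using xy SR by auto
    have "x \<noteq> \<zero>" using xy(3) cxy c mult_nonzero[of s' y] by auto
    have "r' \<otimes> y = r' \<otimes> inv s' \<otimes> (s' \<otimes> y)" using c cxy by (simp add: m_assoc)
    also have "\<dots> = r \<otimes> x" using c cxy unfolding h(5)[symmetric] xy(3) by (simp add: m_assoc)
    finally have "v r' + v y = v r + v x"
      using valn_mult[OF v, of r' y] valn_mult[OF v, of r x] h xy cxy \<open>x \<noteq> \<zero>\<close> by simp
    moreover have "v s' + v y = v s + v x"
      using valn_mult[OF v, of s' y] valn_mult[OF v, of s x] h xy cxy \<open>x \<noteq> \<zero>\<close> by simp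
    ultimately show ?thesis
      by (metis (no_types, opaque_lifting) add.commute add_diff_cancel_left add_diff_cancel_right)
  qed
  have V: "V (r \<otimes> inv s) = v r - v s" if "r \<in> S - {\<zero>}" "s \<in> S - {\<zero>}" for r s
    unfolding V_def
  proof (rule some_equality)
    show "\<exists>r'\<in>S - {\<zero>}. \<exists>s'\<in>S - {\<zero>}. r \<otimes> inv s = r' \<otimes> inv s' \<and> v r - v s = v r' - v s'"
      by (rule bexI[OF _ that(1)], rule bexI[OF _ that(2)]) simp
    fix x assume "\<exists>r'\<in>S - {\<zero>}. \<exists>s'\<in>S - {\<zero>}. r \<otimes> inv s = r' \<otimes> inv s' \<and> x = v r' - v s'"
    then obtain r' s' where "r' \<in> S - {\<zero>}" "s' \<in> S - {\<zero>}" "r \<otimes> inv s = r' \<otimes> inv s'" "x = v r' - v s'"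
      by metis
    then show "x = v r - v s" using unique[OF that, of r' s'] by simp
  qed
  have frac: "\<exists>r\<in>S - {\<zero>}. \<exists>s\<in>S - {\<zero>}. q = r \<otimes> inv s" if q: "q \<in> carrier R" "q \<noteq> \<zero>" for q
  proof -
    obtain r s where "r \<in> S" "s \<in> S - {\<zero>}" "q = r \<otimes> inv s" using fracs_ofE[OF S(2) q(1)] .
    moreover from this have "r \<noteq> \<zero>" using q(2) SR l_null[of "inv s"] by auto
    ultimately show ?thesis by blast
  qed
  show ?thesis
  proof (rule that[of V])
    fix s assume s: "s \<in> S" "s \<noteq> \<zero>"
    have "v \<one> = 0" using valn_mult[OF v, of \<one> \<one>] subringE(3)[OF S(1)] by simp
    moreover have "s = s \<otimes> inv \<one>" using s SR by auto
    ultimately show "V s = v s" using V[of s \<one>] s subringE(3)[OF S(1)] by simp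
  next
    show "valn (carrier R) V"
      unfolding valn_def
    proof (intro conjI ballI impI)
      fix p q assume p: "p \<in> carrier R - {\<zero>}" and q: "q \<in> carrier R - {\<zero>}"
      obtain r s where rs: "r \<in> S - {\<zero>}" "s \<in> S - {\<zero>}" "p = r \<otimes> inv s" using frac p by blast
      obtain r' s' where rs': "r' \<in> S - {\<zero>}" "s' \<in> S - {\<zero>}" "q = r' \<otimes> inv s'" using frac q by blast
      have c: "r \<in> carrier R" "s \<in> carrier R" "r' \<in> carrier R" "s' \<in> carrier R"
        "r \<noteq> \<zero>" "s \<noteq> \<zero>" "r' \<noteq> \<zero>" "s' \<noteq> \<zero>"
        using rs rs' SR by auto
      \<comment> \<open>This choice rewrites \<open>inv s \<otimes> r'\<close> as
        \<open>x \<otimes> inv y\<close> and so moves the inner denominator to the right.\<close>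
      obtain x y where xy: "x \<in> S" "y \<in> S - {\<zero>}" "r' \<otimes> y = s \<otimes> x"
        using ore[OF S, of s r'] rs rs' by auto
      have cxy: "x \<in> carrier R" "y \<in> carrier R" "y \<noteq> \<zero>" using xy SR by auto
      have "x \<noteq> \<zero>" using xy(3) cxy c mult_nonzero[of r' y] by auto
      have "p \<otimes> q = r \<otimes> inv s \<otimes> (r' \<otimes> y \<otimes> inv y) \<otimes> inv s'"
        using c cxy by (simp add: rs(3) rs'(3) m_assoc)
      also have "\<dots> = r \<otimes> x \<otimes> inv (s' \<otimes> y)"
        using c cxy unfolding xy(3) by (simp add: m_assoc inv_mult)
      moreover have "r \<otimes> x \<in> S - {\<zero>}"
        using SD(1)[of r x] rs(1) xy(1) mult_nonzero[of r x] c cxy \<open>x \<noteq> \<zero>\<close> by blast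
      moreover have "s' \<otimes> y \<in> S - {\<zero>}"
        using SD(1)[of s' y] rs'(2) xy(2) mult_nonzero[of s' y] c cxy by blast
      ultimately have "V (p \<otimes> q) = v (r \<otimes> x) - v (s' \<otimes> y)"
        using V by simp
      moreover have "v r' + v y = v s + v x"
        using valn_mult[OF v, of r' y] valn_mult[OF v, of s x] rs rs' xy cxy \<open>x \<noteq> \<zero>\<close> by simp
      then have "v x = v r' + v y - v s" by (simp add: eq_diff_eq add.commute)
      moreover have "V p = v r - v s" "V q = v r' - v s'"
        using V[OF rs(1,2)] V[OF rs'(1,2)] rs(3) rs'(3) by simp_all
      moreover have "v (r \<otimes> x) = v r + v x" "v (s' \<otimes> y) = v s' + v y"
        using valn_mult[OF v] rs rs' xy cxy \<open>x \<noteq> \<zero>\<close> by simp_all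
      ultimately show "V (p \<otimes> q) = V p + V q"
        by (simp only:) (simp add: algebra_simps)
    next
      fix p q assume p: "p \<in> carrier R - {\<zero>}" and q: "q \<in> carrier R - {\<zero>}" and pq: "p \<oplus> q \<noteq> \<zero>"
      obtain s where s: "s \<in> S - {\<zero>}" "p \<otimes> s \<in> S" "q \<otimes> s \<in> S"
        using common_denominator[OF S, of "{p, q}"] p q by auto
      have c: "p \<in> carrier R" "q \<in> carrier R" "s \<in> carrier R" "s \<noteq> \<zero>" "p \<noteq> \<zero>" "q \<noteq> \<zero>" using p q s SR by auto
      have nz: "p \<otimes> s \<noteq> \<zero>" "q \<otimes> s \<noteq> \<zero>" using c mult_nonzero by auto
      have sum: "p \<otimes> s \<oplus> q \<otimes> s = (p \<oplus> q) \<otimes> s" using c by (simp add: l_distr)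
      then have sum_nz: "p \<otimes> s \<oplus> q \<otimes> s \<noteq> \<zero>" using c pq mult_nonzero[of "p \<oplus> q" s] by simp
      have Vp: "V p = v (p \<otimes> s) - v s" using V[of "p \<otimes> s" s] s nz c by (simp add: m_assoc)
      have Vq: "V q = v (q \<otimes> s) - v s" using V[of "q \<otimes> s" s] s nz c by (simp add: m_assoc)
      have "V (p \<oplus> q) = v (p \<otimes> s \<oplus> q \<otimes> s) - v s"
        using V[of "p \<otimes> s \<oplus> q \<otimes> s" s] s sum_nz SD(2)[OF s(2,3)] c by (simp add: sum m_assoc)
      also have "\<dots> \<le> max (v (p \<otimes> s)) (v (q \<otimes> s)) - v s"
        using valn_add[OF v s(2,3) nz sum_nz] by simp
      also have "\<dots> = max (V p) (V q)" by (simp add: Vp Vq max_diff_distrib_left)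
      finally show "V (p \<oplus> q) \<le> max (V p) (V q)" .
    qed
  qed
qed

lemma valn_one: "valn (carrier R) V \<Longrightarrow> V \<one> = 0"
  using valn_mult[of "carrier R" V \<one> \<one>] by simp

lemma valn_uminus:
  assumes "valn (carrier R) V" "x \<in> carrier R" "x \<noteq> \<zero>"
  shows "V (\<ominus> x) = V x"
proof -
  have nz: "\<ominus> \<one> \<noteq> \<zero>" using uminus_one_nonzero[of \<one>] by simp
  have "V (\<ominus> \<one>) + V (\<ominus> \<one>) = V (\<ominus> \<one> \<otimes> \<ominus> \<one>)"
    using valn_mult[OF assms(1), of "\<ominus> \<one>" "\<ominus> \<one>"] nz by simp
  also have "\<dots> = 0" by (simp add: l_minus valn_one[OF assms(1)])
  finally have "V (\<ominus> \<one>) = 0" by simp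
  then show ?thesis
    using valn_mult[OF assms(1), of "\<ominus> \<one>" x] nz assms by (simp add: l_minus)
qed

text \<open>If the larger value dropped in the sum, then
  \<open>x = (x \<oplus> y) \<oplus> \<ominus> y\<close> would bound it by smaller values.\<close>

lemma valn_add_distinct:
  assumes V: "valn (carrier R) V" and "x \<in> carrier R" "y \<in> carrier R" "x \<noteq> \<zero>" "y \<noteq> \<zero>" "V x \<noteq> V y"
  shows "x \<oplus> y \<noteq> \<zero>" "V (x \<oplus> y) = max (V x) (V y)"
proof -
  show nz: "x \<oplus> y \<noteq> \<zero>"
  proof
    assume "x \<oplus> y = \<zero>"
    then have "x = \<ominus> y" using assms(2,3) by (metis minus_equality add.m_comm minus_minus)
    then show False using valn_uminus[OF V, of y] assms by simp
  qed
  have le: "V (a \<oplus> b) = V a" if "a \<in> carrier R" "b \<in> carrier R" "a \<noteq> \<zero>" "b \<noteq> \<zero>" "a \<oplus> b \<noteq> \<zero>" "V b < V a" for a b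
  proof (rule antisym)
    show "V (a \<oplus> b) \<le> V a" using valn_add[OF V, of a b] that by simp
    have "a = (a \<oplus> b) \<oplus> \<ominus> b" using that by algebra
    then have "V a \<le> max (V (a \<oplus> b)) (V b)"
      using valn_add[OF V, of "a \<oplus> b" "\<ominus> b"] that valn_uminus[OF V, of b] uminus_one_nonzero[of b] by auto
    then show "V a \<le> V (a \<oplus> b)" using that by (auto simp: le_max_iff_disj)
  qed
  show "V (x \<oplus> y) = max (V x) (V y)"
  proof (cases "V y < V x")
    case True
    then show ?thesis using le[of x y] assms nz by simp
  next
    case False
    then have "V x < V y" using assms(6) by simp
    then show ?thesis using le[of y x] assms nz by (simp add: a_comm)
  qed
qed

lemma finsum_distinct_valn:
  assumes V: "valn (carrier R) V" and "finite I" "I \<noteq> {}" "\<And>i. i \<in> I \<Longrightarrow> f i \<in> carrier R" "\<And>i. i \<in> I \<Longrightarrow> f i \<noteq> \<zero>"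
    and "inj_on (V \<circ> f) I"
  shows "(\<Oplus>i\<in>I. f i) \<noteq> \<zero> \<and> V (\<Oplus>i\<in>I. f i) \<in> V ` f ` I"
  using assms(2-)
proof (induction I rule: finite_ne_induct)
  case (singleton i)
  then show ?case by simp
next
  case (insert i I)
  have IH: "(\<Oplus>i\<in>I. f i) \<noteq> \<zero>" "V (\<Oplus>i\<in>I. f i) \<in> V ` f ` I" using insert by auto
  have c: "(\<Oplus>i\<in>I. f i) \<in> carrier R" using insert by (intro finsum_closed) auto
  have "V (f i) \<noteq> V (\<Oplus>i\<in>I. f i)" using IH(2) insert(3,7) by auto
  from valn_add_distinct[OF V _ c _ IH(1) this] show ?case
    using insert IH by (auto simp: max_def)
qed

subsection \<open>Growth\<close>

text \<open>Nonzero scalars from \<open>K\<close> do not change values, so a combination of vectors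
  with distinct values takes the value of one of them. The second conjunct carries this through the
  induction and yields independence.\<close>

lemma Span_valn:
  assumes K: "subfield K R" and V: "valn (carrier R) V" "\<And>k. k \<in> K \<Longrightarrow> k \<noteq> \<zero> \<Longrightarrow> V k = 0"
    and Us: "set Us \<subseteq> carrier R - {\<zero>}" "distinct (map V Us)"
  shows "independent K Us \<and> (\<forall>x\<in>Span K Us. x = \<zero> \<or> V x \<in> V ` set Us)"
  using Us
proof (induction Us)
  case (Cons u Us)
  have KR: "K \<subseteq> carrier R" using K by (simp add: subfieldE)
  have u: "u \<in> carrier R" "u \<noteq> \<zero>" and IH: "independent K Us" "\<forall>x\<in>Span K Us. x = \<zero> \<or> V x \<in> V ` set Us"
    using Cons by auto
  have Us: "set Us \<subseteq> carrier R" using Cons by auto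
  have "u \<notin> Span K Us" using IH(2) u Cons(3) by auto
  then have "independent K (u # Us)" using IH u by (intro li_Cons)
  moreover have "x = \<zero> \<or> V x \<in> V ` set (u # Us)" if "x \<in> Span K (u # Us)" for x
  proof -
    obtain k v where kv: "k \<in> K" "v \<in> Span K Us" "x = k \<otimes> u \<oplus> v"
      using \<open>x \<in> Span K (u # Us)\<close> by (auto simp: line_extension_mem_iff)
    have c: "k \<in> carrier R" "v \<in> carrier R" using kv KR Span_in_carrier[of K Us] Us by auto
    show ?thesis
    proof (cases "k = \<zero>")
      case True
      then show ?thesis using kv IH u c by auto
    next
      case False
      then have Vku: "V (k \<otimes> u) = V u" using valn_mult[OF V(1), of k u] V(2)[OF kv(1)] c u by simp
      show ?thesis
      proof (cases "v = \<zero>")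
        case True
        then show ?thesis using Vku kv c u by simp
      next
        case False
        then have "V v \<in> V ` set Us" using IH kv by auto
        moreover have "V v \<noteq> V u" using \<open>V v \<in> V ` set Us\<close> Cons(3) by auto
        ultimately show ?thesis
          using valn_add_distinct(2)[OF V(1), of "k \<otimes> u" v] kv c u Vku False \<open>k \<noteq> \<zero>\<close> mult_nonzero[of k u]
          by (auto simp: max_def)
      qed
    qed
  qed
  ultimately show ?case by blast
qed auto

text \<open>Dropping the vectors that lie in the span of the later ones turns \<open>Us\<close> into
  a basis of its span, to which the dimension bound applies.\<close>

lemma independent_length_le_Span:
  assumes K: "subfield K R" and "independent K Ws" "set Us \<subseteq> carrier R" "set Ws \<subseteq> Span K Us"
  shows "length Ws \<le> length Us"
proof -
  have "\<exists>Vs. independent K Vs \<and> Span K Vs = Span K Us \<and> length Vs \<le> length Us"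
    using assms(3)
  proof (induction Us)
    case (Cons u Us)
    then obtain Vs where Vs: "independent K Vs" "Span K Vs = Span K Us" "length Vs \<le> length Us" by auto
    show ?case
    proof (cases "u \<in> Span K Us")
      case True
      have us: "set Us \<subseteq> carrier R" "u \<in> carrier R" using Cons(2) by auto
      have "Span K (u # Us) \<subseteq> Span K Us"
        by (rule mono_Span_subset[OF K _ us(1)]) (use True Span_base_incl[OF K us(1)] in auto)
      moreover have "Span K Us \<subseteq> Span K (u # Us)" by (rule mono_Span[OF K us])
      ultimately show ?thesis using Vs by (metis length_Cons le_SucI subset_antisym)
    next
      case False
      then have "independent K (u # Vs)" using Vs Cons(2) by (intro li_Cons) auto
      moreover have "Span K (u # Vs) = Span K (u # Us)" using Vs(2) by simp
      ultimately show ?thesis using Vs(3) by (metis length_Cons Suc_le_mono)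
    qed
  qed auto
  then show ?thesis using independent_length_le[OF K assms(2)] assms(4) by fastforce
qed

end

text \<open>A constant sum over \<open>{..<a}\<close> stands for the a-fold multiple of
  \<open>x\<close> in a value group.\<close>

lemma sum_const_add: "(\<Sum>l<a. x) + (\<Sum>l<b. x) = (\<Sum>l<a + b. (x :: 'g::comm_monoid_add))" for a b :: nat
  by (induction b) (simp_all add: add.assoc[symmetric])

lemma sum_const_distrib: "(\<Sum>l<a. x + y) = (\<Sum>l<a. x) + (\<Sum>l<a. (y :: 'g::comm_monoid_add))" for a :: nat
  by (rule sum.distrib)

context skew
begin

lemma valn_pow:
  assumes V: "valn (carrier R) V" and "x \<in> carrier R" "x \<noteq> \<zero>"
  shows "V (x [^] (k::nat)) = (\<Sum>l<k. V x)"
  using assms(2,3) by (induction k) (auto simp: valn_one[OF V] valn_mult[OF V] pow_nonzero)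

text \<open>A filtration of a subring with polynomial growth of order \<open>p\<close> over \<open>K\<close> is incompatible
  with \<open>p + 1\<close> elements of independent valuation in its skewfield of fractions: if \<open>s\<close> is a common
  denominator of the \<open>u\<^sub>i\<close>, the words \<open>(u\<^sub>0 s)\<^sup>i \<dots> (u\<^sub>p s)\<^sup>j s\<^sup>k\<close> have distinct valuations.\<close>

lemma growth_contradiction:
  fixes V :: "'a \<Rightarrow> 'g::linordered_ab_group_add"
  assumes K: "subfield K R" and V: "valn (carrier R) V" "\<And>k. k \<in> K \<Longrightarrow> k \<noteq> \<zero> \<Longrightarrow> V k = 0"
    and S: "subring S R" "fracs_of S" "S = (\<Union>N. W N)"
    and W: "\<And>i j x y. x \<in> W i \<Longrightarrow> y \<in> W j \<Longrightarrow> x \<otimes> y \<in> W (i + j)" "\<one> \<in> W 0" "\<And>i j. i \<le> j \<Longrightarrow> W i \<subseteq> W j"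
    and L: "\<And>N. set (L N) \<subseteq> carrier R" "\<And>N. W N \<subseteq> Span K (L N)" "\<And>N. length (L N) \<le> (c * N + 1) ^ p"
    and u: "\<And>i. i < Suc p \<Longrightarrow> u i \<in> carrier R" "\<And>i. i < Suc p \<Longrightarrow> u i \<noteq> \<zero>"
    and inj: "\<And>\<alpha> \<beta> :: nat \<Rightarrow> nat. (\<Sum>i<Suc p. \<Sum>l<\<alpha> i. V (u i)) = (\<Sum>i<Suc p. \<Sum>l<\<beta> i. V (u i)) \<Longrightarrow>
      \<forall>i<Suc p. \<alpha> i = \<beta> i"
  shows False
proof -
  have SR: "S \<subseteq> carrier R" using S(1) by (rule subringE)
  obtain s where s: "s \<in> S" "s \<noteq> \<zero>" "\<And>i. i < Suc p \<Longrightarrow> u i \<otimes> s \<in> S"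
    using common_denominator[OF S(1,2), of "u ` {..<Suc p}"] u(1) by fastforce
  have sR: "s \<in> carrier R" using s(1) SR by auto
  have "\<exists>f. \<forall>i\<in>{..<Suc p}. u i \<otimes> s \<in> W (f i)"
    by (rule bchoice) (use s(3) S(3) in auto)
  then obtain f where f: "\<And>i. i < Suc p \<Longrightarrow> u i \<otimes> s \<in> W (f i)" by blast
  obtain c1 where c1: "s \<in> W c1" using s(1) S(3) by auto
  \<comment> \<open>One level of the filtration that contains \<open>s\<close> and every
    \<open>u i \<otimes> s\<close>.\<close>
  define c0 where "c0 = c1 + (\<Sum>i<Suc p. f i)"
  have sW: "s \<in> W c0" using W(3)[of c1 c0] c1 by (auto simp: c0_def)
  have uW: "u i \<otimes> s \<in> W c0" if "i < Suc p" for i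
  proof -
    have "f i \<le> (\<Sum>i<Suc p. f i)" using that by (intro member_le_sum) auto
    then show ?thesis using W(3)[of "f i" c0] f[OF that] by (auto simp: c0_def)
  qed
  have powW: "x [^] k \<in> W (c0 * k)" if "x \<in> W c0" "x \<in> carrier R" for x and k :: nat
  proof (induction k)
    case (Suc k)
    then show ?case using W(1)[OF Suc that(1)] that by (simp add: algebra_simps)
  qed (use W(2) in simp)
  have us: "u i \<otimes> s \<in> carrier R" "u i \<otimes> s \<noteq> \<zero>" if "i < Suc p" for i
    using u[OF that] sR s(2) mult_nonzero by auto
  \<comment> \<open>The word is built recursively because its factors need not commute.\<close>
  define wd where "wd \<alpha> = rec_nat \<one> (\<lambda>i w. w \<otimes> (u i \<otimes> s) [^] (\<alpha> i))" for \<alpha> :: "nat \<Rightarrow> nat"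
  have wd_simps: "wd \<alpha> 0 = \<one>" "wd \<alpha> (Suc j) = wd \<alpha> j \<otimes> (u j \<otimes> s) [^] (\<alpha> j)" for \<alpha> j
    by (simp_all add: wd_def)
  have wd: "wd \<alpha> j \<in> W (c0 * (\<Sum>i<j. \<alpha> i)) \<and> wd \<alpha> j \<in> carrier R \<and> wd \<alpha> j \<noteq> \<zero> \<and>
      V (wd \<alpha> j) = (\<Sum>i<j. \<Sum>l<\<alpha> i. V (u i)) + (\<Sum>l<(\<Sum>i<j. \<alpha> i). V s)" if "j \<le> Suc p" for \<alpha> j
    using that
  proof (induction j)
    case 0
    then show ?case using W(2) by (simp add: wd_simps valn_one[OF V(1)])
  next
    case (Suc j)
    then have IH: "wd \<alpha> j \<in> W (c0 * (\<Sum>i<j. \<alpha> i))" "wd \<alpha> j \<in> carrier R" "wd \<alpha> j \<noteq> \<zero>"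
      "V (wd \<alpha> j) = (\<Sum>i<j. \<Sum>l<\<alpha> i. V (u i)) + (\<Sum>l<(\<Sum>i<j. \<alpha> i). V s)" and j: "j < Suc p" by auto
    let ?x = "(u j \<otimes> s) [^] (\<alpha> j)"
    have x: "?x \<in> carrier R" "?x \<noteq> \<zero>" using us[OF j] pow_nonzero by auto
    have "V ?x = (\<Sum>l<\<alpha> j. V (u j)) + (\<Sum>l<\<alpha> j. V s)"
      using valn_pow[OF V(1) us[OF j]] valn_mult[OF V(1) u(1)[OF j] sR u(2)[OF j] s(2)]
      by (simp add: sum_const_distrib)
    then have "V (wd \<alpha> (Suc j)) = (\<Sum>i<Suc j. \<Sum>l<\<alpha> i. V (u i)) + ((\<Sum>l<(\<Sum>i<j. \<alpha> i). V s) + (\<Sum>l<\<alpha> j. V s))"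
      using valn_mult[OF V(1) IH(2) x(1) IH(3) x(2)] IH(4) by (simp add: wd_simps algebra_simps)
    then have "V (wd \<alpha> (Suc j)) = (\<Sum>i<Suc j. \<Sum>l<\<alpha> i. V (u i)) + (\<Sum>l<(\<Sum>i<Suc j. \<alpha> i). V s)"
      unfolding sum_const_add by simp
    moreover have "wd \<alpha> (Suc j) \<in> W (c0 * (\<Sum>i<Suc j. \<alpha> i))"
      using W(1)[OF IH(1) powW[OF uW[OF j] us(1)[OF j], of "\<alpha> j"]] by (simp add: wd_simps algebra_simps)
    moreover have "wd \<alpha> (Suc j) \<in> carrier R" "wd \<alpha> (Suc j) \<noteq> \<zero>"
      using mult_nonzero[OF IH(2) x(1) IH(3) x(2)] IH(2) x(1) by (simp_all add: wd_simps)
    ultimately show ?case by blast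
  qed
  have bound: "(N + 1) ^ Suc p \<le> (c * (c0 * (Suc p * N)) + 1) ^ p" for N
  proof -
    define A :: "(nat \<Rightarrow> nat) set" where "A = PiE {..<Suc p} (\<lambda>_. {..N})"
    \<comment> \<open>Padding with powers of \<open>s\<close> brings every word to exactly
      \<open>Suc p * N\<close> factors \<open>s\<close>. Their contribution to the value is then
      constant, and \<open>inj\<close> applies to the rest.\<close>
    define full where "full \<alpha> = wd \<alpha> (Suc p) \<otimes> s [^] (Suc p * N - (\<Sum>i<Suc p. \<alpha> i))" for \<alpha>
    have A: "finite A" "card A = (N + 1) ^ Suc p" by (simp_all add: A_def finite_PiE card_PiE)
    have le: "(\<Sum>i<Suc p. \<alpha> i) \<le> Suc p * N" if "\<alpha> \<in> A" for \<alpha>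
      using sum_bounded_above[of "{..<Suc p}" \<alpha> N] that by (auto simp: A_def PiE_iff)
    have full: "full \<alpha> \<in> W (c0 * (Suc p * N)) \<and> full \<alpha> \<in> carrier R \<and> full \<alpha> \<noteq> \<zero> \<and>
      V (full \<alpha>) = (\<Sum>i<Suc p. \<Sum>l<\<alpha> i. V (u i)) + (\<Sum>l<Suc p * N. V s)" if "\<alpha> \<in> A" for \<alpha>
    proof -
      let ?r = "Suc p * N - (\<Sum>i<Suc p. \<alpha> i)"
      have w: "wd \<alpha> (Suc p) \<in> W (c0 * (\<Sum>i<Suc p. \<alpha> i))" "wd \<alpha> (Suc p) \<in> carrier R" "wd \<alpha> (Suc p) \<noteq> \<zero>"
        "V (wd \<alpha> (Suc p)) = (\<Sum>i<Suc p. \<Sum>l<\<alpha> i. V (u i)) + (\<Sum>l<(\<Sum>i<Suc p. \<alpha> i). V s)"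
        using wd[of "Suc p" \<alpha>] by blast+
      have sum: "(\<Sum>i<Suc p. \<alpha> i) + ?r = Suc p * N" using le[OF that] by simp
      have x: "s [^] ?r \<in> carrier R" "s [^] ?r \<noteq> \<zero>" using sR s(2) pow_nonzero by auto
      have "full \<alpha> \<in> W (c0 * (\<Sum>i<Suc p. \<alpha> i) + c0 * ?r)"
        unfolding full_def by (rule W(1)[OF w(1) powW[OF sW sR]])
      then have "full \<alpha> \<in> W (c0 * (Suc p * N))" by (simp only: distrib_left[symmetric] sum)
      moreover have "V (full \<alpha>) = (\<Sum>i<Suc p. \<Sum>l<\<alpha> i. V (u i)) + ((\<Sum>l<(\<Sum>i<Suc p. \<alpha> i). V s) + (\<Sum>l<?r. V s))"
        unfolding full_def valn_mult[OF V(1) w(2) x(1) w(3) x(2)] w(4) valn_pow[OF V(1) sR s(2)] by (rule add.assoc)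
      moreover have "full \<alpha> \<in> carrier R" "full \<alpha> \<noteq> \<zero>"
        unfolding full_def using mult_nonzero[OF w(2) x(1) w(3) x(2)] w(2) x(1) by simp_all
      ultimately show ?thesis unfolding sum_const_add sum by blast
    qed
    have inj_full: "inj_on (V \<circ> full) A"
    proof (rule inj_onI)
      fix \<alpha> \<beta> assume ab: "\<alpha> \<in> A" "\<beta> \<in> A" "(V \<circ> full) \<alpha> = (V \<circ> full) \<beta>"
      then have "(\<Sum>i<Suc p. \<Sum>l<\<alpha> i. V (u i)) = (\<Sum>i<Suc p. \<Sum>l<\<beta> i. V (u i))"
        using full by simp
      from inj[OF this] show "\<alpha> = \<beta>"
        using ab(1,2) unfolding A_def by (intro PiE_ext) auto
    qed
    obtain as where as: "set as = A" "distinct as" using A(1) finite_distinct_list by blast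
    define Us where "Us = map full as"
    have "set Us \<subseteq> carrier R - {\<zero>}" using full as by (auto simp: Us_def)
    moreover have "distinct (map V Us)"
      using inj_full as by (simp add: Us_def distinct_map)
    ultimately have "independent K Us" using Span_valn[OF K V] by blast
    moreover have "set Us \<subseteq> Span K (L (c0 * (Suc p * N)))"
      using full as L(2) by (auto simp: Us_def simp del: Span.simps)
    ultimately have "length Us \<le> length (L (c0 * (Suc p * N)))"
      using independent_length_le_Span[OF K _ L(1)] by blast
    moreover have "length Us = (N + 1) ^ Suc p"
      using A(2) as distinct_card[OF as(2)] by (simp add: Us_def)
    ultimately show ?thesis using L(3)[of "c0 * (Suc p * N)"] by linarith
  qed
  \<comment> \<open>For N = C^p the bound becomes (C^p + 1)^(p+1) <= C^p (C^p + 1)^p, which is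
    absurd after cancelling.\<close>
  define C where "C = c * c0 * Suc p + 1"
  have "(C ^ p + 1) ^ Suc p \<le> (c * (c0 * (Suc p * C ^ p)) + 1) ^ p" by (rule bound)
  also have "\<dots> \<le> (C * (C ^ p + 1)) ^ p"
    by (intro power_mono) (simp_all add: C_def algebra_simps)
  also have "\<dots> = C ^ p * (C ^ p + 1) ^ p" by (rule power_mult_distrib)
  finally have "C ^ p + 1 \<le> C ^ p"
    by (simp only: power_Suc mult_le_cancel2) simp
  then show False by simp
qed

subsection \<open>The valuation of a locally nilpotent derivation\<close>

text \<open>For a nonzero \<open>x\<close> on which \<open>d\<close> is nilpotent, this is the index
  of the last nonvanishing iterate, the analogue of the degree of a polynomial under
  differentiation.\<close>

definition dnil :: "('a \<Rightarrow> 'a) \<Rightarrow> 'a \<Rightarrow> nat" where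
  "dnil d x = (LEAST k. (d ^^ Suc k) x = \<zero>)"

text \<open>For differentiation of polynomials this is the degree followed by the value of the
  leading coefficient, up to a factorial.\<close>

definition lexv :: "('a \<Rightarrow> 'a) \<Rightarrow> ('a \<Rightarrow> 'g) \<Rightarrow> 'a \<Rightarrow> int \<times> 'g" where
  "lexv d v x = (int (dnil d x), v ((d ^^ dnil d x) x))"

definition derivation_on :: "'a set \<Rightarrow> ('a \<Rightarrow> 'a) \<Rightarrow> bool" where
  "derivation_on S d \<longleftrightarrow> d ` S \<subseteq> S \<and> (\<forall>x\<in>S. \<forall>y\<in>S. d (x \<oplus> y) = d x \<oplus> d y) \<and>
     (\<forall>x\<in>S. \<forall>y\<in>S. d (x \<otimes> y) = d x \<otimes> y \<oplus> x \<otimes> d y)"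

context
  fixes S d assumes S: "subring S R" and d: "derivation_on S d"
begin

lemma der_closed: "x \<in> S \<Longrightarrow> d x \<in> S" and der_add: "x \<in> S \<Longrightarrow> y \<in> S \<Longrightarrow> d (x \<oplus> y) = d x \<oplus> d y"
  and der_mult: "x \<in> S \<Longrightarrow> y \<in> S \<Longrightarrow> d (x \<otimes> y) = d x \<otimes> y \<oplus> x \<otimes> d y"
  using d by (auto simp: derivation_on_def)

lemma der_carrier: "x \<in> S \<Longrightarrow> x \<in> carrier R"
  using subringE(1)[OF S] by auto

lemma der_zero: "d \<zero> = \<zero>"
proof -
  have z: "\<zero> \<in> S" using subringE(2)[OF S] .
  have "d \<zero> \<oplus> d \<zero> = d \<zero> \<oplus> \<zero>" using der_add[OF z z] der_carrier[OF der_closed[OF z]] by simp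
  then show ?thesis using der_carrier[OF der_closed[OF z]] by (simp only: add.l_cancel zero_closed)
qed

lemma der_pow_closed: "x \<in> S \<Longrightarrow> (d ^^ k) x \<in> S"
  by (induction k) (auto simp: der_closed)

lemma der_pow_add: "x \<in> S \<Longrightarrow> y \<in> S \<Longrightarrow> (d ^^ k) (x \<oplus> y) = (d ^^ k) x \<oplus> (d ^^ k) y"
  by (induction k) (auto simp: der_add der_pow_closed)

lemma der_pow_zero: "(d ^^ k) \<zero> = \<zero>"
  by (induction k) (auto simp: der_zero)

lemma der_pow_zero_mono: "(d ^^ k) x = \<zero> \<Longrightarrow> k \<le> l \<Longrightarrow> (d ^^ l) x = \<zero>"
  by (metis comp_apply der_pow_zero funpow_add le_add_diff_inverse2)

lemma der_pow_nat_mult: "x \<in> S \<Longrightarrow> [n] \<cdot> x \<in> S \<and> (d ^^ k) ([n] \<cdot> x) = [n] \<cdot> ((d ^^ k) x)" for n :: nat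
  using subringE(2,7)[OF S] by (induction n) (auto simp: der_pow_add der_pow_zero)

text \<open>By the Leibniz rule the only surviving term of the iterate p + q is a binomial
  coefficient times the product of the last iterates. Recording only that the coefficient is
  positive makes the induction on p + q short.\<close>

lemma der_pow_mult:
  "x \<in> S \<Longrightarrow> y \<in> S \<Longrightarrow> (d ^^ Suc p) x = \<zero> \<Longrightarrow> (d ^^ Suc q) y = \<zero> \<Longrightarrow>
   (d ^^ Suc (p + q)) (x \<otimes> y) = \<zero> \<and> (\<exists>C>0. (d ^^ (p + q)) (x \<otimes> y) = [(C::nat)] \<cdot> ((d ^^ p) x \<otimes> (d ^^ q) y))"
proof (induction "p + q" arbitrary: p q x y)
  case 0
  then have "d x = \<zero>" "d y = \<zero>" by auto
  then have "d (x \<otimes> y) = \<zero>" using 0 by (simp add: der_mult der_carrier)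
  then show ?case using 0 by (auto simp: der_carrier intro!: exI[of _ "1::nat"])
next
  case (Suc n)
  note xy = \<open>x \<in> S\<close> \<open>y \<in> S\<close>
  have c: "x \<in> carrier R" "y \<in> carrier R" "d x \<in> carrier R" "d y \<in> carrier R"
    using xy der_carrier der_closed by auto
  have m: "d x \<otimes> y \<in> S" "x \<otimes> d y \<in> S" using subringE(6)[OF S] xy der_closed by auto
  have split: "(d ^^ Suc k) (x \<otimes> y) = (d ^^ k) (d x \<otimes> y) \<oplus> (d ^^ k) (x \<otimes> d y)" for k
    using xy m by (simp add: funpow_Suc_right der_mult der_pow_add del: funpow.simps)
  let ?t = "(d ^^ p) x \<otimes> (d ^^ q) y"
  have t: "?t \<in> carrier R" using der_pow_closed der_carrier xy by auto
  \<comment> \<open>For p = 0 this summand vanishes and contributes the coefficient 0. Since p + q >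
    0, at least one of \<open>A\<close> and \<open>B\<close> contributes a positive one.\<close>
  have A: "(d ^^ Suc n) (d x \<otimes> y) = \<zero> \<and> (\<exists>C. (p > 0 \<longrightarrow> C > 0) \<and> (d ^^ n) (d x \<otimes> y) = [(C::nat)] \<cdot> ?t)"
  proof (cases p)
    case 0
    then have "d x = \<zero>" using Suc.prems by simp
    then show ?thesis using 0 c by (auto simp: der_pow_zero simp del: funpow.simps intro!: exI[of _ 0])
  next
    case (Suc p')
    have "(d ^^ Suc p') (d x) = \<zero>" using Suc.prems(3) Suc by (simp add: funpow_swap1)
    moreover have "(d ^^ p') (d x) = (d ^^ p) x" using Suc by (simp add: funpow_swap1)
    ultimately show ?thesis
      using Suc.hyps(1)[of p' q "d x" y] Suc \<open>Suc n = p + q\<close> xy der_closed Suc.prems(4) by auto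
  qed
  have B: "(d ^^ Suc n) (x \<otimes> d y) = \<zero> \<and> (\<exists>C. (q > 0 \<longrightarrow> C > 0) \<and> (d ^^ n) (x \<otimes> d y) = [(C::nat)] \<cdot> ?t)"
  proof (cases q)
    case 0
    then have "d y = \<zero>" using Suc.prems by simp
    then show ?thesis using 0 c by (auto simp: der_pow_zero simp del: funpow.simps intro!: exI[of _ 0])
  next
    case (Suc q')
    have "(d ^^ Suc q') (d y) = \<zero>" using Suc.prems(4) Suc by (simp add: funpow_swap1)
    moreover have "(d ^^ q') (d y) = (d ^^ q) y" using Suc by (simp add: funpow_swap1)
    ultimately show ?thesis
      using Suc.hyps(1)[of p q' x "d y"] Suc \<open>Suc n = p + q\<close> xy der_closed Suc.prems(3) by auto
  qed
  obtain C1 C2 where C: "p > 0 \<longrightarrow> C1 > 0" "q > 0 \<longrightarrow> C2 > 0"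
    "(d ^^ n) (d x \<otimes> y) = [(C1::nat)] \<cdot> ?t" "(d ^^ n) (x \<otimes> d y) = [(C2::nat)] \<cdot> ?t"
    using A B by blast
  have "(d ^^ (p + q)) (x \<otimes> y) = [(C1 + C2)] \<cdot> ?t"
    using split[of n] C(3,4) t unfolding \<open>Suc n = p + q\<close>[symmetric] by (simp add: add.nat_pow_mult)
  moreover have "C1 + C2 > 0" using C(1,2) \<open>Suc n = p + q\<close> by linarith
  moreover have "(d ^^ Suc (p + q)) (x \<otimes> y) = \<zero>"
    using split[of "Suc n"] A B unfolding \<open>Suc n = p + q\<close>[symmetric] by simp
  ultimately show ?case by blast
qed

lemma dnil_eqI:
  assumes "(d ^^ k) x \<noteq> \<zero>" "(d ^^ Suc k) x = \<zero>"
  shows "dnil d x = k"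
  unfolding dnil_def
proof (rule Least_equality)
  show "(d ^^ Suc k) x = \<zero>" by (rule assms(2))
  fix l assume "(d ^^ Suc l) x = \<zero>"
  then show "k \<le> l" using der_pow_zero_mono[of "Suc l" x k] assms(1) by (meson not_less_eq_eq)
qed

lemma dnil_props:
  assumes "\<exists>k. (d ^^ k) x = \<zero>" "x \<noteq> \<zero>"
  shows "(d ^^ dnil d x) x \<noteq> \<zero>" "(d ^^ Suc (dnil d x)) x = \<zero>"
proof -
  obtain k where k: "(d ^^ k) x = \<zero>" using assms(1) by blast
  then have "(d ^^ Suc k) x = \<zero>" by (simp add: der_zero)
  then show *: "(d ^^ Suc (dnil d x)) x = \<zero>" unfolding dnil_def by (rule LeastI)
  show "(d ^^ dnil d x) x \<noteq> \<zero>"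
  proof (cases "dnil d x")
    case (Suc m)
    then have "m < dnil d x" by simp
    then show ?thesis using not_less_Least[of m "\<lambda>k. (d ^^ Suc k) x = \<zero>"] Suc unfolding dnil_def by auto
  qed (use assms in simp)
qed

text \<open>Invariance under positive integer multiples is both assumed for \<open>v\<close> and
  concluded for \<open>lexv d v\<close>, so the construction can be iterated over several
  derivations.\<close>

lemma lexv_valn:
  fixes v :: "'a \<Rightarrow> 'g::linordered_ab_group_add"
  assumes nil: "\<And>x. x \<in> S \<Longrightarrow> \<exists>k. (d ^^ k) x = \<zero>"
    and char: "\<And>n x. x \<in> S \<Longrightarrow> x \<noteq> \<zero> \<Longrightarrow> (n::nat) > 0 \<Longrightarrow> [n] \<cdot> x \<noteq> \<zero>"
    and v: "valn S v" "\<And>n x. x \<in> S \<Longrightarrow> x \<noteq> \<zero> \<Longrightarrow> (n::nat) > 0 \<Longrightarrow> v ([n] \<cdot> x) = v x"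
  shows "valn S (lexv d v)" "\<And>n x. x \<in> S \<Longrightarrow> x \<noteq> \<zero> \<Longrightarrow> (n::nat) > 0 \<Longrightarrow> lexv d v ([n] \<cdot> x) = lexv d v x"
proof -
  note props = dnil_props[OF nil]
  have lexvI: "lexv d v x = (int k, v ((d ^^ k) x))" if "(d ^^ k) x \<noteq> \<zero>" "(d ^^ Suc k) x = \<zero>" for x k
    using dnil_eqI[OF that] by (simp add: lexv_def)
  show "lexv d v ([n] \<cdot> x) = lexv d v x" if "x \<in> S" "x \<noteq> \<zero>" "n > 0" for n :: nat and x
  proof -
    let ?k = "dnil d x"
    have "(d ^^ ?k) ([n] \<cdot> x) \<noteq> \<zero>" "(d ^^ Suc ?k) ([n] \<cdot> x) = \<zero>"
      using that props[of x] char[of "(d ^^ ?k) x" n] der_pow_nat_mult[of x n ?k] der_pow_nat_mult[of x n "Suc ?k"]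
      by (simp_all add: der_pow_closed del: funpow.simps)
    from lexvI[OF this] show ?thesis
      using that props[of x] v(2)[of "(d ^^ ?k) x" n] der_pow_nat_mult[of x n ?k]
      by (simp add: lexv_def der_pow_closed)
  qed
  have mult: "lexv d v (x \<otimes> y) = lexv d v x + lexv d v y" if h: "x \<in> S" "y \<in> S" "x \<noteq> \<zero>" "y \<noteq> \<zero>" for x y
  proof -
    let ?p = "dnil d x" and ?q = "dnil d y"
    let ?lx = "(d ^^ ?p) x" and ?ly = "(d ^^ ?q) y"
    have l: "?lx \<in> S" "?ly \<in> S" "?lx \<noteq> \<zero>" "?ly \<noteq> \<zero>" using that props der_pow_closed by auto
    have ll: "?lx \<otimes> ?ly \<in> S" "?lx \<otimes> ?ly \<noteq> \<zero>"
      using l subringE(6)[OF S] mult_nonzero der_carrier by auto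
    obtain C where C: "C > 0" "(d ^^ (?p + ?q)) (x \<otimes> y) = [(C::nat)] \<cdot> (?lx \<otimes> ?ly)"
      and z: "(d ^^ Suc (?p + ?q)) (x \<otimes> y) = \<zero>"
      using der_pow_mult[OF h(1,2) props(2)[OF h(1,3)] props(2)[OF h(2,4)]] by blast
    have "(d ^^ (?p + ?q)) (x \<otimes> y) \<noteq> \<zero>" using C char[OF ll] by simp
    from lexvI[OF this z] show ?thesis
      using C v(2)[OF ll C(1)] valn_mult[OF v(1) l] by (simp add: lexv_def)
  qed
  have add: "lexv d v (x \<oplus> y) \<le> max (lexv d v x) (lexv d v y)"
    if "x \<in> S" "y \<in> S" "x \<noteq> \<zero>" "y \<noteq> \<zero>" "x \<oplus> y \<noteq> \<zero>" "dnil d y \<le> dnil d x" for x y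
  proof -
    let ?p = "dnil d x"
    let ?lx = "(d ^^ ?p) x" and ?ly = "(d ^^ ?p) y"
    have xy: "x \<oplus> y \<in> S" using that subringE(7)[OF S] by simp
    have lc: "?lx \<in> S" "?ly \<in> S" "?lx \<in> carrier R" "?ly \<in> carrier R" using that der_pow_closed der_carrier by auto
    have sum: "(d ^^ ?p) (x \<oplus> y) = ?lx \<oplus> ?ly" using that der_pow_add by simp
    have "(d ^^ Suc ?p) x = \<zero>" "(d ^^ Suc ?p) y = \<zero>"
      using props(2)[OF that(1,3)] der_pow_zero_mono[OF props(2)[OF that(2,4)], of "Suc ?p"] that(6) by auto
    then have z: "(d ^^ Suc ?p) (x \<oplus> y) = \<zero>" using der_pow_add[OF that(1,2), of "Suc ?p"] by simp
    show ?thesis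
    proof (cases "?lx \<oplus> ?ly = \<zero>")
      case True
      \<comment> \<open>The top iterates cancel, so the first coordinate drops and decides the
        lexicographic comparison.\<close>
      have "dnil d (x \<oplus> y) < ?p"
      proof (rule ccontr)
        assume "\<not> ?thesis"
        then have "(d ^^ dnil d (x \<oplus> y)) (x \<oplus> y) = \<zero>"
          using der_pow_zero_mono[of ?p "x \<oplus> y" "dnil d (x \<oplus> y)"] sum True by simp
        then show False using props(1)[OF xy that(5)] by simp
      qed
      then have "lexv d v (x \<oplus> y) \<le> lexv d v x" by (simp add: lexv_def)
      then show ?thesis by (simp add: le_max_iff_disj)
    next
      case False
      then have eq: "lexv d v (x \<oplus> y) = (int ?p, v (?lx \<oplus> ?ly))"
        using lexvI[of ?p "x \<oplus> y"] sum z by simp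
      show ?thesis
      proof (cases "?ly = \<zero>")
        case True
        have "lexv d v (x \<oplus> y) = lexv d v x" unfolding eq True using lc(3) by (simp add: lexv_def)
        then show ?thesis by (simp add: le_max_iff_disj)
      next
        case False2: False
        then have "dnil d y = ?p"
          using that(6) der_pow_zero_mono[OF props(2)[OF that(2,4)], of ?p] by (cases "dnil d y = ?p") auto
        then show ?thesis
          using eq valn_add[OF v(1) lc(1,2) props(1)[OF that(1,3)] False2 False]
          by (auto simp: lexv_def le_max_iff_disj)
      qed
    qed
  qed
  show "valn S (lexv d v)"
    unfolding valn_def
  proof (intro conjI ballI impI)
    fix x y assume "x \<in> S - {\<zero>}" "y \<in> S - {\<zero>}"
    then show "lexv d v (x \<otimes> y) = lexv d v x + lexv d v y" using mult by simp
  next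
    fix x y assume "x \<in> S - {\<zero>}" "y \<in> S - {\<zero>}" "x \<oplus> y \<noteq> \<zero>"
    then show "lexv d v (x \<oplus> y) \<le> max (lexv d v x) (lexv d v y)"
      using add[of x y] add[of y x] der_carrier a_comm[of x y] by (cases "dnil d y \<le> dnil d x") (auto simp: max.commute)
  qed
qed

lemma lexv_const: "d x = \<zero> \<Longrightarrow> x \<noteq> \<zero> \<Longrightarrow> lexv d v x = (0, v x)"
  using dnil_eqI[of 0 x] by (simp add: lexv_def)

lemma lexv_step: "d x = \<one> \<Longrightarrow> d \<one> = \<zero> \<Longrightarrow> lexv d v x = (1, v \<one>)"
  using dnil_eqI[of 1 x] by (simp add: lexv_def)

end

end

section \<open>Free algebras\<close>

context cring
begin

definition conv :: "('s list \<Rightarrow> 'a) \<Rightarrow> ('s list \<Rightarrow> 'a) \<Rightarrow> 's list \<Rightarrow> 'a" where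
  "conv f g w = (\<Oplus>i\<in>{..length w}. f (take i w) \<otimes> g (drop i w))"

definition mono :: "'a \<Rightarrow> 's list \<Rightarrow> 's list \<Rightarrow> 'a" where
  "mono c w = (\<lambda>u. if u = w then c else \<zero>)"

lemma free_algebra_simps:
  "monoid.mult (free_algebra R S) = conv"
  "\<one>\<^bsub>free_algebra R S\<^esub> = mono \<one> []"
  "\<zero>\<^bsub>free_algebra R S\<^esub> = (\<lambda>w. \<zero>)"
  "add (free_algebra R S) = (\<lambda>f g w. f w \<oplus> g w)"
  by (auto simp: free_algebra_def conv_def mono_def fun_eq_iff)

lemma free_algebra_carrier:
  "f \<in> carrier (free_algebra R S) \<longleftrightarrow>
     (\<forall>w. f w \<in> carrier R) \<and> finite {w. f w \<noteq> \<zero>} \<and> {w. f w \<noteq> \<zero>} \<subseteq> lists S"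
  by (auto simp: free_algebra_def)

lemma free_scalar_eq: "free_scalar R c = mono c []" and free_gen_eq: "free_gen R s = mono \<one> [s]"
  by (auto simp: free_scalar_def free_gen_def mono_def)

lemma mono_in_carrier: "c \<in> carrier R \<Longrightarrow> w \<in> lists S \<Longrightarrow> mono c w \<in> carrier (free_algebra R S)"
  by (auto simp: free_algebra_carrier mono_def)

lemma conv_closed: "(\<And>w. f w \<in> carrier R) \<Longrightarrow> (\<And>w. g w \<in> carrier R) \<Longrightarrow> conv f g w \<in> carrier R"
  unfolding conv_def by (intro finsum_closed) auto

lemma conv_Nil: "f [] \<in> carrier R \<Longrightarrow> g [] \<in> carrier R \<Longrightarrow> conv f g [] = f [] \<otimes> g []"
  by (simp add: conv_def)

text \<open>Splitting off the first letter gives a recursion for the convolution. Associativity and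
  the computations with single words use it in place of reindexed double sums.\<close>

lemma conv_Cons:
  assumes "\<And>w. f w \<in> carrier R" "\<And>w. g w \<in> carrier R"
  shows "conv f g (s # w) = f [] \<otimes> g (s # w) \<oplus> conv (\<lambda>u. f (s # u)) g w"
proof -
  have "conv f g (s # w) = (\<Oplus>i\<in>{..Suc (length w)}. f (take i (s # w)) \<otimes> g (drop i (s # w)))"
    by (simp add: conv_def)
  also have "\<dots> = (\<Oplus>i\<in>{..length w}. f (take (Suc i) (s # w)) \<otimes> g (drop (Suc i) (s # w))) \<oplus> f [] \<otimes> g (s # w)"
    using assms by (subst finsum_Suc2) auto
  also have "\<dots> = f [] \<otimes> g (s # w) \<oplus> conv (\<lambda>u. f (s # u)) g w"
    using assms by (subst a_comm) (auto simp: conv_def intro!: finsum_closed)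
  finally show ?thesis .
qed

lemma conv_add_left:
  assumes "\<And>w. f w \<in> carrier R" "\<And>w. g w \<in> carrier R" "\<And>w. h w \<in> carrier R"
  shows "conv (\<lambda>w. f w \<oplus> g w) h w = conv f h w \<oplus> conv g h w"
  unfolding conv_def using assms by (subst finsum_addf[symmetric]) (auto simp: l_distr intro!: finsum_cong')

lemma conv_add_right:
  assumes "\<And>w. f w \<in> carrier R" "\<And>w. g w \<in> carrier R" "\<And>w. h w \<in> carrier R"
  shows "conv h (\<lambda>w. f w \<oplus> g w) w = conv h f w \<oplus> conv h g w"
  unfolding conv_def using assms by (subst finsum_addf[symmetric]) (auto simp: r_distr intro!: finsum_cong')

lemma conv_scale_left:
  assumes "\<And>w. f w \<in> carrier R" "\<And>w. g w \<in> carrier R" "c \<in> carrier R"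
  shows "conv (\<lambda>w. c \<otimes> f w) g w = c \<otimes> conv f g w"
  unfolding conv_def using assms by (subst finsum_rdistr) (auto simp: m_assoc intro!: finsum_cong')

lemma conv_assoc:
  assumes "\<And>w. f w \<in> carrier R" "\<And>w. g w \<in> carrier R" "\<And>w. h w \<in> carrier R"
  shows "conv (conv f g) h w = conv f (conv g h) w"
  using assms(1)
proof (induction w arbitrary: f)
  case Nil
  then show ?case using assms(2,3) by (simp add: conv_Nil conv_closed m_assoc)
next
  case (Cons s w)
  note f = Cons.prems
  have "conv (conv f g) h (s # w) = conv f g [] \<otimes> h (s # w) \<oplus> conv (\<lambda>u. conv f g (s # u)) h w"
    by (intro conv_Cons conv_closed f assms)
  also have "(\<lambda>u. conv f g (s # u)) = (\<lambda>u. f [] \<otimes> g (s # u) \<oplus> conv (\<lambda>u. f (s # u)) g u)"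
    using f assms(2) by (intro ext conv_Cons)
  also have "conv (\<lambda>u. f [] \<otimes> g (s # u) \<oplus> conv (\<lambda>u. f (s # u)) g u) h w =
      f [] \<otimes> conv (\<lambda>u. g (s # u)) h w \<oplus> conv (conv (\<lambda>u. f (s # u)) g) h w"
    using f assms by (subst conv_add_left) (auto simp: conv_closed conv_scale_left)
  also have "conv (conv (\<lambda>u. f (s # u)) g) h w = conv (\<lambda>u. f (s # u)) (conv g h) w"
    using f by (intro Cons.IH)
  also have "conv f g [] = f [] \<otimes> g []" using f assms by (intro conv_Nil)
  also have "f [] \<otimes> g [] \<otimes> h (s # w) \<oplus> (f [] \<otimes> conv (\<lambda>u. g (s # u)) h w \<oplus> conv (\<lambda>u. f (s # u)) (conv g h) w) =
      f [] \<otimes> (g [] \<otimes> h (s # w) \<oplus> conv (\<lambda>u. g (s # u)) h w) \<oplus> conv (\<lambda>u. f (s # u)) (conv g h) w"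
    using f assms conv_closed[of "\<lambda>u. g (s # u)" h w] conv_closed[of "\<lambda>u. f (s # u)" "conv g h" w] conv_closed[of g h]
    by (simp add: r_distr m_assoc a_assoc)
  also have "g [] \<otimes> h (s # w) \<oplus> conv (\<lambda>u. g (s # u)) h w = conv g h (s # w)"
    using assms by (intro conv_Cons[symmetric])
  also have "f [] \<otimes> conv g h (s # w) \<oplus> conv (\<lambda>u. f (s # u)) (conv g h) w = conv f (conv g h) (s # w)"
    using f assms by (intro conv_Cons[symmetric] conv_closed)
  finally show ?case .
qed

lemma conv_mono_Nil:
  assumes "c \<in> carrier R" "\<And>w. g w \<in> carrier R"
  shows "conv (mono c []) g w = c \<otimes> g w"
proof (cases w)
  case (Cons s v)
  have "conv (\<lambda>u. \<zero>) g v = \<zero>"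
    unfolding conv_def using assms by (intro add.finprod_one_eqI) auto
  then show ?thesis using assms Cons by (simp add: conv_Cons mono_def)
qed (use assms in \<open>simp add: conv_Nil mono_def\<close>)

lemma conv_mono_Cons:
  assumes "c \<in> carrier R" "\<And>w. g w \<in> carrier R"
  shows "conv (mono c (s # u)) g w = (case w of [] \<Rightarrow> \<zero> | s' # w' \<Rightarrow> if s' = s then conv (mono c u) g w' else \<zero>)"
proof (cases w)
  case Nil
  then show ?thesis using assms by (simp add: conv_Nil mono_def)
next
  case (Cons s' w')
  have z: "conv (\<lambda>u. \<zero>) g w' = \<zero>"
    unfolding conv_def using assms by (intro add.finprod_one_eqI) auto
  have "(\<lambda>v. mono c (s # u) (s' # v)) = (if s' = s then mono c u else (\<lambda>u. \<zero>))"
    by (auto simp: mono_def)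
  moreover have "conv (mono c u) g w' \<in> carrier R" using assms by (intro conv_closed) (auto simp: mono_def)
  ultimately show ?thesis using assms Cons z by (simp add: conv_Cons mono_def)
qed

lemma conv_mono_mono:
  assumes "c \<in> carrier R" "d \<in> carrier R"
  shows "conv (mono c u) (mono d v) = mono (c \<otimes> d) (u @ v)"
proof (induction u)
  case Nil
  show ?case
  proof
    fix w
    have "conv (mono c []) (mono d v) w = c \<otimes> mono d v w"
      using assms by (intro conv_mono_Nil) (auto simp: mono_def)
    then show "conv (mono c []) (mono d v) w = mono (c \<otimes> d) ([] @ v) w"
      using assms by (simp add: mono_def)
  qed
next
  case (Cons s u)
  show ?case
  proof
    fix w
    have "conv (mono c (s # u)) (mono d v) w = (case w of [] \<Rightarrow> \<zero> | s' # w' \<Rightarrow> if s' = s then conv (mono c u) (mono d v) w' else \<zero>)"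
      using assms by (intro conv_mono_Cons) (auto simp: mono_def)
    also have "\<dots> = mono (c \<otimes> d) ((s # u) @ v) w"
      unfolding Cons by (auto simp: mono_def split: list.splits)
    finally show "conv (mono c (s # u)) (mono d v) w = mono (c \<otimes> d) ((s # u) @ v) w" .
  qed
qed

lemma conv_one_right:
  assumes "\<And>w. f w \<in> carrier R"
  shows "conv f (mono \<one> []) w = f w"
  using assms
proof (induction w arbitrary: f)
  case Nil
  then show ?case by (simp add: conv_Nil mono_def)
next
  case (Cons s w)
  have "conv f (mono \<one> []) (s # w) = f [] \<otimes> mono \<one> [] (s # w) \<oplus> conv (\<lambda>u. f (s # u)) (mono \<one> []) w"
    using Cons.prems by (intro conv_Cons) (auto simp: mono_def)
  also have "conv (\<lambda>u. f (s # u)) (mono \<one> []) w = f (s # w)" using Cons.prems by (intro Cons.IH)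
  finally show ?case using Cons.prems by (simp add: mono_def)
qed

lemma conv_supp: "{w. conv f g w \<noteq> \<zero>} \<subseteq> (\<lambda>(u, v). u @ v) ` ({w. f w \<noteq> \<zero>} \<times> {w. g w \<noteq> \<zero>})"
  if fg: "\<And>w. f w \<in> carrier R" "\<And>w. g w \<in> carrier R"
proof
  fix w assume "w \<in> {w. conv f g w \<noteq> \<zero>}"
  then have "\<not> (\<forall>i\<in>{..length w}. f (take i w) \<otimes> g (drop i w) = \<zero>)"
    unfolding conv_def by (auto intro: add.finprod_one_eqI)
  then obtain i where "f (take i w) \<otimes> g (drop i w) \<noteq> \<zero>" by blast
  then have "f (take i w) \<noteq> \<zero>" "g (drop i w) \<noteq> \<zero>" using fg by auto
  then show "w \<in> (\<lambda>(u, v). u @ v) ` ({w. f w \<noteq> \<zero>} \<times> {w. g w \<noteq> \<zero>})"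
    by (intro image_eqI[of _ _ "(take i w, drop i w)"]) auto
qed

lemma conv_in_carrier:
  assumes "f \<in> carrier (free_algebra R S)" "g \<in> carrier (free_algebra R S)"
  shows "conv f g \<in> carrier (free_algebra R S)"
proof -
  have f: "\<And>w. f w \<in> carrier R" "finite {w. f w \<noteq> \<zero>}" "{w. f w \<noteq> \<zero>} \<subseteq> lists S"
    and g: "\<And>w. g w \<in> carrier R" "finite {w. g w \<noteq> \<zero>}" "{w. g w \<noteq> \<zero>} \<subseteq> lists S"
    using assms unfolding free_algebra_carrier by blast+
  note supp = conv_supp[of f g, OF f(1) g(1)]
  have "finite {w. conv f g w \<noteq> \<zero>}"
    by (rule finite_subset[OF supp]) (use f(2) g(2) in auto)
  moreover have "{w. conv f g w \<noteq> \<zero>} \<subseteq> lists S"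
    using supp f(3) g(3) by fastforce
  ultimately show ?thesis unfolding free_algebra_carrier
    using conv_closed[of f g] f(1) g(1) by auto
qed

lemma add_in_carrier:
  assumes "f \<in> carrier (free_algebra R S)" "g \<in> carrier (free_algebra R S)"
  shows "(\<lambda>w. f w \<oplus> g w) \<in> carrier (free_algebra R S)"
proof -
  have f: "\<And>w. f w \<in> carrier R" "finite {w. f w \<noteq> \<zero>}" "{w. f w \<noteq> \<zero>} \<subseteq> lists S"
    and g: "\<And>w. g w \<in> carrier R" "finite {w. g w \<noteq> \<zero>}" "{w. g w \<noteq> \<zero>} \<subseteq> lists S"
    using assms unfolding free_algebra_carrier by blast+
  have supp: "{w. f w \<oplus> g w \<noteq> \<zero>} \<subseteq> {w. f w \<noteq> \<zero>} \<union> {w. g w \<noteq> \<zero>}"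
    by auto
  have "finite {w. f w \<oplus> g w \<noteq> \<zero>}"
    by (rule finite_subset[OF supp]) (use f(2) g(2) in auto)
  moreover have "{w. f w \<oplus> g w \<noteq> \<zero>} \<subseteq> lists S"
    using supp f(3) g(3) by blast
  ultimately show ?thesis unfolding free_algebra_carrier using f(1) g(1) by blast
qed

lemma free_algebra_ring: "ring (free_algebra R S)"
proof -
  let ?A = "free_algebra R S"
  have car: "f w \<in> carrier R" if "f \<in> carrier ?A" for f w
    using that by (simp add: free_algebra_carrier)
  have "abelian_group ?A"
  proof (rule abelian_groupI)
    fix f assume f: "f \<in> carrier ?A"
    have "(\<lambda>w. \<ominus> f w) \<in> carrier ?A"
    proof -
      have "{w. \<ominus> f w \<noteq> \<zero>} = {w. f w \<noteq> \<zero>}"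
        using car[OF f] by (metis minus_minus minus_zero)
      then show ?thesis using f by (simp add: free_algebra_carrier)
    qed
    moreover have "(\<lambda>w. \<ominus> f w) \<oplus>\<^bsub>?A\<^esub> f = \<zero>\<^bsub>?A\<^esub>"
      using car[OF f] by (simp add: free_algebra_simps l_neg)
    ultimately show "\<exists>g\<in>carrier ?A. g \<oplus>\<^bsub>?A\<^esub> f = \<zero>\<^bsub>?A\<^esub>" by blast
  next
    show "\<zero>\<^bsub>?A\<^esub> \<in> carrier ?A" by (simp add: free_algebra_simps free_algebra_carrier)
  qed (auto simp: free_algebra_simps add_in_carrier car a_assoc a_comm[OF car car])
  moreover have "monoid ?A"
    by (rule monoidI)
      (auto simp: free_algebra_simps conv_in_carrier mono_in_carrier fun_eq_iff conv_assoc car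
        conv_one_right conv_mono_Nil)
  ultimately show ?thesis
    by (rule ringI) (auto simp: free_algebra_simps fun_eq_iff conv_add_left conv_add_right car)
qed

text \<open>The set \<open>U\<close> carries a restriction on the support through the induction, for
  instance a bound on the length of words.\<close>

lemma free_algebra_induct [consumes 2, case_names zero add]:
  fixes f :: "'s list \<Rightarrow> 'a" and U :: "'s list set"
  assumes f: "f \<in> carrier (free_algebra R S)" and "{w. f w \<noteq> \<zero>} \<subseteq> U"
    and zero: "P (\<lambda>w. \<zero>)"
    and add: "\<And>f c w. f \<in> carrier (free_algebra R S) \<Longrightarrow> c \<in> carrier R \<Longrightarrow> w \<in> lists S \<Longrightarrow> w \<in> U \<Longrightarrow>
      P f \<Longrightarrow> P (\<lambda>v. mono c w v \<oplus> f v)"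
  shows "P f"
proof -
  have "finite {w. f w \<noteq> \<zero>}" using f by (simp add: free_algebra_carrier)
  have "P f" if "{w. f w \<noteq> \<zero>} = W" "W \<subseteq> U" "f \<in> carrier (free_algebra R S)" "finite W" for W f
    using that(4,1-3)
  proof (induction W arbitrary: f)
    case empty
    then have "f = (\<lambda>w. \<zero>)" by auto
    then show ?case using zero by simp
  next
    case (insert w W)
    have car: "f v \<in> carrier R" for v using insert by (simp add: free_algebra_carrier)
    define g where "g = (\<lambda>v. if v = w then \<zero> else f v)"
    have supp: "{v. g v \<noteq> \<zero>} = W" using insert by (auto simp: g_def)
    have g: "g \<in> carrier (free_algebra R S)"
      using insert by (auto simp: free_algebra_carrier supp) (auto simp: g_def)
    have eq: "f = (\<lambda>v. mono (f w) w v \<oplus> g v)" using car by (auto simp: mono_def g_def)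
    have "w \<in> lists S" using insert by (auto simp: free_algebra_carrier)
    then have "P (\<lambda>v. mono (f w) w v \<oplus> g v)"
      using insert supp g car by (intro add) auto
    then show ?case using eq by simp
  qed
  then show ?thesis using assms(1,2) \<open>finite {w. f w \<noteq> \<zero>}\<close> by blast
qed

lemma free_scalar_hom: "free_scalar R \<in> ring_hom R (free_algebra R S)"
  by (rule ring_hom_memI)
    (auto simp: free_scalar_eq mono_in_carrier free_algebra_simps conv_mono_mono, auto simp: mono_def)

lemma free_scalar_commute:
  "c \<in> carrier R \<Longrightarrow> free_scalar R c \<otimes>\<^bsub>free_algebra R S\<^esub> free_gen R s = free_gen R s \<otimes>\<^bsub>free_algebra R S\<^esub> free_scalar R c"
  by (simp add: free_scalar_eq free_gen_eq free_algebra_simps conv_mono_mono)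

lemma mono_Cons_eq: "mono \<one> (s # w) = free_gen R s \<otimes>\<^bsub>free_algebra R S\<^esub> mono \<one> w"
  by (simp add: free_gen_eq free_algebra_simps conv_mono_mono)

lemma mono_eq: "c \<in> carrier R \<Longrightarrow> mono c w = free_scalar R c \<otimes>\<^bsub>free_algebra R S\<^esub> mono \<one> w"
  by (simp add: free_scalar_eq free_algebra_simps conv_mono_mono)

end

subsection \<open>Normal forms for the relation \<open>y x = x y + 1\<close>\<close>

text \<open>The ring is any ring containing such a pair. The locale is applied to a skewfield, where
  it bounds growth, and to the presented Weyl algebra, where it gives normal forms.\<close>

locale weyl_pair = ring R + F: cring F for R (structure) and F (structure) +
  fixes \<sigma> x y
  assumes sigma: "\<sigma> \<in> ring_hom F R"
    and x [simp]: "x \<in> carrier R" and y [simp]: "y \<in> carrier R"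
    and x_comm: "c \<in> carrier F \<Longrightarrow> \<sigma> c \<otimes> x = x \<otimes> \<sigma> c"
    and y_comm: "c \<in> carrier F \<Longrightarrow> \<sigma> c \<otimes> y = y \<otimes> \<sigma> c"
    and rel: "y \<otimes> x = x \<otimes> y \<oplus> \<one>"
begin

definition nm :: "nat \<times> nat \<Rightarrow> 'a" where
  "nm p = x [^] fst p \<otimes> y [^] snd p"

text \<open>Both exponents are bounded by \<open>N\<close> separately, so there are (N + 1)^2
  monomials. Existence of these forms is all that is claimed here; uniqueness comes later from a
  valuation.\<close>

definition NF :: "nat \<Rightarrow> 'a set" where
  "NF N = {(\<Oplus>p\<in>{..N} \<times> {..N}. \<sigma> (c p) \<otimes> nm p) | c. \<forall>p. c p \<in> carrier F}"

lemma nm_closed [simp]: "nm p \<in> carrier R"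
  by (simp add: nm_def)

lemma sigma_closed [simp]: "c \<in> carrier F \<Longrightarrow> \<sigma> c \<in> carrier R"
  using ring_hom_closed[OF sigma] .

lemma sigma_zero [simp]: "\<sigma> \<zero>\<^bsub>F\<^esub> = \<zero>"
  using ring_hom_zero[OF sigma] F.ring_axioms ring_axioms by blast

lemma sigma_one [simp]: "\<sigma> \<one>\<^bsub>F\<^esub> = \<one>"
  using ring_hom_one[OF sigma] .

lemma sigma_add: "c \<in> carrier F \<Longrightarrow> d \<in> carrier F \<Longrightarrow> \<sigma> (c \<oplus>\<^bsub>F\<^esub> d) = \<sigma> c \<oplus> \<sigma> d"
  using ring_hom_add[OF sigma] .

lemma sigma_mult: "c \<in> carrier F \<Longrightarrow> d \<in> carrier F \<Longrightarrow> \<sigma> (c \<otimes>\<^bsub>F\<^esub> d) = \<sigma> c \<otimes> \<sigma> d"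
  using ring_hom_mult[OF sigma] .

lemma NF_carrier: "v \<in> NF N \<Longrightarrow> v \<in> carrier R"
  by (auto simp: NF_def intro!: finsum_closed)

lemma NF_add: "v \<in> NF N \<Longrightarrow> w \<in> NF N \<Longrightarrow> v \<oplus> w \<in> NF N"
proof -
  assume "v \<in> NF N" "w \<in> NF N"
  then obtain c d where c: "\<And>p. c p \<in> carrier F" and v: "v = (\<Oplus>p\<in>{..N} \<times> {..N}. \<sigma> (c p) \<otimes> nm p)"
    and d: "\<And>p. d p \<in> carrier F" and w: "w = (\<Oplus>p\<in>{..N} \<times> {..N}. \<sigma> (d p) \<otimes> nm p)"
    unfolding NF_def by blast
  have "v \<oplus> w = (\<Oplus>p\<in>{..N} \<times> {..N}. \<sigma> (c p) \<otimes> nm p \<oplus> \<sigma> (d p) \<otimes> nm p)"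
    unfolding v w using c d by (intro finsum_addf[symmetric]) auto
  also have "\<dots> = (\<Oplus>p\<in>{..N} \<times> {..N}. \<sigma> (c p \<oplus>\<^bsub>F\<^esub> d p) \<otimes> nm p)"
    using c d by (intro finsum_cong') (auto simp: sigma_add l_distr)
  finally show ?thesis unfolding NF_def using c d by (intro CollectI exI[of _ "\<lambda>p. c p \<oplus>\<^bsub>F\<^esub> d p"]) auto
qed

lemma NF_zero: "\<zero> \<in> NF N"
proof -
  have "(\<Oplus>p\<in>{..N} \<times> {..N}. \<sigma> \<zero>\<^bsub>F\<^esub> \<otimes> nm p) = \<zero>" by (intro add.finprod_one_eqI) simp
  then show ?thesis unfolding NF_def by (intro CollectI exI[of _ "\<lambda>_. \<zero>\<^bsub>F\<^esub>"]) auto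
qed

lemma NF_finsum: "(\<And>a. a \<in> A \<Longrightarrow> f a \<in> NF N) \<Longrightarrow> finsum R f A \<in> NF N"
proof (induction A rule: infinite_finite_induct)
  case (insert a A)
  then have "f \<in> A \<rightarrow> carrier R" "f a \<in> carrier R" using NF_carrier by auto
  then show ?case using insert by (simp add: NF_add)
qed (auto simp: NF_zero)

lemma NF_base: "c \<in> carrier F \<Longrightarrow> i \<le> N \<Longrightarrow> j \<le> N \<Longrightarrow> \<sigma> c \<otimes> (x [^] i \<otimes> y [^] j) \<in> NF N"
proof -
  assume c: "c \<in> carrier F" and ij: "i \<le> N" "j \<le> N"
  have "(\<Oplus>p\<in>{..N} \<times> {..N}. \<sigma> (if (i, j) = p then c else \<zero>\<^bsub>F\<^esub>) \<otimes> nm p) =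
      (\<Oplus>p\<in>{..N} \<times> {..N}. if (i, j) = p then \<sigma> c \<otimes> nm p else \<zero>)"
    using c by (intro finsum_cong') auto
  also have "\<dots> = \<sigma> c \<otimes> nm (i, j)"
    using c ij by (intro add.finprod_singleton) auto
  finally show ?thesis
    unfolding NF_def using c by (intro CollectI exI[of _ "\<lambda>p. if (i, j) = p then c else \<zero>\<^bsub>F\<^esub>"]) (auto simp: nm_def)
qed

lemma NF_E:
  assumes "v \<in> NF N"
  obtains c where "\<And>p. c p \<in> carrier F" "v = (\<Oplus>p\<in>{..N} \<times> {..N}. \<sigma> (c p) \<otimes> nm p)"
  using assms unfolding NF_def by blast

lemma NF_map:
  assumes v: "v \<in> NF N" and u: "u \<in> carrier R"
    and base: "\<And>c i j. c \<in> carrier F \<Longrightarrow> i \<le> N \<Longrightarrow> j \<le> N \<Longrightarrow> u \<otimes> (\<sigma> c \<otimes> (x [^] i \<otimes> y [^] j)) \<in> NF M"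
  shows "u \<otimes> v \<in> NF M"
proof -
  obtain c where c: "\<And>p. c p \<in> carrier F" and v: "v = (\<Oplus>p\<in>{..N} \<times> {..N}. \<sigma> (c p) \<otimes> nm p)"
    using NF_E[OF v] by blast
  have "u \<otimes> v = (\<Oplus>p\<in>{..N} \<times> {..N}. u \<otimes> (\<sigma> (c p) \<otimes> nm p))"
    unfolding v using c u by (intro finsum_rdistr) auto
  also have "\<dots> \<in> NF M" by (rule NF_finsum) (use c base in \<open>auto simp: nm_def\<close>)
  finally show ?thesis .
qed

lemma NF_mono:
  assumes "v \<in> NF N" "N \<le> M"
  shows "v \<in> NF M"
proof -
  have "\<one> \<otimes> v \<in> NF M" by (rule NF_map[OF assms(1)]) (use assms(2) in \<open>auto intro: NF_base\<close>)
  then show ?thesis using NF_carrier[OF assms(1)] by simp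
qed

lemma NF_scale:
  assumes "v \<in> NF N" "d \<in> carrier F"
  shows "\<sigma> d \<otimes> v \<in> NF N"
proof (rule NF_map[OF assms(1)])
  fix c i j assume h: "c \<in> carrier F" "i \<le> N" "j \<le> N"
  have "\<sigma> d \<otimes> (\<sigma> c \<otimes> (x [^] i \<otimes> y [^] j)) = \<sigma> (d \<otimes>\<^bsub>F\<^esub> c) \<otimes> (x [^] i \<otimes> y [^] j)"
    using h assms by (simp add: sigma_mult m_assoc)
  then show "\<sigma> d \<otimes> (\<sigma> c \<otimes> (x [^] i \<otimes> y [^] j)) \<in> NF N" using h assms by (simp add: NF_base)
qed (use assms in simp)

text \<open>The relation makes \<open>y\<close> act on powers of \<open>x\<close> like a derivative.
  At \<open>i = 0\<close> the truncated exponent \<open>i - 1\<close> is harmless because its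
  coefficient is 0.\<close>

lemma y_x_pow: "y \<otimes> x [^] (i::nat) = x [^] i \<otimes> y \<oplus> [i] \<cdot> (x [^] (i - 1))"
proof (induction i)
  case (Suc i)
  have "[i] \<cdot> (x [^] (i - 1)) \<otimes> x = [i] \<cdot> (x [^] (i - 1) \<otimes> x)" by (rule add_pow_ldistr) auto
  also have "\<dots> = [i] \<cdot> (x [^] i)"
    using nat_pow_Suc[of x "i - 1"] by (cases "i = 0") auto
  finally have "[i] \<cdot> (x [^] (i - 1)) \<otimes> x = [i] \<cdot> (x [^] i)" .
  moreover have "y \<otimes> x [^] Suc i = (x [^] i \<otimes> y \<oplus> [i] \<cdot> (x [^] (i - 1))) \<otimes> x"
    using Suc by (simp add: m_assoc[symmetric])
  moreover have "x [^] i \<otimes> y \<otimes> x = x [^] Suc i \<otimes> y \<oplus> x [^] i"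
    by (simp add: m_assoc rel r_distr)
  ultimately show ?case
    by (simp add: l_distr a_assoc) (simp add: a_comm)
qed simp

lemma NF_x:
  assumes "v \<in> NF N"
  shows "x \<otimes> v \<in> NF (Suc N)"
proof (rule NF_map[OF assms x])
  fix c i j assume h: "c \<in> carrier F" "i \<le> N" "j \<le> N"
  have "x \<otimes> (\<sigma> c \<otimes> (x [^] i \<otimes> y [^] j)) = \<sigma> c \<otimes> (x \<otimes> (x [^] i \<otimes> y [^] j))"
    using h x_comm[of c] by (simp add: m_assoc[symmetric])
  also have "x \<otimes> (x [^] i \<otimes> y [^] j) = x [^] Suc i \<otimes> y [^] j"
    using nat_pow_Suc2[OF x, of i] by (simp add: m_assoc[symmetric])
  finally show "x \<otimes> (\<sigma> c \<otimes> (x [^] i \<otimes> y [^] j)) \<in> NF (Suc N)"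
    using NF_base[OF h(1), of "Suc i" "Suc N" j] h by simp
qed

lemma NF_y:
  assumes "v \<in> NF N"
  shows "y \<otimes> v \<in> NF (Suc N)"
proof (rule NF_map[OF assms y])
  fix c i j assume h: "c \<in> carrier F" "i \<le> N" "j \<le> N"
  have s: "[i] \<cdot> v = \<sigma> ([i] \<cdot>\<^bsub>F\<^esub> \<one>\<^bsub>F\<^esub>) \<otimes> v" if "v \<in> carrier R" for v
    by (induction i) (use that in \<open>auto simp: sigma_add l_distr\<close>)
  have "y \<otimes> (\<sigma> c \<otimes> (x [^] i \<otimes> y [^] j)) = \<sigma> c \<otimes> (y \<otimes> x [^] i \<otimes> y [^] j)"
    using h y_comm[of c] by (simp add: m_assoc[symmetric])
  also have "y \<otimes> x [^] i \<otimes> y [^] j = x [^] i \<otimes> y [^] Suc j \<oplus> \<sigma> ([i] \<cdot>\<^bsub>F\<^esub> \<one>\<^bsub>F\<^esub>) \<otimes> (x [^] (i - 1) \<otimes> y [^] j)"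
    using nat_pow_Suc2[OF y, of j] by (simp add: y_x_pow s l_distr m_assoc)
  finally have eq: "y \<otimes> (\<sigma> c \<otimes> (x [^] i \<otimes> y [^] j)) =
      \<sigma> c \<otimes> (x [^] i \<otimes> y [^] Suc j \<oplus> \<sigma> ([i] \<cdot>\<^bsub>F\<^esub> \<one>\<^bsub>F\<^esub>) \<otimes> (x [^] (i - 1) \<otimes> y [^] j))" .
  have "x [^] i \<otimes> y [^] Suc j \<in> NF (Suc N)"
    using NF_base[of "\<one>\<^bsub>F\<^esub>" i "Suc N" "Suc j"] h by simp
  then show "y \<otimes> (\<sigma> c \<otimes> (x [^] i \<otimes> y [^] j)) \<in> NF (Suc N)"
    unfolding eq using h by (intro NF_scale NF_add NF_base) auto
qed

lemma NF_one: "\<one> \<in> NF N"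
  using NF_base[of "\<one>\<^bsub>F\<^esub>" 0 N 0] by simp

end

subsection \<open>Homomorphisms from free algebras\<close>

context cring
begin

text \<open>A word is absorbed letter by letter from the right end, and each letter raises the bound
  by one. Hence word length controls the exponents of the normal form.\<close>

lemma free_hom_word_NF:
  assumes T: "weyl_pair T R (\<lambda>c. h (free_scalar R c)) (h (free_gen R s)) (h (free_gen R t))"
    and h: "h \<in> ring_hom (free_algebra R {s, t}) T"
    and f: "f \<in> carrier (free_algebra R {s, t})" "{w. f w \<noteq> \<zero>} \<subseteq> {w. length w \<le> N}"
  shows "h f \<in> weyl_pair.NF T R (\<lambda>c. h (free_scalar R c)) (h (free_gen R s)) (h (free_gen R t)) N"
proof -
  interpret T: weyl_pair T R "\<lambda>c. h (free_scalar R c)" "h (free_gen R s)" "h (free_gen R t)" by (rule T)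
  let ?A = "free_algebra R {s, t}"
  note hom = ring_hom_mult[OF h] ring_hom_add[OF h] ring_hom_one[OF h]
  have gen: "free_gen R u \<in> carrier ?A" if "u \<in> {s, t}" for u
    using that by (auto simp: free_gen_eq intro: mono_in_carrier)
  have word: "h (mono \<one> w) \<in> T.NF (length w)" if "w \<in> lists {s, t}" for w
    using that
  proof (induction w)
    case Nil
    have "h (mono \<one> []) = \<one>\<^bsub>T\<^esub>" using hom(3) by (simp add: free_algebra_simps)
    then show ?case by (simp add: T.NF_one)
  next
    case (Cons u w)
    have "h (mono \<one> (u # w)) = h (free_gen R u) \<otimes>\<^bsub>T\<^esub> h (mono \<one> w)"
      unfolding mono_Cons_eq[where S = "{s, t}"] using Cons gen by (intro hom(1) mono_in_carrier) auto
    then show ?case using Cons T.NF_x[of "h (mono \<one> w)"] T.NF_y[of "h (mono \<one> w)"] by auto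
  qed
  show ?thesis
    using f
  proof (induction f rule: free_algebra_induct)
    case zero
    have "h \<zero>\<^bsub>?A\<^esub> = \<zero>\<^bsub>T\<^esub>" using ring_hom_zero[OF h free_algebra_ring T.ring_axioms] .
    then show ?case by (simp add: free_algebra_simps T.NF_zero)
  next
    case (add f c w)
    have m: "mono c w \<in> carrier ?A" using add by (intro mono_in_carrier)
    have "h (\<lambda>v. mono c w v \<oplus> f v) = h (mono c w) \<oplus>\<^bsub>T\<^esub> h f"
      using hom(2)[OF m add(1)] by (simp add: free_algebra_simps)
    moreover have "h (mono c w) = h (free_scalar R c) \<otimes>\<^bsub>T\<^esub> h (mono \<one> w)"
      unfolding mono_eq[OF add(2), where S = "{s, t}"] using add
      by (intro hom(1)) (auto simp: free_scalar_eq intro!: mono_in_carrier)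
    moreover have "h (mono \<one> w) \<in> T.NF N" using word[OF add(3)] add(4) T.NF_mono by auto
    ultimately show ?case using add by (auto intro!: T.NF_add T.NF_scale)
  qed
qed


text \<open>The universal property of the free algebra. The images of scalars have to commute with
  the images of generators, but need not be central in \<open>T\<close>.\<close>

lemma free_eval:
  assumes T: "ring T" and k: "\<kappa> \<in> ring_hom R T" and g: "\<And>s. s \<in> S \<Longrightarrow> g s \<in> carrier T"
    and comm: "\<And>c s. c \<in> carrier R \<Longrightarrow> s \<in> S \<Longrightarrow> \<kappa> c \<otimes>\<^bsub>T\<^esub> g s = g s \<otimes>\<^bsub>T\<^esub> \<kappa> c"
  obtains h where "h \<in> ring_hom (free_algebra R S) T" "\<And>c. c \<in> carrier R \<Longrightarrow> h (free_scalar R c) = \<kappa> c"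
    "\<And>s. s \<in> S \<Longrightarrow> h (free_gen R s) = g s"
proof -
  interpret T: ring T by (rule T)
  let ?A = "free_algebra R S"
  interpret A: ring ?A by (rule free_algebra_ring)
  note kc = ring_hom_closed[OF k] and ka = ring_hom_add[OF k] and km = ring_hom_mult[OF k] and k1 = ring_hom_one[OF k]
  have k0: "\<kappa> \<zero> = \<zero>\<^bsub>T\<^esub>" using ring_hom_zero[OF k ring_axioms T] .
  define wv where "wv w = foldr (\<lambda>s t. g s \<otimes>\<^bsub>T\<^esub> t) w \<one>\<^bsub>T\<^esub>" for w
  have wv_simps: "wv [] = \<one>\<^bsub>T\<^esub>" "wv (s # w) = g s \<otimes>\<^bsub>T\<^esub> wv w" for s w by (simp_all add: wv_def)
  have wv: "wv w \<in> carrier T" if "w \<in> lists S" for w using that by (induction w) (auto simp: wv_simps g)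
  have wv_app: "wv (u @ w) = wv u \<otimes>\<^bsub>T\<^esub> wv w" if "u \<in> lists S" "w \<in> lists S" for u w
    using that by (induction u) (auto simp: wv_simps wv g T.m_assoc)
  have wv_comm: "\<kappa> c \<otimes>\<^bsub>T\<^esub> wv w = wv w \<otimes>\<^bsub>T\<^esub> \<kappa> c" if "c \<in> carrier R" "w \<in> lists S" for c w
    using that(2)
  proof (induction w)
    case (Cons s w)
    have "wv (s # w) = g s \<otimes>\<^bsub>T\<^esub> wv w" by (simp add: wv_def)
    moreover have "\<kappa> c \<otimes>\<^bsub>T\<^esub> (g s \<otimes>\<^bsub>T\<^esub> wv w) = g s \<otimes>\<^bsub>T\<^esub> (\<kappa> c \<otimes>\<^bsub>T\<^esub> wv w)"
      using Cons(1,2) that(1) kc g wv comm by (simp add: T.m_assoc[symmetric])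
    moreover have "\<dots> = g s \<otimes>\<^bsub>T\<^esub> wv w \<otimes>\<^bsub>T\<^esub> \<kappa> c"
      using Cons that kc g wv by (simp add: T.m_assoc)
    ultimately show ?case by simp
  qed (use that kc in \<open>simp add: wv_def\<close>)
  define h where "h f = (\<Oplus>\<^bsub>T\<^esub>w\<in>{w. f w \<noteq> \<zero>}. \<kappa> (f w) \<otimes>\<^bsub>T\<^esub> wv w)" for f
  \<comment> \<open>Allowing any finite superset of the support lets two elements be summed over the
    same index set.\<close>
  have hsup: "h f = (\<Oplus>\<^bsub>T\<^esub>w\<in>U. \<kappa> (f w) \<otimes>\<^bsub>T\<^esub> wv w)"
    if U: "finite U" "{w. f w \<noteq> \<zero>} \<subseteq> U" "U \<subseteq> lists S" "f \<in> carrier ?A" for f U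
  proof -
    have "wv w \<in> carrier T" "\<kappa> (f w) \<in> carrier T" if "w \<in> U" for w
      using wv[of w] subsetD[OF U(3) that] kc[of "f w"] U(4) by (simp_all add: free_algebra_carrier)
    then show ?thesis
      unfolding h_def by (intro T.add.finprod_mono_neutral_cong_left U(1,2)) (auto simp: k0)
  qed
  have hadd: "h (\<lambda>w. e w \<oplus> f w) = h e \<oplus>\<^bsub>T\<^esub> h f" if "e \<in> carrier ?A" "f \<in> carrier ?A" for e f
  proof -
    let ?U = "{w. e w \<noteq> \<zero>} \<union> {w. f w \<noteq> \<zero>}"
    have U: "finite ?U" "?U \<subseteq> lists S" and car: "\<And>w. e w \<in> carrier R" "\<And>w. f w \<in> carrier R"
      using that by (auto simp: free_algebra_carrier)
    have "h (\<lambda>w. e w \<oplus> f w) = (\<Oplus>\<^bsub>T\<^esub>w\<in>?U. \<kappa> (e w \<oplus> f w) \<otimes>\<^bsub>T\<^esub> wv w)"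
      by (rule hsup) (use U that add_in_carrier in auto)
    also have "\<dots> = (\<Oplus>\<^bsub>T\<^esub>w\<in>?U. \<kappa> (e w) \<otimes>\<^bsub>T\<^esub> wv w \<oplus>\<^bsub>T\<^esub> \<kappa> (f w) \<otimes>\<^bsub>T\<^esub> wv w)"
    proof (rule T.finsum_cong'[OF refl])
      show "(\<lambda>w. \<kappa> (e w) \<otimes>\<^bsub>T\<^esub> wv w \<oplus>\<^bsub>T\<^esub> \<kappa> (f w) \<otimes>\<^bsub>T\<^esub> wv w) \<in> ?U \<rightarrow> carrier T"
        using U(2) wv kc[OF car(1)] kc[OF car(2)] by blast
      fix w assume "w \<in> ?U"
      then have "wv w \<in> carrier T" using wv U(2) by blast
      then show "\<kappa> (e w \<oplus> f w) \<otimes>\<^bsub>T\<^esub> wv w = \<kappa> (e w) \<otimes>\<^bsub>T\<^esub> wv w \<oplus>\<^bsub>T\<^esub> \<kappa> (f w) \<otimes>\<^bsub>T\<^esub> wv w"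
        using kc[OF car(1)] kc[OF car(2)] by (simp add: ka[OF car] T.l_distr)
    qed
    also have "\<dots> = (\<Oplus>\<^bsub>T\<^esub>w\<in>?U. \<kappa> (e w) \<otimes>\<^bsub>T\<^esub> wv w) \<oplus>\<^bsub>T\<^esub> (\<Oplus>\<^bsub>T\<^esub>w\<in>?U. \<kappa> (f w) \<otimes>\<^bsub>T\<^esub> wv w)"
      by (rule T.finsum_addf) (use U(2) wv kc[OF car(1)] kc[OF car(2)] in blast)+
    also have "\<dots> = h e \<oplus>\<^bsub>T\<^esub> h f"
      using hsup[of ?U e] hsup[of ?U f] U that by simp
    finally show ?thesis .
  qed
  have hmono: "h (mono c w) = \<kappa> c \<otimes>\<^bsub>T\<^esub> wv w" if "c \<in> carrier R" "w \<in> lists S" for c w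
  proof -
    have "h (mono c w) = (\<Oplus>\<^bsub>T\<^esub>v\<in>{w}. \<kappa> (mono c w v) \<otimes>\<^bsub>T\<^esub> wv v)"
      using that by (intro hsup mono_in_carrier) (auto simp: mono_def split: if_splits)
    also have "\<dots> = \<kappa> c \<otimes>\<^bsub>T\<^esub> wv w" using that kc wv by (simp add: mono_def)
    finally show ?thesis .
  qed
  have hclosed: "h f \<in> carrier T" if "f \<in> carrier ?A" for f
    unfolding h_def
  proof (rule T.finsum_closed, rule Pi_I)
    fix w assume "w \<in> {w. f w \<noteq> \<zero>}"
    then have "w \<in> lists S" "f w \<in> carrier R" using that unfolding free_algebra_carrier by blast+
    then show "\<kappa> (f w) \<otimes>\<^bsub>T\<^esub> wv w \<in> carrier T" using wv kc by simp
  qed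
  have hzero: "h (\<lambda>w. \<zero>) = \<zero>\<^bsub>T\<^esub>" by (simp add: h_def)
  \<comment> \<open>Multiplicativity is proved with a single word on the left and extended
    additively in \<open>hmult\<close>. The scalar \<open>\<kappa> d\<close> is moved past
    \<open>wv u\<close> by \<open>wv_comm\<close>.\<close>
  have hmult1: "h (conv (mono c u) f) = h (mono c u) \<otimes>\<^bsub>T\<^esub> h f"
    if c: "c \<in> carrier R" "u \<in> lists S" and f: "f \<in> carrier ?A" for c u f
    using f subset_UNIV
  proof (induction f rule: free_algebra_induct)
    case zero
    have "conv (mono c u) (\<lambda>w. \<zero>) = (\<lambda>w. \<zero>)"
      using A.r_null[OF mono_in_carrier[OF c]] by (simp add: free_algebra_simps)
    then show ?case using hzero hclosed[OF mono_in_carrier[OF c]] by simp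
  next
    case (add f d w)
    have m: "mono c u \<in> carrier ?A" "mono d w \<in> carrier ?A" using c add by (auto intro: mono_in_carrier)
    have "conv (mono c u) (\<lambda>v. mono d w v \<oplus> f v) = (\<lambda>v. conv (mono c u) (mono d w) v \<oplus> conv (mono c u) f v)"
      using A.r_distr[OF m(2) add(1) m(1)] by (simp add: free_algebra_simps)
    then have "h (conv (mono c u) (\<lambda>v. mono d w v \<oplus> f v)) = h (conv (mono c u) (mono d w)) \<oplus>\<^bsub>T\<^esub> h (conv (mono c u) f)"
      using hadd[OF conv_in_carrier[OF m] conv_in_carrier[OF m(1) add(1)]] by simp
    also have "h (conv (mono c u) (mono d w)) = \<kappa> c \<otimes>\<^bsub>T\<^esub> \<kappa> d \<otimes>\<^bsub>T\<^esub> (wv u \<otimes>\<^bsub>T\<^esub> wv w)"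
      using c add by (simp add: conv_mono_mono hmono km wv_app)
    also have "\<dots> = \<kappa> c \<otimes>\<^bsub>T\<^esub> (\<kappa> d \<otimes>\<^bsub>T\<^esub> wv u) \<otimes>\<^bsub>T\<^esub> wv w"
      using c add kc wv by (simp add: T.m_assoc)
    also have "\<dots> = (\<kappa> c \<otimes>\<^bsub>T\<^esub> wv u) \<otimes>\<^bsub>T\<^esub> (\<kappa> d \<otimes>\<^bsub>T\<^esub> wv w)"
      unfolding wv_comm[OF add(2) c(2)] using c add kc wv by (simp add: T.m_assoc)
    also have "\<dots> = h (mono c u) \<otimes>\<^bsub>T\<^esub> h (mono d w)" using c add by (simp add: hmono)
    finally show ?case
      using add(5) hadd[OF m(2) add(1)] hclosed[OF m(1)] hclosed[OF m(2)] hclosed[OF add(1)]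
      by (simp add: T.r_distr)
  qed
  have hmult: "h (conv e f) = h e \<otimes>\<^bsub>T\<^esub> h f" if e: "e \<in> carrier ?A" and f: "f \<in> carrier ?A" for e f
    using e subset_UNIV
  proof (induction e rule: free_algebra_induct)
    case zero
    have "conv (\<lambda>w. \<zero>) f = (\<lambda>w. \<zero>)" using A.l_null[OF f] by (simp add: free_algebra_simps)
    then show ?case using hzero hclosed[OF f] by simp
  next
    case (add e d w)
    have m: "mono d w \<in> carrier ?A" using add by (auto intro: mono_in_carrier)
    have "conv (\<lambda>v. mono d w v \<oplus> e v) f = (\<lambda>v. conv (mono d w) f v \<oplus> conv e f v)"
      using A.l_distr[OF m add(1) f] by (simp add: free_algebra_simps)
    then have "h (conv (\<lambda>v. mono d w v \<oplus> e v) f) = h (conv (mono d w) f) \<oplus>\<^bsub>T\<^esub> h (conv e f)"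
      using hadd[OF conv_in_carrier[OF m f] conv_in_carrier[OF add(1) f]] by simp
    then show ?case
      using add(5) hmult1[OF add(2,3) f] hadd[OF m add(1)] hclosed[OF m] hclosed[OF add(1)] hclosed[OF f]
      by (simp add: T.l_distr)
  qed
  show ?thesis
  proof (rule that)
    show "h \<in> ring_hom ?A T"
      by (rule ring_hom_memI)
        (auto simp: hclosed free_algebra_simps hmult hadd hmono k1 wv_def)
  qed (auto simp: free_scalar_eq free_gen_eq hmono kc k1 g wv_def)
qed

end

section \<open>Weyl algebras in skewfields\<close>

context skew
begin

definition ad :: "'a \<Rightarrow> 'a \<Rightarrow> 'a" where
  "ad u x = u \<otimes> x \<oplus> \<ominus> (x \<otimes> u)"

lemma ad_closed [simp]: "u \<in> carrier R \<Longrightarrow> x \<in> carrier R \<Longrightarrow> ad u x \<in> carrier R"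
  by (simp add: ad_def)

lemma ad_derivation:
  assumes u: "u \<in> carrier R"
  shows "derivation_on (carrier R) (ad u)"
  unfolding derivation_on_def
proof (intro conjI ballI)
  show "ad u ` carrier R \<subseteq> carrier R" using u by auto
next
  fix x y assume "x \<in> carrier R" "y \<in> carrier R"
  then show "ad u (x \<oplus> y) = ad u x \<oplus> ad u y" using u unfolding ad_def by algebra
next
  fix x y assume xy: "x \<in> carrier R" "y \<in> carrier R"
  then have "ad u x \<otimes> y \<oplus> x \<otimes> ad u y = (u \<otimes> x \<otimes> y \<oplus> \<ominus> (x \<otimes> u \<otimes> y)) \<oplus> (x \<otimes> u \<otimes> y \<oplus> \<ominus> (x \<otimes> y \<otimes> u))"
    using u by (simp add: ad_def l_distr r_distr l_minus r_minus m_assoc)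
  also have "\<dots> = u \<otimes> (x \<otimes> y) \<oplus> \<ominus> (x \<otimes> y \<otimes> u)"
    using u xy by (simp add: a_assoc m_assoc r_neg1)
  finally show "ad u (x \<otimes> y) = ad u x \<otimes> y \<oplus> x \<otimes> ad u y" by (simp add: ad_def)
qed

lemma ad_eq_zero_iff:
  assumes "u \<in> carrier R" "x \<in> carrier R"
  shows "ad u x = \<zero> \<longleftrightarrow> u \<otimes> x = x \<otimes> u"
proof
  assume "ad u x = \<zero>"
  then show "u \<otimes> x = x \<otimes> u"
    using assms unfolding ad_def by (metis add.inv_closed add.inv_inv m_closed minus_equality)
next
  assume "u \<otimes> x = x \<otimes> u"
  then show "ad u x = \<zero>" using assms by (simp add: ad_def r_neg)
qed

text \<open>The commutator of two inner derivations is the inner derivation of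
  \<open>ad u w\<close>, which vanishes when \<open>ad u w\<close> is central.\<close>

lemma ad_commute:
  assumes "u \<in> carrier R" "w \<in> carrier R" "x \<in> carrier R" and c: "ad u w \<in> ring_center R"
  shows "ad u (ad w x) = ad w (ad u x)"
proof -
  have e: "ad w x = w \<otimes> x \<oplus> \<ominus> (x \<otimes> w)" by (simp add: ad_def)
  note D = ad_derivation[OF assms(1)]
  have add: "ad u (p \<oplus> q) = ad u p \<oplus> ad u q" if "p \<in> carrier R" "q \<in> carrier R" for p q
    using D that by (simp add: derivation_on_def)
  have mult: "ad u (p \<otimes> q) = ad u p \<otimes> q \<oplus> p \<otimes> ad u q" if "p \<in> carrier R" "q \<in> carrier R" for p q
    using D that by (simp add: derivation_on_def)
  have minus: "ad u (\<ominus> p) = \<ominus> ad u p" if "p \<in> carrier R" for p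
    using that assms by (simp add: ad_def l_minus r_minus minus_add)
  have comm: "ad u w \<otimes> x = x \<otimes> ad u w" using c assms by (simp add: ring_center_def)
  have "ad u (ad w x) = (ad u w \<otimes> x \<oplus> w \<otimes> ad u x) \<oplus> \<ominus> (ad u x \<otimes> w \<oplus> x \<otimes> ad u w)"
    using assms unfolding e by (simp add: add mult minus)
  also have "\<dots> = w \<otimes> ad u x \<oplus> \<ominus> (ad u x \<otimes> w)"
  proof -
    have "(z \<oplus> p) \<oplus> \<ominus> (q \<oplus> z) = p \<oplus> \<ominus> q" if "z \<in> carrier R" "p \<in> carrier R" "q \<in> carrier R" for z p q
      using that by algebra
    then show ?thesis using assms comm by simp
  qed
  finally show ?thesis by (simp add: ad_def)
qed

text \<open>If k and l iterations kill the factors, then by the Leibniz rule k + l + 1 iterations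
  kill the product.\<close>

lemma ad_nil_subring:
  assumes u: "\<And>i. i \<in> I \<Longrightarrow> u i \<in> carrier R"
  shows "subring {x \<in> carrier R. \<forall>i\<in>I. \<exists>k. (ad (u i) ^^ k) x = \<zero>} R" (is "subring ?S R")
proof (rule subringI)
  note C = carrier_is_subring
  show "?S \<subseteq> carrier R" by blast
  have "(ad (u i) ^^ 1) \<one> = \<zero>" if "i \<in> I" for i
    using u[OF that] by (simp add: ad_def r_neg)
  then show "\<one> \<in> ?S" by blast
next
  fix x assume x: "x \<in> ?S"
  have "\<exists>k. (ad (u i) ^^ k) (\<ominus> x) = \<zero>" if i: "i \<in> I" for i
  proof -
    note D = carrier_is_subring ad_derivation[OF u[OF i]]
    obtain k where k: "(ad (u i) ^^ k) x = \<zero>" using x i by auto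
    have "(ad (u i) ^^ k) (x \<oplus> \<ominus> x) = (ad (u i) ^^ k) x \<oplus> (ad (u i) ^^ k) (\<ominus> x)"
      using x by (intro der_pow_add[OF D]) auto
    then have "(ad (u i) ^^ k) (\<ominus> x) = \<zero>"
      using x k der_pow_zero[OF D] der_pow_closed[OF D, of "\<ominus> x" k] by (simp add: r_neg)
    then show ?thesis by blast
  qed
  then show "\<ominus> x \<in> ?S" using x by auto
next
  fix x y assume x: "x \<in> ?S" and y: "y \<in> ?S"
  have "(\<exists>k. (ad (u i) ^^ k) (x \<otimes> y) = \<zero>) \<and> (\<exists>k. (ad (u i) ^^ k) (x \<oplus> y) = \<zero>)" if i: "i \<in> I" for i
  proof -
    note D = carrier_is_subring ad_derivation[OF u[OF i]]
    obtain k where k: "(ad (u i) ^^ k) x = \<zero>" using x i by auto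
    obtain l where l: "(ad (u i) ^^ l) y = \<zero>" using y i by auto
    have k': "(ad (u i) ^^ j) x = \<zero>" if "k \<le> j" for j using der_pow_zero_mono[OF D k that] .
    have l': "(ad (u i) ^^ j) y = \<zero>" if "l \<le> j" for j using der_pow_zero_mono[OF D l that] .
    have xy: "x \<in> carrier R" "y \<in> carrier R" using x y by auto
    have "(ad (u i) ^^ Suc (k + l)) (x \<otimes> y) = \<zero>"
      using der_pow_mult[OF D xy k' l', of k l] by simp
    moreover have "(ad (u i) ^^ (k + l)) (x \<oplus> y) = \<zero>"
      using der_pow_add[OF D xy, of "k + l"] k'[of "k + l"] l'[of "k + l"] by simp
    ultimately show ?thesis by blast
  qed
  then show "x \<otimes> y \<in> ?S" "x \<oplus> y \<in> ?S" using x y by auto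
qed

lemma derivation_on_subset:
  "derivation_on (carrier R) d \<Longrightarrow> S \<subseteq> carrier R \<Longrightarrow> d ` S \<subseteq> S \<Longrightarrow> derivation_on S d"
  unfolding derivation_on_def by blast

lemma nat_mult_nonzero:
  assumes char: "\<And>n. (n::nat) > 0 \<Longrightarrow> [n] \<cdot> \<one> \<noteq> \<zero>" and "x \<in> carrier R" "x \<noteq> \<zero>" "(n::nat) > 0"
  shows "[n] \<cdot> x \<noteq> \<zero>"
proof -
  have "[n] \<cdot> x = ([n] \<cdot> \<one>) \<otimes> x" using assms(2) by (simp add: add_pow_ldistr)
  then show ?thesis using mult_nonzero[of "[n] \<cdot> \<one>" x] char[OF assms(4)] assms by simp
qed

lemma ad_pow_commute:
  assumes "\<And>x. x \<in> carrier R \<Longrightarrow> ad u (ad w x) = ad w (ad u x)" "u \<in> carrier R" "w \<in> carrier R" "x \<in> carrier R"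
  shows "(ad u ^^ k) (ad w x) = ad w ((ad u ^^ k) x)"
proof -
  have "(ad u ^^ k) x \<in> carrier R" for k
    using assms(2,4) by (induction k) auto
  then show ?thesis using assms by (induction k) auto
qed

text \<open>\<open>lexv\<close> is iterated over four commuting inner derivations, with
  \<open>ad (u 0)\<close> outermost. An element on which the earlier derivations vanish and the next
  gives 1 has a unit vector as its value; in the clauses, \<open>0\<close> also abbreviates tuples
  of zeros. Central elements are killed by all four and have value 0.\<close>

lemma ad_valuation:
  fixes u :: "nat \<Rightarrow> 'a"
  defines "S \<equiv> {x \<in> carrier R. \<forall>i\<in>{..<4}. \<exists>k. (ad (u i) ^^ k) x = \<zero>}"
  assumes u: "\<And>i. i < 4 \<Longrightarrow> u i \<in> carrier R"
    and comm: "\<And>i j. i < 4 \<Longrightarrow> j < 4 \<Longrightarrow> ad (u i) (u j) \<in> ring_center R"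
    and char: "\<And>n. (n::nat) > 0 \<Longrightarrow> [n] \<cdot> \<one> \<noteq> \<zero>"
  obtains v :: "'a \<Rightarrow> int \<times> int \<times> int \<times> int \<times> int" where "valn S v"
    "\<And>c. c \<in> ring_center R \<Longrightarrow> c \<noteq> \<zero> \<Longrightarrow> v c = 0"
    "\<And>g. g \<in> S \<Longrightarrow> ad (u 0) g = \<one> \<Longrightarrow> v g = (1, 0)"
    "\<And>g. g \<in> S \<Longrightarrow> ad (u 0) g = \<zero> \<Longrightarrow> ad (u 1) g = \<one> \<Longrightarrow> v g = (0, 1, 0)"
    "\<And>g. g \<in> S \<Longrightarrow> ad (u 0) g = \<zero> \<Longrightarrow> ad (u 1) g = \<zero> \<Longrightarrow> ad (u 2) g = \<one> \<Longrightarrow> v g = (0, 0, 1, 0)"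
    "\<And>g. g \<in> S \<Longrightarrow> ad (u 0) g = \<zero> \<Longrightarrow> ad (u 1) g = \<zero> \<Longrightarrow> ad (u 2) g = \<zero> \<Longrightarrow> ad (u 3) g = \<one> \<Longrightarrow>
       v g = (0, 0, 0, 1, 0)"
proof -
  let ?d = "\<lambda>i. ad (u i)"
  have S: "subring S R" unfolding S_def by (rule ad_nil_subring) (use u in auto)
  have SR: "S \<subseteq> carrier R" by (auto simp: S_def)
  have cc: "ad (u i) (ad (u j) x) = ad (u j) (ad (u i) x)" if "i < 4" "j < 4" "x \<in> carrier R" for i j x
    using ad_commute[OF u u that(3) comm] that by simp
  \<comment> \<open>Each derivation preserves the common domain \<open>S\<close> because the
    derivations commute.\<close>
  have closed: "?d j ` S \<subseteq> S" if j: "j < 4" for j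
  proof
    fix y assume "y \<in> ?d j ` S"
    then obtain x where x: "x \<in> S" "y = ad (u j) x" by blast
    have "\<exists>k. (ad (u i) ^^ k) y = \<zero>" if i: "i < 4" for i
    proof -
      obtain k where k: "(ad (u i) ^^ k) x = \<zero>" using x i by (auto simp: S_def)
      have "(ad (u i) ^^ k) y = ad (u j) \<zero>"
        unfolding x(2) using ad_pow_commute[OF cc[OF i j] u[OF i] u[OF j], of x k] x(1) k SR by auto
      also have "\<dots> = \<zero>" using u[OF j] by (simp add: ad_def)
      finally show ?thesis by blast
    qed
    then show "y \<in> S" using x SR u[OF j] by (auto simp: S_def)
  qed
  have D: "derivation_on S (?d i)" if "i < 4" for i
    using derivation_on_subset[OF ad_derivation[OF u[OF that]] SR closed[OF that]] .
  have nil: "\<exists>k. (?d i ^^ k) x = \<zero>" if "i < 4" "x \<in> S" for i x using that by (auto simp: S_def)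
  have char': "[n] \<cdot> x \<noteq> \<zero>" if "x \<in> S" "x \<noteq> \<zero>" "(n::nat) > 0" for n x
    using nat_mult_nonzero[OF char] that SR by auto
  \<comment> \<open>The iteration starts from the trivial valuation, which becomes a constant last
    coordinate.\<close>
  define v4 :: "'a \<Rightarrow> int" where "v4 = (\<lambda>_. 0)"
  have v4: "valn S v4" by (simp add: valn_def v4_def)
  have v4n: "v4 ([n] \<cdot> x) = v4 x" for n :: nat and x by (simp add: v4_def)
  define v3 where "v3 = lexv (?d 3) v4"
  define v2 where "v2 = lexv (?d 2) v3"
  define v1 where "v1 = lexv (?d 1) v2"
  define v0 where "v0 = lexv (?d 0) v1"
  note L = lexv_valn[OF S D _ char']
  have v3: "valn S v3" "\<And>n x. x \<in> S \<Longrightarrow> x \<noteq> \<zero> \<Longrightarrow> (n::nat) > 0 \<Longrightarrow> v3 ([n] \<cdot> x) = v3 x"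
    unfolding v3_def using L[of 3 v4] nil v4 v4n by auto
  have v2: "valn S v2" "\<And>n x. x \<in> S \<Longrightarrow> x \<noteq> \<zero> \<Longrightarrow> (n::nat) > 0 \<Longrightarrow> v2 ([n] \<cdot> x) = v2 x"
    unfolding v2_def using L[of 2 v3] nil v3 by auto
  have v1: "valn S v1" "\<And>n x. x \<in> S \<Longrightarrow> x \<noteq> \<zero> \<Longrightarrow> (n::nat) > 0 \<Longrightarrow> v1 ([n] \<cdot> x) = v1 x"
    unfolding v1_def using L[of 1 v2] nil v2 by auto
  have v0: "valn S v0" unfolding v0_def using L(1)[of 0 v1] nil v1 by auto
  note const = lexv_const[OF S D] and step = lexv_step[OF S D]
  have d1: "?d i \<one> = \<zero>" if "i < 4" for i using u[OF that] by (simp add: ad_def r_neg)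
  have one3: "v3 \<one> = 0" using const[of 3 \<one> v4] d1[of 3] by (simp add: v3_def v4_def zero_prod_def)
  have one2: "v2 \<one> = 0" using const[of 2 \<one> v3] d1[of 2] one3 by (simp add: v2_def zero_prod_def)
  have one1: "v1 \<one> = 0" using const[of 1 \<one> v2] d1[of 1] one2 by (simp add: v1_def zero_prod_def)
  note one = one1 one2 one3
  have nz: "g \<noteq> \<zero>" if "ad (u i) g = \<one>" "i < 4" for g i
    using that u[of i] by (auto simp: ad_def)
  show ?thesis
  proof (rule that[of v0])
    fix c assume c: "c \<in> ring_center R" "c \<noteq> \<zero>"
    then have d: "?d i c = \<zero>" if "i < 4" for i
      using u[OF that] ad_eq_zero_iff[of "u i" c] by (auto simp: ring_center_def)
    have "v3 c = 0" using const[of 3 c v4] d[of 3] c(2) by (simp add: v3_def v4_def zero_prod_def)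
    then have "v2 c = 0" using const[of 2 c v3] d[of 2] c(2) by (simp add: v2_def zero_prod_def)
    then have "v1 c = 0" using const[of 1 c v2] d[of 1] c(2) by (simp add: v1_def zero_prod_def)
    then show "v0 c = 0" using const[of 0 c v1] d[of 0] c(2) by (simp add: v0_def zero_prod_def)
  next
    fix g assume "g \<in> S" "ad (u 0) g = \<one>"
    then show "v0 g = (1, 0)" unfolding v0_def using step[of 0 g v1] d1[of 0] one by simp
  next
    fix g assume g: "g \<in> S" "ad (u 0) g = \<zero>" "ad (u 1) g = \<one>"
    then show "v0 g = (0, 1, 0)"
      unfolding v0_def using const[of 0 g v1] nz[OF g(3)] step[of 1 g v2] d1[of 1] one by (simp add: v1_def)
  next
    fix g assume g: "g \<in> S" "ad (u 0) g = \<zero>" "ad (u 1) g = \<zero>" "ad (u 2) g = \<one>"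
    then show "v0 g = (0, 0, 1, 0)"
      unfolding v0_def using const[of 0 g v1] const[of 1 g v2] nz[OF g(4)] step[of 2 g v3] d1[of 2] one
      by (simp add: v1_def v2_def)
  next
    fix g assume g: "g \<in> S" "ad (u 0) g = \<zero>" "ad (u 1) g = \<zero>" "ad (u 2) g = \<zero>" "ad (u 3) g = \<one>"
    then show "v0 g = (0, 0, 0, 1, 0)"
      unfolding v0_def using const[of 0 g v1] const[of 1 g v2] const[of 2 g v3] nz[OF g(5)] step[of 3 g v4] d1[of 3]
      by (simp add: v1_def v2_def v3_def v4_def)
  qed (rule v0)
qed

lemma centralizer_subring:
  assumes z: "z \<in> carrier R"
  shows "subring {x \<in> carrier R. z \<otimes> x = x \<otimes> z} R"
proof (rule subringI)
  fix x y assume "x \<in> {x \<in> carrier R. z \<otimes> x = x \<otimes> z}" "y \<in> {x \<in> carrier R. z \<otimes> x = x \<otimes> z}"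
  then have c: "x \<in> carrier R" "y \<in> carrier R" "z \<otimes> x = x \<otimes> z" "z \<otimes> y = y \<otimes> z" by auto
  have "z \<otimes> (x \<otimes> y) = x \<otimes> y \<otimes> z" using c z by (metis m_assoc)
  then show "x \<otimes> y \<in> {x \<in> carrier R. z \<otimes> x = x \<otimes> z}" "x \<oplus> y \<in> {x \<in> carrier R. z \<otimes> x = x \<otimes> z}"
    using c z by (auto simp: l_distr r_distr)
qed (use z in \<open>auto simp: l_minus r_minus\<close>)

lemma center_of_fracs:
  assumes "fracs_of S" "S \<subseteq> carrier R" "z \<in> carrier R" "\<And>s. s \<in> S \<Longrightarrow> z \<otimes> s = s \<otimes> z"
  shows "z \<in> ring_center R"
proof -
  have "z \<otimes> q = q \<otimes> z" if q: "q \<in> carrier R" for q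
  proof -
    obtain r s where rs: "r \<in> S" "s \<in> S - {\<zero>}" "q = r \<otimes> inv s" using fracs_ofE[OF assms(1) q] .
    have c: "r \<in> carrier R" "s \<in> carrier R" "s \<noteq> \<zero>" using rs assms(2) by auto
    have zr: "z \<otimes> r = r \<otimes> z" and zs: "inv s \<otimes> z = z \<otimes> inv s"
      using assms(4) rs inv_commute[OF c(2,3) assms(3)] by auto
    have "z \<otimes> q = z \<otimes> r \<otimes> inv s" using c assms(3) by (simp add: rs(3) m_assoc)
    also have "\<dots> = r \<otimes> (z \<otimes> inv s)" using c assms(3) by (simp add: zr m_assoc)
    also have "\<dots> = q \<otimes> z" using c assms(3) by (simp add: rs(3) m_assoc zs)
    finally show ?thesis .
  qed
  then show ?thesis using assms(3) by (simp add: ring_center_def)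
qed

end

context cring
begin

lemma free_hom_image_subset:
  assumes h: "h \<in> ring_hom (free_algebra R S) T" "ring T" and B: "subring B T"
    and c: "\<And>c. c \<in> carrier R \<Longrightarrow> h (free_scalar R c) \<in> B" and g: "\<And>s. s \<in> S \<Longrightarrow> h (free_gen R s) \<in> B"
    and f: "f \<in> carrier (free_algebra R S)"
  shows "h f \<in> B"
proof -
  let ?A = "free_algebra R S"
  note hom = ring_hom_mult[OF h(1)] ring_hom_add[OF h(1)] ring_hom_one[OF h(1)]
  note BE = subringE[OF B]
  have word: "h (mono \<one> w) \<in> B" if "w \<in> lists S" for w
    using that
  proof (induction w)
    case Nil
    then show ?case using hom(3) BE(3) by (simp add: free_algebra_simps)
  next
    case (Cons s w)
    have "h (mono \<one> (s # w)) = h (free_gen R s) \<otimes>\<^bsub>T\<^esub> h (mono \<one> w)"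
      unfolding mono_Cons_eq[where S = S] using Cons by (intro hom(1)) (auto simp: free_gen_eq intro!: mono_in_carrier)
    then show ?case using Cons g BE(6) by auto
  qed
  show ?thesis
    using f subset_UNIV
  proof (induction f rule: free_algebra_induct)
    case zero
    have "h \<zero>\<^bsub>?A\<^esub> = \<zero>\<^bsub>T\<^esub>" using ring_hom_zero[OF h(1) free_algebra_ring h(2)] .
    then show ?case using BE(2) by (simp add: free_algebra_simps)
  next
    case (add f c w)
    have m: "mono c w \<in> carrier ?A" using add by (intro mono_in_carrier)
    have "h (\<lambda>v. mono c w v \<oplus> f v) = h (mono c w) \<oplus>\<^bsub>T\<^esub> h f"
      using hom(2)[OF m add(1)] by (simp add: free_algebra_simps)
    moreover have "h (mono c w) = h (free_scalar R c) \<otimes>\<^bsub>T\<^esub> h (mono \<one> w)"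
      unfolding mono_eq[OF add(2), where S = S] using add
      by (intro hom(1)) (auto simp: free_scalar_eq intro!: mono_in_carrier)
    ultimately show ?case using add word c BE(6,7) by auto
  qed
qed

end

subsection \<open>The relations\<close>

text \<open>Stating the relations for a map out of the free algebra covers two targets at once: the
  Weyl algebra itself and a skewfield into which it is embedded.\<close>

locale weyl_hom = F: field F + T: ring T for F (structure) and T (structure) + fixes m h
  assumes hom: "h \<in> ring_hom (weyl_free m F) T"
    and relations: "\<And>r. r \<in> weyl_relations m F \<Longrightarrow> h r = \<zero>\<^bsub>T\<^esub>"
begin

abbreviation "px i \<equiv> h (free_gen F (Pos i))"
abbreviation "py i \<equiv> h (free_gen F (Mom i))"
abbreviation "sc c \<equiv> h (free_scalar F c)"

lemma hom': "h \<in> ring_hom (free_algebra F (weyl_gens m)) T"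
  using hom by (simp add: weyl_free_def)

lemma free_ring: "ring (weyl_free m F)"
  unfolding weyl_free_def by (rule F.free_algebra_ring)

lemma gen_closed: "s \<in> weyl_gens m \<Longrightarrow> free_gen F s \<in> carrier (weyl_free m F)"
  unfolding weyl_free_def by (auto simp: F.free_gen_eq intro!: F.mono_in_carrier)

lemma scalar_closed: "c \<in> carrier F \<Longrightarrow> free_scalar F c \<in> carrier (weyl_free m F)"
  unfolding weyl_free_def by (auto simp: F.free_scalar_eq intro!: F.mono_in_carrier)

lemma gens: "i < m \<Longrightarrow> Pos i \<in> weyl_gens m" "i < m \<Longrightarrow> Mom i \<in> weyl_gens m"
  by (auto simp: weyl_gens_def)

lemma px_closed [simp]: "i < m \<Longrightarrow> px i \<in> carrier T" and py_closed [simp]: "i < m \<Longrightarrow> py i \<in> carrier T"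
  and sc_closed [simp]: "c \<in> carrier F \<Longrightarrow> sc c \<in> carrier T"
  using ring_hom_closed[OF hom] gen_closed gens scalar_closed by auto

lemma sc_hom: "sc \<in> ring_hom F T"
  using ring_hom_trans[OF F.free_scalar_hom hom'] by (simp add: comp_def)

lemma sc_comm: "c \<in> carrier F \<Longrightarrow> s \<in> weyl_gens m \<Longrightarrow> sc c \<otimes>\<^bsub>T\<^esub> h (free_gen F s) = h (free_gen F s) \<otimes>\<^bsub>T\<^esub> sc c"
  using F.free_scalar_commute[of c "weyl_gens m" s] ring_hom_mult[OF hom] gen_closed scalar_closed
  by (metis weyl_free_def)

interpretation h: ring_hom_ring "weyl_free m F" T h
  by (intro ring_hom_ring.intro ring_hom_ring_axioms.intro free_ring T.ring_axioms hom)

lemma h_minus: "x \<in> carrier (weyl_free m F) \<Longrightarrow> y \<in> carrier (weyl_free m F) \<Longrightarrow>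
    h (x \<ominus>\<^bsub>weyl_free m F\<^esub> y) = h x \<oplus>\<^bsub>T\<^esub> \<ominus>\<^bsub>T\<^esub> h y"
  by (simp add: a_minus_def)

lemma h_commutator: "s \<in> weyl_gens m \<Longrightarrow> t \<in> weyl_gens m \<Longrightarrow>
    h (free_commutator m F s t) =
      h (free_gen F s) \<otimes>\<^bsub>T\<^esub> h (free_gen F t) \<oplus>\<^bsub>T\<^esub> \<ominus>\<^bsub>T\<^esub> (h (free_gen F t) \<otimes>\<^bsub>T\<^esub> h (free_gen F s))"
  unfolding free_commutator_def by (subst h_minus) (auto simp: gen_closed)

lemma commutator_closed: "s \<in> weyl_gens m \<Longrightarrow> t \<in> weyl_gens m \<Longrightarrow>
    free_commutator m F s t \<in> carrier (weyl_free m F)"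
  unfolding free_commutator_def by (auto simp: gen_closed)

lemma px_px: "i < m \<Longrightarrow> j < m \<Longrightarrow> px i \<otimes>\<^bsub>T\<^esub> px j \<oplus>\<^bsub>T\<^esub> \<ominus>\<^bsub>T\<^esub> (px j \<otimes>\<^bsub>T\<^esub> px i) = \<zero>\<^bsub>T\<^esub>"
  using relations[of "free_commutator m F (Pos i) (Pos j)"] h_commutator[of "Pos i" "Pos j"] gens
  by (auto simp: weyl_relations_def)

lemma py_py: "i < m \<Longrightarrow> j < m \<Longrightarrow> py i \<otimes>\<^bsub>T\<^esub> py j \<oplus>\<^bsub>T\<^esub> \<ominus>\<^bsub>T\<^esub> (py j \<otimes>\<^bsub>T\<^esub> py i) = \<zero>\<^bsub>T\<^esub>"
  using relations[of "free_commutator m F (Mom i) (Mom j)"] h_commutator[of "Mom i" "Mom j"] gens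
  by (auto simp: weyl_relations_def)

lemma py_px:
  assumes "i < m" "j < m"
  shows "py i \<otimes>\<^bsub>T\<^esub> px j \<oplus>\<^bsub>T\<^esub> \<ominus>\<^bsub>T\<^esub> (px j \<otimes>\<^bsub>T\<^esub> py i) = (if i = j then \<one>\<^bsub>T\<^esub> else \<zero>\<^bsub>T\<^esub>)"
proof -
  let ?A = "weyl_free m F" and ?e = "if i = j then \<one>\<^bsub>weyl_free m F\<^esub> else \<zero>\<^bsub>weyl_free m F\<^esub>"
  have "free_commutator m F (Mom i) (Pos j) \<ominus>\<^bsub>?A\<^esub> ?e \<in> weyl_relations m F"
    using assms unfolding weyl_relations_def by blast
  then have "h (free_commutator m F (Mom i) (Pos j) \<ominus>\<^bsub>?A\<^esub> ?e) = \<zero>\<^bsub>T\<^esub>" by (rule relations)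
  moreover have "h (free_commutator m F (Mom i) (Pos j) \<ominus>\<^bsub>?A\<^esub> ?e) =
      h (free_commutator m F (Mom i) (Pos j)) \<oplus>\<^bsub>T\<^esub> \<ominus>\<^bsub>T\<^esub> h ?e"
    using assms gens by (intro h_minus commutator_closed) auto
  moreover have "h ?e = (if i = j then \<one>\<^bsub>T\<^esub> else \<zero>\<^bsub>T\<^esub>)" by simp
  moreover have "h (free_commutator m F (Mom i) (Pos j)) \<in> carrier T"
    using assms gens by (intro h.hom_closed commutator_closed)
  ultimately have "h (free_commutator m F (Mom i) (Pos j)) = (if i = j then \<one>\<^bsub>T\<^esub> else \<zero>\<^bsub>T\<^esub>)"
    by (metis T.add.inv_closed T.add.inv_inv T.minus_equality T.one_closed T.zero_closed)
  then show ?thesis using h_commutator[of "Mom i" "Pos j"] gens assms by simp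
qed

lemma weyl_pair: "0 < m \<Longrightarrow> weyl_pair T F sc (px 0) (py 0)"
proof (unfold_locales)
  assume m: "0 < m"
  have c: "px 0 \<in> carrier T" "py 0 \<in> carrier T" using m by auto
  then show "py 0 \<otimes>\<^bsub>T\<^esub> px 0 = px 0 \<otimes>\<^bsub>T\<^esub> py 0 \<oplus>\<^bsub>T\<^esub> \<one>\<^bsub>T\<^esub>"
  proof -
    let ?a = "py 0 \<otimes>\<^bsub>T\<^esub> px 0" and ?b = "px 0 \<otimes>\<^bsub>T\<^esub> py 0"
    have ab: "?a \<in> carrier T" "?b \<in> carrier T" using c by auto
    then have "?a = (?a \<oplus>\<^bsub>T\<^esub> \<ominus>\<^bsub>T\<^esub> ?b) \<oplus>\<^bsub>T\<^esub> ?b" by (simp add: T.a_assoc T.l_neg)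
    also have "\<dots> = ?b \<oplus>\<^bsub>T\<^esub> \<one>\<^bsub>T\<^esub>" using py_px[OF m m] ab by (simp add: T.a_comm)
    finally show ?thesis .
  qed
qed (use sc_hom sc_comm gens in auto)

end

lemma weyl_quotient:
  assumes "field F"
  shows "ideal (weyl_ideal m F) (weyl_free m F)"
    and "weyl_hom F (weyl_algebra m F) m (\<lambda>f. weyl_ideal m F +>\<^bsub>weyl_free m F\<^esub> f)"
    and "carrier (weyl_algebra m F) = (\<lambda>f. weyl_ideal m F +>\<^bsub>weyl_free m F\<^esub> f) ` carrier (weyl_free m F)"
proof -
  interpret F: field F by (rule assms)
  let ?A = "weyl_free m F" and ?I = "weyl_ideal m F"
  interpret A: ring ?A unfolding weyl_free_def by (rule F.free_algebra_ring)
  have gen: "free_gen F s \<in> carrier ?A" if "s \<in> weyl_gens m" for s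
    using that unfolding weyl_free_def by (auto simp: F.free_gen_eq intro!: F.mono_in_carrier)
  have rel: "weyl_relations m F \<subseteq> carrier ?A"
    unfolding weyl_relations_def free_commutator_def using gen by (auto simp: weyl_gens_def)
  show I: "ideal ?I ?A" unfolding weyl_ideal_def by (rule A.genideal_ideal[OF rel])
  interpret I: ideal ?I ?A by (rule I)
  show "weyl_hom F (weyl_algebra m F) m (\<lambda>f. ?I +>\<^bsub>?A\<^esub> f)"
  proof (intro weyl_hom.intro weyl_hom_axioms.intro assms)
    show "ring (weyl_algebra m F)" unfolding weyl_algebra_def by (rule I.quotient_is_ring)
    show "(\<lambda>f. ?I +>\<^bsub>?A\<^esub> f) \<in> ring_hom ?A (weyl_algebra m F)"
      unfolding weyl_algebra_def by (rule I.rcos_ring_hom)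
    fix r assume "r \<in> weyl_relations m F"
    then have "r \<in> ?I" unfolding weyl_ideal_def using A.genideal_self[OF rel] by auto
    then show "?I +>\<^bsub>?A\<^esub> r = \<zero>\<^bsub>weyl_algebra m F\<^esub>"
      unfolding weyl_algebra_def FactRing_def by (simp add: I.a_rcos_const)
  qed
  show "carrier (weyl_algebra m F) = (\<lambda>f. ?I +>\<^bsub>?A\<^esub> f) ` carrier ?A"
    unfolding weyl_algebra_def FactRing_def A_RCOSETS_def' by auto
qed

lemma sum_pair: "(\<Sum>l<k. (x, y)) = (\<Sum>l<k. x, \<Sum>l<k. y)" for k :: nat
  by (induction k) (simp_all add: zero_prod_def)

text \<open>The quotient presentation is removed: for the exclusion results only a map from the free
  algebra that kills the relations, and fractions over its image, are kept.\<close>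

lemma weyl_skewfield_hom:
  assumes "weyl_skewfield m F Q \<eta>"
  obtains h where "skew Q" "weyl_hom F Q m h" "subring (h ` carrier (weyl_free m F)) Q"
    "skew.fracs_of Q (h ` carrier (weyl_free m F))"
proof -
  let ?A = "weyl_free m F" and ?I = "weyl_ideal m F" and ?W = "weyl_algebra m F"
  have F: "field F" and Q: "skew Q" and eta: "\<eta> \<in> ring_hom ?W Q"
    and frac: "\<forall>q\<in>carrier Q. \<exists>r\<in>carrier ?W. \<exists>s\<in>carrier ?W - {\<zero>\<^bsub>?W\<^esub>}. q = \<eta> r \<otimes>\<^bsub>Q\<^esub> inv\<^bsub>Q\<^esub> (\<eta> s)"
    and inj: "inj_on \<eta> (carrier ?W)"
    using assms unfolding weyl_skewfield_def skewfield_of_fractions_def skewfield_iff by auto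
  interpret Q: skew Q by (rule Q)
  interpret P: weyl_hom F ?W m "\<lambda>f. ?I +>\<^bsub>?A\<^esub> f" by (rule weyl_quotient(2)[OF F])
  define h where "h = (\<lambda>f. \<eta> (?I +>\<^bsub>?A\<^esub> f))"
  have e0: "\<eta> \<zero>\<^bsub>?W\<^esub> = \<zero>\<^bsub>Q\<^esub>" using ring_hom_zero[OF eta P.T.ring_axioms Q.ring_axioms] .
  have hom: "h \<in> ring_hom ?A Q"
    using ring_hom_trans[OF P.hom eta] by (simp add: h_def comp_def)
  have wh: "weyl_hom F Q m h"
    by (intro weyl_hom.intro weyl_hom_axioms.intro F Q.ring_axioms hom) (simp add: h_def P.relations e0)
  interpret h: ring_hom_ring ?A Q h
    by (intro ring_hom_ring.intro ring_hom_ring_axioms.intro P.free_ring Q.ring_axioms hom)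
  have im: "h ` carrier ?A = \<eta> ` carrier ?W"
    unfolding weyl_quotient(3)[OF F] h_def by auto
  have sub: "subring (h ` carrier ?A) Q"
    by (rule h.img_is_subring[OF h.R.carrier_is_subring])
  have "Q.fracs_of (h ` carrier ?A)"
    unfolding Q.fracs_of_def im
  proof
    fix q assume "q \<in> carrier Q"
    then obtain r s where rs: "r \<in> carrier ?W" "s \<in> carrier ?W" "s \<noteq> \<zero>\<^bsub>?W\<^esub>" "q = \<eta> r \<otimes>\<^bsub>Q\<^esub> inv\<^bsub>Q\<^esub> (\<eta> s)"
      using frac by blast
    then have "\<eta> s \<noteq> \<zero>\<^bsub>Q\<^esub>" using inj e0 by (metis P.T.zero_closed inj_on_def)
    then show "\<exists>r\<in>\<eta> ` carrier ?W. \<exists>s\<in>\<eta> ` carrier ?W - {\<zero>\<^bsub>Q\<^esub>}. q = r \<otimes>\<^bsub>Q\<^esub> inv\<^bsub>Q\<^esub> s"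
      using rs by blast
  qed
  then show ?thesis using that Q wh sub by blast
qed

lemma weyl_skewfield_iso:
  assumes W: "weyl_skewfield m F D \<eta>" and \<phi>: "\<phi> \<in> ring_iso Q D" and Q: "skew Q"
  shows "weyl_skewfield m F Q (inv_into (carrier Q) \<phi> \<circ> \<eta>)"
proof -
  let ?W = "weyl_algebra m F"
  have F: "field F" and D: "skew D" and eta: "\<eta> \<in> ring_hom ?W D"
    and frac: "\<forall>q\<in>carrier D. \<exists>r\<in>carrier ?W. \<exists>s\<in>carrier ?W - {\<zero>\<^bsub>?W\<^esub>}. q = \<eta> r \<otimes>\<^bsub>D\<^esub> inv\<^bsub>D\<^esub> (\<eta> s)"
    and inj: "inj_on \<eta> (carrier ?W)"
    using W unfolding weyl_skewfield_def skewfield_of_fractions_def skewfield_iff by auto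
  interpret Q: skew Q by (rule Q)
  interpret D: skew D by (rule D)
  interpret P: weyl_hom F ?W m "\<lambda>f. weyl_ideal m F +>\<^bsub>weyl_free m F\<^esub> f" by (rule weyl_quotient(2)[OF F])
  define \<psi> where "\<psi> = inv_into (carrier Q) \<phi>"
  have psi: "\<psi> \<in> ring_iso D Q" unfolding \<psi>_def by (rule ring_iso_set_sym[OF Q.ring_axioms \<phi>])
  then have hom: "\<psi> \<in> ring_hom D Q" and bij: "bij_betw \<psi> (carrier D) (carrier Q)"
    by (auto simp: ring_iso_def)
  note hE = ring_hom_closed[OF hom] ring_hom_mult[OF hom] ring_hom_one[OF hom]
  have h0: "\<psi> \<zero>\<^bsub>D\<^esub> = \<zero>\<^bsub>Q\<^esub>" using ring_hom_zero[OF hom D.ring_axioms Q.ring_axioms] .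
  have e0: "\<eta> \<zero>\<^bsub>?W\<^esub> = \<zero>\<^bsub>D\<^esub>" using ring_hom_zero[OF eta P.T.ring_axioms D.ring_axioms] .
  have injp: "inj_on \<psi> (carrier D)" using bij by (rule bij_betw_imp_inj_on)
  have ec: "\<eta> ` carrier ?W \<subseteq> carrier D" using ring_hom_closed[OF eta] by auto
  have inv: "\<psi> (inv\<^bsub>D\<^esub> s) = inv\<^bsub>Q\<^esub> (\<psi> s)" if s: "s \<in> carrier D" "s \<noteq> \<zero>\<^bsub>D\<^esub>" for s
  proof (rule Q.m_cancel_left[of "\<psi> s"])
    show nz: "\<psi> s \<noteq> \<zero>\<^bsub>Q\<^esub>" using inj_onD[OF injp, of s "\<zero>\<^bsub>D\<^esub>"] s h0 by auto
    have "\<psi> s \<otimes>\<^bsub>Q\<^esub> \<psi> (inv\<^bsub>D\<^esub> s) = \<psi> (s \<otimes>\<^bsub>D\<^esub> inv\<^bsub>D\<^esub> s)"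
      using hE(2)[of s "inv\<^bsub>D\<^esub> s"] s by simp
    then show "\<psi> s \<otimes>\<^bsub>Q\<^esub> \<psi> (inv\<^bsub>D\<^esub> s) = \<psi> s \<otimes>\<^bsub>Q\<^esub> inv\<^bsub>Q\<^esub> \<psi> s"
      using s nz hE(1)[of s] hE(3) by simp
    show "\<psi> s \<in> carrier Q" "\<psi> (inv\<^bsub>D\<^esub> s) \<in> carrier Q" using s hE(1) by auto
    then show "inv\<^bsub>Q\<^esub> \<psi> s \<in> carrier Q" using nz by simp
  qed
  have "\<exists>r\<in>carrier ?W. \<exists>s\<in>carrier ?W - {\<zero>\<^bsub>?W\<^esub>}. q = (\<psi> \<circ> \<eta>) r \<otimes>\<^bsub>Q\<^esub> inv\<^bsub>Q\<^esub> ((\<psi> \<circ> \<eta>) s)"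
    if q: "q \<in> carrier Q" for q
  proof -
    obtain d where d: "d \<in> carrier D" "q = \<psi> d" using bij q by (auto simp: bij_betw_def)
    obtain r s where rs: "r \<in> carrier ?W" "s \<in> carrier ?W - {\<zero>\<^bsub>?W\<^esub>}" "d = \<eta> r \<otimes>\<^bsub>D\<^esub> inv\<^bsub>D\<^esub> (\<eta> s)"
      using frac d(1) by blast
    have c: "\<eta> r \<in> carrier D" "\<eta> s \<in> carrier D" using rs(1,2) ec by blast+
    have "\<eta> s \<noteq> \<zero>\<^bsub>D\<^esub>" using inj_onD[OF inj, of s "\<zero>\<^bsub>?W\<^esub>"] rs(2) e0 P.T.zero_closed by auto
    note c = c this
    have "q = \<psi> (\<eta> r) \<otimes>\<^bsub>Q\<^esub> inv\<^bsub>Q\<^esub> (\<psi> (\<eta> s))"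
      unfolding d(2) rs(3) using c by (simp add: hE inv)
    then show ?thesis using rs(1,2) by auto
  qed
  moreover have "\<psi> \<circ> \<eta> \<in> ring_hom ?W Q" by (rule ring_hom_trans[OF eta hom])
  moreover have "inj_on (\<psi> \<circ> \<eta>) (carrier ?W)"
    by (rule comp_inj_on[OF inj inj_on_subset[OF injp ec]])
  ultimately show ?thesis
    unfolding weyl_skewfield_def skewfield_of_fractions_def skewfield_iff \<psi>_def[symmetric]
    using F Q by blast
qed

context weyl_hom
begin

lemma free_image_subset:
  assumes "subring B T" "\<And>c. c \<in> carrier F \<Longrightarrow> sc c \<in> B" "\<And>i. i < m \<Longrightarrow> px i \<in> B" "\<And>i. i < m \<Longrightarrow> py i \<in> B"
  shows "h ` carrier (weyl_free m F) \<subseteq> B"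
  using F.free_hom_image_subset[OF hom' T.ring_axioms assms(1,2)] assms(3,4)
  by (auto simp: weyl_free_def weyl_gens_def)

end

section \<open>Obstructions to being a Weyl skewfield, for m = 0, m = 1 and m >= 2\<close>

context skew
begin

text \<open>Scalars commute with each other and with the generators, hence with the image of the
  free algebra and with all fractions of it.\<close>

lemma sc_central:
  assumes "weyl_hom F R m h" "fracs_of (h ` carrier (weyl_free m F))" "c \<in> carrier F"
  shows "h (free_scalar F c) \<in> ring_center R"
proof -
  interpret h: weyl_hom F R m h by (rule assms)
  let ?z = "h (free_scalar F c)"
  have z: "?z \<in> carrier R" using assms(3) by simp
  have comm_sc: "?z \<otimes> h (free_scalar F d) = h (free_scalar F d) \<otimes> ?z" if "d \<in> carrier F" for d
    using that assms(3) h.F.m_comm ring_hom_mult[OF h.sc_hom] by metis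
  have "h ` carrier (weyl_free m F) \<subseteq> {x \<in> carrier R. ?z \<otimes> x = x \<otimes> ?z}"
    by (rule h.free_image_subset[OF centralizer_subring[OF z]])
      (use comm_sc h.sc_comm[OF assms(3)] h.gens in auto)
  then show ?thesis using z by (intro center_of_fracs[OF assms(2)]) auto
qed

lemma weyl0_commutative:
  assumes "weyl_hom F R 0 h" "fracs_of (h ` carrier (weyl_free 0 F))" "x \<in> carrier R" "y \<in> carrier R"
  shows "x \<otimes> y = y \<otimes> x"
proof -
  interpret h: weyl_hom F R 0 h by (rule assms)
  have ZR: "ring_center R \<subseteq> carrier R" by (auto simp: ring_center_def)
  have "h ` carrier (weyl_free 0 F) \<subseteq> ring_center R"
    by (rule h.free_image_subset[OF center_subring]) (use sc_central[OF assms(1,2)] in auto)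
  moreover have "r \<otimes> inv s \<in> ring_center R" if "r \<in> ring_center R" "s \<in> ring_center R - {\<zero>}" for r s
  proof -
    have "inv s \<in> ring_center R" using subfield_m_inv(1)[OF center_subfield that(2)] by auto
    then show ?thesis using that subringE(6)[OF center_subring] by auto
  qed
  ultimately have "x \<in> ring_center R" using fracs_ofE[OF assms(2,3)] by (metis Diff_iff subsetD)
  then show ?thesis using assms(4) by (simp add: ring_center_def)
qed

lemma Span_finsum:
  assumes "subfield K R" "set Us \<subseteq> carrier R" "\<And>p. p \<in> P \<Longrightarrow> f p \<in> Span K Us"
  shows "finsum R f P \<in> Span K Us"
  using assms(3)
proof (induction P rule: infinite_finite_induct)
  case (insert p P)
  have "Span K Us \<subseteq> carrier R" by (rule Span_subgroup_props(1)[OF assms(1,2)])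
  then have "f \<in> P \<rightarrow> carrier R" "f p \<in> carrier R" using insert by auto
  then show ?case using insert Span_subgroup_props(3)[OF assms(1,2)] by simp
qed (use Span_subgroup_props(2)[OF assms(1,2)] in simp_all)

text \<open>Words of length at most N span, over the scalars, a space generated by the (N + 1)^2
  normal monomials. Growth of order two excludes three elements with independent values.\<close>

lemma weyl1_growth:
  fixes V :: "'a \<Rightarrow> 'g::linordered_ab_group_add"
  assumes wh: "weyl_hom F R 1 h" and fr: "fracs_of (h ` carrier (weyl_free 1 F))"
    and V: "valn (carrier R) V" "\<And>k. k \<in> ring_center R \<Longrightarrow> k \<noteq> \<zero> \<Longrightarrow> V k = 0"
    and u: "\<And>i. i < 3 \<Longrightarrow> u i \<in> carrier R" "\<And>i. i < 3 \<Longrightarrow> u i \<noteq> \<zero>"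
    and inj: "\<And>\<alpha> \<beta> :: nat \<Rightarrow> nat. (\<Sum>i<3. \<Sum>l<\<alpha> i. V (u i)) = (\<Sum>i<3. \<Sum>l<\<beta> i. V (u i)) \<Longrightarrow> \<forall>i<3. \<alpha> i = \<beta> i"
  shows False
proof -
  note One_nat_def [simp del]
  interpret h: weyl_hom F R 1 h by (rule wh)
  interpret P: weyl_pair R F h.sc "h.px 0" "h.py 0" by (rule h.weyl_pair) simp
  let ?A = "weyl_free 1 F"
  interpret A: ring ?A by (rule h.free_ring)
  interpret hh: ring_hom_ring ?A R h
    by (intro ring_hom_ring.intro ring_hom_ring_axioms.intro A.ring_axioms ring_axioms h.hom)
  interpret sc: ring_hom_ring F R h.sc
    by (intro ring_hom_ring.intro ring_hom_ring_axioms.intro h.F.ring_axioms ring_axioms h.sc_hom)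
  \<comment> \<open>The scalars come from \<open>F\<close> and form a subfield inside the centre,
    where \<open>V\<close> is trivial.\<close>
  define K where "K = h.sc ` carrier F"
  have K: "subfield K R"
    unfolding K_def by (rule sc.img_is_subfield(2)[OF h.F.carrier_is_subfield]) simp
  have KZ: "K \<subseteq> ring_center R" unfolding K_def using sc_central[OF wh fr] by auto
  have gens: "weyl_gens 1 = {Pos 0, Mom 0}" by (auto simp: weyl_gens_def)
  have Aeq: "?A = free_algebra F {Pos 0, Mom 0}" by (simp only: weyl_free_def gens)
  have car: "f w \<in> carrier F" if "f \<in> carrier ?A" for f w
    using that by (simp add: Aeq h.F.free_algebra_carrier)
  define D where "D N = {f \<in> carrier ?A. {w. f w \<noteq> \<zero>\<^bsub>F\<^esub>} \<subseteq> {w. length w \<le> N}}" for N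
  define L where "L N = map P.nm (List.product [0..<Suc N] [0..<Suc N])" for N
  have Lset: "set (L N) \<subseteq> carrier R" for N by (auto simp: L_def)
  have mult: "f \<otimes>\<^bsub>?A\<^esub> g \<in> D (i + j)" if fg: "f \<in> D i" "g \<in> D j" for f g i j
  proof -
    have c: "f \<in> carrier ?A" "g \<in> carrier ?A" using fg by (auto simp: D_def)
    have "{w. h.F.conv f g w \<noteq> \<zero>\<^bsub>F\<^esub>} \<subseteq> (\<lambda>(u, v). u @ v) ` ({w. f w \<noteq> \<zero>\<^bsub>F\<^esub>} \<times> {w. g w \<noteq> \<zero>\<^bsub>F\<^esub>})"
      by (rule h.F.conv_supp) (use car c in auto)
    also have "\<dots> \<subseteq> {w. length w \<le> i + j}" using fg by (fastforce simp: D_def)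
    finally show ?thesis
      using A.m_closed[OF c] by (simp add: D_def Aeq h.F.free_algebra_simps)
  qed
  show False
  proof (rule growth_contradiction[where K = K and V = V and S = "h ` carrier ?A" and W = "\<lambda>N. h ` D N"
        and L = L and c = 1 and p = 2 and u = u])
    show "subring (h ` carrier ?A) R" by (rule hh.img_is_subring[OF A.carrier_is_subring])
    have "\<exists>N. f \<in> D N" if f: "f \<in> carrier ?A" for f
    proof -
      have "finite (length ` {w. f w \<noteq> \<zero>\<^bsub>F\<^esub>})" using f by (simp add: Aeq h.F.free_algebra_carrier)
      then obtain N where "\<forall>k\<in>length ` {w. f w \<noteq> \<zero>\<^bsub>F\<^esub>}. k \<le> N" by (meson finite_nat_set_iff_bounded_le)
      then show ?thesis using f by (auto simp: D_def)
    qed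
    then have "carrier ?A = (\<Union>N. D N)" by (auto simp: D_def)
    then show "h ` carrier ?A = (\<Union>N. h ` D N)" by (simp only: image_UN)
    show "x \<otimes> y \<in> h ` D (i + j)" if xy: "x \<in> h ` D i" "y \<in> h ` D j" for x y i j
    proof -
      obtain f g where fg: "f \<in> D i" "g \<in> D j" "x = h f" "y = h g" using xy by blast
      then have "x \<otimes> y = h (f \<otimes>\<^bsub>?A\<^esub> g)" by (simp add: D_def)
      then show ?thesis using mult[OF fg(1,2)] by blast
    qed
    have "\<one>\<^bsub>?A\<^esub> \<in> D 0"
      using A.one_closed by (auto simp: D_def Aeq h.F.free_algebra_simps h.F.mono_def)
    then show "\<one> \<in> h ` D 0" using hh.hom_one by force
    show "h ` D i \<subseteq> h ` D j" if "i \<le> j" for i j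
      using that by (intro image_mono) (auto simp: D_def)
    show "h ` D N \<subseteq> Span K (L N)" for N
    proof
      fix z assume "z \<in> h ` D N"
      then obtain f where f: "f \<in> carrier ?A" "{w. f w \<noteq> \<zero>\<^bsub>F\<^esub>} \<subseteq> {w. length w \<le> N}" "z = h f"
        by (auto simp: D_def)
      have "z \<in> P.NF N"
        unfolding f(3) by (rule h.F.free_hom_word_NF[OF P.weyl_pair_axioms]) (use f h.hom' in \<open>simp_all add: Aeq gens\<close>)
      then obtain c where c: "\<And>p. c p \<in> carrier F" "z = (\<Oplus>p\<in>{..N} \<times> {..N}. h.sc (c p) \<otimes> P.nm p)"
        using P.NF_E by blast
      show "z \<in> Span K (L N)"
        unfolding c(2)
      proof (rule Span_finsum[OF K Lset])
        fix p :: "nat \<times> nat" assume "p \<in> {..N} \<times> {..N}"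
        moreover have "set (L N) = P.nm ` ({..N} \<times> {..N})"
          by (simp add: L_def atLeastLessThanSuc_atLeastAtMost atLeast0AtMost del: upt_Suc)
        ultimately have "P.nm p \<in> set (L N)" by blast
        then have "P.nm p \<in> Span K (L N)" using Span_base_incl[OF K Lset] by blast
        then show "h.sc (c p) \<otimes> P.nm p \<in> Span K (L N)"
          using Span_smult_closed[OF K Lset] c(1) by (auto simp: K_def simp del: Span.simps)
      qed
    qed
    show "length (L N) \<le> (1 * N + 1) ^ 2" for N by (simp add: L_def power2_eq_square algebra_simps)
  qed (use K V KZ fr Lset u inj in \<open>auto simp: numeral_3_eq_3[symmetric] numeral_2_eq_2\<close>)
qed

text \<open>The inner derivations of two canonical pairs commute, since the commutators of the pairs
  lie in {0, 1, -1}. They are locally nilpotent on the Weyl algebra, so they define a valuation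
  under which the four generators have the first four unit vectors as values.\<close>

lemma weyl2_valuation:
  assumes wh: "weyl_hom F R m h" and fr: "fracs_of (h ` carrier (weyl_free m F))" and m: "2 \<le> m"
    and char: "\<And>n. (n::nat) > 0 \<Longrightarrow> [n] \<cdot> \<one> \<noteq> \<zero>"
  obtains V :: "'a \<Rightarrow> int \<times> int \<times> int \<times> int \<times> int" and g where "valn (carrier R) V"
    "\<And>c. c \<in> ring_center R \<Longrightarrow> c \<noteq> \<zero> \<Longrightarrow> V c = 0"
    "\<And>i. i < 4 \<Longrightarrow> g i \<in> carrier R" "\<And>i. i < 4 \<Longrightarrow> g i \<noteq> \<zero>"
    "\<And>\<alpha> \<beta> :: nat \<Rightarrow> nat. (\<Sum>i<4. \<Sum>l<\<alpha> i. V (g i)) = (\<Sum>i<4. \<Sum>l<\<beta> i. V (g i)) \<Longrightarrow> \<forall>i<4. \<alpha> i = \<beta> i"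
proof -
  interpret h: weyl_hom F R m h by (rule wh)
  let ?C = "{\<zero>, \<one>, \<ominus> \<one>}"
  have CZ: "?C \<subseteq> ring_center R"
    using subringE(2,3,5)[OF center_subring] by auto
  have m01: "0 < m" "1 < m" using m by auto
  have minus_ad: "ad (\<ominus> a) b = \<ominus> ad a b" "ad a (\<ominus> b) = \<ominus> ad a b"
    if "a \<in> carrier R" "b \<in> carrier R" for a b
    using that by (simp_all add: ad_def l_minus r_minus minus_add)
  have ad_swap: "ad a b = \<ominus> ad b a" if "a \<in> carrier R" "b \<in> carrier R" for a b
    using that by (simp add: ad_def minus_add a_comm)
  have xx: "ad (h.px i) (h.px j) = \<zero>" and yy: "ad (h.py i) (h.py j) = \<zero>"
    and yx: "ad (h.py i) (h.px j) = (if i = j then \<one> else \<zero>)"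
    if "i < m" "j < m" for i j
    unfolding ad_def using h.px_px[OF that] h.py_py[OF that] h.py_px[OF that] by auto
  have xy: "ad (h.px i) (h.py j) = (if i = j then \<ominus> \<one> else \<zero>)" if "i < m" "j < m" for i j
    using ad_swap[of "h.px i" "h.py j"] yx[OF that(2,1)] that by auto
  \<comment> \<open>The element \<open>u i\<close> is dual to \<open>g i\<close>: the signs are
    chosen so that \<open>ad (u i) (g i) = \<one>\<close>.\<close>
  define u :: "nat \<Rightarrow> 'a" where "u i = [h.py 0, \<ominus> h.px 0, h.py 1, \<ominus> h.px 1] ! i" for i
  define g :: "nat \<Rightarrow> 'a" where "g i = [h.px 0, h.py 0, h.px 1, h.py 1] ! i" for i
  have cases4: "i = 0 \<or> i = 1 \<or> i = 2 \<or> i = 3" if "i < 4" for i :: nat using that by auto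
  have u_simps: "u 0 = h.py 0" "u 1 = \<ominus> h.px 0" "u 2 = h.py 1" "u 3 = \<ominus> h.px 1"
    and g_simps: "g 0 = h.px 0" "g 1 = h.py 0" "g 2 = h.px 1" "g 3 = h.py 1"
    by (simp_all add: u_def g_def numeral_2_eq_2 numeral_3_eq_3)
  have u_closed: "u i \<in> carrier R" if "i < 4" for i
    using cases4[OF that] m01 by (auto simp: u_simps simp del: One_nat_def)
  have g_closed: "g i \<in> carrier R" if "i < 4" for i
    using cases4[OF that] m01 by (auto simp: g_simps simp del: One_nat_def)
  have ad_gen: "ad (u i) (h.px j) \<in> ?C" "ad (u i) (h.py j) \<in> ?C" if "i < 4" "j < m" for i j
    using cases4[OF that(1)] m01 that(2)
    by (auto simp: u_simps minus_ad xx yy xy yx simp del: One_nat_def split: if_splits)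
  have comm: "ad (u i) (u j) \<in> ring_center R" if ij: "i < 4" "j < 4" for i j
  proof -
    have "ad (u i) (u j) \<in> ?C"
      using cases4[OF ij(2)] ad_gen[OF ij(1) m01(1)] ad_gen[OF ij(1) m01(2)] u_closed[OF ij(1)] m01
      by (elim disjE) (auto simp: u_simps(1-4)[of] minus_ad simp del: One_nat_def)
    then show ?thesis using CZ by blast
  qed
  let ?S = "{x \<in> carrier R. \<forall>i\<in>{..<4}. \<exists>k. (ad (u i) ^^ k) x = \<zero>}"
  obtain v :: "'a \<Rightarrow> int \<times> int \<times> int \<times> int \<times> int"
    where v: "valn ?S v"
      and vc: "\<And>c. c \<in> ring_center R \<Longrightarrow> c \<noteq> \<zero> \<Longrightarrow> v c = 0"
      and v0: "\<And>g. g \<in> ?S \<Longrightarrow> ad (u 0) g = \<one> \<Longrightarrow> v g = (1, 0)"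
      and v1: "\<And>g. g \<in> ?S \<Longrightarrow> ad (u 0) g = \<zero> \<Longrightarrow> ad (u 1) g = \<one> \<Longrightarrow> v g = (0, 1, 0)"
      and v2: "\<And>g. g \<in> ?S \<Longrightarrow> ad (u 0) g = \<zero> \<Longrightarrow> ad (u 1) g = \<zero> \<Longrightarrow> ad (u 2) g = \<one> \<Longrightarrow> v g = (0, 0, 1, 0)"
      and v3: "\<And>g. g \<in> ?S \<Longrightarrow> ad (u 0) g = \<zero> \<Longrightarrow> ad (u 1) g = \<zero> \<Longrightarrow> ad (u 2) g = \<zero> \<Longrightarrow> ad (u 3) g = \<one> \<Longrightarrow>
        v g = (0, 0, 0, 1, 0)"
    using ad_valuation[of u, OF u_closed comm char] by blast
  have S: "subring ?S R" by (rule ad_nil_subring) (use u_closed in auto)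
  have ad_central: "ad (u i) c = \<zero>" if "i < 4" "c \<in> ring_center R" for i c
    using that u_closed[OF that(1)] ad_eq_zero_iff[of "u i" c] by (auto simp: ring_center_def)
  have cS: "c \<in> ?S" if "c \<in> ring_center R" for c
  proof -
    have "(ad (u i) ^^ 1) c = \<zero>" if "i < 4" for i using ad_central[OF that \<open>c \<in> ring_center R\<close>] by simp
    then show ?thesis using that by (auto simp: ring_center_def intro!: exI[of _ 1])
  qed
  \<comment> \<open>One application of \<open>ad (u i)\<close> lands in the centre, so a second one
    gives zero.\<close>
  have gS: "x \<in> ?S" if x: "x \<in> carrier R" "\<And>i. i < 4 \<Longrightarrow> ad (u i) x \<in> ?C" for x
  proof -
    have "(ad (u i) ^^ 2) x = \<zero>" if "i < 4" for i
      using ad_central[OF that, of "ad (u i) x"] x(2)[OF that] CZ by (auto simp: numeral_2_eq_2)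
    then show ?thesis using x(1) by blast
  qed
  have "h ` carrier (weyl_free m F) \<subseteq> ?S"
  proof (rule h.free_image_subset[OF S])
    show "h.sc c \<in> ?S" if "c \<in> carrier F" for c using cS[OF sc_central[OF wh fr that]] .
    show "h.px i \<in> ?S" "h.py i \<in> ?S" if "i < m" for i
      using gS[of "h.px i"] gS[of "h.py i"] ad_gen that by auto
  qed
  \<comment> \<open>\<open>S\<close> contains the image of the Weyl algebra, so every element is a
    fraction over \<open>S\<close> and the valuation extends.\<close>
  then have "fracs_of ?S" using fr unfolding fracs_of_def by (meson Diff_iff subsetD)
  then obtain V where V: "valn (carrier R) V" "\<And>s. s \<in> ?S \<Longrightarrow> s \<noteq> \<zero> \<Longrightarrow> V s = v s"
    using valn_extend[OF S _ v] by blast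
  have gnil: "g i \<in> ?S" if "i < 4" for i
    using cases4[OF that] gS[of "g i"] g_closed[OF that] ad_gen m01
    by (auto simp: g_simps simp del: One_nat_def)
  have ad_ug: "ad (u 0) (g 0) = \<one>" "ad (u 0) (g 1) = \<zero>" "ad (u 1) (g 1) = \<one>" "ad (u 0) (g 2) = \<zero>"
    "ad (u 1) (g 2) = \<zero>" "ad (u 2) (g 2) = \<one>" "ad (u 0) (g 3) = \<zero>" "ad (u 1) (g 3) = \<zero>"
    "ad (u 2) (g 3) = \<zero>" "ad (u 3) (g 3) = \<one>"
    using m01 by (auto simp: u_simps g_simps minus_ad xx yy xy yx simp del: One_nat_def)
  have vg: "v (g 0) = (1, 0)" "v (g 1) = (0, 1, 0)" "v (g 2) = (0, 0, 1, 0)" "v (g 3) = (0, 0, 0, 1, 0)"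
    using v0[OF gnil, of 0] v1[OF gnil, of 1] v2[OF gnil, of 2] v3[OF gnil, of 3] ad_ug by simp_all
  have gnz: "g i \<noteq> \<zero>" if "i < 4" for i
  proof
    assume z: "g i = \<zero>"
    have "ad (u i) (g i) = \<one>" using cases4[OF that] ad_ug by auto
    then show False using z u_closed[OF that] by (simp add: ad_def)
  qed
  have Vg: "V (g 0) = (1, 0, 0, 0, 0)" "V (g 1) = (0, 1, 0, 0, 0)" "V (g 2) = (0, 0, 1, 0, 0)" "V (g 3) = (0, 0, 0, 1, 0)"
    using V(2)[OF gnil gnz] vg by (simp_all add: zero_prod_def)
  have sum4: "(\<Sum>i<4. \<Sum>l<\<alpha> i. V (g i)) = (int (\<alpha> 0), int (\<alpha> 1), int (\<alpha> 2), int (\<alpha> 3), 0)" for \<alpha> :: "nat \<Rightarrow> nat"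
  proof -
    have "{..<4::nat} = {0, 1, 2, 3}" by auto
    then show ?thesis by (simp add: Vg[simplified] sum_pair)
  qed
  show ?thesis
  proof (rule that[of V g])
    fix \<alpha> \<beta> :: "nat \<Rightarrow> nat"
    assume "(\<Sum>i<4. \<Sum>l<\<alpha> i. V (g i)) = (\<Sum>i<4. \<Sum>l<\<beta> i. V (g i))"
    then show "\<forall>i<4. \<alpha> i = \<beta> i" unfolding sum4 using cases4 by auto
  qed (use V vc cS g_closed gnz in auto)
qed

end

section \<open>The skewfield of fractions of \<open>R(n,a)\<close>\<close>

declare single_of_nat [simp del]

text \<open>\<open>Delta\<close> lowers the weight by one and keeps the degree, so it shifts the
  eigenvalue of \<open>Gamma\<close> by one. In particular \<open>Gamma\<close> preserves the kernel
  of \<open>Delta\<close>.\<close>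

lemma Delta_Gamma: "Delta n (Gamma n a f) = Gamma n a (Delta n f) + Delta n f"
proof (rule poly_mapping_eqI)
  fix m
  have g: "gam n a (m - unit_exp (i - 1) + unit_exp i) = gam n a m + 1" if "i \<in> {1..n}" for i
    using that by (auto simp: gam_eq deg_exp_add deg_exp_diff wt_exp_add wt_exp_diff of_nat_diff)
  have "lookup (Delta n (Gamma n a f)) m =
      (\<Sum>i=1..n. (gam n a m + 1) * (of_int (lookup m i + 1) * lookup f (m - unit_exp (i - 1) + unit_exp i)))"
    unfolding lookup_Delta lookup_Gamma
  proof (intro sum.cong refl)
    fix i assume "i \<in> {1..n}"
    from g[OF this] show "of_int (lookup m i + 1) * (gam n a (m - unit_exp (i - 1) + unit_exp i) * lookup f (m - unit_exp (i - 1) + unit_exp i)) =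
      (gam n a m + 1) * (of_int (lookup m i + 1) * lookup f (m - unit_exp (i - 1) + unit_exp i))"
      by (simp only: mult_ac)
  qed
  also have "\<dots> = (gam n a m + 1) * lookup (Delta n f) m"
    by (simp add: lookup_Delta sum_distrib_left)
  finally show "lookup (Delta n (Gamma n a f)) m = lookup (Gamma n a (Delta n f) + Delta n f) m"
    by (simp add: lookup_add distrib_right)
qed

lemma keys_X0_mult:
  "keys (X0_powi e * f) = (\<lambda>m. m + single 0 e) ` keys (f :: 'k::comm_ring_1 laurent)"
proof -
  have "lookup (X0_powi e * f) m = lookup f (m - single 0 e)" for m
    by (simp add: X0_powi_def lookup_single_mult)
  then have *: "m \<in> keys (X0_powi e * f) \<longleftrightarrow> m - single 0 e \<in> keys f" for m
    by (simp add: in_keys_iff)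
  show ?thesis
  proof (intro equalityI subsetI)
    fix m assume "m \<in> keys (X0_powi e * f)"
    then show "m \<in> (\<lambda>m. m + single 0 e) ` keys f"
      unfolding * by (intro image_eqI[of _ _ "m - single 0 e"]) simp_all
  next
    fix m assume "m \<in> (\<lambda>m. m + single 0 e) ` keys f"
    then show "m \<in> keys (X0_powi e * f)" unfolding * by force
  qed
qed

lemma loc_clear_denominator:
  fixes f :: "'k::comm_ring_1 laurent"
  assumes "keys f \<subseteq> loc_exps n"
  obtains N where "Var 0 ^ N * f \<in> poly_carrier n"
proof -
  define N where "N = nat (Max (insert 0 ((\<lambda>m. - lookup m 0) ` keys f)))"
  have "m + single 0 (int N) \<in> poly_exps n" if m: "m \<in> keys f" for m
  proof -
    have "- lookup m 0 \<le> Max (insert 0 ((\<lambda>m. - lookup m 0) ` keys f))"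
      by (intro Max_ge) (use m in auto)
    then have "0 \<le> lookup m 0 + int N" unfolding N_def by linarith
    moreover have "keys (m + single 0 (int N)) \<subseteq> {..n}"
    proof (rule keys_add_subset)
      show "keys m \<subseteq> {..n}" using subsetD[OF assms m] by (simp add: loc_exps_def)
    qed simp
    moreover have "0 \<le> lookup m i" if "i > 0" for i
      using subsetD[OF assms m] that by (simp add: loc_exps_def)
    ultimately show ?thesis by (auto simp: poly_exps_def lookup_add lookup_single when_def)
  qed
  then have "Var 0 ^ N * f \<in> poly_carrier n"
    unfolding poly_carrier_iff Var_0_power keys_X0_mult by auto
  then show ?thesis by (rule that)
qed

lemma Var_neq_0 [simp]: "Var i \<noteq> (0 :: 'k::zero_neq_one laurent)"
  by (metis Var_def lookup_single_eq lookup_zero zero_neq_one)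

locale frac_R = skew Q for Q :: "'q ring" (structure) +
  fixes n :: nat and a :: "'k::field_char_0" and \<iota> :: "'k laurent \<Rightarrow> 'q"
  assumes n2: "n \<ge> 2" and sf: "skewfield_of_fractions (R_alg n a) Q \<iota>"
begin

abbreviation A :: "'k laurent set" where "A \<equiv> poly_carrier n"
abbreviation "kap c \<equiv> \<iota> (Const c)"
abbreviation "loc \<equiv> loc_embed n Q \<iota>"

lemma iota_hom: "\<iota> \<in> ring_hom (R_alg n a) Q" and iota_inj_on: "inj_on \<iota> A"
  using sf by (auto simp: skewfield_of_fractions_def R_alg_def)

lemma iota_closed [simp]: "f \<in> A \<Longrightarrow> \<iota> f \<in> carrier Q"
  using ring_hom_closed[OF iota_hom] by (simp add: R_alg_def)

lemma iota_add: "f \<in> A \<Longrightarrow> g \<in> A \<Longrightarrow> \<iota> (f + g) = \<iota> f \<oplus> \<iota> g"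
  using ring_hom_add[OF iota_hom] by (simp add: R_alg_def)

lemma iota_star: "f \<in> A \<Longrightarrow> g \<in> A \<Longrightarrow> \<iota> (star n a f g) = \<iota> f \<otimes> \<iota> g"
  using ring_hom_mult[OF iota_hom] by (simp add: R_alg_def)

lemma iota_one [simp]: "\<iota> 1 = \<one>"
  using ring_hom_one[OF iota_hom] by (simp add: R_alg_def)

lemma iota_zero [simp]: "\<iota> 0 = \<zero>"
proof -
  have "\<iota> 0 \<oplus> \<iota> 0 = \<iota> 0 \<oplus> \<zero>" using iota_add[of 0 0] by simp
  then show ?thesis by (simp only: add.l_cancel iota_closed poly_carrier_0 zero_closed)
qed

lemma iota_eq_iff: "f \<in> A \<Longrightarrow> g \<in> A \<Longrightarrow> \<iota> f = \<iota> g \<longleftrightarrow> f = g"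
  using iota_inj_on by (auto simp: inj_on_def)

lemma iota_eq_0_iff: "f \<in> A \<Longrightarrow> \<iota> f = \<zero> \<longleftrightarrow> f = 0"
  using iota_eq_iff[of f 0] by simp

lemma iota_uminus: "f \<in> A \<Longrightarrow> \<iota> (- f) = \<ominus> \<iota> f"
  using iota_add[of "- f" f] poly_carrier_uminus[of f n] minus_equality[of "\<iota> (- f)" "\<iota> f"] by simp

lemma iota_diff: "f \<in> A \<Longrightarrow> g \<in> A \<Longrightarrow> \<iota> (f - g) = \<iota> f \<oplus> \<ominus> \<iota> g"
  using iota_add[of f "- g"] by (simp add: iota_uminus poly_carrier_uminus)

lemma poly_carrier_diff: "f \<in> A \<Longrightarrow> g \<in> A \<Longrightarrow> f - g \<in> A"
  using poly_carrier_add[of f n "- g"] poly_carrier_uminus[of g n] by simp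

lemma iota_mult: "f \<in> A \<Longrightarrow> g \<in> A \<Longrightarrow> Delta n f = 0 \<Longrightarrow> \<iota> (f * g) = \<iota> f \<otimes> \<iota> g"
  using iota_star[of f g] by (simp add: star_Delta_eq_0)

lemma image_subring: "subring (\<iota> ` A) Q"
proof (rule subringI)
  show "\<iota> ` A \<subseteq> carrier Q" by auto
  show "\<one> \<in> \<iota> ` A" by (rule image_eqI[of _ _ 1]) auto
next
  fix x assume "x \<in> \<iota> ` A"
  then show "\<ominus> x \<in> \<iota> ` A" using iota_uminus poly_carrier_uminus by force
next
  fix x y assume "x \<in> \<iota> ` A" "y \<in> \<iota> ` A"
  then obtain f g where "f \<in> A" "g \<in> A" "x = \<iota> f" "y = \<iota> g" by auto
  then show "x \<otimes> y \<in> \<iota> ` A" "x \<oplus> y \<in> \<iota> ` A"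
    using iota_star[of f g] iota_add[of f g] poly_carrier_star[of f n g a] poly_carrier_add[of f n g] by force+
qed

lemma image_fracs: "fracs_of (\<iota> ` A)"
proof -
  have "\<forall>q\<in>carrier Q. \<exists>r\<in>A. \<exists>s\<in>A - {0}. q = \<iota> r \<otimes> inv (\<iota> s)"
    using sf by (simp add: skewfield_of_fractions_def R_alg_def)
  then show ?thesis
    unfolding fracs_of_def using iota_eq_0_iff by fastforce
qed

text \<open>Constants have eigenvalue 0 and binomials of 0 vanish for k > 0. So a constant on the
  right multiplies commutatively, just as it does on the left.\<close>

lemma kap_central: "kap c \<in> ring_center Q"
proof (rule center_of_fracs[OF image_fracs])
  show "\<iota> ` A \<subseteq> carrier Q" "kap c \<in> carrier Q" by (auto simp: poly_carrier_Const)
  fix s assume "s \<in> \<iota> ` A"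
  then obtain f where f: "f \<in> A" "s = \<iota> f" by auto
  obtain N where N: "(Delta n ^^ N) f = 0" using poly_carrier_Delta_nilpotent[OF f(1)] .
  then have N': "(Delta n ^^ Suc N) f = 0" by simp
  have "star n a f (Const c) = (\<Sum>k<Suc N. Const (0 gchoose k) * (Delta n ^^ k) f) * Const c"
    by (rule star_eigen[OF N']) (auto simp: Const_def gam_def split: if_splits)
  also have "(\<Sum>k<Suc N. Const ((0::'k) gchoose k) * (Delta n ^^ k) f) = f"
    by (subst sum.lessThan_Suc_shift) (simp add: gbinomial_0)
  finally have "star n a f (Const c) = Const c * f" by (simp only: mult.commute)
  then have "\<iota> f \<otimes> kap c = \<iota> (Const c * f)"
    using iota_star[OF f(1) poly_carrier_Const, of c] by simp
  also have "\<dots> = kap c \<otimes> \<iota> f" using f by (intro iota_mult poly_carrier_Const) auto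
  finally show "kap c \<otimes> s = s \<otimes> kap c" using f by simp
qed

lemma kap_closed [simp]: "kap c \<in> carrier Q"
  by (simp add: poly_carrier_Const)

lemma kap_comm: "x \<in> carrier Q \<Longrightarrow> kap c \<otimes> x = x \<otimes> kap c"
  using kap_central by (auto simp: ring_center_def)

lemma kap_add: "kap (c + d) = kap c \<oplus> kap d"
  by (simp add: Const_add iota_add poly_carrier_Const)

lemma kap_mult: "kap (c * d) = kap c \<otimes> kap d"
  using iota_mult[of "Const c" "Const d"] by (simp add: poly_carrier_Const)

lemma kap_1 [simp]: "kap 1 = \<one>" and kap_0 [simp]: "kap 0 = \<zero>"
  by simp_all

lemma kap_eq_0_iff [simp]: "kap c = \<zero> \<longleftrightarrow> c = 0"
  using iota_eq_0_iff[of "Const c"] by (simp add: poly_carrier_Const)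

lemma kap_uminus: "kap (- c) = \<ominus> kap c"
  by (simp add: Const_uminus iota_uminus poly_carrier_Const)

lemma iota_Const_mult: "f \<in> A \<Longrightarrow> \<iota> (Const c * f) = kap c \<otimes> \<iota> f"
  by (intro iota_mult) (auto simp: poly_carrier_Const)

lemma kap_of_nat: "kap (of_nat k) = [k] \<cdot> \<one>"
  by (induction k) (simp_all add: kap_add a_comm)

lemma char_0: "(k::nat) > 0 \<Longrightarrow> [k] \<cdot> \<one> \<noteq> \<zero>"
  using kap_eq_0_iff[of "of_nat k"] by (simp add: kap_of_nat del: kap_eq_0_iff)

lemma iota_kernel_comm:
  "f \<in> A \<Longrightarrow> g \<in> A \<Longrightarrow> Delta n f = 0 \<Longrightarrow> Delta n g = 0 \<Longrightarrow> \<iota> f \<otimes> \<iota> g = \<iota> g \<otimes> \<iota> f"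
  using iota_mult[of f g] iota_mult[of g f] by (simp add: mult.commute)

subsection \<open>The localisation\<close>

lemma X0_in: "Var 0 ^ N \<in> A"
  by (intro poly_carrier_power poly_carrier_Var) simp

lemma Delta_X0 [simp]: "Delta n (Var 0 ^ N :: 'k laurent) = 0"
  by (simp add: Var_0_power)

lemma iota_X0 [simp]: "\<iota> (Var 0 ^ N) \<in> carrier Q" "\<iota> (Var 0 ^ N) \<noteq> \<zero>"
  using X0_in[of N] iota_eq_0_iff[OF X0_in, of N] by auto

lemma loc_indep_aux:
  assumes f: "Var 0 ^ N * f \<in> A"
  shows "inv (\<iota> (Var 0 ^ (M + N))) \<otimes> \<iota> (Var 0 ^ (M + N) * f) = inv (\<iota> (Var 0 ^ N)) \<otimes> \<iota> (Var 0 ^ N * f)"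
proof -
  have 1: "\<iota> (Var 0 ^ (M + N) * f) = \<iota> (Var 0 ^ M) \<otimes> \<iota> (Var 0 ^ N * f)"
    using iota_mult[OF X0_in f, of M] by (simp add: power_add mult.assoc)
  have "\<iota> (Var 0 ^ (M + N)) = \<iota> (Var 0 ^ M) \<otimes> \<iota> (Var 0 ^ N)"
    using iota_mult[OF X0_in X0_in, of M N] by (simp add: power_add)
  then have 2: "inv (\<iota> (Var 0 ^ (M + N))) = inv (\<iota> (Var 0 ^ N)) \<otimes> inv (\<iota> (Var 0 ^ M))"
    using inv_mult[OF iota_X0(1) iota_X0(1) iota_X0(2) iota_X0(2)] by simp
  show ?thesis unfolding 1 2 using f by (simp add: m_assoc)
qed

text \<open>Any admissible power of X_0 may replace the least one of the definition, which permits
  common denominators.\<close>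

lemma loc_eq:
  assumes f: "Var 0 ^ N * f \<in> A"
  shows "loc f = inv (\<iota> (Var 0 ^ N)) \<otimes> \<iota> (Var 0 ^ N * f)"
proof -
  define L where "L = (LEAST N. Var 0 ^ N * f \<in> A)"
  have L: "Var 0 ^ L * f \<in> A" unfolding L_def using f by (rule LeastI)
  have "loc f = inv (\<iota> (Var 0 ^ L)) \<otimes> \<iota> (Var 0 ^ L * f)"
    by (simp add: loc_embed_def L_def Let_def)
  then show ?thesis using loc_indep_aux[OF L, of N] loc_indep_aux[OF f, of L] by (simp add: add.commute)
qed

lemma loc_iota: "f \<in> A \<Longrightarrow> loc f = \<iota> f"
  using loc_eq[of 0 f] by simp

lemma clear2:
  fixes f g :: "'k laurent"
  assumes "keys f \<subseteq> loc_exps n" "keys g \<subseteq> loc_exps n"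
  obtains N where "Var 0 ^ N * f \<in> A" "Var 0 ^ N * g \<in> A"
proof -
  obtain N where N: "Var 0 ^ N * f \<in> A" using loc_clear_denominator[OF assms(1)] .
  obtain M where M: "Var 0 ^ M * g \<in> A" using loc_clear_denominator[OF assms(2)] .
  note NM = N M
  show ?thesis
    using that[of "M + N"] poly_carrier_mult[OF X0_in NM(1), of M] poly_carrier_mult[OF X0_in NM(2), of N]
    by (simp add: power_add mult_ac)
qed

lemma loc_closed [simp]: "keys f \<subseteq> loc_exps n \<Longrightarrow> loc f \<in> carrier Q"
  by (rule loc_clear_denominator[of f n]) (auto simp: loc_eq)

lemma loc_add:
  assumes "keys f \<subseteq> loc_exps n" "keys g \<subseteq> loc_exps n"
  shows "loc (f + g) = loc f \<oplus> loc g"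
proof -
  obtain N where N: "Var 0 ^ N * f \<in> A" "Var 0 ^ N * g \<in> A" using clear2[OF assms] .
  then have fg: "Var 0 ^ N * (f + g) \<in> A" by (simp add: distrib_left poly_carrier_add)
  show ?thesis
    unfolding loc_eq[OF fg] loc_eq[OF N(1)] loc_eq[OF N(2)] using N
    by (simp add: distrib_left iota_add r_distr)
qed

text \<open>The product inside \<open>loc\<close> is the commutative one. For a left factor in the
  kernel of \<open>Delta\<close> it agrees with the product of the localised ring, which is why
  \<open>b\<close> has to be killed by \<open>Delta\<close>.\<close>

lemma loc_mult:
  assumes "keys b \<subseteq> loc_exps n" "keys f \<subseteq> loc_exps n" "Delta n b = 0"
  shows "loc (b * f) = loc b \<otimes> loc f"
proof -
  obtain N where N: "Var 0 ^ N * b \<in> A" "Var 0 ^ N * f \<in> A" using clear2[OF assms(1,2)] .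
  have D: "Delta n (Var 0 ^ N * b) = 0" using assms(3) by (simp add: Delta_mult)
  have eq: "Var 0 ^ (N + N) * (b * f) = (Var 0 ^ N * b) * (Var 0 ^ N * f)" by (simp add: power_add mult_ac)
  then have bf: "Var 0 ^ (N + N) * (b * f) \<in> A" using poly_carrier_mult[OF N] by (simp only: eq)
  let ?x = "\<iota> (Var 0 ^ N)" and ?b = "\<iota> (Var 0 ^ N * b)" and ?f = "\<iota> (Var 0 ^ N * f)"
  have c: "?x \<in> carrier Q" "?x \<noteq> \<zero>" "?b \<in> carrier Q" "?f \<in> carrier Q" using N by auto
  have "\<iota> (Var 0 ^ (N + N)) = ?x \<otimes> ?x" using iota_mult[OF X0_in X0_in, of N N] by (simp add: power_add)
  then have "loc (b * f) = inv (?x \<otimes> ?x) \<otimes> (?b \<otimes> ?f)"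
    unfolding loc_eq[OF bf] eq using iota_mult[OF N D] by simp
  also have "\<dots> = inv ?x \<otimes> (inv ?x \<otimes> ?b) \<otimes> ?f" using c by (simp add: inv_mult m_assoc)
  also have "inv ?x \<otimes> ?b = ?b \<otimes> inv ?x"
    by (rule inv_commute[OF c(1,2,3)]) (use iota_kernel_comm[OF X0_in N(1) _ D] in simp)
  also have "inv ?x \<otimes> (?b \<otimes> inv ?x) \<otimes> ?f = loc b \<otimes> loc f"
    unfolding loc_eq[OF N(1)] loc_eq[OF N(2)] using c by (simp add: m_assoc)
  finally show ?thesis .
qed

lemma loc_neq_0:
  assumes "keys f \<subseteq> loc_exps n" "f \<noteq> 0"
  shows "loc f \<noteq> \<zero>"
proof -
  obtain N where N: "Var 0 ^ N * f \<in> A" using loc_clear_denominator[OF assms(1)] .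
  have "\<iota> (Var 0 ^ N * f) \<noteq> \<zero>" using iota_eq_0_iff[OF N] assms(2) by simp
  then show ?thesis unfolding loc_eq[OF N] using N by (intro mult_nonzero) auto
qed

lemma loc_0 [simp]: "loc 0 = \<zero>"
  using loc_iota[of 0] by simp

lemma hom_exps_loc: "hom_exps n d w \<subseteq> loc_exps n"
  by (auto simp: hom_exps_def)

lemma B_loc: "(b :: 'k laurent) \<in> B_component n d \<Longrightarrow> keys b \<subseteq> loc_exps n"
  using keys_B_component[OF _ n2] hom_exps_loc by blast

lemma zed_loc: "keys (zed ^ j :: 'k laurent) \<subseteq> loc_exps n"
  using keys_power_hom[OF keys_zed, of n j] n2 hom_exps_loc[of "int j * 0" "int j * 1"] by auto

lemma mult_loc: "keys f \<subseteq> loc_exps n \<Longrightarrow> keys g \<subseteq> loc_exps n \<Longrightarrow> keys (f * g :: 'k laurent) \<subseteq> loc_exps n"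
  by (rule keys_mult_subset) (auto intro: loc_exps_add)

lemma zed_span_loc: "(f :: 'k laurent) \<in> zed_span n d w \<Longrightarrow> keys f \<subseteq> loc_exps n"
proof (induction f rule: zed_span.induct)
  case (add b j f)
  show ?case by (rule keys_add_subset[OF mult_loc[OF B_loc[OF add(1)] zed_loc] add(3)])
qed simp

subsection \<open>The field \<open>K\<close> is central\<close>

text \<open>Multiplying numerator and denominator by the same power of X_0 moves both into
  \<open>A\<close>, keeps them in one common component, and leaves the fraction unchanged because
  X_0 commutes with them.\<close>

lemma K_field_iff:
  "z \<in> K_field n Q \<iota> \<longleftrightarrow> (\<exists>e. \<exists>b\<in>A \<inter> B_component n e. \<exists>s\<in>A \<inter> B_component n e - {0}. z = \<iota> b \<otimes> inv (\<iota> s))"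
proof
  assume "z \<in> K_field n Q \<iota>"
  then obtain b s e where s: "s \<in> B_component n e" "s \<noteq> 0" and b: "b \<in> B_component n e"
    and z: "z = loc b \<otimes> inv (loc s)"
    by (auto simp: K_field_def Qgr_B_component_def)
  obtain N where N: "Var 0 ^ N * b \<in> A" "Var 0 ^ N * s \<in> A" using clear2[OF B_loc[OF b] B_loc[OF s(1)]] .
  let ?x = "\<iota> (Var 0 ^ N)" and ?b = "\<iota> (Var 0 ^ N * b)" and ?s = "\<iota> (Var 0 ^ N * s)"
  have D: "Delta n (Var 0 ^ N * b) = 0" "Delta n (Var 0 ^ N * s) = 0"
    using B_component_Delta[OF b] B_component_Delta[OF s(1)] by (simp_all add: Delta_mult)
  have c: "?x \<in> carrier Q" "?x \<noteq> \<zero>" "?b \<in> carrier Q" "?s \<in> carrier Q" "?s \<noteq> \<zero>"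
    using N iota_eq_0_iff[OF N(2)] s(2) by auto
  have comm: "inv ?x \<otimes> ?b = ?b \<otimes> inv ?x" "inv ?x \<otimes> ?s = ?s \<otimes> inv ?x"
    using inv_commute c iota_kernel_comm[OF X0_in N(1) _ D(1)] iota_kernel_comm[OF X0_in N(2) _ D(2)] by simp_all
  have "inv (?s \<otimes> inv ?x) = ?x \<otimes> inv ?s"
  proof (rule m_cancel_left[of "?s \<otimes> inv ?x"])
    show "?s \<otimes> inv ?x \<noteq> \<zero>" using c by (intro mult_nonzero) auto
    then show "?s \<otimes> inv ?x \<otimes> inv (?s \<otimes> inv ?x) = ?s \<otimes> inv ?x \<otimes> (?x \<otimes> inv ?s)" using c by (simp add: m_assoc)
    show "inv (?s \<otimes> inv ?x) \<in> carrier Q" using \<open>?s \<otimes> inv ?x \<noteq> \<zero>\<close> c by simp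
  qed (use c in auto)
  then have "z = ?b \<otimes> inv ?x \<otimes> (?x \<otimes> inv ?s)"
    unfolding z loc_eq[OF N(1)] loc_eq[OF N(2)] comm by simp
  also have "\<dots> = ?b \<otimes> inv ?s" using c by (simp add: m_assoc)
  finally have "z = ?b \<otimes> inv ?s" .
  moreover have "Var 0 ^ N * b \<in> B_component n (int N + fst e, 0 + snd e)"
    "Var 0 ^ N * s \<in> B_component n (int N + fst e, 0 + snd e)"
    using B_component_mult[OF B_component_X0_powi b, of "int N"] B_component_mult[OF B_component_X0_powi s(1), of "int N"]
    by (simp_all add: Var_0_power)
  moreover have "Var 0 ^ N * s \<noteq> 0" using s(2) by simp
  ultimately show "\<exists>e. \<exists>b\<in>A \<inter> B_component n e. \<exists>s\<in>A \<inter> B_component n e - {0}. z = \<iota> b \<otimes> inv (\<iota> s)"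
    using N by blast
next
  assume "\<exists>e. \<exists>b\<in>A \<inter> B_component n e. \<exists>s\<in>A \<inter> B_component n e - {0}. z = \<iota> b \<otimes> inv (\<iota> s)"
  then obtain e b s where "b \<in> A \<inter> B_component n e" "s \<in> A \<inter> B_component n e - {0}" "z = \<iota> b \<otimes> inv (\<iota> s)"
    by blast
  then have "s \<in> B_component n e" "s \<noteq> 0" "b \<in> B_component n (fst (0 :: int, 0 :: int) + fst e, snd (0 :: int, 0 :: int) + snd e)"
    "z = loc b \<otimes> inv (loc s)"
    by (auto simp: loc_iota)
  then show "z \<in> K_field n Q \<iota>"
    unfolding K_field_def Qgr_B_component_def by (intro CollectI exI[of _ b] exI[of _ s] exI[of _ e]) simp
qed

lemma gam_B: "(b :: 'k laurent) \<in> B_component n e \<Longrightarrow> m \<in> keys b \<Longrightarrow> gam n a m = a * of_int (fst e) + of_int (snd e)"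
  using keys_B_component[OF _ n2] by (fastforce simp: hom_exps_def gam_eq)

text \<open>Numerator and denominator have the same bidegree, hence the same \<open>Gamma\<close>
  eigenvalue. Passing an element of R across either of them produces the same twist, which cancels
  in the quotient.\<close>

lemma K_field_central: "K_field n Q \<iota> \<subseteq> ring_center Q"
proof
  fix z assume "z \<in> K_field n Q \<iota>"
  then obtain e b s where b: "b \<in> A" "b \<in> B_component n e" and s: "s \<in> A" "s \<in> B_component n e" "s \<noteq> 0"
    and z: "z = \<iota> b \<otimes> inv (\<iota> s)"
    unfolding K_field_iff by blast
  have c: "\<iota> b \<in> carrier Q" "\<iota> s \<in> carrier Q" "\<iota> s \<noteq> \<zero>" using b s iota_eq_0_iff by auto
  have bs: "inv (\<iota> s) \<otimes> \<iota> b = \<iota> b \<otimes> inv (\<iota> s)"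
    using inv_commute[OF c(2,3,1)] iota_kernel_comm[OF s(1) b(1) B_component_Delta[OF s(2)] B_component_Delta[OF b(2)]]
    by simp
  show "z \<in> ring_center Q"
  proof (rule center_of_fracs[OF image_fracs])
    fix x assume "x \<in> \<iota> ` A"
    then obtain f where f: "f \<in> A" "x = \<iota> f" by auto
    obtain N where N: "(Delta n ^^ N) f = 0" using poly_carrier_Delta_nilpotent[OF f(1)] .
    \<comment> \<open>The twist of \<open>f\<close> prescribed by \<open>star_eigen\<close>; it
      depends only on the common bidegree \<open>e\<close>.\<close>
    define g where "g = (\<Sum>k<N. Const ((a * of_int (fst e) + of_int (snd e)) gchoose k) * (Delta n ^^ k) f)"
    have g: "g \<in> A" unfolding g_def
      by (intro poly_carrier_sum poly_carrier_mult poly_carrier_Const poly_carrier_Delta_pow f)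
    have tw: "\<iota> f \<otimes> \<iota> h = \<iota> h \<otimes> \<iota> g" if h: "h \<in> A" "h \<in> B_component n e" for h
    proof -
      have "star n a f h = g * h" unfolding g_def by (rule star_eigen[OF N]) (rule gam_B[OF h(2)])
      then have "\<iota> f \<otimes> \<iota> h = \<iota> (h * g)" using iota_star[OF f(1) h(1)] by (simp add: mult.commute)
      then show ?thesis using iota_mult[OF h(1) g] B_component_Delta[OF h(2)] by simp
    qed
    have gc: "\<iota> g \<in> carrier Q" "\<iota> f \<in> carrier Q" using g f by auto
    have "x \<otimes> z = \<iota> f \<otimes> \<iota> b \<otimes> inv (\<iota> s)" using c gc by (simp add: f z m_assoc)
    also have "\<dots> = \<iota> b \<otimes> (inv (\<iota> s) \<otimes> (\<iota> s \<otimes> \<iota> g)) \<otimes> inv (\<iota> s)"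
      using c gc by (simp add: tw[OF b])
    also have "\<dots> = \<iota> b \<otimes> (inv (\<iota> s) \<otimes> (\<iota> f \<otimes> \<iota> s)) \<otimes> inv (\<iota> s)"
      by (simp only: tw[OF s(1,2)])
    also have "\<dots> = z \<otimes> x" using c gc by (simp add: f z m_assoc)
    finally show "z \<otimes> x = x \<otimes> z" by simp
  qed (use c z in auto)
qed

end

declare single_one [simp del]

context frac_R
begin

subsection \<open>The centre for irrational \<open>a\<close>\<close>

text \<open>X_0 is an eigenvector with eigenvalue \<open>a\<close>, and the term k = 0 cancels
  against the other product, which is commutative.\<close>

lemma star_X0_commutator:
  assumes f: "f \<in> A" and N: "(Delta n ^^ Suc N) f = 0"
  shows "star n a f (Var 0) - star n a (Var 0) f =
    (\<Sum>k<N. Const (a gchoose Suc k) * (Delta n ^^ Suc k) f) * Var 0"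
proof -
  have "star n a f (Var 0) = (\<Sum>k<Suc N. Const (a gchoose k) * (Delta n ^^ k) f) * Var 0"
    by (rule star_eigen[OF N]) (auto simp: Var_def gam_eq)
  also have "(\<Sum>k<Suc N. Const (a gchoose k) * (Delta n ^^ k) f) =
      f + (\<Sum>k<N. Const (a gchoose Suc k) * (Delta n ^^ Suc k) f)"
    by (subst sum.lessThan_Suc_shift) simp
  finally show ?thesis
    using star_Delta_eq_0[of n "Var 0" a f] by (simp add: Delta_Var algebra_simps del: funpow.simps)
qed

text \<open>The commutator with \<open>X\<^sub>0\<close> lowers the order of nilpotency under \<open>\<Delta>\<close> by exactly one.\<close>

lemma commutator_lowers:
  assumes a: "a \<noteq> 0" and f: "f \<in> A" and p: "(Delta n ^^ Suc p) f \<noteq> 0" "(Delta n ^^ Suc (Suc p)) f = 0"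
  shows "(Delta n ^^ p) (star n a f (Var 0) - star n a (Var 0) f) \<noteq> 0"
    "(Delta n ^^ Suc p) (star n a f (Var 0) - star n a (Var 0) f) = 0"
proof -
  define t where "t = star n a f (Var 0) - star n a (Var 0) f"
  define h where "h l = (Delta n ^^ l) (\<Sum>k<Suc p. Const (a gchoose Suc k) * (Delta n ^^ Suc k) f)" for l
  have mult: "(Delta n ^^ l) (g * Var 0) = (Delta n ^^ l) g * Var 0" for l and g :: "'k laurent"
    by (induction l) (simp_all add: Delta_mult Delta_Var)
  have t: "(Delta n ^^ l) t = h l * Var 0" for l
    unfolding t_def star_X0_commutator[OF f p(2)] mult h_def by (rule refl)
  have h: "h l = (\<Sum>k<Suc p. Const (a gchoose Suc k) * (Delta n ^^ (l + Suc k)) f)" for l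
    unfolding h_def Delta_pow_sum Delta_pow_Const_mult by (simp only: funpow_add comp_apply)
  have z: "(Delta n ^^ l) f = 0" if "Suc (Suc p) \<le> l" for l
    using Delta_pow_eq_0_mono[OF p(2) that] .
  have "h (Suc p) = 0"
    unfolding h by (intro sum.neutral ballI) (simp add: z del: funpow.simps)
  then show "(Delta n ^^ Suc p) (star n a f (Var 0) - star n a (Var 0) f) = 0"
    using t[of "Suc p"] by (simp only: t_def mult_zero_left)
  \<comment> \<open>After p further derivatives only the term k = 0 survives; its coefficient is
    \<open>a\<close>.\<close>
  have "h p = (\<Sum>k<Suc p. if k = 0 then Const a * (Delta n ^^ Suc p) f else 0)"
    unfolding h by (intro sum.cong refl) (auto simp: z simp del: funpow.simps)
  also have "\<dots> = Const a * (Delta n ^^ Suc p) f" by simp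
  finally have "h p \<noteq> 0" using a p(1) by (simp del: funpow.simps)
  then show "(Delta n ^^ p) (star n a f (Var 0) - star n a (Var 0) f) \<noteq> 0"
    using t[of p] by (simp only: t_def mult_eq_0_iff Var_neq_0 simp_thms)
qed

definition nord :: "'k laurent \<Rightarrow> nat" where
  "nord f = (LEAST p. (Delta n ^^ Suc p) f = 0)"

lemma nord_props:
  assumes f: "f \<in> A" "f \<noteq> 0"
  shows "(Delta n ^^ nord f) f \<noteq> 0" "(Delta n ^^ Suc (nord f)) f = 0"
proof -
  obtain N where "(Delta n ^^ N) f = 0" using poly_carrier_Delta_nilpotent[OF f(1)] .
  then have "(Delta n ^^ Suc N) f = 0" by simp
  then show *: "(Delta n ^^ Suc (nord f)) f = 0" unfolding nord_def by (rule LeastI)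
  show "(Delta n ^^ nord f) f \<noteq> 0"
  proof (cases "nord f")
    case (Suc m)
    then have "m < nord f" by simp
    then have "\<not> (Delta n ^^ Suc m) f = 0" unfolding nord_def by (rule not_less_Least)
    then show ?thesis using Suc by simp
  qed (use f in simp)
qed

lemma nord_le: "(Delta n ^^ Suc p) f = 0 \<Longrightarrow> nord f \<le> p"
  unfolding nord_def by (rule Least_le)

lemma iota_commutator:
  "f \<in> A \<Longrightarrow> g \<in> A \<Longrightarrow> \<iota> (star n a f g - star n a g f) = \<iota> f \<otimes> \<iota> g \<oplus> \<ominus> (\<iota> g \<otimes> \<iota> f)"
  by (simp add: iota_diff poly_carrier_star iota_star)

lemma X_in: "i \<le> n \<Longrightarrow> Var i \<in> A"
  by (rule poly_carrier_Var)

text \<open>On the kernel of \<open>Delta\<close> the commutator with X_1 is the operator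
  \<open>Gamma\<close>, up to the factor X_0.\<close>

lemma x1_commutator:
  assumes s: "s \<in> A" "Delta n s = 0"
  shows "\<iota> (Var 1) \<otimes> \<iota> s \<oplus> \<ominus> (\<iota> s \<otimes> \<iota> (Var 1)) = \<iota> (Var 0) \<otimes> \<iota> (Gamma n a s)"
proof -
  have V: "Var 1 \<in> A" "Var 0 \<in> A" using X_in n2 by auto
  have "star n a (Var 1) s - star n a s (Var 1) = Var 0 * Gamma n a s"
    using star_Var1[of n a s] star_Delta_eq_0[OF s(2)] n2 by (simp add: mult.commute)
  then show ?thesis
    using iota_commutator[OF V(1) s(1)] iota_mult[OF V(2) poly_carrier_Gamma[OF s(1)]] by (simp add: Delta_Var)
qed

lemma commutator_scale:
  assumes "c \<in> ring_center Q" "x \<in> carrier Q" "y \<in> carrier Q"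
  shows "c \<otimes> x \<otimes> y \<oplus> \<ominus> (y \<otimes> (c \<otimes> x)) = c \<otimes> (x \<otimes> y \<oplus> \<ominus> (y \<otimes> x))"
    "y \<otimes> (c \<otimes> x) \<oplus> \<ominus> (c \<otimes> x \<otimes> y) = c \<otimes> (y \<otimes> x \<oplus> \<ominus> (x \<otimes> y))"
proof -
  have c: "c \<in> carrier Q" and "c \<otimes> y = y \<otimes> c" using assms by (auto simp: ring_center_def)
  then have "y \<otimes> (c \<otimes> x) = c \<otimes> (y \<otimes> x)" using assms by (simp add: m_assoc[symmetric])
  then show "c \<otimes> x \<otimes> y \<oplus> \<ominus> (y \<otimes> (c \<otimes> x)) = c \<otimes> (x \<otimes> y \<oplus> \<ominus> (y \<otimes> x))"
    "y \<otimes> (c \<otimes> x) \<oplus> \<ominus> (c \<otimes> x \<otimes> y) = c \<otimes> (y \<otimes> x \<oplus> \<ominus> (x \<otimes> y))"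
    using c assms by (simp_all add: r_distr r_minus m_assoc)
qed

text \<open>Two bidegrees with the same eigenvalue but different degrees would exhibit
  \<open>a\<close> as a quotient of integers.\<close>

lemma Gamma_eigen_hom:
  assumes a: "a \<notin> \<rat>" and f: "f \<in> A" and g: "\<And>m. m \<in> keys f \<Longrightarrow> gam n a m = a * of_int d + of_int w"
  shows "keys f \<subseteq> hom_exps n d w"
proof
  fix m assume m: "m \<in> keys f"
  have eq: "a * of_int (deg_exp n m - d) = of_int (w - wt_exp n m)"
    using g[OF m] by (simp add: gam_eq algebra_simps)
  have "deg_exp n m = d"
  proof (rule ccontr)
    assume "deg_exp n m \<noteq> d"
    then have "of_int (deg_exp n m - d) \<noteq> (0::'k)" by simp
    then have "a = of_int (w - wt_exp n m) / of_int (deg_exp n m - d)" using eq by (simp add: field_simps)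
    then show False using a by (metis Rats_divide Rats_of_int)
  qed
  moreover from this have "w = wt_exp n m" using eq by simp
  moreover have "m \<in> loc_exps n" using m f poly_exps_subset by (auto simp: poly_carrier_iff)
  ultimately show "m \<in> hom_exps n d w" by (simp add: hom_exps_def)
qed

text \<open>For a central \<open>c\<close>, an operation such as the commutator with X_0 or X_1 may
  be applied to numerator and denominator alike without changing the fraction. A denominator minimal
  for nilpotency under \<open>Delta\<close>, and within the kernel one minimal for the number of
  \<open>Gamma\<close> eigenvalues, must be a \<open>Gamma\<close> eigenvector in the kernel.
  Irrationality turns this into bihomogeneity.\<close>

lemma center_eq:
  assumes a: "a \<notin> \<rat>"
  shows "ring_center Q = K_field n Q \<iota>"
proof
  show "K_field n Q \<iota> \<subseteq> ring_center Q" by (rule K_field_central)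
  have a0: "a \<noteq> 0" using a by auto
  have V: "Var 1 \<in> A" "Var 0 \<in> A" using X_in n2 by auto
  show "ring_center Q \<subseteq> K_field n Q \<iota>"
  proof
    fix c assume c: "c \<in> ring_center Q"
    then have cc: "c \<in> carrier Q" by (simp add: ring_center_def)
    \<comment> \<open>The admissible denominators of \<open>c\<close>.\<close>
    define P where "P s \<longleftrightarrow> s \<in> A \<and> s \<noteq> 0 \<and> (\<exists>r\<in>A. \<iota> r = c \<otimes> \<iota> s)" for s
    have "\<exists>s. P s"
    proof -
      obtain r s where rs: "r \<in> \<iota> ` A" "s \<in> \<iota> ` A - {\<zero>}" "c = r \<otimes> inv s"
        using fracs_ofE[OF image_fracs cc] .
      then obtain f g where fg: "f \<in> A" "g \<in> A" "r = \<iota> f" "s = \<iota> g" "\<iota> g \<noteq> \<zero>" by auto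
      then have "c \<otimes> \<iota> g = \<iota> f" by (simp add: rs(3) m_assoc)
      then have "P g" unfolding P_def using fg iota_eq_0_iff[of g] by auto
      then show ?thesis by blast
    qed
    then obtain s where s: "P s" and min: "\<And>t. P t \<Longrightarrow> nord s \<le> nord t"
      using ex_has_least_nat[of P _ nord] by blast
    obtain r where r: "r \<in> A" "\<iota> r = c \<otimes> \<iota> s" and sA: "s \<in> A" "s \<noteq> 0" using s by (auto simp: P_def)
    let ?br = "\<lambda>f. star n a f (Var 0) - star n a (Var 0) f"
    have brA: "?br f \<in> A" if "f \<in> A" for f
      by (intro poly_carrier_diff poly_carrier_star that V)
    have br: "\<iota> (?br r) = c \<otimes> \<iota> (?br s)"
      using commutator_scale(1)[OF c, of "\<iota> s" "\<iota> (Var 0)"] sA r V by (simp add: iota_commutator)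
    \<comment> \<open>Otherwise the commutator of \<open>s\<close> with X_0 would be an admissible
      denominator of smaller order.\<close>
    have "nord s = 0"
    proof (rule ccontr)
      assume "nord s \<noteq> 0"
      then obtain p where p: "nord s = Suc p" by (cases "nord s") auto
      note L = commutator_lowers[OF a0 sA(1), of p]
      have L': "(Delta n ^^ p) (?br s) \<noteq> 0" "(Delta n ^^ Suc p) (?br s) = 0"
        using L nord_props[OF sA] unfolding p by blast+
      then have "?br s \<noteq> 0" using Delta_pow_0 by metis
      then have "P (?br s)" unfolding P_def using brA[OF sA(1)] brA[OF r(1)] br by blast
      from min[OF this] show False using nord_le[OF L'(2)] p by simp
    qed
    then have Ds: "Delta n s = 0" using nord_props(2)[OF sA] by simp
    have "?br s = 0" using star_X0_commutator[OF sA(1), of 0] Ds by simp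
    then have "?br r = 0" using br cc iota_eq_0_iff[OF brA[OF r(1)]] by simp
    \<comment> \<open>The commutator of \<open>r\<close> with X_0 vanishes too, and for nonzero
      \<open>a\<close> it can vanish only on the kernel of \<open>Delta\<close>.\<close>
    have Dr: "Delta n r = 0"
    proof (rule ccontr)
      assume Dr: "Delta n r \<noteq> 0"
      then have "r \<noteq> 0" by auto
      note np = nord_props[OF r(1) this]
      have "nord r \<noteq> 0" using Dr np(2) by (cases "nord r") auto
      then obtain p where p: "nord r = Suc p" by (cases "nord r") auto
      have "(Delta n ^^ p) (?br r) \<noteq> 0"
        using commutator_lowers(1)[OF a0 r(1), of p] np unfolding p by blast
      then show False using \<open>?br r = 0\<close> by simp
    qed
    \<comment> \<open>The same denominators, now with numerator and denominator in the kernel of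
      \<open>Delta\<close>, where \<open>Gamma\<close> acts.\<close>
    define P' where "P' s \<longleftrightarrow> s \<in> A \<and> s \<noteq> 0 \<and> Delta n s = 0 \<and> (\<exists>r\<in>A. Delta n r = 0 \<and> \<iota> r = c \<otimes> \<iota> s)" for s
    have "P' s" unfolding P'_def using sA Ds r Dr by blast
    then obtain s where s: "P' s" and min: "\<And>t. P' t \<Longrightarrow> card (gam n a ` keys s) \<le> card (gam n a ` keys t)"
      using ex_has_least_nat[of P' _ "\<lambda>s. card (gam n a ` keys s)"] by blast
    obtain r where r: "r \<in> A" "\<iota> r = c \<otimes> \<iota> s" "Delta n r = 0" and sA: "s \<in> A" "s \<noteq> 0" "Delta n s = 0"
      using s by (auto simp: P'_def)
    have x0: "\<iota> (Var 0) \<in> carrier Q" "\<iota> (Var 0) \<noteq> \<zero>" using V iota_eq_0_iff[OF V(2)] by auto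
    have Gs: "\<iota> (Gamma n a s) \<in> carrier Q" and Gr: "\<iota> (Gamma n a r) \<in> carrier Q"
      using sA r by (simp_all add: poly_carrier_Gamma)
    have "\<iota> (Var 0) \<otimes> \<iota> (Gamma n a r) = c \<otimes> (\<iota> (Var 0) \<otimes> \<iota> (Gamma n a s))"
      using x1_commutator[OF r(1,3)] x1_commutator[OF sA(1,3)]
        commutator_scale(2)[OF c, of "\<iota> s" "\<iota> (Var 1)"] sA r V by simp
    also have "\<dots> = \<iota> (Var 0) \<otimes> (c \<otimes> \<iota> (Gamma n a s))"
    proof -
      have "c \<otimes> \<iota> (Var 0) = \<iota> (Var 0) \<otimes> c" using c x0 by (simp add: ring_center_def)
      then show ?thesis
        unfolding m_assoc[OF cc x0(1) Gs, symmetric] m_assoc[OF x0(1) cc Gs, symmetric] by simp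
    qed
    finally have G: "\<iota> (Gamma n a r) = c \<otimes> \<iota> (Gamma n a s)"
      by (rule m_cancel_left[OF x0 Gr m_closed[OF cc Gs]])
    \<comment> \<open>Subtracting \<open>g\<close> allows one eigenvalue of the denominator to be
      removed at will.\<close>
    have shift: "\<iota> (Gamma n a r - Const g * r) = c \<otimes> \<iota> (Gamma n a s - Const g * s)" for g
    proof -
      have "kap g \<otimes> (c \<otimes> \<iota> s) = c \<otimes> (kap g \<otimes> \<iota> s)"
        using cc sA kap_comm[of c g] by (simp add: m_assoc[symmetric])
      then show ?thesis
        using sA r cc Gs poly_carrier_mult[OF poly_carrier_Const sA(1), of g]
          poly_carrier_mult[OF poly_carrier_Const r(1), of g]
        by (simp add: iota_diff poly_carrier_Gamma G iota_Const_mult r_distr r_minus)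
    qed
    have shiftA: "Gamma n a f - Const g * f \<in> A" if "f \<in> A" for f g
      by (intro poly_carrier_diff poly_carrier_Gamma poly_carrier_mult poly_carrier_Const that)
    obtain m0 where m0: "m0 \<in> keys s" using sA(2) keys_eq_empty by blast
    \<comment> \<open>If a second eigenvalue occurred, the shift by the eigenvalue at
      \<open>m0\<close> would give a nonzero denominator with strictly fewer eigenvalues.\<close>
    have all: "gam n a m = gam n a m0" if m: "m \<in> keys s" for m
    proof (rule ccontr)
      assume ne: "gam n a m \<noteq> gam n a m0"
      let ?t = "Gamma n a s - Const (gam n a m0) * s"
      have keys: "keys ?t = {m \<in> keys s. gam n a m \<noteq> gam n a m0}"
        by (auto simp: in_keys_iff lookup_minus)
      have D: "Delta n (Gamma n a f - Const g * f) = 0" if "Delta n f = 0" for f g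
      proof -
        have "Delta n (Gamma n a f - Const g * f) = Delta n (Gamma n a f + Const (- g) * f)"
          by (simp add: Const_uminus)
        also have "\<dots> = Gamma n a (Delta n f) + Delta n f + Const (- g) * Delta n f"
          by (simp only: Delta_add Delta_Gamma Delta_Const_mult)
        also have "\<dots> = 0" by (rule poly_mapping_eqI) (simp add: that lookup_add)
        finally show ?thesis .
      qed
      have "?t \<noteq> 0" using keys m ne by (metis (mono_tags, lifting) empty_iff keys_zero mem_Collect_eq)
      then have "P' ?t"
        unfolding P'_def using shiftA[OF sA(1)] shiftA[OF r(1)] D[OF sA(3)] D[OF r(3)] shift by blast
      then have "card (gam n a ` keys s) \<le> card (gam n a ` keys ?t)" by (rule min)
      moreover have "gam n a ` keys ?t \<subset> gam n a ` keys s"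
      proof (rule psubsetI)
        show "gam n a ` keys ?t \<subseteq> gam n a ` keys s" unfolding keys by (rule image_mono) simp
        have "gam n a m0 \<notin> gam n a ` keys ?t" unfolding keys by auto
        moreover have "gam n a m0 \<in> gam n a ` keys s" using m0 by (rule imageI)
        ultimately show "gam n a ` keys ?t \<noteq> gam n a ` keys s" by metis
      qed
      ultimately show False using psubset_card_mono[of "gam n a ` keys s" "gam n a ` keys ?t"] by simp
    qed
    define d where "d = deg_exp n m0" define w where "w = wt_exp n m0"
    have g0: "gam n a m0 = a * of_int d + of_int w" by (simp add: gam_eq d_def w_def)
    have "Gamma n a s - Const (gam n a m0) * s = 0"
      by (rule poly_mapping_eqI) (use all in \<open>auto simp: lookup_minus in_keys_iff\<close>)
    then have "Gamma n a r - Const (gam n a m0) * r = 0"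
      using shift[of "gam n a m0"] cc iota_eq_0_iff[OF shiftA[OF r(1)]] by simp
    then have allr: "gam n a m = gam n a m0" if "m \<in> keys r" for m
    proof -
      have "lookup (Gamma n a r - Const (gam n a m0) * r) m = 0"
        using \<open>Gamma n a r - Const (gam n a m0) * r = 0\<close> by simp
      then show ?thesis using that by (simp add: lookup_minus in_keys_iff)
    qed
    have "s \<in> B_component n (d, w)"
      by (rule kernel_hom_B_component[OF _ Gamma_eigen_hom[OF a sA(1)] sA(3)]) (use n2 all g0 in auto)
    moreover have "r \<in> B_component n (d, w)"
      by (rule kernel_hom_B_component[OF _ Gamma_eigen_hom[OF a r(1)] r(3)]) (use n2 allr g0 in auto)
    moreover have "c = \<iota> r \<otimes> inv (\<iota> s)"
      using sA r cc iota_eq_0_iff[OF sA(1)] by (simp add: m_assoc)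
    ultimately show "c \<in> K_field n Q \<iota>"
      unfolding K_field_iff using sA(1,2) r(1) by blast
  qed
qed

subsection \<open>Valuation and growth\<close>

text \<open>The weight comes first so that \<open>Delta\<close> lowers the value. The negative
  exponent of X_1 makes the terms of an element of \<open>B\<close> without X_1 the leading ones.
  With the degree as third entry, the values (0, 0, 1), (1, -1, 1) and (2, 0, 1) of X_0, X_1 and X_2
  are independent.\<close>

definition wphi :: "exponent \<Rightarrow> int \<times> int \<times> int" where
  "wphi m = (wt_exp n m, - lookup m 1, deg_exp n m)"

lemma wphi_add: "wphi (m + m') = wphi m + wphi m'"
  by (simp add: wphi_def wt_exp_add deg_exp_add lookup_add)

lemma R_valuation:
  "\<exists>V :: 'q \<Rightarrow> int \<times> int \<times> int. valn (carrier Q) V \<and> (\<forall>f\<in>A. f \<noteq> 0 \<longrightarrow> V (\<iota> f) = val wphi f)"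
proof -
  define v where "v q = val wphi (the_inv_into A \<iota> q)" for q
  have v: "v (\<iota> f) = val wphi f" if "f \<in> A" for f
    using the_inv_into_f_f[OF iota_inj_on that] by (simp add: v_def)
  have shift: "wphi (unit_exp (i - 1)) < wphi (unit_exp i)" if "i \<in> {1..n}" for i
    using that by (auto simp: wphi_def)
  have "valn (\<iota> ` A) v"
    unfolding valn_def
  proof (intro conjI ballI impI)
    fix x y assume "x \<in> \<iota> ` A - {\<zero>}" "y \<in> \<iota> ` A - {\<zero>}"
    then obtain f g where fg: "f \<in> A" "g \<in> A" "x = \<iota> f" "y = \<iota> g" "f \<noteq> 0" "g \<noteq> 0"
      using iota_eq_0_iff by auto
    have "keys f \<subseteq> loc_exps n" using fg(1) poly_exps_subset by (auto simp: poly_carrier_iff)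
    then have "val wphi (star n a f g) = val wphi f + val wphi g"
      using val_star(2)[of wphi n f g a, OF wphi_add shift] fg by blast
    moreover have "v (x \<otimes> y) = v (\<iota> (star n a f g))" using fg by (simp add: iota_star)
    ultimately show "v (x \<otimes> y) = v x + v y"
      using fg v[OF poly_carrier_star[OF fg(1,2), of a]] by (simp add: v)
  next
    fix x y assume "x \<in> \<iota> ` A - {\<zero>}" "y \<in> \<iota> ` A - {\<zero>}" "x \<oplus> y \<noteq> \<zero>"
    then obtain f g where fg: "f \<in> A" "g \<in> A" "x = \<iota> f" "y = \<iota> g" "f \<noteq> 0" "g \<noteq> 0" "\<iota> f \<oplus> \<iota> g \<noteq> \<zero>"
      using iota_eq_0_iff by auto
    then have "f + g \<noteq> 0" using iota_add[OF fg(1,2)] by auto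
    from val_add[OF this fg(5,6), of wphi] show "v (x \<oplus> y) \<le> max (v x) (v y)"
      using fg v[OF poly_carrier_add[OF fg(1,2)]] by (simp add: iota_add v)
  qed
  from valn_extend[OF image_subring image_fracs this] obtain V where V: "valn (carrier Q) V"
    "\<And>s. s \<in> \<iota> ` A \<Longrightarrow> s \<noteq> \<zero> \<Longrightarrow> V s = v s" by blast
  show ?thesis
  proof (intro exI conjI ballI impI)
    show "valn (carrier Q) V" by (rule V(1))
    fix f assume "f \<in> A" "f \<noteq> 0"
    then show "V (\<iota> f) = val wphi f" using V(2)[of "\<iota> f"] v iota_eq_0_iff[of f] by simp
  qed
qed

text \<open>Weight and degree are constant on the support, so the maximum is decided by the exponent
  of X_1, and \<open>B_component_key\<close> provides a term where it is 0. The value depends on the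
  bidegree alone.\<close>

lemma val_B_component:
  assumes "(b :: 'k laurent) \<in> B_component n e" "b \<noteq> 0"
  shows "val wphi b = (snd e, 0, fst e)"
proof -
  obtain m where m: "m \<in> keys b" "lookup m 1 = 0" using B_component_key[OF assms] by blast
  have k: "keys b \<subseteq> hom_exps n (fst e) (snd e)" by (rule keys_B_component[OF assms(1) n2])
  show ?thesis
  proof (rule val_eqI[OF m(1)])
    show "wphi m = (snd e, 0, fst e)" using subsetD[OF k m(1)] m(2) by (simp add: wphi_def hom_exps_def)
    fix m' assume "m' \<in> keys b"
    then have "m' \<in> hom_exps n (fst e) (snd e)" using k by blast
    then show "wphi m' \<le> (snd e, 0, fst e)" by (simp add: wphi_def hom_exps_def loc_exps_def)
  qed
qed

text \<open>Central elements are fractions of two members of one component of \<open>B\<close>,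
  which have equal values.\<close>

lemma center_valuation:
  assumes a: "a \<notin> \<rat>" and V: "valn (carrier Q) V" "\<And>f. f \<in> A \<Longrightarrow> f \<noteq> 0 \<Longrightarrow> V (\<iota> f) = val wphi f"
    and c: "c \<in> ring_center Q" "c \<noteq> \<zero>"
  shows "V c = 0"
proof -
  obtain e b s where b: "b \<in> A" "b \<in> B_component n e" and s: "s \<in> A" "s \<in> B_component n e" "s \<noteq> 0"
    and z: "c = \<iota> b \<otimes> inv (\<iota> s)"
    using c(1) unfolding center_eq[OF a] K_field_iff by blast
  have cc: "c \<in> carrier Q" using c(1) by (simp add: ring_center_def)
  have nz: "\<iota> s \<noteq> \<zero>" using s iota_eq_0_iff by simp
  have eq: "c \<otimes> \<iota> s = \<iota> b" using b s nz by (simp add: z m_assoc)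
  have "b \<noteq> 0" using z b s nz c(2) by auto
  have "V c + V (\<iota> s) = V (\<iota> b)"
    using valn_mult[OF V(1) cc iota_closed[OF s(1)] c(2) nz] eq by simp
  also have "\<dots> = V (\<iota> s)"
    using V(2)[OF b(1) \<open>b \<noteq> 0\<close>] V(2)[OF s(1,3)] val_B_component[OF b(2) \<open>b \<noteq> 0\<close>] val_B_component[OF s(2,3)] by simp
  finally show ?thesis by simp
qed

lemma not_weyl1:
  assumes a: "a \<notin> \<rat>" and "weyl_hom F Q 1 h" "fracs_of (h ` carrier (weyl_free 1 F))"
  shows False
proof -
  obtain V :: "'q \<Rightarrow> int \<times> int \<times> int" where V: "valn (carrier Q) V"
    "\<And>f. f \<in> A \<Longrightarrow> f \<noteq> 0 \<Longrightarrow> V (\<iota> f) = val wphi f" using R_valuation by blast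
  have VX: "V (\<iota> (Var i)) = wphi (unit_exp i)" "\<iota> (Var i) \<in> carrier Q" "\<iota> (Var i) \<noteq> \<zero>" if "i < 3" for i
  proof -
    have "val wphi (Var i :: 'k laurent) = wphi (unit_exp i)" by (simp add: Var_def)
    then show "V (\<iota> (Var i)) = wphi (unit_exp i)" "\<iota> (Var i) \<in> carrier Q" "\<iota> (Var i) \<noteq> \<zero>"
      using that n2 V(2)[of "Var i"] iota_eq_0_iff[of "Var i"] X_in[of i] by auto
  qed
  have w: "wphi (unit_exp 0) = (0, 0, 1)" "wphi (unit_exp 1) = (1, - 1, 1)" "wphi (unit_exp 2) = (2, 0, 1)"
    using n2 by (auto simp: wphi_def lookup_single)
  have s3: "(\<Sum>i<3. \<Sum>l<\<alpha> i. V (\<iota> (Var i))) = (int (\<alpha> 1) + 2 * int (\<alpha> 2), - int (\<alpha> 1), int (\<alpha> 0) + int (\<alpha> 1) + int (\<alpha> 2))"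
    for \<alpha> :: "nat \<Rightarrow> nat"
  proof -
    have "(\<Sum>i<3. \<Sum>l<\<alpha> i. V (\<iota> (Var i))) = (\<Sum>i<3. \<Sum>l<\<alpha> i. wphi (unit_exp i))"
      by (intro sum.cong refl) (simp add: VX(1))
    moreover have "{..<3::nat} = {0, 1, 2}" by auto
    ultimately show ?thesis by (simp add: w[simplified] sum_pair)
  qed
  show False
  proof (rule weyl1_growth[OF assms(2,3) V(1), of "\<lambda>i. \<iota> (Var i)"])
    fix \<alpha> \<beta> :: "nat \<Rightarrow> nat"
    assume "(\<Sum>i<3. \<Sum>l<\<alpha> i. V (\<iota> (Var i))) = (\<Sum>i<3. \<Sum>l<\<beta> i. V (\<iota> (Var i)))"
    then have e: "\<alpha> 0 = \<beta> 0 \<and> \<alpha> 1 = \<beta> 1 \<and> \<alpha> 2 = \<beta> 2" unfolding s3 by auto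
    have "i = 0 \<or> i = 1 \<or> i = 2" if "i < 3" for i :: nat using that by auto
    then show "\<forall>i<3. \<alpha> i = \<beta> i" using e by metis
  qed (use VX center_valuation[OF a V] in auto)
qed

text \<open>The quotient of two nonzero members of one component of \<open>B\<close> lies in
  \<open>K\<close> and is central. Over the centre any nonzero member therefore spans its component,
  and weight \<open>w\<close> leaves one vector for each power of \<open>zed\<close> up to
  \<open>w\<close>.\<close>

lemma zed_span_Span:
  assumes a: "a \<notin> \<rat>" and f: "f \<in> zed_span n d w"
    and Us: "set Us \<subseteq> carrier Q"
    and sd: "\<And>j. j \<le> nat w \<Longrightarrow> B_component n (d, w - int j) \<noteq> {0 :: 'k laurent} \<Longrightarrow>
      \<exists>s \<in> B_component n (d, w - int j) - {0}. loc s \<otimes> loc (zed ^ j) \<in> set Us"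
  shows "loc f \<in> Span (ring_center Q) Us"
  using f
proof (induction f rule: zed_span.induct)
  case zero
  show ?case using Span_subgroup_props(2)[OF center_subfield Us] by simp
next
  case (add b j f)
  note K = center_subfield
  have bz: "keys (b * zed ^ j) \<subseteq> loc_exps n" by (rule mult_loc[OF B_loc[OF add(1)] zed_loc])
  have "loc (b * zed ^ j) \<in> Span (ring_center Q) Us"
  proof (cases "b = 0")
    case True
    then show ?thesis using Span_subgroup_props(2)[OF K Us] by simp
  next
    case False
    then have "\<not> snd (d, w - int j) < 0" using B_component_neg[OF add(1)] by blast
    then have "j \<le> nat w" by simp
    then obtain s where s: "s \<in> B_component n (d, w - int j)" "s \<noteq> 0" "loc s \<otimes> loc (zed ^ j) \<in> set Us"
      using sd[of j] add(1) False by blast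
    have c: "loc b \<in> carrier Q" "loc s \<in> carrier Q" "loc s \<noteq> \<zero>" "loc (zed ^ j) \<in> carrier Q"
      using B_loc[OF add(1)] B_loc[OF s(1)] loc_neq_0[OF B_loc[OF s(1)] s(2)] zed_loc by auto
    have "loc b \<otimes> inv (loc s) \<in> K_field n Q \<iota>"
      unfolding K_field_def Qgr_B_component_def using s add(1)
      by (intro CollectI exI[of _ b] exI[of _ s] exI[of _ "(d, w - int j)"]) simp
    then have k: "loc b \<otimes> inv (loc s) \<in> ring_center Q" using K_field_central by blast
    have "loc (b * zed ^ j) = loc b \<otimes> loc (zed ^ j)"
      by (rule loc_mult[OF B_loc[OF add(1)] zed_loc B_component_Delta[OF add(1)]])
    also have "\<dots> = (loc b \<otimes> inv (loc s)) \<otimes> (loc s \<otimes> loc (zed ^ j))" using c by (simp add: m_assoc)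
    also have "\<dots> \<in> Span (ring_center Q) Us"
      using Span_smult_closed[OF K Us k] Span_base_incl[OF K Us] s(3) by blast
    finally show ?thesis .
  qed
  then show ?case
    using Span_subgroup_props(3)[OF K Us] add(3) loc_add[OF bz zed_span_loc[OF add(2)]] by simp
qed

text \<open>In degree at most N, weights are at most nN. One representative per component of
  \<open>B\<close> and one power of \<open>zed\<close> give at most (nN + 1)^3 spanning vectors over
  the centre, too few for four independent values.\<close>

lemma not_weyl2:
  assumes a: "a \<notin> \<rat>" and "weyl_hom F Q m h" "fracs_of (h ` carrier (weyl_free m F))" "2 \<le> m"
  shows False
proof -
  obtain V :: "'q \<Rightarrow> int \<times> int \<times> int \<times> int \<times> int" and g where V: "valn (carrier Q) V"
    "\<And>c. c \<in> ring_center Q \<Longrightarrow> c \<noteq> \<zero> \<Longrightarrow> V c = 0"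
    "\<And>i. i < 4 \<Longrightarrow> g i \<in> carrier Q" "\<And>i. i < 4 \<Longrightarrow> g i \<noteq> \<zero>"
    "\<And>\<alpha> \<beta> :: nat \<Rightarrow> nat. (\<Sum>i<4. \<Sum>l<\<alpha> i. V (g i)) = (\<Sum>i<4. \<Sum>l<\<beta> i. V (g i)) \<Longrightarrow> \<forall>i<4. \<alpha> i = \<beta> i"
    using weyl2_valuation[OF assms(2,3,4) char_0] by blast
  define D where "D N = {f \<in> A. \<forall>m\<in>keys f. deg_exp n m \<le> int N}" for N
  \<comment> \<open>A representative of each component, nonzero whenever the component is
    nonzero.\<close>
  define sd where "sd d w = (SOME s :: 'k laurent. s \<in> B_component n (int d, int w) \<and> (B_component n (int d, int w) \<noteq> {0 :: 'k laurent} \<longrightarrow> s \<noteq> 0))" for d w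
  have sd: "sd d w \<in> B_component n (int d, int w) \<and> (B_component n (int d, int w) \<noteq> {0 :: 'k laurent} \<longrightarrow> sd d w \<noteq> 0)" for d w
    unfolding sd_def
  proof (rule someI_ex)
    let ?B = "B_component n (int d, int w) :: 'k laurent set"
    have 0: "0 \<in> ?B" by simp
    show "\<exists>s. s \<in> ?B \<and> (?B \<noteq> {0} \<longrightarrow> s \<noteq> 0)"
    proof (cases "?B = {0}")
      case True
      then show ?thesis using 0 by (intro exI[of _ 0]) simp
    next
      case False
      then obtain s where "s \<in> ?B" "s \<noteq> 0" using 0 unfolding set_eq_iff singleton_iff by metis
      then show ?thesis by (intro exI[of _ s]) simp
    qed
  qed
  \<comment> \<open>Triples of the degree, the weight of the coefficient and the exponent of
    \<open>zed\<close>.\<close>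
  define ix where "ix N = List.product [0..<Suc N] (List.product [0..<Suc (n * N)] [0..<Suc (n * N)])" for N
  define el where "el = (\<lambda>(d, w, j). loc (sd d w) \<otimes> loc (zed ^ j))"
  define L where "L N = map el (ix N)" for N
  have ixset: "set (ix N) = {..N} \<times> {..n * N} \<times> {..n * N}" for N
    by (simp add: ix_def atLeastLessThanSuc_atLeastAtMost atLeast0AtMost del: upt_Suc)
  have Lset: "set (L N) \<subseteq> carrier Q" for N
  proof -
    have "loc (sd d w) \<in> carrier Q" for d w using B_loc[OF conjunct1[OF sd]] by (rule loc_closed)
    then show ?thesis using loc_closed[OF zed_loc] by (auto simp: L_def el_def)
  qed
  \<comment> \<open>Each variable has weight at most \<open>n\<close>, so a bound on the degree also
    bounds the weight.\<close>
  have degree_bounds: "0 \<le> deg_exp n m \<and> 0 \<le> wt_exp n m \<and> wt_exp n m \<le> int n * deg_exp n m" if "m \<in> poly_exps n" for m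
  proof -
    have nn: "0 \<le> lookup m i" for i using that by (simp add: poly_exps_def)
    have "wt_exp n m \<le> (\<Sum>i\<le>n. int n * lookup m i)"
      unfolding wt_exp_def by (intro sum_mono mult_right_mono) (use nn in auto)
    then show ?thesis
      using nn by (auto simp: deg_exp_def wt_exp_def sum_distrib_left intro!: sum_nonneg)
  qed
  have span: "\<iota> f \<in> Span (ring_center Q) (L N)" if f: "f \<in> D N" for f N
  proof -
    have kf: "keys f \<subseteq> {m \<in> poly_exps n. deg_exp n m \<le> int N}" using f by (auto simp: D_def poly_carrier_iff)
    have "f \<in> A \<and> \<iota> f \<in> Span (ring_center Q) (L N)"
      using kf
    proof (induction f rule: laurent_induct_on)
      case zero
      show ?case using Span_subgroup_props(2)[OF center_subfield Lset] by simp
    next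
      case (add m c f)
      define d where "d = nat (deg_exp n m)" define w where "w = nat (wt_exp n m)"
      have dw: "deg_exp n m = int d" "wt_exp n m = int w" "d \<le> N" "w \<le> n * N"
      proof -
        note b = degree_bounds[of m]
        show 1: "deg_exp n m = int d" "wt_exp n m = int w" "d \<le> N" using b add(1) by (auto simp: d_def w_def)
        have "int w \<le> int n * int N" using b add(1) 1 by (smt (verit) mem_Collect_eq mult_left_mono of_nat_0_le_iff)
        then show "w \<le> n * N" by (metis of_nat_le_iff of_nat_mult)
      qed
      have m: "single m c \<in> A" using add(1) by (simp add: poly_carrier_iff)
      have zs: "single m c \<in> zed_span n (int d) (int w)"
        using single_in_zed_span[of m n c] add(1) poly_exps_subset dw by auto
      have "loc (single m c) \<in> Span (ring_center Q) (L N)"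
      proof (rule zed_span_Span[OF a zs Lset])
        fix j assume j: "j \<le> nat (int w)" "B_component n (int d, int w - int j) \<noteq> {0 :: 'k laurent}"
        have e: "int w - int j = int (w - j)" using j(1) by linarith
        have "sd d (w - j) \<in> B_component n (int d, int w - int j) - {0}"
          using sd[of d "w - j"] j(2) unfolding e by blast
        moreover have "el (d, w - j, j) \<in> set (L N)"
          unfolding L_def set_map ixset using dw j by (intro imageI) auto
        ultimately show "\<exists>s\<in>B_component n (int d, int w - int j) - {0}. loc s \<otimes> loc (zed ^ j) \<in> set (L N)"
          unfolding el_def by auto
      qed
      then have "\<iota> (single m c) \<in> Span (ring_center Q) (L N)" using loc_iota[OF m] by simp
      then show ?case
        using add(2) m Span_subgroup_props(3)[OF center_subfield Lset] by (simp add: iota_add poly_carrier_add)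
    qed
    then show ?thesis by blast
  qed
  show False
  proof (rule growth_contradiction[where K = "ring_center Q" and V = V and S = "\<iota> ` A" and W = "\<lambda>N. \<iota> ` D N"
        and L = L and c = n and p = 3 and u = g])
    show "subfield (ring_center Q) Q" by (rule center_subfield)
    show "subring (\<iota> ` A) Q" by (rule image_subring)
    show "fracs_of (\<iota> ` A)" by (rule image_fracs)
    have "\<exists>N. f \<in> D N" if f: "f \<in> A" for f
    proof -
      have "deg_exp n m \<le> int (nat (Max (insert 0 (deg_exp n ` keys f))))" if "m \<in> keys f" for m
      proof -
        have "deg_exp n m \<le> Max (insert 0 (deg_exp n ` keys f))" by (intro Max_ge) (use that in auto)
        then show ?thesis by linarith
      qed
      then have "f \<in> D (nat (Max (insert 0 (deg_exp n ` keys f))))" using f by (simp add: D_def)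
      then show ?thesis by blast
    qed
    then have "A = (\<Union>N. D N)" by (auto simp: D_def)
    then show "\<iota> ` A = (\<Union>N. \<iota> ` D N)" by (simp only: image_UN)
    show "x \<otimes> y \<in> \<iota> ` D (i + j)" if xy: "x \<in> \<iota> ` D i" "y \<in> \<iota> ` D j" for x y i j
    proof -
      obtain f g where fg: "f \<in> D i" "g \<in> D j" "x = \<iota> f" "y = \<iota> g" using xy by blast
      then have "star n a f g \<in> D (i + j)"
        using deg_star[of f n "int i" g "int j" _ a] poly_carrier_star[of f n g a] by (auto simp: D_def)
      moreover have "x \<otimes> y = \<iota> (star n a f g)" using fg by (simp add: D_def iota_star)
      ultimately show ?thesis by blast
    qed
    have "1 \<in> D 0" by (simp add: D_def)
    then show "\<one> \<in> \<iota> ` D 0" using iota_one by (metis imageI)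
    show "\<iota> ` D i \<subseteq> \<iota> ` D j" if "i \<le> j" for i j
      using that by (intro image_mono) (force simp: D_def)
    show "\<iota> ` D N \<subseteq> Span (ring_center Q) (L N)" for N using span by blast
    show "length (L N) \<le> (n * N + 1) ^ 3" for N
    proof -
      have "length (L N) = Suc N * (Suc (n * N) * Suc (n * N))" by (simp add: L_def ix_def del: upt_Suc)
      moreover have "Suc N \<le> Suc (n * N)" using n2 by simp
      ultimately show ?thesis by (simp add: power3_eq_cube mult_le_mono1 algebra_simps del: mult_Suc mult_Suc_right)
    qed
    show "\<And>\<alpha> \<beta> :: nat \<Rightarrow> nat. (\<Sum>i<Suc 3. \<Sum>l<\<alpha> i. V (g i)) = (\<Sum>i<Suc 3. \<Sum>l<\<beta> i. V (g i)) \<Longrightarrow> \<forall>i<Suc 3. \<alpha> i = \<beta> i"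
      using V(5) by simp
  qed (use V(1-4) Lset in auto)
qed

lemma not_weyl:
  assumes a: "a \<notin> \<rat>" and W: "weyl_skewfield m F D \<eta>"
  shows "\<not> Q \<simeq> D"
proof
  assume "Q \<simeq> D"
  then obtain \<phi> where "\<phi> \<in> ring_iso Q D" by (auto simp: is_ring_iso_def)
  then have "weyl_skewfield m F Q (inv_into (carrier Q) \<phi> \<circ> \<eta>)"
    by (intro weyl_skewfield_iso[OF W] skew_axioms)
  then obtain h where h: "weyl_hom F Q m h" "fracs_of (h ` carrier (weyl_free m F))"
    using weyl_skewfield_hom by blast
  consider "m = 0" | "m = 1" | "2 \<le> m" by linarith
  then show False
  proof cases
    case 1
    \<comment> \<open>Noncommutativity is witnessed by X_1 and X_0: their commutator is X_0 times
      \<open>Gamma\<close> of X_0, that is \<open>a\<close> times the square of X_0.\<close>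
    have V: "Var 1 \<in> A" "Var 0 \<in> A" using X_in n2 by auto
    have z: "\<iota> (Var 1) \<otimes> \<iota> (Var 0) = \<iota> (Var 0) \<otimes> \<iota> (Var 1)"
      using weyl0_commutative[of F h] h V unfolding 1 by simp
    have "Gamma n a (Var 0) = Const a * Var 0"
      by (rule poly_mapping_eqI) (auto simp: Var_def gam_eq lookup_single when_def)
    then have "Gamma n a (Var 0) \<noteq> 0" using a by auto
    then have "\<iota> (Var 0) \<otimes> \<iota> (Gamma n a (Var 0)) \<noteq> \<zero>"
      using iota_eq_0_iff V poly_carrier_Gamma[of "Var 0" n a] by (intro mult_nonzero) auto
    moreover have "\<iota> (Var 0) \<otimes> \<iota> (Gamma n a (Var 0)) = \<zero>"
      using x1_commutator[OF V(2)] z V by (simp add: Delta_Var r_neg)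
    ultimately show False by blast
  next
    case 2
    show False by (rule not_weyl1[OF a h[unfolded 2]])
  next
    case 3
    show False by (rule not_weyl2[OF a h 3])
  qed
qed

end

section \<open>Fractions of commuting elements, and algebraicity of roots\<close>

lemma (in skew) frac_eqI:
  assumes c: "x \<in> carrier R" "y \<in> carrier R" "z \<in> carrier R" "w \<in> carrier R" "y \<noteq> \<zero>" "w \<noteq> \<zero>"
    and "x \<otimes> w = z \<otimes> y" "w \<otimes> y = y \<otimes> w"
  shows "x \<otimes> inv y = z \<otimes> inv w"
proof -
  have yw: "inv w \<otimes> y = y \<otimes> inv w" using inv_commute[of w y] assms by simp
  have "x \<otimes> inv y = x \<otimes> w \<otimes> inv w \<otimes> inv y" using c by (simp add: m_assoc)
  also have "\<dots> = z \<otimes> (y \<otimes> inv w) \<otimes> inv y" using c by (simp add: assms(7) m_assoc)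
  also have "\<dots> = z \<otimes> inv w" unfolding yw[symmetric] using c by (simp add: m_assoc)
  finally show ?thesis .
qed

lemma (in skew) frac_multI:
  assumes c: "x \<in> carrier R" "y \<in> carrier R" "z \<in> carrier R" "w \<in> carrier R" "y \<noteq> \<zero>" "w \<noteq> \<zero>"
    and "y \<otimes> z = z \<otimes> y" "w \<otimes> y = y \<otimes> w"
  shows "(x \<otimes> inv y) \<otimes> (z \<otimes> inv w) = (x \<otimes> z) \<otimes> inv (y \<otimes> w)"
proof -
  have yz: "inv y \<otimes> z = z \<otimes> inv y" using inv_commute[of y z] assms by simp
  have "inv (y \<otimes> w) = inv (w \<otimes> y)" using assms(8) by simp
  also have "\<dots> = inv y \<otimes> inv w" using c by (intro inv_mult)
  finally have i: "inv (y \<otimes> w) = inv y \<otimes> inv w" .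
  have "(x \<otimes> inv y) \<otimes> (z \<otimes> inv w) = x \<otimes> (inv y \<otimes> z) \<otimes> inv w" using c by (simp add: m_assoc)
  also have "\<dots> = (x \<otimes> z) \<otimes> inv (y \<otimes> w)" unfolding yz i using c by (simp add: m_assoc)
  finally show ?thesis .
qed

lemma (in field) algebraic_of_power:
  assumes k: "subfield k R" and x: "x \<in> carrier R" and N: "(N::nat) > 0" and xN: "x [^] N \<in> k"
  shows "\<not> transcendental k x"
proof -
  note ke = subringE[OF subfieldE(1)[OF k]]
  \<comment> \<open>The polynomial T^N - x^N, written with its leading coefficient at the head of
    the list.\<close>
  define p where "p = \<one> # replicate (N - 1) \<zero> @ [\<ominus> (x [^] N)]"
  have ev: "eval (replicate j \<zero> @ [c]) x = c" if "c \<in> carrier R" for j c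
    using that x by (induction j) auto
  have "eval p x = \<one> \<otimes> x [^] N \<oplus> \<ominus> (x [^] N)"
    using N x by (simp add: p_def ev)
  then have "eval p x = \<zero>" using x by (simp add: r_neg)
  moreover have "p \<in> carrier (univ_poly R k)"
    using ke(2,3) ke(5)[OF xN] by (auto simp: univ_poly_def polynomial_def p_def)
  moreover have "p \<noteq> []" by (simp add: p_def)
  ultimately show ?thesis using algebraicI[of p k x] by (simp add: over_def)
qed

context frac_R
begin

subsection \<open>Fractions of monomials\<close>

abbreviation "BE \<equiv> B_exponents n"

text \<open>A group of exponents: those of fractions of monomials in X_0 and the Y_j, where negative
  powers of every generator are allowed.\<close>

definition GE :: "exponent set" where "GE = {e. keys e \<subseteq> {0} \<union> {2..n}}"

definition Mb :: "exponent \<Rightarrow> 'q" where "Mb e = loc (B_monom n e)"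

definition mabs :: "exponent \<Rightarrow> exponent" where "mabs e = Poly_Mapping.map abs e"

text \<open>The splitting \<open>e = (e + mabs e) - mabs e\<close> picks, uniformly in
  \<open>e\<close>, a numerator and a denominator with nonnegative exponents at the Y_j. By
  \<open>gh_add\<close> this gives a homomorphism from the exponent group.\<close>

definition gh :: "exponent \<Rightarrow> 'q" where "gh e = Mb (e + mabs e) \<otimes> inv (Mb (mabs e))"

lemma Bmon_loc: "e \<in> BE \<Longrightarrow> keys (B_monom n e :: 'k laurent) \<subseteq> loc_exps n"
  using keys_B_monom[OF _ n2, of e] hom_exps_loc by blast

lemma BE_1: "e \<in> GE \<Longrightarrow> lookup e 1 = 0"
proof -
  assume "e \<in> GE"
  then have "1 \<notin> keys e" by (force simp: GE_def)
  then show ?thesis by (simp add: in_keys_iff)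
qed

lemma BE_GE: "BE \<subseteq> GE"
  by (auto simp: B_exponents_def GE_def)

lemma Bmon_neq_0: "e \<in> BE \<Longrightarrow> B_monom n e \<noteq> (0 :: 'k laurent)"
proof
  assume e: "e \<in> BE" and z: "B_monom n e = (0 :: 'k laurent)"
  have "lookup e 1 = 0" using BE_1 BE_GE e by blast
  then have "lookup (B_monom n e :: 'k laurent) e = (1 when e = e)" by (rule lookup_B_monom[OF e])
  then have "lookup (B_monom n e :: 'k laurent) e = 1" by simp
  then show False using z by simp
qed

lemma Mb_closed [simp]: "e \<in> BE \<Longrightarrow> Mb e \<in> carrier Q" and Mb_nz [simp]: "e \<in> BE \<Longrightarrow> Mb e \<noteq> \<zero>"
  using Bmon_loc loc_closed loc_neq_0 Bmon_neq_0 by (auto simp: Mb_def)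

lemma Mb_add: "e \<in> BE \<Longrightarrow> e' \<in> BE \<Longrightarrow> Mb (e + e') = Mb e \<otimes> Mb e'"
  by (simp add: Mb_def B_monom_add loc_mult Bmon_loc)

lemma Mb_comm: "e \<in> BE \<Longrightarrow> e' \<in> BE \<Longrightarrow> Mb e \<otimes> Mb e' = Mb e' \<otimes> Mb e"
  by (metis Mb_add add.commute)

lemma lookup_mabs: "lookup (mabs e) i = \<bar>lookup e i\<bar>"
  by (simp add: mabs_def Poly_Mapping.map.rep_eq when_def)

lemma mabs_BE: "e \<in> GE \<Longrightarrow> mabs e \<in> BE" and add_mabs_BE: "e \<in> GE \<Longrightarrow> e + mabs e \<in> BE"
proof -
  assume e: "e \<in> GE"
  have k: "keys (mabs e) = keys e" by (auto simp: in_keys_iff lookup_mabs)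
  then show "mabs e \<in> BE" using e by (auto simp: B_exponents_def GE_def lookup_mabs)
  have "keys (e + mabs e) \<subseteq> keys e" using k by (intro keys_add_subset) auto
  then show "e + mabs e \<in> BE" using e by (auto simp: B_exponents_def GE_def lookup_mabs lookup_add)
qed

lemma GE_add: "e \<in> GE \<Longrightarrow> e' \<in> GE \<Longrightarrow> e + e' \<in> GE"
  unfolding GE_def using keys_add_subset by blast

lemma GE_uminus: "e \<in> GE \<Longrightarrow> - e \<in> GE"
  by (auto simp: GE_def)

lemma GE_diff: "e \<in> GE \<Longrightarrow> e' \<in> GE \<Longrightarrow> e - e' \<in> GE"
  using GE_add[OF _ GE_uminus, of e e'] by simp

lemma GE_cmul: "e \<in> GE \<Longrightarrow> frag_cmul k e \<in> GE"
  by (auto simp: GE_def in_keys_iff)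

lemma GE_0 [simp]: "0 \<in> GE"
  by (simp add: GE_def)

lemma gh_eq:
  assumes "e1 \<in> BE" "e2 \<in> BE"
  shows "gh (e1 - e2) = Mb e1 \<otimes> inv (Mb e2)"
proof -
  let ?e = "e1 - e2"
  have e: "?e \<in> GE" using assms BE_GE GE_diff by blast
  note b = mabs_BE[OF e] add_mabs_BE[OF e]
  have "Mb (?e + mabs ?e) \<otimes> Mb e2 = Mb (?e + mabs ?e + e2)" by (rule Mb_add[symmetric, OF b(2) assms(2)])
  also have "?e + mabs ?e + e2 = e1 + mabs ?e" by (simp add: algebra_simps)
  also have "Mb \<dots> = Mb e1 \<otimes> Mb (mabs ?e)" by (rule Mb_add[OF assms(1) b(1)])
  finally show ?thesis
    unfolding gh_def using assms b by (intro frac_eqI) (auto intro: Mb_comm)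
qed

lemma gh_closed [simp]: "e \<in> GE \<Longrightarrow> gh e \<in> carrier Q" and gh_nz [simp]: "e \<in> GE \<Longrightarrow> gh e \<noteq> \<zero>"
  by (auto simp: gh_def mabs_BE add_mabs_BE mult_nonzero)

lemma gh_add:
  assumes "e \<in> GE" "e' \<in> GE"
  shows "gh (e + e') = gh e \<otimes> gh e'"
proof -
  note b = mabs_BE[OF assms(1)] add_mabs_BE[OF assms(1)] mabs_BE[OF assms(2)] add_mabs_BE[OF assms(2)]
  have "gh e \<otimes> gh e' = (Mb (e + mabs e) \<otimes> Mb (e' + mabs e')) \<otimes> inv (Mb (mabs e) \<otimes> Mb (mabs e'))"
    unfolding gh_def using b by (intro frac_multI) (auto intro: Mb_comm)
  also have "\<dots> = gh ((e + mabs e + (e' + mabs e')) - (mabs e + mabs e'))"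
    using b by (subst gh_eq) (auto simp: Mb_add B_exponents_add)
  also have "(e + mabs e + (e' + mabs e')) - (mabs e + mabs e') = e + e'" by (simp add: algebra_simps)
  finally show ?thesis by simp
qed

lemma gh_Mb: "e \<in> BE \<Longrightarrow> gh e = Mb e"
proof -
  assume e: "e \<in> BE"
  have "Mb 0 = \<one>" using loc_iota[of 1] by (simp add: Mb_def)
  moreover have "inv \<one> = \<one>" by simp
  ultimately show ?thesis using gh_eq[OF e, of 0] e by simp
qed

lemma gh_0 [simp]: "gh 0 = \<one>"
  using gh_Mb[of 0] loc_iota[of 1] by (simp add: Mb_def)

lemma gh_comm: "e \<in> GE \<Longrightarrow> e' \<in> GE \<Longrightarrow> gh e \<otimes> gh e' = gh e' \<otimes> gh e"
  by (metis gh_add add.commute)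

lemma gh_uminus: "e \<in> GE \<Longrightarrow> gh (- e) = inv (gh e)"
proof -
  assume e: "e \<in> GE"
  show ?thesis
    by (rule m_cancel_left[of "gh e"]) (use e gh_add[OF e GE_uminus[OF e]] GE_uminus[OF e] in auto)
qed

lemma gh_pow: "e \<in> GE \<Longrightarrow> gh e [^] (k::nat) = gh (frag_cmul (int k) e)"
proof (induction k)
  case (Suc k)
  have "frag_cmul (int (Suc k)) e = frag_cmul (int k) e + e"
    by (rule poly_mapping_eqI) (simp add: lookup_add algebra_simps)
  then show ?case using Suc gh_add[OF GE_cmul[OF Suc(2)] Suc(2), of "int k"] by simp
qed simp

text \<open>Multiplying by the monomial with exponent \<open>e2\<close>, the sum of all
  \<open>mabs e\<close>, turns the fractions into distinct monomials of \<open>B\<close>. Their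
  coefficients are then read off at exponents free of X_1.\<close>

lemma gh_independent:
  assumes E: "finite E" "E \<subseteq> GE" and z: "(\<Oplus>e\<in>E. kap (c e) \<otimes> gh e) = \<zero>" and e: "e \<in> E"
  shows "c e = 0"
proof -
  define e2 where "e2 = (\<Sum>e\<in>E. mabs e)"
  have lk: "lookup e2 i = (\<Sum>e\<in>E. \<bar>lookup e i\<bar>)" for i by (simp add: e2_def lookup_sum lookup_mabs)
  have k2: "keys e2 \<subseteq> {0} \<union> {2..n}"
    unfolding e2_def by (rule keys_sum_subset) (use E(2) mabs_BE in \<open>auto simp: B_exponents_def\<close>)
  have e2: "e2 \<in> BE" using k2 by (auto simp: B_exponents_def lk intro: sum_nonneg)
  have ee2: "e + e2 \<in> BE" if "e \<in> E" for e
  proof -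
    have "0 \<le> lookup e i + lookup e2 i" for i
    proof -
      have "\<bar>lookup e i\<bar> \<le> lookup e2 i" unfolding lk by (rule member_le_sum) (use that E in auto)
      then show ?thesis by linarith
    qed
    moreover have "keys (e + e2) \<subseteq> {0} \<union> {2..n}"
      using k2 that E(2) by (intro keys_add_subset) (auto simp: GE_def)
    ultimately show ?thesis by (auto simp: B_exponents_def lookup_add)
  qed
  have term_eq: "kap (c e) \<otimes> gh e \<otimes> Mb e2 = loc (Const (c e) * B_monom n (e + e2))" if "e \<in> E" for e
  proof -
    have g: "e \<in> GE" "e2 \<in> GE" using that E(2) e2 BE_GE by auto
    have "kap (c e) \<otimes> gh e \<otimes> Mb e2 = kap (c e) \<otimes> Mb (e + e2)"
      using g gh_add[OF g] gh_Mb[OF e2] gh_Mb[OF ee2[OF that]] e2 by (simp add: m_assoc)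
    also have "\<dots> = loc (Const (c e)) \<otimes> loc (B_monom n (e + e2))"
      by (simp add: Mb_def loc_iota poly_carrier_Const)
    also have "\<dots> = loc (Const (c e) * B_monom n (e + e2))"
      by (rule loc_mult[symmetric, OF _ Bmon_loc[OF ee2[OF that]]])
        (use poly_carrier_Const[of "c e" n] poly_exps_subset in \<open>auto simp: poly_carrier_iff\<close>)
    finally show ?thesis .
  qed
  have ks: "keys (\<Sum>e\<in>E'. Const (c e) * B_monom n (e + e2) :: 'k laurent) \<subseteq> loc_exps n" if "E' \<subseteq> E" for E'
    by (rule keys_sum_subset) (use that Bmon_loc[OF ee2] keys_Const_mult in blast)
  have sum: "(\<Oplus>e\<in>E'. kap (c e) \<otimes> gh e) \<otimes> Mb e2 = loc (\<Sum>e\<in>E'. Const (c e) * B_monom n (e + e2))"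
    if "finite E'" "E' \<subseteq> E" for E'
    using that
  proof (induction E')
    case (insert e' E')
    have cl: "(\<lambda>e. kap (c e) \<otimes> gh e) \<in> E' \<rightarrow> carrier Q" "kap (c e') \<otimes> gh e' \<in> carrier Q"
      using insert(4) E(2) by auto
    have "(\<Oplus>e\<in>insert e' E'. kap (c e) \<otimes> gh e) \<otimes> Mb e2 =
        kap (c e') \<otimes> gh e' \<otimes> Mb e2 \<oplus> (\<Oplus>e\<in>E'. kap (c e) \<otimes> gh e) \<otimes> Mb e2"
      using insert(1,2) cl e2 by (simp add: l_distr)
    also have "\<dots> = loc (Const (c e') * B_monom n (e' + e2)) \<oplus> loc (\<Sum>e\<in>E'. Const (c e) * B_monom n (e + e2))"
      using insert term_eq[of e'] by simp
    also have "\<dots> = loc (\<Sum>e\<in>insert e' E'. Const (c e) * B_monom n (e + e2))"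
      using insert ks[of "{e'}"] ks[of E'] by (simp add: loc_add)
    finally show ?case .
  qed (use e2 in simp)
  let ?S = "\<Sum>e\<in>E. Const (c e) * B_monom n (e + e2) :: 'k laurent"
  have "loc ?S = \<zero>" using sum[OF E(1) subset_refl] z e2 by simp
  then have S0: "?S = 0" using loc_neq_0[OF ks[OF subset_refl]] by blast
  have l1: "lookup (e + e2) 1 = 0" using BE_1 ee2[OF e] BE_GE by blast
  have lm: "lookup (B_monom n (e' + e2) :: 'k laurent) (e + e2) = (1 when e + e2 = e' + e2)" if "e' \<in> E" for e'
    by (rule lookup_B_monom[OF ee2[OF that] l1])
  have "lookup ?S (e + e2) = (\<Sum>e'\<in>E. c e' * (1 when e + e2 = e' + e2))"
    unfolding lookup_sum lookup_Const_mult by (intro sum.cong refl) (simp only: lm)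
  also have "\<dots> = (\<Sum>e'\<in>E. if e' = e then c e' else 0)"
    by (intro sum.cong refl) (auto simp: when_def)
  also have "\<dots> = c e" using E(1) e by simp
  finally show ?thesis using S0 by simp
qed

subsection \<open>Eigenvectors\<close>

definition Zh :: 'q where "Zh = inv (\<iota> (Var 0)) \<otimes> \<iota> (Var 1)"

text \<open>Eigenvectors of the inner derivation of \<open>Zh\<close>. Eigenvalues add under
  products and change sign under inversion.\<close>

definition eig :: "'k \<Rightarrow> 'q \<Rightarrow> bool" where
  "eig g u \<longleftrightarrow> u \<in> carrier Q \<and> u \<noteq> \<zero> \<and> Zh \<otimes> u = u \<otimes> Zh \<oplus> kap g \<otimes> u"

lemma x0x1: "\<iota> (Var 0) \<in> carrier Q" "\<iota> (Var 0) \<noteq> \<zero>" "\<iota> (Var 1) \<in> carrier Q"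
  using X_in[of 0] X_in[of 1] n2 iota_eq_0_iff[OF X_in[of 0]] by auto

lemma Zh_closed [simp]: "Zh \<in> carrier Q"
  using x0x1 by (simp add: Zh_def)

lemma kap_left_comm: "u \<in> carrier Q \<Longrightarrow> v \<in> carrier Q \<Longrightarrow> u \<otimes> (kap g \<otimes> v) = kap g \<otimes> (u \<otimes> v)"
  using kap_comm[of u g] by (simp add: m_assoc[symmetric])

lemma eig_mult:
  assumes "eig g u" "eig g' v"
  shows "eig (g + g') (u \<otimes> v)"
proof -
  have c: "u \<in> carrier Q" "u \<noteq> \<zero>" "v \<in> carrier Q" "v \<noteq> \<zero>"
    and u: "Zh \<otimes> u = u \<otimes> Zh \<oplus> kap g \<otimes> u" and v: "Zh \<otimes> v = v \<otimes> Zh \<oplus> kap g' \<otimes> v"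
    using assms by (auto simp: eig_def)
  have "Zh \<otimes> (u \<otimes> v) = (Zh \<otimes> u) \<otimes> v" using c by (simp add: m_assoc)
  also have "\<dots> = u \<otimes> (Zh \<otimes> v) \<oplus> kap g \<otimes> (u \<otimes> v)" unfolding u using c by (simp add: l_distr m_assoc)
  also have "\<dots> = u \<otimes> v \<otimes> Zh \<oplus> (kap g' \<otimes> (u \<otimes> v) \<oplus> kap g \<otimes> (u \<otimes> v))"
    unfolding v using c by (simp add: r_distr m_assoc kap_left_comm a_assoc)
  also have "kap g' \<otimes> (u \<otimes> v) \<oplus> kap g \<otimes> (u \<otimes> v) = kap (g + g') \<otimes> (u \<otimes> v)"
    using c by (simp add: kap_add l_distr a_comm)
  finally show ?thesis using c by (simp add: eig_def mult_nonzero)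
qed

lemma eig_inv:
  assumes "eig g u"
  shows "eig (- g) (inv u)"
proof -
  have c: "u \<in> carrier Q" "u \<noteq> \<zero>" and u: "Zh \<otimes> u = u \<otimes> Zh \<oplus> kap g \<otimes> u"
    using assms by (auto simp: eig_def)
  have "inv u \<otimes> Zh = inv u \<otimes> (Zh \<otimes> u) \<otimes> inv u" using c by (simp add: m_assoc)
  also have "\<dots> = Zh \<otimes> inv u \<oplus> kap g \<otimes> inv u"
    unfolding u using c by (simp add: r_distr l_distr m_assoc kap_left_comm)
  finally have "inv u \<otimes> Zh \<oplus> kap (- g) \<otimes> inv u = Zh \<otimes> inv u \<oplus> (kap g \<otimes> inv u \<oplus> \<ominus> (kap g \<otimes> inv u))"
    using c by (simp add: kap_uminus l_minus a_assoc)
  then show ?thesis using c by (simp add: eig_def r_neg)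
qed

lemma eig_iota:
  assumes h: "h \<in> A" "h \<noteq> 0" "Delta n h = 0" and G: "\<And>m. m \<in> keys h \<Longrightarrow> gam n a m = g"
  shows "eig g (\<iota> h)"
proof -
  have Gh: "Gamma n a h = Const g * h"
    by (rule poly_mapping_eqI) (use G in \<open>auto simp: in_keys_iff\<close>)
  let ?x0 = "\<iota> (Var 0)" and ?x1 = "\<iota> (Var 1)"
  have c: "\<iota> h \<in> carrier Q" "\<iota> h \<noteq> \<zero>" using h iota_eq_0_iff by auto
  have comm: "inv ?x0 \<otimes> \<iota> h = \<iota> h \<otimes> inv ?x0"
    using inv_commute[OF x0x1(1,2) c(1)] iota_kernel_comm[of "Var 0" h] X_in[of 0] h by (simp add: Delta_Var)
  have "?x1 \<otimes> \<iota> h = (?x1 \<otimes> \<iota> h \<oplus> \<ominus> (\<iota> h \<otimes> ?x1)) \<oplus> \<iota> h \<otimes> ?x1"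
    using c x0x1 by (simp add: a_assoc l_neg)
  also have "?x1 \<otimes> \<iota> h \<oplus> \<ominus> (\<iota> h \<otimes> ?x1) = ?x0 \<otimes> (kap g \<otimes> \<iota> h)"
    using x1_commutator[OF h(1,3)] h by (simp add: Gh iota_Const_mult)
  finally have "inv ?x0 \<otimes> (?x1 \<otimes> \<iota> h) = kap g \<otimes> \<iota> h \<oplus> (inv ?x0 \<otimes> \<iota> h) \<otimes> ?x1"
    using c x0x1 by (simp add: r_distr m_assoc)
  also have "\<dots> = \<iota> h \<otimes> Zh \<oplus> kap g \<otimes> \<iota> h"
    unfolding comm Zh_def using c x0x1 by (simp add: m_assoc a_comm)
  finally show ?thesis using c x0x1 by (simp add: eig_def Zh_def m_assoc)
qed

lemma eig_X0: "eig (of_nat N * a) (\<iota> (Var 0 ^ N))"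
proof (rule eig_iota)
  show "gam n a m = of_nat N * a" if "m \<in> keys (Var 0 ^ N :: 'k laurent)" for m
    using that by (auto simp: Var_power gam_eq split: if_splits)
qed (auto simp: X0_in)

lemma eig_Mb:
  assumes e: "e \<in> BE"
  shows "eig (a * of_int (fst (B_degree n e)) + of_int (snd (B_degree n e))) (Mb e)" (is "eig ?g _")
proof -
  obtain N where N: "Var 0 ^ N * B_monom n e \<in> A" using loc_clear_denominator[OF Bmon_loc[OF e]] .
  have "eig (of_nat N * a + ?g) (\<iota> (Var 0 ^ N * B_monom n e))"
  proof (rule eig_iota[OF N])
    show "Var 0 ^ N * B_monom n e \<noteq> (0 :: 'k laurent)" using Bmon_neq_0[OF e] by simp
    show "Delta n (Var 0 ^ N * B_monom n e :: 'k laurent) = 0" by (simp add: Delta_mult)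
    fix m assume "m \<in> keys (Var 0 ^ N * B_monom n e :: 'k laurent)"
    then obtain m' where m': "m' \<in> keys (B_monom n e :: 'k laurent)" "m = m' + single 0 (int N)"
      unfolding Var_0_power keys_X0_mult by blast
    then have "m' \<in> hom_exps n (fst (B_degree n e)) (snd (B_degree n e))" using keys_B_monom[OF e n2] by blast
    then show "gam n a m = of_nat N * a + ?g"
      unfolding m'(2) gam_add by (simp add: gam_eq hom_exps_def algebra_simps)
  qed
  from eig_mult[OF eig_inv[OF eig_X0[of N]] this] show ?thesis
    unfolding Mb_def loc_eq[OF N] by simp
qed

text \<open>The commutative power \<open>zed ^ j\<close> is not the j-th power of \<open>Zh\<close>
  in the skewfield, but the falling factorial Zh(Zh - 1)...(Zh - j + 1). In particular it lies in
  every subring containing the constants and \<open>Zh\<close>.\<close>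

lemma loc_zed_Suc: "loc (zed ^ Suc j) = (Zh \<oplus> kap (- of_nat j)) \<otimes> loc (zed ^ j)"
proof -
  have zX: "Var 0 ^ j * zed ^ j = (Var 1 ^ j :: 'k laurent)" for j
    by (simp add: zed_power Var_0_power mult.assoc[symmetric] X0_powi_mult)
  have XA: "Var 1 ^ j \<in> A" for j using n2 by (intro poly_carrier_power X_in) simp
  have lz: "loc (zed ^ j) = inv (\<iota> (Var 0 ^ j)) \<otimes> \<iota> (Var 1 ^ j)" for j
    using loc_eq[of j "zed ^ j"] XA[of j] by (simp add: zX)
  let ?x0 = "\<iota> (Var 0)" and ?x1 = "\<iota> (Var 1)" and ?u = "inv (\<iota> (Var 0 ^ j))" and ?y = "\<iota> (Var 1 ^ j)"
  define c where "c = of_nat j * (a + 1)"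
  have car: "?u \<in> carrier Q" "?y \<in> carrier Q" using XA by auto
  have G: "Gamma n a (Var 1 ^ j) = Const c * Var 1 ^ j"
  proof (rule poly_mapping_eqI)
    have "(\<Sum>x\<le>n. of_nat x * of_int (if Suc 0 = x then int j else 0)) = (\<Sum>x\<le>n. if Suc 0 = x then of_nat j else 0 :: 'k)"
      by (intro sum.cong) auto
    also have "\<dots> = of_nat j" using n2 by simp
    finally have g: "gam n a (single 1 (int j)) = c"
      using n2 by (simp add: gam_eq lookup_single when_def c_def algebra_simps deg_exp_def wt_exp_def)
    show "lookup (Gamma n a (Var 1 ^ j)) m = lookup (Const c * Var 1 ^ j) m" for m
      by (cases "m = single 1 (int j)") (simp_all add: Var_power lookup_single when_def g[simplified])
  qed
  have "star n a (Var 1) (Var 1 ^ j) = Var 1 ^ Suc j + Var 0 * (Const c * Var 1 ^ j)"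
    using star_Var1[of n a "Var 1 ^ j"] n2 by (simp add: G[simplified])
  then have "?x1 \<otimes> ?y = \<iota> (Var 1 ^ Suc j) \<oplus> ?x0 \<otimes> (kap c \<otimes> ?y)"
    using iota_star[OF X_in[of 1] XA[of j]] n2 XA[of j] XA[of "Suc j"] X_in[of 0]
      iota_mult[OF X_in[of 0] poly_carrier_mult[OF poly_carrier_Const XA[of j]], of c]
      poly_carrier_mult[OF X_in[of 0] poly_carrier_mult[OF poly_carrier_Const XA[of j]], of c]
    by (simp add: iota_add iota_Const_mult Delta_Var del: power_Suc)
  moreover have "\<iota> (Var 1 ^ Suc j) \<in> carrier Q" by (rule iota_closed[OF XA])
  ultimately have X1: "\<iota> (Var 1 ^ Suc j) = ?x1 \<otimes> ?y \<oplus> \<ominus> (?x0 \<otimes> (kap c \<otimes> ?y))"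
    using car x0x1 by (simp add: a_assoc r_neg del: power_Suc)
  have "\<iota> (Var 0 ^ Suc j) = ?x0 \<otimes> \<iota> (Var 0 ^ j)"
    using iota_mult[OF X_in[of 0] X0_in, of j] by (simp add: Delta_Var)
  then have i: "inv (\<iota> (Var 0 ^ Suc j)) = ?u \<otimes> inv ?x0" using x0x1 by (simp add: inv_mult del: power_Suc)
  have E: "Zh \<otimes> ?u = ?u \<otimes> Zh \<oplus> kap (- (of_nat j * a)) \<otimes> ?u" using eig_inv[OF eig_X0[of j]] by (simp add: eig_def)
  then have "Zh \<otimes> ?u \<oplus> kap (of_nat j * a) \<otimes> ?u = ?u \<otimes> Zh \<oplus> (kap (- (of_nat j * a)) \<otimes> ?u \<oplus> kap (of_nat j * a) \<otimes> ?u)"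
    using car by (simp add: a_assoc)
  also have "kap (- (of_nat j * a)) \<otimes> ?u \<oplus> kap (of_nat j * a) \<otimes> ?u = \<zero>"
    using car by (simp add: kap_uminus l_minus l_neg)
  finally have uZ: "?u \<otimes> Zh = Zh \<otimes> ?u \<oplus> kap (of_nat j * a) \<otimes> ?u" using car by simp
  have "loc (zed ^ Suc j) = ?u \<otimes> inv ?x0 \<otimes> (?x1 \<otimes> ?y \<oplus> \<ominus> (?x0 \<otimes> (kap c \<otimes> ?y)))"
    unfolding lz[of "Suc j"] X1 i by (rule refl)
  also have "\<dots> = (?u \<otimes> Zh) \<otimes> ?y \<oplus> \<ominus> (kap c \<otimes> (?u \<otimes> ?y))"
    using car x0x1 by (simp add: Zh_def r_distr r_minus m_assoc kap_left_comm)
  also have "\<dots> = Zh \<otimes> (?u \<otimes> ?y) \<oplus> (kap (of_nat j * a) \<otimes> (?u \<otimes> ?y) \<oplus> kap (- c) \<otimes> (?u \<otimes> ?y))"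
    unfolding uZ using car by (simp add: l_distr m_assoc a_assoc kap_uminus l_minus)
  also have "kap (of_nat j * a) \<otimes> (?u \<otimes> ?y) \<oplus> kap (- c) \<otimes> (?u \<otimes> ?y) = kap (of_nat j * a + - c) \<otimes> (?u \<otimes> ?y)"
    using car unfolding kap_add by (simp add: l_distr)
  \<comment> \<open>The dependence on \<open>a\<close> cancels: passing \<open>Zh\<close> across the
    inverse of X_0^j contributes ja, while \<open>Gamma\<close> on X_1^j contributes j(a + 1) with a
    minus sign.\<close>
  also have "of_nat j * a + - c = - of_nat j" by (simp add: c_def algebra_simps)
  finally show ?thesis unfolding lz[of j] using car by (simp add: l_distr)
qed

text \<open>Every monomial of \<open>A\<close> is a polynomial in \<open>zed\<close> over
  \<open>B\<close>, and the powers of \<open>zed\<close> are polynomials in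
  \<open>Zh\<close>.\<close>

lemma image_in_subring:
  assumes B: "subring B Q" "\<And>c. kap c \<in> B" "\<And>e. e \<in> BE \<Longrightarrow> Mb e \<in> B" "Zh \<in> B"
  shows "\<iota> ` A \<subseteq> B"
proof -
  note BE' = subringE[OF B(1)]
  have z: "loc (zed ^ j) \<in> B" for j
  proof (induction j)
    case 0
    show ?case using BE'(3) loc_iota[of 1] by simp
  next
    case (Suc j)
    then show ?case unfolding loc_zed_Suc using BE'(6,7) B(2,4) by blast
  qed
  have b: "loc b \<in> B" if "b \<in> B_component n d" for b d
    using that
  proof (induction b rule: B_component_induct)
    case (add e c f)
    have k: "keys (Const c * B_monom n e :: 'k laurent) \<subseteq> loc_exps n" using keys_Const_mult Bmon_loc[OF add(1)] by blast
    have "loc (Const c * B_monom n e) = loc (Const c) \<otimes> Mb e"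
      unfolding Mb_def by (rule loc_mult[OF _ Bmon_loc[OF add(1)]])
        (use poly_carrier_Const[of c n] poly_exps_subset in \<open>auto simp: poly_carrier_iff\<close>)
    then show ?case
      using add B(2,3) BE'(6,7) loc_add[OF k B_loc[OF add(3)]] by (simp add: loc_iota poly_carrier_Const)
  qed (use BE'(2) in simp)
  have s: "loc f \<in> B" if "f \<in> zed_span n d w" for f d w
    using that
  proof (induction f rule: zed_span.induct)
    case (add b' j f)
    have "keys (b' * zed ^ j) \<subseteq> loc_exps n" by (rule mult_loc[OF B_loc[OF add(1)] zed_loc])
    then show ?case
      using loc_mult[OF B_loc[OF add(1)] zed_loc B_component_Delta[OF add(1)], of j]
        b[OF add(1)] z[of j] add(3) BE'(6,7) loc_add zed_span_loc[OF add(2)] by simp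
  qed (use BE'(2) in simp)
  have "f \<in> A \<and> \<iota> f \<in> B" if "keys f \<subseteq> poly_exps n" for f
    using that
  proof (induction f rule: laurent_induct_on)
    case (add m c f)
    have m: "single m c \<in> A" using add(1) by (simp add: poly_carrier_iff)
    have "loc (single m c) \<in> B" using s[OF single_in_zed_span[of m n c]] add(1) poly_exps_subset by blast
    then show ?case using add(2) m BE'(7) loc_iota[OF m] by (simp add: iota_add poly_carrier_add)
  qed (use BE'(2) in simp)
  then show ?thesis by (auto simp: poly_carrier_iff)
qed

text \<open>Eigenvalue 0 means commuting with \<open>Zh\<close>, and monomial fractions commute
  among themselves, so the centralizer contains a generating set.\<close>

lemma gh_eigen_central:
  assumes e: "e \<in> GE" and E: "eig 0 (gh e)"
  shows "gh e \<in> ring_center Q"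
proof (rule center_of_fracs[OF image_fracs])
  have c: "gh e \<in> carrier Q" using e by simp
  have "\<iota> ` A \<subseteq> {x \<in> carrier Q. gh e \<otimes> x = x \<otimes> gh e}"
  proof (rule image_in_subring[OF centralizer_subring[OF c]])
    show "Zh \<in> {x \<in> carrier Q. gh e \<otimes> x = x \<otimes> gh e}" using E c by (simp add: eig_def)
    show "kap d \<in> {x \<in> carrier Q. gh e \<otimes> x = x \<otimes> gh e}" for d using kap_comm[OF c] by simp
    show "Mb e' \<in> {x \<in> carrier Q. gh e \<otimes> x = x \<otimes> gh e}" if "e' \<in> BE" for e'
      using gh_comm[OF e, of e'] that BE_GE gh_Mb[OF that] by auto
  qed
  then show "gh e \<otimes> s = s \<otimes> gh e" if "s \<in> \<iota> ` A" for s using that by blast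
qed (use e in auto)

end

subsection \<open>Recognising the first Weyl skewfield\<close>

context skew
begin

lemma fracs_of_mono: "fracs_of S \<Longrightarrow> S \<subseteq> T \<Longrightarrow> fracs_of T"
  unfolding fracs_of_def by blast

text \<open>
  The elements \<open>x\<close> such that every \<open>t\<^sup>M B\<close> contains some \<open>x t\<^sup>N\<close> form a ring containing \<open>t\<^sup>-\<^sup>1\<close>, and
  its fractions are fractions over \<open>B\<close>.
\<close>
lemma fracs_of_localisation:
  assumes B: "subring B R" "t \<in> B" "y \<in> B" "t \<noteq> \<zero>" and rel: "y \<otimes> t = t \<otimes> y \<oplus> \<one>"
    and L: "\<And>L. subring L R \<Longrightarrow> B \<inter> ring_center R \<subseteq> L \<Longrightarrow> t \<in> L \<Longrightarrow> inv t \<in> L \<Longrightarrow> y \<in> L \<Longrightarrow> fracs_of L"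
  shows "fracs_of B"
proof -
  note BE = subringE[OF B(1)]
  have c [simp]: "t \<in> carrier R" "y \<in> carrier R" using B BE(1) by auto
  have Bc [simp]: "w \<in> B \<Longrightarrow> w \<in> carrier R" for w using BE(1) by blast
  have tB: "t [^] (k::nat) \<in> B" for k using BE(3,6) B(2) by (induction k) auto
  have tn: "t [^] (k::nat) \<noteq> \<zero>" for k by (rule pow_nonzero) (use B in auto)
  define P where "P x M N \<longleftrightarrow> (\<exists>w\<in>B. x \<otimes> t [^] N = t [^] M \<otimes> w)" for x and M N :: nat
  define L where "L = {x \<in> carrier R. \<forall>M. \<exists>N. P x M N}"
  have up: "P x M N'" if h: "P x M N" and NN: "N \<le> N'" and cx: "x \<in> carrier R" for x M N N'
  proof -
    obtain w where w: "w \<in> B" "x \<otimes> t [^] N = t [^] M \<otimes> w" using h by (auto simp: P_def)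
    have "t [^] N' = t [^] N \<otimes> t [^] (N' - N)" using NN by (simp add: nat_pow_mult)
    then have "x \<otimes> t [^] N' = (x \<otimes> t [^] N) \<otimes> t [^] (N' - N)" using cx by (simp add: m_assoc)
    also have "\<dots> = t [^] M \<otimes> (w \<otimes> t [^] (N' - N))" unfolding w(2) using w by (simp add: m_assoc)
    finally show ?thesis unfolding P_def using BE(6)[OF w(1) tB] by blast
  qed
  have central: "x \<in> L" if x: "x \<in> B" "x \<in> ring_center R" for x
  proof -
    have "P x M M" for M using x by (auto simp: P_def ring_center_def intro!: bexI[of _ x])
    then show ?thesis using x by (auto simp: L_def)
  qed
  have sub: "subring L R"
  proof (rule subringI)
    show "L \<subseteq> carrier R" by (auto simp: L_def)
    show "\<one> \<in> L" using central[OF BE(3)] by (simp add: ring_center_def)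
  next
    fix x assume x: "x \<in> L"
    have "P (\<ominus> x) M N" if h: "P x M N" for M N
    proof -
      obtain w where w: "w \<in> B" "x \<otimes> t [^] N = t [^] M \<otimes> w" using h by (auto simp: P_def)
      have "\<ominus> x \<otimes> t [^] N = t [^] M \<otimes> (\<ominus> w)" using w x by (simp add: L_def l_minus r_minus)
      then show ?thesis unfolding P_def using BE(5)[OF w(1)] by blast
    qed
    then show "\<ominus> x \<in> L" using x unfolding L_def by blast
  next
    fix x x' assume x: "x \<in> L" "x' \<in> L"
    then have cx: "x \<in> carrier R" "x' \<in> carrier R" by (auto simp: L_def)
    have "\<exists>N. P (x \<otimes> x') M N" for M
    proof -
      obtain N where "P x M N" using x by (auto simp: L_def)
      then obtain w where w: "w \<in> B" "x \<otimes> t [^] N = t [^] M \<otimes> w" by (auto simp: P_def)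
      obtain N' where "P x' N N'" using x by (auto simp: L_def)
      then obtain w' where w': "w' \<in> B" "x' \<otimes> t [^] N' = t [^] N \<otimes> w'" by (auto simp: P_def)
      have "x \<otimes> x' \<otimes> t [^] N' = x \<otimes> t [^] N \<otimes> w'" using cx w' by (simp add: m_assoc)
      also have "\<dots> = t [^] M \<otimes> (w \<otimes> w')" unfolding w(2) using w w' by (simp add: m_assoc)
      finally show ?thesis unfolding P_def using BE(6)[OF w(1) w'(1)] by blast
    qed
    then show "x \<otimes> x' \<in> L" using cx by (simp add: L_def)
    have "\<exists>N. P (x \<oplus> x') M N" for M
    proof -
      obtain N where N: "P x M N" using x by (auto simp: L_def)
      obtain N' where N': "P x' M N'" using x by (auto simp: L_def)
      obtain w where w: "w \<in> B" "x \<otimes> t [^] (max N N') = t [^] M \<otimes> w"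
        using up[OF N max.cobounded1 cx(1), of N'] by (auto simp: P_def)
      obtain w' where w': "w' \<in> B" "x' \<otimes> t [^] (max N N') = t [^] M \<otimes> w'"
        using up[OF N' max.cobounded2 cx(2), of N] by (auto simp: P_def)
      have "(x \<oplus> x') \<otimes> t [^] (max N N') = t [^] M \<otimes> (w \<oplus> w')"
        using cx w w' by (simp add: l_distr r_distr)
      then show ?thesis unfolding P_def using BE(7)[OF w(1) w'(1)] by blast
    qed
    then show "x \<oplus> x' \<in> L" using cx by (simp add: L_def)
  qed
  have t: "t \<in> L"
  proof -
    have "P t M M" for M
      unfolding P_def using B(2) nat_pow_Suc[of t M] nat_pow_Suc2[of t M] by (intro bexI[of _ t]) simp_all
    then show ?thesis by (auto simp: L_def)
  qed
  have it: "inv t \<in> L"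
  proof -
    have "P (inv t) M (Suc M)" for M
      unfolding P_def nat_pow_Suc2[OF c(1)] using B(4) BE(3) by (intro bexI[of _ \<one>]) simp_all
    then show ?thesis using B(4) by (auto simp: L_def)
  qed
  have y: "y \<in> L"
  proof -
    \<comment> \<open>Moving \<open>y\<close> to the right across a power of \<open>t\<close> costs
      one factor of \<open>t\<close>, hence the shifted exponent.\<close>
    have "P y M (Suc M)" for M
    proof (induction M)
      case 0
      then show ?case unfolding P_def using BE(6)[OF B(3,2)] by (intro bexI[of _ "y \<otimes> t"]) simp_all
    next
      case (Suc M)
      then obtain w where w: "w \<in> B" "y \<otimes> t [^] Suc M = t [^] M \<otimes> w" by (auto simp: P_def)
      have "y \<otimes> t [^] Suc (Suc M) = (y \<otimes> t) \<otimes> t [^] Suc M"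
        unfolding nat_pow_Suc2[OF c(1), of "Suc M"] by (simp add: m_assoc)
      also have "\<dots> = t \<otimes> (y \<otimes> t [^] Suc M) \<oplus> t [^] Suc M"
        unfolding rel by (simp add: l_distr m_assoc del: nat_pow_Suc)
      also have "\<dots> = t \<otimes> t [^] M \<otimes> w \<oplus> t [^] Suc M" unfolding w(2) using w(1) by (simp add: m_assoc del: nat_pow_Suc)
      also have "\<dots> = t [^] Suc M \<otimes> (w \<oplus> \<one>)"
        unfolding nat_pow_Suc2[OF c(1), of M] using w(1) by (simp add: r_distr)
      finally show ?case unfolding P_def using BE(7)[OF w(1) BE(3)] by blast
    qed
    then show ?thesis unfolding L_def using c(2) by blast
  qed
  have frac: "fracs_of L" by (rule L[OF sub _ t it y]) (use central in auto)
  show ?thesis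
    unfolding fracs_of_def
  proof
    fix q assume "q \<in> carrier R"
    then obtain r s where rs: "r \<in> L" "s \<in> L - {\<zero>}" "q = r \<otimes> inv s" using fracs_ofE[OF frac] by metis
    then have crs: "r \<in> carrier R" "s \<in> carrier R" "s \<noteq> \<zero>" by (auto simp: L_def)
    obtain N where N: "P r 0 N" using rs by (auto simp: L_def)
    obtain N' where N': "P s 0 N'" using rs by (auto simp: L_def)
    let ?t = "t [^] (max N N')"
    have rt: "r \<otimes> ?t \<in> B" using up[OF N max.cobounded1 crs(1), of N'] by (auto simp: P_def)
    have st: "s \<otimes> ?t \<in> B" using up[OF N' max.cobounded2 crs(2), of N] by (auto simp: P_def)
    have "q = (r \<otimes> ?t) \<otimes> inv (s \<otimes> ?t)"
      unfolding rs(3) using crs tn by (simp add: inv_mult m_assoc)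
    moreover have "s \<otimes> ?t \<noteq> \<zero>" using crs tn by (intro mult_nonzero) auto
    ultimately show "\<exists>r\<in>B. \<exists>s\<in>B - {\<zero>}. q = r \<otimes> inv s" using rt st by blast
  qed
qed

text \<open>A single canonical pair gives two useful derivations; the general construction is filled
  up with zero derivations.\<close>

lemma weyl_valuation:
  assumes ty: "t \<in> carrier R" "y \<in> carrier R" and rel: "y \<otimes> t = t \<otimes> y \<oplus> \<one>"
    and char: "\<And>n. (n::nat) > 0 \<Longrightarrow> [n] \<cdot> \<one> \<noteq> \<zero>"
    and frac: "\<And>S. subring S R \<Longrightarrow> ring_center R \<subseteq> S \<Longrightarrow> t \<in> S \<Longrightarrow> y \<in> S \<Longrightarrow> fracs_of S"
  obtains V :: "'a \<Rightarrow> int \<times> int \<times> int \<times> int \<times> int" where "valn (carrier R) V"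
    "\<And>c. c \<in> ring_center R \<Longrightarrow> c \<noteq> \<zero> \<Longrightarrow> V c = 0" "V t = (1, 0)" "V y = (0, 1, 0)"
proof -
  \<comment> \<open>The sign makes \<open>ad (u 1) y = \<one>\<close>, and the zeros at the indices
    2 and 3 give trivial derivations.\<close>
  define u where "u = (\<lambda>i::nat. if i = 0 then y else if i = 1 then \<ominus> t else \<zero>)"
  have u [simp]: "u i \<in> carrier R" for i using ty by (simp add: u_def)
  note Z = subringE[OF center_subring]
  have yt: "ad y t = \<one>" using ty by (simp add: ad_def rel a_ac r_neg)
  have yt': "ad y (\<ominus> t) = \<ominus> \<one>"
    unfolding yt[symmetric] using ty by (simp add: ad_def r_minus l_minus minus_add)
  have ty': "ad (\<ominus> t) y = \<one>"
    using ty by (simp add: ad_def rel r_minus l_minus a_assoc[symmetric] l_neg)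
  have tt: "ad (\<ominus> t) t = \<zero>" "ad (\<ominus> t) (\<ominus> t) = \<zero>" "ad y y = \<zero>"
    using ty by (simp_all add: ad_def r_minus l_minus r_neg l_neg)
  have a0: "ad \<zero> x = \<zero>" "ad x \<zero> = \<zero>" if "x \<in> carrier R" for x
    using that by (simp_all add: ad_def)
  have az: "ad x c = \<zero>" if "c \<in> ring_center R" "x \<in> carrier R" for x c
    using that by (auto simp: ring_center_def ad_eq_zero_iff)
  have comm: "ad (u i) (u j) \<in> ring_center R" for i j
    using ty Z(2,3) Z(5)[OF Z(3)] by (simp add: u_def yt' ty' tt a0)
  have at: "ad (u i) t \<in> ring_center R" and ay: "ad (u i) y \<in> ring_center R" for i
    using ty Z(2,3) by (simp_all add: u_def yt ty' tt a0)
  define S where "S = {x \<in> carrier R. \<forall>i\<in>{..<4}. \<exists>k. (ad (u i) ^^ k) x = \<zero>}"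
  have S: "subring S R" unfolding S_def by (rule ad_nil_subring) simp
  have zS: "ring_center R \<subseteq> S"
  proof
    fix c assume c: "c \<in> ring_center R"
    have "(ad (u i) ^^ 1) c = \<zero>" for i using az[OF c u] by simp
    then show "c \<in> S" using c unfolding S_def ring_center_def by blast
  qed
  have two: "x \<in> S" if x: "x \<in> carrier R" "\<And>i. ad (u i) x \<in> ring_center R" for x
  proof -
    have "(ad (u i) ^^ Suc 1) x = \<zero>" for i using az[OF x(2) u] by simp
    then show ?thesis using x(1) unfolding S_def by blast
  qed
  have tS: "t \<in> S" and yS: "y \<in> S" using two ty at ay by auto
  obtain v :: "'a \<Rightarrow> int \<times> int \<times> int \<times> int \<times> int" where v: "valn S v"
      "\<And>c. c \<in> ring_center R \<Longrightarrow> c \<noteq> \<zero> \<Longrightarrow> v c = 0"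
      "\<And>g. g \<in> S \<Longrightarrow> ad (u 0) g = \<one> \<Longrightarrow> v g = (1, 0)"
      "\<And>g. g \<in> S \<Longrightarrow> ad (u 0) g = \<zero> \<Longrightarrow> ad (u 1) g = \<one> \<Longrightarrow> v g = (0, 1, 0)"
  proof (rule ad_valuation[of u, folded S_def])
    fix v :: "'a \<Rightarrow> int \<times> int \<times> int \<times> int \<times> int"
    assume "valn S v" "\<And>c. c \<in> ring_center R \<Longrightarrow> c \<noteq> \<zero> \<Longrightarrow> v c = 0"
      "\<And>g. g \<in> S \<Longrightarrow> ad (u 0) g = \<one> \<Longrightarrow> v g = (1, 0)"
      "\<And>g. g \<in> S \<Longrightarrow> ad (u 0) g = \<zero> \<Longrightarrow> ad (u 1) g = \<one> \<Longrightarrow> v g = (0, 1, 0)"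
    then show ?thesis by (rule that)
  qed (auto simp: comm char)
  obtain V where V: "valn (carrier R) V" "\<And>s. s \<in> S \<Longrightarrow> s \<noteq> \<zero> \<Longrightarrow> V s = v s"
    using valn_extend[OF S frac[OF S zS tS yS] v(1)] by blast
  have nz: "t \<noteq> \<zero>" "y \<noteq> \<zero>" using yt ty' ty a0 by auto
  show ?thesis
  proof (rule that[OF V(1)])
    show "V c = 0" if "c \<in> ring_center R" "c \<noteq> \<zero>" for c using V(2) v(2) that zS by auto
    show "V t = (1, 0)" using V(2)[OF tS nz(1)] v(3)[OF tS] yt by (simp add: u_def)
    show "V y = (0, 1, 0)" using V(2)[OF yS nz(2)] v(4)[OF yS] tt ty' by (simp add: u_def)
  qed
qed

text \<open>A nonzero term with exponents (i, j) has value (i, j, 0), so distinct terms have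
  distinct values and cannot cancel.\<close>

lemma weyl_monomials_independent:
  fixes V :: "'a \<Rightarrow> int \<times> int \<times> int \<times> int \<times> int"
  assumes V: "valn (carrier R) V" "\<And>c. c \<in> ring_center R \<Longrightarrow> c \<noteq> \<zero> \<Longrightarrow> V c = 0" "V t = (1, 0)" "V y = (0, 1, 0)"
    and ty: "t \<in> carrier R" "y \<in> carrier R" "t \<noteq> \<zero>" "y \<noteq> \<zero>"
    and c: "\<And>p. c p \<in> ring_center R" and fin: "finite P" and z: "(\<Oplus>p\<in>P. c p \<otimes> (t [^] fst p \<otimes> y [^] snd p)) = \<zero>"
    and p: "(p :: nat \<times> nat) \<in> P"
  shows "c p = \<zero>"
proof (rule ccontr)
  assume np: "c p \<noteq> \<zero>"
  define I where "I = {p \<in> P. c p \<noteq> \<zero>}"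
  define f where "f p = c p \<otimes> (t [^] fst p \<otimes> y [^] snd p)" for p
  have cc: "c p \<in> carrier R" for p using c by (simp add: ring_center_def)
  have fc [simp]: "f p \<in> carrier R" for p using cc ty by (simp add: f_def)
  have tn: "t [^] (k::nat) \<noteq> \<zero>" "y [^] (k::nat) \<noteq> \<zero>" for k using pow_nonzero[OF ty(1,3)] pow_nonzero[OF ty(2,4)] by auto
  have vf: "V (f p) = (int (fst p), int (snd p), 0)" if "p \<in> I" for p
  proof -
    have "V (f p) = V (c p) + (V (t [^] fst p) + V (y [^] snd p))"
      unfolding f_def using valn_mult[OF V(1)] cc ty tn that mult_nonzero[OF _ _ tn] by (simp add: I_def)
    also have "\<dots> = (\<Sum>l<fst p. (1, 0)) + (\<Sum>l<snd p. (0, 1, 0))"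
      using valn_pow[OF V(1)] ty V(2)[OF c] V(3,4) that by (simp add: I_def)
    also have "\<dots> = (int (fst p), int (snd p), 0)" by (simp add: sum_pair)
    finally show ?thesis .
  qed
  have "(\<Oplus>p\<in>P. f p) = (\<Oplus>p\<in>I. f p)"
    by (rule add.finprod_mono_neutral_cong_right) (use fin cc ty in \<open>auto simp: I_def f_def\<close>)
  moreover have "(\<Oplus>p\<in>I. f p) \<noteq> \<zero> \<and> V (\<Oplus>p\<in>I. f p) \<in> V ` f ` I"
  proof (rule finsum_distinct_valn[OF V(1)])
    show "finite I" using fin by (simp add: I_def)
    have "p \<in> I" using p np by (simp add: I_def)
    then show "I \<noteq> {}" by blast
    show "f p \<noteq> \<zero>" if "p \<in> I" for p
      unfolding f_def using that cc ty tn by (intro mult_nonzero) (auto simp: I_def)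
    show "inj_on (V \<circ> f) I" by (rule inj_onI) (auto simp: vf prod_eq_iff)
  qed simp
  ultimately show False using z by (simp add: f_def)
qed

text \<open>The map from the Weyl algebra is induced by evaluation on the free algebra. It is
  injective because the quotient has normal forms whose monomials stay independent over the centre
  in \<open>R\<close>. The hypothesis on fractions may use \<open>inv t\<close>, which is not in the
  Weyl algebra; \<open>fracs_of_localisation\<close> removes it.\<close>

lemma weyl_skewfieldI:
  fixes Fc t y
  defines "F \<equiv> R\<lparr>carrier := Fc\<rparr>"
  assumes Fc: "subfield Fc R" "Fc \<subseteq> ring_center R"
    and ty: "t \<in> carrier R" "y \<in> carrier R" and rel: "y \<otimes> t = t \<otimes> y \<oplus> \<one>"
    and char: "\<And>n. (n::nat) > 0 \<Longrightarrow> [n] \<cdot> \<one> \<noteq> \<zero>"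
    and frac: "\<And>L. subring L R \<Longrightarrow> Fc \<subseteq> L \<Longrightarrow> t \<in> L \<Longrightarrow> inv t \<in> L \<Longrightarrow> y \<in> L \<Longrightarrow> fracs_of L"
  obtains \<eta> where "weyl_skewfield 1 F R \<eta>" "\<And>c. c \<in> Fc \<Longrightarrow> \<eta> (weyl_scalar 1 F c) = c"
proof -
  define m1 :: nat where "m1 = 1"
  have m1: "i < m1 \<longleftrightarrow> i = 0" for i by (auto simp: m1_def)
  have fF: "field F" unfolding F_def by (rule subfield_iff(2)[OF Fc(1)])
  interpret F: field F by (rule fF)
  have cF: "carrier F = Fc" by (simp add: F_def)
  have Fcc: "c \<in> carrier R" if "c \<in> Fc" for c using that Fc(2) by (auto simp: ring_center_def)
  let ?A = "weyl_free m1 F" and ?I = "weyl_ideal m1 F" and ?W = "weyl_algebra m1 F"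
  define g where "g s = (case s of Pos (i::nat) \<Rightarrow> t | Mom i \<Rightarrow> y)" for s
  define ga where "ga = {Pos 0, Mom 0}"
  have gens: "weyl_gens m1 = ga" by (auto simp: weyl_gens_def ga_def m1)
  have idh: "(\<lambda>c. c) \<in> ring_hom F R" by (rule ring_hom_memI) (auto simp: F_def Fcc)
  obtain ev where ev: "ev \<in> ring_hom (free_algebra F ga) R"
    "\<And>c. c \<in> carrier F \<Longrightarrow> ev (free_scalar F c) = c" "\<And>s. s \<in> ga \<Longrightarrow> ev (free_gen F s) = g s"
  proof (rule F.free_eval[OF ring_axioms idh, where S = ga and g = g])
    show "g s \<in> carrier R" for s using ty by (simp add: g_def split: weyl_gen.split)
    show "c \<otimes> g s = g s \<otimes> c" if "c \<in> carrier F" for c s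
      using that Fc(2) ty by (auto simp: g_def cF ring_center_def split: weyl_gen.split)
  qed (rule that)
  have evA: "ev \<in> ring_hom ?A R" using ev(1) by (simp add: weyl_free_def gens)
  have evg: "ev (free_gen F (Pos 0)) = t" "ev (free_gen F (Mom 0)) = y" using ev(3) by (auto simp: ga_def g_def)
  interpret A: ring ?A unfolding weyl_free_def by (rule F.free_algebra_ring)
  interpret E: ring_hom_ring ?A R ev
    by (intro ring_hom_ring.intro ring_hom_ring_axioms.intro A.ring_axioms ring_axioms evA)
  interpret P: weyl_hom F ?W m1 "\<lambda>f. ?I +>\<^bsub>?A\<^esub> f" by (rule weyl_quotient(2)[OF fF])
  let ?p = "\<lambda>f. ?I +>\<^bsub>?A\<^esub> f"
  have gc: "free_gen F (Pos 0) \<in> carrier ?A" "free_gen F (Mom 0) \<in> carrier ?A"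
    using P.gen_closed P.gens[of 0] m1 by auto
  have evm: "ev (u \<ominus>\<^bsub>?A\<^esub> v) = ev u \<oplus> \<ominus> ev v" if "u \<in> carrier ?A" "v \<in> carrier ?A" for u v
    using that by (simp add: a_minus_def)
  have P0: "Pos 0 \<in> weyl_gens m1" and M0: "Mom 0 \<in> weyl_gens m1" by (auto simp: gens ga_def)
  have cc: "free_commutator m1 F s s' \<in> carrier ?A" if "s \<in> weyl_gens m1" "s' \<in> weyl_gens m1" for s s'
    by (rule P.commutator_closed[OF that])
  have ce: "ev (free_commutator m1 F s s') =
      ev (free_gen F s) \<otimes> ev (free_gen F s') \<oplus> \<ominus> (ev (free_gen F s') \<otimes> ev (free_gen F s))"
    if h: "s \<in> weyl_gens m1" "s' \<in> weyl_gens m1" for s s'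
  proof -
    note c = P.gen_closed[OF h(1)] P.gen_closed[OF h(2)]
    show ?thesis
      unfolding free_commutator_def evm[OF A.m_closed[OF c] A.m_closed[OF c(2,1)]]
        ring_hom_mult[OF evA c] ring_hom_mult[OF evA c(2,1)] by (rule refl)
  qed
  have rel_ker: "weyl_relations m1 F \<subseteq> a_kernel ?A R ev"
  proof
    fix r assume "r \<in> weyl_relations m1 F"
    then consider "r = free_commutator m1 F (Pos 0) (Pos 0)" | "r = free_commutator m1 F (Mom 0) (Mom 0)"
      | "r = free_commutator m1 F (Mom 0) (Pos 0) \<ominus>\<^bsub>?A\<^esub> \<one>\<^bsub>?A\<^esub>"
      by (auto simp: weyl_relations_def m1)
    then show "r \<in> a_kernel ?A R ev"
    proof cases
      case 1
      have "t \<otimes> t \<oplus> \<ominus> (t \<otimes> t) = \<zero>" using ty by (intro r_neg) simp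
      then show ?thesis unfolding 1 a_kernel_def' using cc[OF P0 P0] ce[OF P0 P0] evg by simp
    next
      case 2
      have "y \<otimes> y \<oplus> \<ominus> (y \<otimes> y) = \<zero>" using ty by (intro r_neg) simp
      then show ?thesis unfolding 2 a_kernel_def' using cc[OF M0 M0] ce[OF M0 M0] evg by simp
    next
      case 3
      have yt: "y \<otimes> t \<oplus> \<ominus> (t \<otimes> y) = \<one>" using ty by (simp add: rel a_ac r_neg)
      have "ev r = ev (free_commutator m1 F (Mom 0) (Pos 0)) \<oplus> \<ominus> ev \<one>\<^bsub>?A\<^esub>"
        unfolding 3 by (rule evm[OF cc[OF M0 P0] A.one_closed])
      also have "\<dots> = \<zero>"
        unfolding ce[OF M0 P0] evg yt ring_hom_one[OF evA] by (rule r_neg[OF one_closed])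
      finally have "ev r = \<zero>" .
      moreover have "r \<in> carrier ?A" unfolding 3 by (rule A.minus_closed[OF cc[OF M0 P0] A.one_closed])
      ultimately show ?thesis unfolding a_kernel_def' by blast
    qed
  qed
  have I: "ideal ?I ?A" by (rule weyl_quotient(1)[OF fF])
  interpret I: ideal ?I ?A by (rule I)
  have I_ker: "?I \<subseteq> a_kernel ?A R ev"
    unfolding weyl_ideal_def
  proof (rule A.genideal_minimal)
    show "ideal (a_kernel ?A R ev) ?A" by (rule E.kernel_is_ideal)
  qed (rule rel_ker)
  \<comment> \<open>\<open>ev\<close> is constant on each coset, as the ideal lies in its kernel;
    this is that constant.\<close>
  define \<eta> where "\<eta> z = the_elem (ev ` z)" for z
  have eta: "\<eta> (?p f) = ev f" if f: "f \<in> carrier ?A" for f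
  proof -
    have A0: "ev (i \<oplus>\<^bsub>?A\<^esub> f) = ev f" if "i \<in> ?I" for i
    proof -
      have i: "i \<in> carrier ?A" "ev i = \<zero>" using subsetD[OF I_ker that] unfolding a_kernel_def' by blast+
      show ?thesis
        unfolding ring_hom_add[OF evA i(1) f] i(2) by (rule l_zero[OF ring_hom_closed[OF evA f]])
    qed
    have "?p f = (\<lambda>i. i \<oplus>\<^bsub>?A\<^esub> f) ` ?I" unfolding a_r_coset_def' by blast
    then have "ev ` ?p f = (\<lambda>i. ev (i \<oplus>\<^bsub>?A\<^esub> f)) ` ?I" by (simp only: image_image)
    also have "\<dots> = (\<lambda>i. ev f) ` ?I" by (rule image_cong[OF refl A0])
    also have "\<dots> = {ev f}" by (rule image_constant[OF I.zero_closed])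
    finally have "ev ` ?p f = {ev f}" .
    then show ?thesis by (simp add: \<eta>_def)
  qed
  have cW: "carrier ?W = ?p ` carrier ?A" by (rule weyl_quotient(3)[OF fF])
  note ph = ring_hom_mult[OF P.hom] ring_hom_add[OF P.hom] ring_hom_one[OF P.hom]
  have eta_hom: "\<eta> \<in> ring_hom ?W R"
  proof (rule ring_hom_memI)
    show "\<eta> z \<in> carrier R" if "z \<in> carrier ?W" for z using that eta by (auto simp: cW)
    show "\<eta> (z \<otimes>\<^bsub>?W\<^esub> Y) = \<eta> z \<otimes> \<eta> Y" "\<eta> (z \<oplus>\<^bsub>?W\<^esub> Y) = \<eta> z \<oplus> \<eta> Y"
      if XY: "z \<in> carrier ?W" "Y \<in> carrier ?W" for z Y
    proof -
      obtain f f' where f: "f \<in> carrier ?A" "f' \<in> carrier ?A" "z = ?p f" "Y = ?p f'" using XY by (auto simp: cW)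
      show "\<eta> (z \<otimes>\<^bsub>?W\<^esub> Y) = \<eta> z \<otimes> \<eta> Y" "\<eta> (z \<oplus>\<^bsub>?W\<^esub> Y) = \<eta> z \<oplus> \<eta> Y"
        using eta[of "f \<otimes>\<^bsub>?A\<^esub> f'"] eta[of "f \<oplus>\<^bsub>?A\<^esub> f'"] ph(1,2)[OF f(1,2)] eta[OF f(1)] eta[OF f(2)] f by simp_all
    qed
    show "\<eta> \<one>\<^bsub>?W\<^esub> = \<one>" using eta[OF A.one_closed] ph(3) by simp
  qed
  interpret H: ring_hom_ring ?W R \<eta>
    by (intro ring_hom_ring.intro ring_hom_ring_axioms.intro P.T.ring_axioms ring_axioms eta_hom)
  define B where "B = ev ` carrier ?A"
  have B: "subring B R" unfolding B_def by (rule E.img_is_subring[OF A.carrier_is_subring])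
  have BE: "Fc \<subseteq> B" "t \<in> B" "y \<in> B"
  proof -
    show "Fc \<subseteq> B"
    proof
      fix c assume c: "c \<in> Fc"
      then have "ev (free_scalar F c) = c" "free_scalar F c \<in> carrier ?A" using ev(2) P.scalar_closed by (auto simp: cF)
      then show "c \<in> B" unfolding B_def by (metis image_eqI)
    qed
    show "t \<in> B" "y \<in> B" unfolding B_def using gc evg by (metis image_eqI)+
  qed
  have nz: "t \<noteq> \<zero>" "y \<noteq> \<zero>" using rel ty by auto
  have BS: "B \<subseteq> S" if S: "subring S R" "Fc \<subseteq> S" "t \<in> S" "y \<in> S" for S
  proof
    fix x assume "x \<in> B"
    then obtain f where f: "f \<in> carrier (free_algebra F ga)" "x = ev f" by (auto simp: B_def weyl_free_def gens)
    show "x \<in> S" unfolding f(2)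
      by (rule F.free_hom_image_subset[OF ev(1) ring_axioms S(1) _ _ f(1)])
        (use S ev(2,3) in \<open>auto simp: cF ga_def g_def\<close>)
  qed
  have fracB: "fracs_of B"
    by (rule fracs_of_localisation[OF B BE(2,3) nz(1) rel], rule frac) (use BE Fc in auto)
  obtain V :: "'a \<Rightarrow> int \<times> int \<times> int \<times> int \<times> int" where V: "valn (carrier R) V"
    "\<And>c. c \<in> ring_center R \<Longrightarrow> c \<noteq> \<zero> \<Longrightarrow> V c = 0" "V t = (1, 0)" "V y = (0, 1, 0)"
  proof (rule weyl_valuation[OF ty rel char])
    fix S assume "subring S R" "ring_center R \<subseteq> S" "t \<in> S" "y \<in> S"
    then show "fracs_of S" using fracs_of_mono[OF fracB BS] Fc(2) by blast
  qed (use that in auto)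
  \<comment> \<open>The normal form of an element of the kernel is mapped to a vanishing combination
    of the \<open>t [^] i \<otimes> y [^] j\<close>, so all its coefficients vanish.\<close>
  have ker: "z = \<zero>\<^bsub>?W\<^esub>" if z: "z \<in> carrier ?W" "\<eta> z = \<zero>" for z
  proof -
    interpret N: weyl_pair ?W F P.sc "P.px 0" "P.py 0" by (rule P.weyl_pair) (simp add: m1)
    obtain f where f: "f \<in> carrier (free_algebra F ga)" "z = ?p f" using z(1) by (auto simp: cW weyl_free_def gens)
    have "finite {w. f w \<noteq> \<zero>\<^bsub>F\<^esub>}" using f(1) by (simp add: free_algebra_def)
    then have "finite (length ` {w. f w \<noteq> \<zero>\<^bsub>F\<^esub>})" by simp
    then obtain k where k: "\<forall>l\<in>length ` {w. f w \<noteq> \<zero>\<^bsub>F\<^esub>}. l \<le> k" using finite_nat_set_iff_bounded_le by blast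
    have gens': "{Pos 0, Mom 0} = weyl_gens m1" unfolding gens ga_def ..
    have hh: "?p \<in> ring_hom (free_algebra F {Pos 0, Mom 0}) ?W" unfolding gens' by (rule P.hom')
    have ff: "f \<in> carrier (free_algebra F {Pos 0, Mom 0})" using f(1) unfolding ga_def .
    have ss: "{w. f w \<noteq> \<zero>\<^bsub>F\<^esub>} \<subseteq> {w. length w \<le> k}" using k by blast
    have nf: "?p f \<in> N.NF k"
      by (rule F.free_hom_word_NF[where h = ?p and s = "Pos 0" and t = "Mom 0", OF N.weyl_pair_axioms hh ff ss])
    obtain c where c': "\<forall>p. c p \<in> carrier F"
      and pf: "?p f = (\<Oplus>\<^bsub>?W\<^esub>p\<in>{..k} \<times> {..k}. P.sc (c p) \<otimes>\<^bsub>?W\<^esub> N.nm p)"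
      using nf unfolding N.NF_def by blast
    have c: "c p \<in> carrier F" for p using c' by blast
    have Xc: "z = (\<Oplus>\<^bsub>?W\<^esub>p\<in>{..k} \<times> {..k}. P.sc (c p) \<otimes>\<^bsub>?W\<^esub> N.nm p)" unfolding f(2) by (rule pf)
    have pw: "\<eta> (x [^]\<^bsub>?W\<^esub> (i::nat)) = \<eta> x [^] i" if "x \<in> carrier ?W" for x i
      using that by (induction i) auto
    have ec: "\<eta> (P.sc d) = d" if "d \<in> carrier F" for d using eta[OF P.scalar_closed[OF that]] ev(2) that by simp
    have eg: "\<eta> (P.px 0) = t" "\<eta> (P.py 0) = y" using eta[OF gc(1)] eta[OF gc(2)] evg by auto
    have en: "\<eta> (P.sc (c p) \<otimes>\<^bsub>?W\<^esub> N.nm p) = c p \<otimes> (t [^] fst p \<otimes> y [^] snd p)" for p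
      using c[of p] by (simp add: N.nm_def pw ec eg)
    have es: "\<eta> (\<Oplus>\<^bsub>?W\<^esub>p\<in>U. P.sc (c p) \<otimes>\<^bsub>?W\<^esub> N.nm p) = (\<Oplus>p\<in>U. c p \<otimes> (t [^] fst p \<otimes> y [^] snd p))"
      if "finite U" for U
      using that
    proof (induction U)
      case (insert p U)
      have cc: "c p \<in> carrier R" for p using c[of p] Fcc by (simp add: cF)
      then show ?case using insert c ty by (simp add: en Pi_def)
    qed simp
    have "c p = \<zero>" if p: "p \<in> {..k} \<times> {..k}" for p
    proof (rule weyl_monomials_independent[OF V ty nz _ _ _ p])
      show "c p \<in> ring_center R" for p using c[of p] Fc(2) by (auto simp: cF)
      show "(\<Oplus>p\<in>{..k} \<times> {..k}. c p \<otimes> (t [^] fst p \<otimes> y [^] snd p)) = \<zero>"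
        using es[of "{..k} \<times> {..k}"] z(2) Xc by simp
    qed simp_all
    then have c0: "c p = \<zero>\<^bsub>F\<^esub>" if "p \<in> {..k} \<times> {..k}" for p using that by (simp add: F_def)
    show ?thesis unfolding Xc
    proof (rule P.T.add.finprod_one_eqI)
      show "P.sc (c p) \<otimes>\<^bsub>?W\<^esub> N.nm p = \<zero>\<^bsub>?W\<^esub>" if "p \<in> {..k} \<times> {..k}" for p
        unfolding c0[OF that] N.sigma_zero by (rule P.T.l_null[OF N.nm_closed])
    qed
  qed
  have inj: "inj_on \<eta> (carrier ?W)"
  proof (rule H.trivial_ker_imp_inj)
    show "a_kernel ?W R \<eta> = {\<zero>\<^bsub>?W\<^esub>}"
      unfolding a_kernel_def' using ker H.hom_zero P.T.zero_closed by blast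
  qed
  have "\<exists>r\<in>carrier ?W. \<exists>s\<in>carrier ?W - {\<zero>\<^bsub>?W\<^esub>}. q = \<eta> r \<otimes> inv (\<eta> s)" if q: "q \<in> carrier R" for q
  proof -
    obtain r s where rs: "r \<in> B" "s \<in> B - {\<zero>}" "q = r \<otimes> inv s" using fracs_ofE[OF fracB q] by metis
    then obtain f f' where f: "f \<in> carrier ?A" "f' \<in> carrier ?A" "r = ev f" "s = ev f'" by (auto simp: B_def)
    have "?p f' \<noteq> \<zero>\<^bsub>?W\<^esub>" using eta[OF f(2)] rs(2) f(4) by auto
    then show ?thesis using f rs eta by (intro bexI[of _ "?p f"] bexI[of _ "?p f'"]) (auto simp: cW)
  qed
  then have "weyl_skewfield 1 F R \<eta>"
    unfolding weyl_skewfield_def skewfield_of_fractions_def skewfield_iff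
    using fF skew_axioms eta_hom inj unfolding m1_def by blast
  moreover have "\<eta> (weyl_scalar 1 F c) = c" if "c \<in> Fc" for c
    unfolding weyl_scalar_def m1_def[symmetric] using eta[OF P.scalar_closed] ev(2) that by (simp add: cF)
  ultimately show ?thesis by (rule that)
qed

end

subsection \<open>Rational parameters\<close>

text \<open>The relative algebraic closure in the centre of the field generated by \<open>H\<close>.
  It contains every central root of an element of that field and is algebraic over the field by
  construction.\<close>

lemma (in skew) center_algebraic:
  assumes H: "H \<subseteq> ring_center R"
  defines "C \<equiv> R\<lparr>carrier := ring_center R\<rparr>"
  defines "K0 \<equiv> generate_field C H"
  defines "Fc \<equiv> {x \<in> ring_center R. \<not> ring.transcendental C K0 x}"
  defines "F \<equiv> R\<lparr>carrier := Fc\<rparr>"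
  shows "field C" "subfield K0 C" "subfield Fc R" "field F" "H \<subseteq> Fc"
    and "\<And>z. z \<in> Fc \<Longrightarrow> \<not> ring.transcendental F (generate_field F H) z"
    and "\<And>x N. x \<in> ring_center R \<Longrightarrow> (N::nat) > 0 \<Longrightarrow> x [^] N \<in> K0 \<Longrightarrow> x \<in> Fc"
proof -
  show fC: "field C" unfolding C_def by (rule subfield_iff(2)[OF center_subfield])
  interpret C: field C by (rule fC)
  have cC: "carrier C = ring_center R" by (simp add: C_def)
  have HC: "H \<subseteq> carrier C" using H by (simp add: cC)
  show K0: "subfield K0 C" unfolding K0_def by (rule C.generate_field_is_subfield[OF HC])
  have Fc: "subfield Fc C"
    using C.subfield_of_algebraics[OF K0] by (simp add: over_def Fc_def cC)
  have CF: "C\<lparr>carrier := Fc\<rparr> = F" by (simp add: C_def F_def)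
  show fF: "field F" using C.subfield_iff(2)[OF Fc] by (simp add: CF)
  show "subfield Fc R"
    by (rule subfield_iff(1)) (use fF in \<open>auto simp: F_def Fc_def ring_center_def\<close>)
  have "K0 \<subseteq> Fc"
  proof
    fix x assume x: "x \<in> K0"
    have "\<not> ring.transcendental C K0 x"
      using C.algebraic_self[OF subfieldE(1)[OF K0] x] unfolding over_def .
    moreover have "x \<in> ring_center R" using subringE(1)[OF subfieldE(1)[OF K0]] x unfolding cC by blast
    ultimately show "x \<in> Fc" unfolding Fc_def by blast
  qed
  moreover have "H \<subseteq> K0" unfolding K0_def by (rule subsetI) (rule generate_field.incl)
  ultimately show HF: "H \<subseteq> Fc" by blast
  have "K0 = generate_field F H" unfolding K0_def C.subfield_gen_equality[OF Fc HF] CF ..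
  moreover have "C.transcendental = ring.transcendental F"
    using C.transcendental_consistent[OF subfieldE(1)[OF Fc]] by (simp add: CF)
  ultimately show "\<not> ring.transcendental F (generate_field F H) z" if "z \<in> Fc" for z
    using that by (simp add: Fc_def)
  show "x \<in> Fc" if x: "x \<in> ring_center R" "(N::nat) > 0" "x [^] N \<in> K0" for x N
  proof -
    have "x [^] N = x [^]\<^bsub>C\<^esub> N" by (simp add: C_def nat_pow_def)
    then show ?thesis using C.algebraic_of_power[OF K0 _ x(2), of x] x by (simp add: Fc_def cC)
  qed
qed

section \<open>Rational \<open>a\<close>: weights of monomial fractions and the field of
  coefficients\<close>

context frac_R
begin

definition J :: "nat set" where "J = insert 0 {2..n}"

lemma J [simp]: "finite J" "card J = n"
  using n2 by (auto simp: J_def)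

lemma GE_J: "e \<in> GE \<longleftrightarrow> keys e \<subseteq> J"
  by (auto simp: GE_def J_def)

context
  fixes p q :: int
  assumes a: "a = of_int p / of_int q" and q: "q > 0"
begin

text \<open>With \<open>a = p / q\<close> this is \<open>q\<close> times the eigenvalue
  \<open>a + j\<close> of Y_j, or of X_0 when \<open>j = 0\<close>.\<close>

definition wgt :: "nat \<Rightarrow> int" where "wgt j = p + q * int j"

text \<open>The eigenvalue of a monomial fraction, multiplied by \<open>q\<close> to make it an
  integer.\<close>

definition gq :: "exponent \<Rightarrow> int" where "gq e = (\<Sum>j\<in>J. lookup e j * wgt j)"

lemma gq_B: "gq e = p * fst (B_degree n e) + q * snd (B_degree n e)"
  by (simp add: gq_def J_def wgt_def B_degree_def sum.distrib sum_distrib_left algebra_simps)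

lemma gq_add: "gq (e + e') = gq e + gq e'"
  by (simp add: gq_def lookup_add sum.distrib algebra_simps)

lemma gq_cmul: "gq (frag_cmul k e) = k * gq e"
  by (simp add: gq_def sum_distrib_left algebra_simps)

lemma gq_uminus: "gq (- e) = - gq e"
  by (simp add: gq_def sum_negf)

lemma gq_diff: "gq (e - e') = gq e - gq e'"
  using gq_add[of e "- e'"] by (simp add: gq_uminus)

lemma gq_unit: "j \<in> J \<Longrightarrow> gq (unit_exp j) = wgt j"
proof -
  assume j: "j \<in> J"
  have "gq (unit_exp j) = (\<Sum>i\<in>J. if i = j then wgt j else 0)"
    unfolding gq_def by (intro sum.cong) (auto simp: lookup_single when_def)
  then show ?thesis using j by simp
qed

lemma unit_GE: "j \<in> J \<Longrightarrow> unit_exp j \<in> GE"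
  by (simp add: GE_J)

lemma eig_gh:
  assumes e: "e \<in> GE"
  shows "eig (of_int (gq e) / of_int q) (gh e)"
proof -
  have q0: "of_int q \<noteq> (0 :: 'k)" using q by simp
  have "of_int (gq e) / of_int q =
      (a * of_int (fst (B_degree n (e + mabs e))) + of_int (snd (B_degree n (e + mabs e)))) +
      - (a * of_int (fst (B_degree n (mabs e))) + of_int (snd (B_degree n (mabs e))))"
    unfolding B_degree_add gq_B a using q0 by (simp add: field_simps)
  then show ?thesis
    unfolding gh_def using eig_mult[OF eig_Mb[OF add_mabs_BE[OF e]] eig_inv[OF eig_Mb[OF mabs_BE[OF e]]]] by simp
qed

lemma gh_central: "e \<in> GE \<Longrightarrow> gq e = 0 \<Longrightarrow> gh e \<in> ring_center Q"
  using gh_eigen_central[of e] eig_gh[of e] by simp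

text \<open>For \<open>p = 0\<close> the element Y_2 has weight \<open>2 * q\<close>; otherwise X_0
  has weight \<open>p\<close>.\<close>

lemma nonzero_weight: obtains j0 where "j0 \<in> J" "wgt j0 \<noteq> 0"
proof (cases "p = 0")
  case True
  have "wgt 2 \<noteq> 0" unfolding wgt_def using True q by simp
  moreover have "2 \<in> J" using n2 by (simp add: J_def)
  ultimately show ?thesis by (intro that)
next
  case False
  then have "wgt 0 \<noteq> 0" by (simp add: wgt_def)
  moreover have "0 \<in> J" by (simp add: J_def)
  ultimately show ?thesis by (intro that)
qed

text \<open>The values of \<open>gq\<close> form a nonzero subgroup of the integers, and by division
  with remainder its least positive member divides all the others.\<close>

lemma weight_generator:
  obtains \<tau> where "\<tau> \<in> GE" "gq \<tau> > 0" "\<And>e. e \<in> GE \<Longrightarrow> gq \<tau> dvd gq e"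
proof -
  obtain j0 where j0: "j0 \<in> J" "wgt j0 \<noteq> 0" by (rule nonzero_weight)
  define P where "P k \<longleftrightarrow> (\<exists>e\<in>GE. gq e = int k \<and> k > 0)" for k
  have g: "gq (frag_cmul (sgn (wgt j0)) (unit_exp j0)) = \<bar>wgt j0\<bar>"
    unfolding gq_cmul gq_unit[OF j0(1)] by (simp add: abs_sgn mult.commute)
  have "P (nat \<bar>wgt j0\<bar>)"
    unfolding P_def using g GE_cmul[OF unit_GE[OF j0(1)]] j0(2)
    by (intro bexI[of _ "frag_cmul (sgn (wgt j0)) (unit_exp j0)"]) simp_all
  then have L: "P (LEAST k. P k)" by (rule LeastI)
  then obtain \<tau> where t: "\<tau> \<in> GE" "gq \<tau> = int (LEAST k. P k)" "(LEAST k. P k) > 0" unfolding P_def by blast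
  show ?thesis
  proof (rule that[of \<tau>])
    show "gq \<tau> dvd gq e" if e: "e \<in> GE" for e
    proof (rule ccontr)
      assume "\<not> gq \<tau> dvd gq e"
      define e' where "e' = e - frag_cmul (gq e div gq \<tau>) \<tau>"
      have g: "gq e' = gq e mod gq \<tau>"
        by (simp add: e'_def gq_diff gq_cmul minus_div_mult_eq_mod)
      have tp: "gq \<tau> > 0" using t(2,3) by linarith
      have "gq e mod gq \<tau> \<noteq> 0" using \<open>\<not> gq \<tau> dvd gq e\<close> unfolding dvd_eq_mod_eq_0 .
      then have b: "0 < gq e'" "gq e' < gq \<tau>"
        unfolding g using pos_mod_sign[OF tp, of "gq e"] pos_mod_bound[OF tp, of "gq e"] by linarith+
      have "e' \<in> GE" unfolding e'_def by (intro GE_diff GE_cmul e t)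
      moreover have "gq e' = int (nat (gq e'))" "0 < nat (gq e')" using b(1) by linarith+
      ultimately have "P (nat (gq e'))" unfolding P_def by blast
      moreover have "nat (gq e') < (LEAST k. P k)" using b t(2) by linarith
      ultimately show False using not_less_Least by blast
    qed
    show "gq \<tau> > 0" using t(2,3) by linarith
  qed (rule t(1))
qed

text \<open>The obvious relation between the weights of \<open>j0\<close> and \<open>j\<close>. For
  \<open>j\<close> different from \<open>j0\<close> this gives n - 1 vectors in the kernel of
  \<open>gq\<close>.\<close>

definition vexp :: "nat \<Rightarrow> nat \<Rightarrow> exponent" where
  "vexp j0 j = frag_cmul (wgt j0) (unit_exp j) - frag_cmul (wgt j) (unit_exp j0)"

lemma lookup_vexp: "lookup (vexp j0 j) i = (if j = i then wgt j0 else 0) - (if j0 = i then wgt j else 0)"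
  by (simp add: vexp_def lookup_minus lookup_single when_def)

lemma vexp_GE: "j0 \<in> J \<Longrightarrow> j \<in> J \<Longrightarrow> vexp j0 j \<in> GE"
  unfolding vexp_def by (intro GE_diff GE_cmul unit_GE)

lemma gq_vexp: "j0 \<in> J \<Longrightarrow> j \<in> J \<Longrightarrow> gq (vexp j0 j) = 0"
  by (simp add: vexp_def gq_diff gq_cmul gq_unit)

text \<open>The vectors \<open>vexp j0 j\<close> generate the kernel of \<open>gq\<close> only up to
  the factor \<open>wgt j0\<close>. Hence a power of each fraction of eigenvalue 0, rather than the
  fraction itself, is expressed by them.\<close>

lemma vexp_span:
  assumes e: "e \<in> GE" "gq e = 0" and j0: "j0 \<in> J"
  shows "frag_cmul (wgt j0) e = (\<Sum>j\<in>J - {j0}. frag_cmul (lookup e j) (vexp j0 j))"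
proof (rule poly_mapping_eqI)
  fix i
  have s: "(\<Sum>j\<in>J - {j0}. lookup e j * wgt j) = - (lookup e j0 * wgt j0)"
    using e(2) sum.remove[OF J(1) j0, of "\<lambda>j. lookup e j * wgt j"] by (simp add: gq_def)
  have "lookup (\<Sum>j\<in>J - {j0}. frag_cmul (lookup e j) (vexp j0 j)) i =
      (\<Sum>j\<in>J - {j0}. (if j = i then lookup e i * wgt j0 else 0) - (if j0 = i then lookup e j * wgt j else 0))"
    unfolding lookup_sum by (intro sum.cong) (auto simp: lookup_vexp right_diff_distrib)
  also have "\<dots> = (\<Sum>j\<in>J - {j0}. if j = i then lookup e i * wgt j0 else 0) -
      (if j0 = i then (\<Sum>j\<in>J - {j0}. lookup e j * wgt j) else 0)"
    by (simp add: sum_subtractf)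
  also have "\<dots> = (if i \<in> J - {j0} then lookup e i * wgt j0 else 0) + (if j0 = i then lookup e j0 * wgt j0 else 0)"
    unfolding s by (simp add: sum.delta)
  also have "\<dots> = wgt j0 * lookup e i"
    using e(1) j0 by (auto simp: GE_J in_keys_iff)
  finally show "lookup (frag_cmul (wgt j0) e) i = lookup (\<Sum>j\<in>J - {j0}. frag_cmul (lookup e j) (vexp j0 j)) i"
    by simp
qed

lemma gh_cmul_neg: "e \<in> GE \<Longrightarrow> gh (frag_cmul (- int m) e) = inv (gh e) [^] m"
proof -
  assume e: "e \<in> GE"
  have "frag_cmul (- int m) e = frag_cmul (int m) (- e)" by (rule poly_mapping_eqI) simp
  then show ?thesis using gh_pow[OF GE_uminus[OF e], of m] gh_uminus[OF e] by simp
qed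

text \<open>The n - 1 fractions \<open>gh (vexp j0 j)\<close> form a transcendence basis: distinct
  monomials in them have distinct exponent vectors, and distinct monomial fractions are linearly
  independent over the constants.\<close>

lemma rational_field:
  assumes j0: "j0 \<in> J" "wgt j0 \<noteq> 0"
  obtains Fc where "subfield Fc Q" "Fc \<subseteq> ring_center Q" "range (\<lambda>c. kap c) \<subseteq> Fc"
    "\<And>e. e \<in> GE \<Longrightarrow> gq e = 0 \<Longrightarrow> gh e \<in> Fc"
    "has_transcendence_degree (\<lambda>c. kap c) (Q\<lparr>carrier := Fc\<rparr>) (n - 1)"
proof -
  have cJ: "card (J - {j0}) = n - 1" using j0 by simp
  obtain b where b: "bij_betw b {0..<card (J - {j0})} (J - {j0})"
    using ex_bij_betw_nat_finite[of "J - {j0}"] by auto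
  then have b: "bij_betw b {..<n - 1} (J - {j0})" unfolding cJ by (simp add: atLeast0LessThan)
  have bJ: "b i \<in> J" "b i \<noteq> j0" if "i < n - 1" for i using b that by (auto simp: bij_betw_def)
  define w where "w i = vexp j0 (b i)" for i
  define tv where "tv i = gh (w i)" for i
  have w: "w i \<in> GE" "gq (w i) = 0" if "i < n - 1" for i
    using vexp_GE gq_vexp j0 bJ[OF that] by (auto simp: w_def)
  define H where "H = range (\<lambda>c. kap c) \<union> tv ` {..<n - 1}"
  have H: "H \<subseteq> ring_center Q" using kap_central gh_central w by (auto simp: H_def tv_def)
  define C where "C = Q\<lparr>carrier := ring_center Q\<rparr>"
  define K0 where "K0 = generate_field C H"
  define Fc where "Fc = {x \<in> ring_center Q. \<not> ring.transcendental C K0 x}"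
  define F where "F = Q\<lparr>carrier := Fc\<rparr>"
  note ca = center_algebraic[OF H, folded C_def, folded K0_def, folded Fc_def, folded F_def]
  interpret C: field C by (rule ca(1))
  interpret F: field F by (rule ca(4))
  have ops: "carrier F = Fc" "monoid.mult F = monoid.mult Q" "\<one>\<^bsub>F\<^esub> = \<one>" "add F = add Q" "\<zero>\<^bsub>F\<^esub> = \<zero>"
    by (simp_all add: F_def)
  have Fcc: "x \<in> carrier Q" if "x \<in> Fc" for x using that by (auto simp: Fc_def ring_center_def)
  have K0E: "\<one> \<in> K0" "\<And>x y. x \<in> K0 \<Longrightarrow> y \<in> K0 \<Longrightarrow> x \<otimes> y \<in> K0"
    using subringE(3,6)[OF subfieldE(1)[OF ca(2)]] by (auto simp: C_def)
  have pK: "x [^] (m::nat) \<in> K0" if "x \<in> K0" for x m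
    using K0E that by (induction m) auto
  have iK: "inv (gh e) \<in> K0" if e: "e \<in> GE" "gq e = 0" "gh e \<in> K0" for e
  proof -
    have c: "gh e \<in> carrier C" "gh (- e) \<in> carrier C"
      using gh_central[OF e(1,2)] gh_central[OF GE_uminus[OF e(1)]] e by (auto simp: C_def gq_uminus)
    have "inv\<^bsub>C\<^esub> (gh e) = gh (- e)"
      using gh_uminus[OF e(1)] e(1) by (intro C.comm_inv_char c) (simp add: C_def)
    moreover have "inv\<^bsub>C\<^esub> (gh e) \<in> K0"
      unfolding K0_def
    proof (rule generate_field.m_inv)
      show "gh e \<in> generate_field C H" using e(3) unfolding K0_def .
      show "gh e \<noteq> \<zero>\<^bsub>C\<^esub>" using e(1) by (simp add: C_def)
    qed
    ultimately show ?thesis using gh_uminus[OF e(1)] by simp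
  qed
  have cK: "gh (frag_cmul k e) \<in> K0" if e: "e \<in> GE" "gq e = 0" "gh e \<in> K0" for k e
    by (cases k rule: int_cases2) (use gh_pow[OF e(1), symmetric] gh_cmul_neg[OF e(1)] pK[OF e(3)] pK[OF iK[OF e]] in simp_all)
  have vK: "gh (vexp j0 j) \<in> K0" if "j \<in> J - {j0}" for j
  proof -
    have "j \<in> b ` {..<n - 1}" using b that unfolding bij_betw_def by blast
    then obtain i where "i < n - 1" "j = b i" by blast
    then have "gh (vexp j0 j) \<in> H" by (auto simp: H_def tv_def w_def)
    then show ?thesis unfolding K0_def by (rule generate_field.incl)
  qed
  have sK: "(\<Sum>j\<in>U. f j) \<in> GE \<and> gh (\<Sum>j\<in>U. f j) \<in> K0"
    if "finite U" "\<And>j. j \<in> U \<Longrightarrow> f j \<in> GE \<and> gh (f j) \<in> K0" for U :: "nat set" and f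
    using that by (induction U) (auto simp: GE_add gh_add K0E)
  \<comment> \<open>By \<open>vexp_span\<close> the power with exponent \<bar>wgt j0\<bar> lies in
    \<open>K0\<close>, so the fraction is algebraic over \<open>K0\<close>. The factor
    \<open>sgn\<close> in the proof turns the integer multiple into a power with natural
    exponent.\<close>
  have ghF: "gh e \<in> Fc" if e: "e \<in> GE" "gq e = 0" for e
  proof (rule ca(7)[of _ "nat \<bar>wgt j0\<bar>"])
    have "gh (\<Sum>j\<in>J - {j0}. frag_cmul (lookup e j) (vexp j0 j)) \<in> K0"
      using vexp_GE[OF j0(1)] gq_vexp[OF j0(1)] vK by (intro conjunct2[OF sK] conjI GE_cmul cK) auto
    then have A: "gh (frag_cmul (wgt j0) e) \<in> K0" unfolding vexp_span[OF e j0(1)] .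
    have "frag_cmul (sgn (wgt j0)) (frag_cmul (wgt j0) e) = frag_cmul \<bar>wgt j0\<bar> e"
      by (rule poly_mapping_eqI) (cases "wgt j0" "0::int" rule: linorder_cases; simp)
    then have "gh (frag_cmul \<bar>wgt j0\<bar> e) \<in> K0"
      using cK[OF GE_cmul[OF e(1)] _ A, of "sgn (wgt j0)"] e(2) by (simp add: gq_cmul)
    then show "gh e [^] nat \<bar>wgt j0\<bar> \<in> K0" using gh_pow[OF e(1), of "nat \<bar>wgt j0\<bar>"] by simp
  qed (use gh_central[OF e] j0 in auto)
  have tvF: "tv i \<in> Fc" if "i < n - 1" for i using ca(5) that by (auto simp: H_def)
  have kF: "kap c \<in> Fc" for c using ca(5) by (auto simp: H_def)
  \<comment> \<open>The exponent vector, in terms of X_0 and the Y_j, of a monomial in the basis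
    elements \<open>tv\<close>.\<close>
  define \<theta> where "\<theta> m U = (\<Sum>i\<in>U. frag_cmul (int (lookup m i)) (w i))" for m :: "nat \<Rightarrow>\<^sub>0 nat" and U
  have pow_eq: "x [^]\<^bsub>F\<^esub> (k::nat) = x [^] k" for x k by (simp add: F_def nat_pow_def)
  have fp: "\<theta> m U \<in> GE \<and> (\<Otimes>\<^bsub>F\<^esub>i\<in>U. tv i [^]\<^bsub>F\<^esub> lookup m i) = gh (\<theta> m U)"
    if "finite U" "U \<subseteq> {..<n - 1}" for m U
    using that
  proof (induction U)
    case empty
    then show ?case by (simp add: \<theta>_def ops)
  next
    case (insert i U)
    have i: "i < n - 1" and U: "U \<subseteq> {..<n - 1}" using insert by auto
    have th: "\<theta> m (insert i U) = frag_cmul (int (lookup m i)) (w i) + \<theta> m U"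
      unfolding \<theta>_def using insert by simp
    have cl: "tv j [^]\<^bsub>F\<^esub> lookup m j \<in> carrier F" if "j \<in> insert i U" for j
      using tvF[of j] that i U by (intro F.nat_pow_closed) (auto simp: ops)
    have "(\<Otimes>\<^bsub>F\<^esub>i\<in>insert i U. tv i [^]\<^bsub>F\<^esub> lookup m i) =
        tv i [^]\<^bsub>F\<^esub> lookup m i \<otimes>\<^bsub>F\<^esub> (\<Otimes>\<^bsub>F\<^esub>i\<in>U. tv i [^]\<^bsub>F\<^esub> lookup m i)"
      using insert cl by (intro F.finprod_insert) auto
    also have "\<dots> = gh (frag_cmul (int (lookup m i)) (w i)) \<otimes> gh (\<theta> m U)"
      using insert.IH[OF U] gh_pow[OF w(1)[OF i], of "lookup m i"] by (simp add: pow_eq ops tv_def)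
    also have "\<dots> = gh (\<theta> m (insert i U))"
      unfolding th using insert.IH[OF U] GE_cmul[OF w(1)[OF i]] by (simp add: gh_add)
    finally show ?case unfolding th using insert.IH[OF U] GE_cmul[OF w(1)[OF i]] GE_add by simp
  qed
  have fs: "(\<Oplus>\<^bsub>F\<^esub>m\<in>M. f m) = (\<Oplus>m\<in>M. f m)" if "finite M" "f ` M \<subseteq> Fc" for M :: "(nat \<Rightarrow>\<^sub>0 nat) set" and f
    using that
  proof (induction M)
    case (insert m M)
    have "f \<in> M \<rightarrow> carrier F" "f m \<in> carrier F" "f \<in> M \<rightarrow> carrier Q" "f m \<in> carrier Q"
      using insert Fcc by (auto simp: ops)
    then show ?case using insert F.finsum_insert[of M m f] by (simp add: ops)
  qed (simp add: ops)
  have indep: "algebraically_independent (\<lambda>c. kap c) F (n - 1) tv"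
    unfolding algebraically_independent_def
  proof (intro allI impI)
    fix P :: "(nat \<Rightarrow>\<^sub>0 nat) \<Rightarrow>\<^sub>0 'k"
    assume P: "\<forall>m\<in>keys P. keys m \<subseteq> {..<n - 1}" and z: "poly_eval (\<lambda>c. kap c) F tv P = \<zero>\<^bsub>F\<^esub>"
    define \<psi> where "\<psi> m = \<theta> m (keys m)" for m
    have \<psi>: "\<psi> m \<in> GE" "(\<Otimes>\<^bsub>F\<^esub>i\<in>keys m. tv i [^]\<^bsub>F\<^esub> lookup m i) = gh (\<psi> m)" if "m \<in> keys P" for m
      using fp[of "keys m" m] P that by (auto simp: \<psi>_def)
    \<comment> \<open>The entry at \<open>b i\<close> sees only the i-th basis vector and recovers
      \<open>lookup m i\<close>, because \<open>wgt j0\<close> is nonzero.\<close>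
    have lk: "lookup (\<psi> m) (b i) = int (lookup m i) * wgt j0" if m: "m \<in> keys P" and i: "i < n - 1" for m i
    proof -
      have "lookup (\<psi> m) (b i) = (\<Sum>i'\<in>keys m. if i' = i then int (lookup m i) * wgt j0 else 0)"
        unfolding \<psi>_def \<theta>_def lookup_sum
      proof (rule sum.cong[OF refl])
        fix i' assume "i' \<in> keys m"
        then have "i' < n - 1" using P m by auto
        then have "b i' = b i \<longleftrightarrow> i' = i" using b i by (auto simp: bij_betw_def inj_on_def)
        then show "lookup (frag_cmul (int (lookup m i')) (w i')) (b i) = (if i' = i then int (lookup m i) * wgt j0 else 0)"
          using bJ[OF i] by (auto simp: w_def lookup_vexp)
      qed
      then show ?thesis by (simp add: in_keys_iff)
    qed
    have inj: "inj_on \<psi> (keys P)"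
    proof (rule inj_onI)
      fix m m' assume m: "m \<in> keys P" "m' \<in> keys P" "\<psi> m = \<psi> m'"
      show "m = m'"
      proof (rule poly_mapping_eqI)
        fix i
        show "lookup m i = lookup m' i"
        proof (cases "i < n - 1")
          case True
          then show ?thesis using lk[OF m(1) True] lk[OF m(2) True] m(3) j0(2) by simp
        next
          case False
          then have "i \<notin> keys m" "i \<notin> keys m'" using P m by auto
          then show ?thesis by (simp add: in_keys_iff)
        qed
      qed
    qed
    \<comment> \<open>The coefficients of \<open>P\<close>, reindexed by exponent vectors as
      \<open>gh_independent\<close> expects.\<close>
    define c where "c e = lookup P (inv_into (keys P) \<psi> e)" for e
    have cm: "c (\<psi> m) = lookup P m" if "m \<in> keys P" for m
      using inv_into_f_f[OF inj that] by (simp add: c_def)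
    have gF: "gh (\<psi> m) \<in> Fc" if "m \<in> keys P" for m
    proof -
      have "(\<Otimes>\<^bsub>F\<^esub>i\<in>keys m. tv i [^]\<^bsub>F\<^esub> lookup m i) \<in> carrier F"
        by (rule F.finprod_closed) (use P that tvF ops in \<open>auto intro!: F.nat_pow_closed\<close>)
      then show ?thesis using \<psi>(2)[OF that] by (simp add: ops)
    qed
    have "\<zero> = (\<Oplus>\<^bsub>F\<^esub>m\<in>keys P. kap (lookup P m) \<otimes>\<^bsub>F\<^esub> (\<Otimes>\<^bsub>F\<^esub>i\<in>keys m. tv i [^]\<^bsub>F\<^esub> lookup m i))"
      using z by (simp add: poly_eval_def ops)
    also have "\<dots> = (\<Oplus>\<^bsub>F\<^esub>m\<in>keys P. kap (lookup P m) \<otimes>\<^bsub>F\<^esub> gh (\<psi> m))"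
      using kF gF \<psi>(2) F.m_closed by (intro F.finsum_cong') (auto simp: ops)
    also have "\<dots> = (\<Oplus>m\<in>keys P. kap (lookup P m) \<otimes>\<^bsub>F\<^esub> gh (\<psi> m))"
      using kF gF F.m_closed by (intro fs) (auto simp: ops)
    also have "\<dots> = (\<Oplus>m\<in>keys P. kap (c (\<psi> m)) \<otimes> gh (\<psi> m))"
      using \<psi>(1) cm by (intro finsum_cong') (auto simp: ops)
    also have "\<dots> = (\<Oplus>e\<in>\<psi> ` keys P. kap (c e) \<otimes> gh e)"
      using \<psi>(1) by (intro add.finprod_reindex[symmetric] inj) auto
    finally have "(\<Oplus>e\<in>\<psi> ` keys P. kap (c e) \<otimes> gh e) = \<zero>" by simp
    then have c0: "c (\<psi> m) = 0" if "m \<in> keys P" for m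
      using \<psi>(1) that by (intro gh_independent[of "\<psi> ` keys P" c]) auto
    show "P = 0"
    proof (rule poly_mapping_eqI)
      fix m
      show "lookup P m = lookup 0 m"
      proof (cases "m \<in> keys P")
        case True
        then show ?thesis using cm[OF True] c0[OF True] by simp
      next
        case False
        then show ?thesis by (simp add: in_keys_iff)
      qed
    qed
  qed
  have "has_transcendence_degree (\<lambda>c. kap c) F (n - 1)"
    unfolding has_transcendence_degree_def
  proof (intro exI[of _ tv] conjI ballI)
    show "tv ` {..<n - 1} \<subseteq> carrier F" using tvF by (auto simp: ops)
    show "\<not> ring.transcendental F (generate_field F (range (\<lambda>c. kap c) \<union> tv ` {..<n - 1})) z" if "z \<in> carrier F" for z
      using ca(6)[of z] that by (simp add: ops H_def)
  qed (rule indep)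
  then show ?thesis
    using that[of Fc] ca(3) ghF kF by (auto simp: Fc_def F_def)
qed

text \<open>\<open>Q\<close> itself is recognised as the Weyl skewfield, so the isomorphism is the
  identity, and compatibility with constants says that \<open>\<eta>\<close> fixes the scalars of
  \<open>Fc\<close>.\<close>

lemma rational_weyl:
  "\<exists>(\<kappa> :: 'k \<Rightarrow> 'q) (F :: 'q ring) (D :: 'q ring) \<eta> \<phi>.
     field_extension \<kappa> F \<and> has_transcendence_degree \<kappa> F (n - 1) \<and> weyl_skewfield 1 F D \<eta> \<and>
     \<phi> \<in> ring_iso Q D \<and> (\<forall>c. \<phi> (\<iota> (Const c)) = \<eta> (weyl_scalar 1 F (\<kappa> c)))"
proof -
  obtain j0 where j0: "j0 \<in> J" "wgt j0 \<noteq> 0" by (rule nonzero_weight)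
  obtain Fc where Fc: "subfield Fc Q" "Fc \<subseteq> ring_center Q" "range (\<lambda>c. kap c) \<subseteq> Fc"
    "\<And>e. e \<in> GE \<Longrightarrow> gq e = 0 \<Longrightarrow> gh e \<in> Fc"
    "has_transcendence_degree (\<lambda>c. kap c) (Q\<lparr>carrier := Fc\<rparr>) (n - 1)"
    using rational_field[OF j0] by metis
  obtain \<tau> where \<tau>: "\<tau> \<in> GE" "gq \<tau> > 0" "\<And>e. e \<in> GE \<Longrightarrow> gq \<tau> dvd gq e" using weight_generator by metis
  define t where "t = gh \<tau>"
  define lam :: 'k where "lam = of_int (gq \<tau>) / of_int q"
  \<comment> \<open>Since Zh t - t Zh = lam t, the commutator of \<open>inv t \<otimes> Zh\<close>
    with \<open>t\<close> is lam; dividing by it gives 1.\<close>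
  define y where "y = kap (1 / lam) \<otimes> (inv t \<otimes> Zh)"
  have lam0: "lam \<noteq> 0" using \<tau>(2) q by (simp add: lam_def)
  have t [simp]: "t \<in> carrier Q" "t \<noteq> \<zero>" using \<tau>(1) by (auto simp: t_def)
  have y [simp]: "y \<in> carrier Q" by (simp add: y_def)
  have et: "Zh \<otimes> t = t \<otimes> Zh \<oplus> kap lam \<otimes> t" using eig_gh[OF \<tau>(1)] by (simp add: eig_def t_def lam_def)
  have k1: "kap (1 / lam) \<otimes> kap lam = \<one>" "kap lam \<otimes> kap (1 / lam) = \<one>"
    using kap_mult[of "1 / lam" lam] kap_mult[of lam "1 / lam"] lam0 by auto
  have tyz: "t \<otimes> y = kap (1 / lam) \<otimes> Zh" by (simp add: y_def kap_left_comm)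
  have "y \<otimes> t = kap (1 / lam) \<otimes> (inv t \<otimes> (Zh \<otimes> t))" by (simp add: y_def m_assoc)
  also have "\<dots> = kap (1 / lam) \<otimes> Zh \<oplus> kap (1 / lam) \<otimes> kap lam"
    unfolding et by (simp add: r_distr kap_left_comm)
  finally have rel: "y \<otimes> t = t \<otimes> y \<oplus> \<one>" by (simp add: tyz k1)
  have Zt: "Zh = kap lam \<otimes> (t \<otimes> y)" unfolding tyz by (simp add: m_assoc[symmetric] k1)
  have frac: "fracs_of L" if L: "subring L Q" "Fc \<subseteq> L" "t \<in> L" "inv t \<in> L" "y \<in> L" for L
  proof (rule fracs_of_mono[OF image_fracs image_in_subring[OF L(1)]])
    note LE = subringE[OF L(1)]
    show k: "kap c \<in> L" for c using Fc(3) L(2) by blast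
    show "Zh \<in> L" unfolding Zt using k LE(6) L(3,5) by blast
    have pw: "x [^] (m::nat) \<in> L" if "x \<in> L" for x m using LE(3,6) that by (induction m) auto
    \<comment> \<open>Negative powers of \<open>t\<close> occur here, which is why
      \<open>inv t\<close> belongs to \<open>L\<close>.\<close>
    have gk: "gh (frag_cmul k \<tau>) \<in> L" for k
      by (cases k rule: int_cases2)
        (use gh_pow[OF \<tau>(1), symmetric] gh_cmul_neg[OF \<tau>(1)] pw L(3,4) in \<open>simp_all add: t_def\<close>)
    show "Mb e \<in> L" if e: "e \<in> BE" for e
    proof -
      have eG: "e \<in> GE" using e BE_GE by blast
      obtain k where k: "gq e = gq \<tau> * k" using \<tau>(3)[OF eG] by (auto simp: dvd_def)
      \<comment> \<open>Removing a suitable power of \<open>t\<close> leaves weight 0, that is, a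
        scalar from \<open>Fc\<close>.\<close>
      let ?e = "e - frag_cmul k \<tau>"
      have G: "?e \<in> GE" "frag_cmul k \<tau> \<in> GE" using eG \<tau>(1) GE_diff GE_cmul by auto
      have "gh ?e \<in> L" using Fc(4)[OF G(1)] L(2) k by (auto simp: gq_diff gq_cmul)
      then have "gh ?e \<otimes> gh (frag_cmul k \<tau>) \<in> L" using gk LE(6) by blast
      then show ?thesis using gh_add[OF G] gh_Mb[OF e] by simp
    qed
  qed
  let ?F = "Q\<lparr>carrier := Fc\<rparr>"
  obtain \<eta> where \<eta>: "weyl_skewfield 1 ?F Q \<eta>" "\<And>c. c \<in> Fc \<Longrightarrow> \<eta> (weyl_scalar 1 ?F c) = c"
  proof (rule weyl_skewfieldI[OF Fc(1,2) t(1) y rel])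
    show "[k] \<cdot> \<one> \<noteq> \<zero>" if "k > 0" for k :: nat using char_0[OF that] .
    show "fracs_of L" if "subring L Q" "Fc \<subseteq> L" "t \<in> L" "inv t \<in> L" "y \<in> L" for L by (rule frac[OF that])
  qed (rule that)
  have "kap c \<in> Fc" for c using Fc(3) by blast
  then have eta_kap: "\<forall>c. \<iota> (Const c) = \<eta> (weyl_scalar 1 ?F (kap c))" using \<eta>(2) by metis
  have fe: "field_extension (\<lambda>c. kap c) ?F"
    unfolding field_extension_def
  proof
    show "field ?F" by (rule subfield_iff(2)[OF Fc(1)])
    show "(\<lambda>c. kap c) \<in> ring_hom ring_of_type_algebra ?F"
      by (rule ring_hom_memI) (use Fc(3) in \<open>auto simp: ring_of_type_algebra_def kap_add kap_mult\<close>)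
  qed
  have "(\<lambda>x. x) \<in> ring_iso Q Q"
    by (auto simp: ring_iso_def ring_hom_def bij_betw_def)
  moreover have "\<forall>c. kap c = \<eta> (weyl_scalar 1 ?F (kap c))" by (rule eta_kap)
  ultimately have "field_extension (\<lambda>c. kap c) ?F \<and> has_transcendence_degree (\<lambda>c. kap c) ?F (n - 1) \<and>
     weyl_skewfield 1 ?F Q \<eta> \<and> (\<lambda>x. x) \<in> ring_iso Q Q \<and>
     (\<forall>c. (\<lambda>x. x) (\<iota> (Const c)) = \<eta> (weyl_scalar 1 ?F (kap c)))"
    by (intro conjI fe Fc(5) \<eta>(1)) (use eta_kap in \<open>(assumption | blast | simp)+\<close>)
  then show ?thesis by (intro exI)
qed

end

lemma rational_case:
  assumes "a \<in> \<rat>"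
  shows "\<exists>(\<kappa> :: 'k \<Rightarrow> 'q) (F :: 'q ring) (D :: 'q ring) \<eta> \<phi>.
     field_extension \<kappa> F \<and> has_transcendence_degree \<kappa> F (n - 1) \<and> weyl_skewfield 1 F D \<eta> \<and>
     \<phi> \<in> ring_iso Q D \<and> (\<forall>c. \<phi> (\<iota> (Const c)) = \<eta> (weyl_scalar 1 F (\<kappa> c)))"
proof -
  obtain p q :: int where pq: "q > 0" "coprime p q" "a = of_int p / of_int q" by (rule Rats_cases'[OF assms])
  show ?thesis by (rule rational_weyl[OF pq(3,1)])
qed

end

theorem theorem8p11:
  fixes n :: nat and a :: "'k::field_char_0"
    and Q :: "'q ring" and \<iota> :: "'k laurent \<Rightarrow> 'q"
  assumes "n \<ge> 2"
    and "skewfield_of_fractions (R_alg n a) Q \<iota>"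
  shows
    "(a \<in> \<rat> \<longrightarrow>
        (\<exists>(\<kappa> :: 'k \<Rightarrow> 'q) (F :: 'q ring) (D :: 'q ring) \<eta> \<phi>.
           field_extension \<kappa> F \<and> has_transcendence_degree \<kappa> F (n - 1) \<and>
           weyl_skewfield 1 F D \<eta> \<and>
           \<phi> \<in> ring_iso Q D \<and>
           (\<forall>c. \<phi> (\<iota> (Const c)) = \<eta> (weyl_scalar 1 F (\<kappa> c)))))
     \<and>
     (a \<notin> \<rat> \<longrightarrow>
        ring_center Q = K_field n Q \<iota> \<and>
        (\<forall>m (F :: 'f ring) (D :: 'd ring) \<eta>.
           weyl_skewfield m F D \<eta> \<longrightarrow> \<not> Q \<simeq> D))"
proof -
  interpret frac_R Q n a \<iota>
    using assms by (intro frac_R.intro frac_R_axioms.intro) (auto simp: skewfield_of_fractions_def skewfield_iff)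
  show ?thesis
    using rational_case center_eq not_weyl by blast
qed

end
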